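(* Let $d\ge 1$, let $B\in C^1_b(\mathbb{R}^d,\mathbb{R}^d)$ and $A\in C^2_b(\mathbb{R}^d,\mathbb{R}^{d\times d})$, and assume there is $c>0$ such that $c\|v\|^2\le v^tA(x)A(x)^tv$ for all $v,x\in\mathbb{R}^d$. Let $\mu_0$ be a probability measure on $\mathbb{R}^d$, let $X$ be the solution of $dX_t=B(X_t)dt+A(X_t)dW_t$ with $X_0\sim\mu_0$ independent of the $d$-dimensional Brownian motion $W$, and let $M_t=\sup_{0\le s\le t}X^1_s$. Let $p_V(\cdot;t)$ denote the density of $(M_t,X_t)$, $t>0$, and assume that $(M,X)$ satisfies Hypothesis (H) (stated in the context). Then for every $F\in C^2_b(\mathbb{R}^{d+1},\mathbb{R})$ and every $t>0$, $$\mathbb{E}[F(M_t,X_t)]=\mathbb{E}[F(X^1_0,X_0)]+\int_0^t\mathbb{E}[\mathcal{L}(F)(M_s,X_s)]\,ds+\frac12\int_0^t\mathbb{E}\left[\partial_mF(X^1_s,X_s)\,\|A^1(X_s)\|^2\,\frac{p_V(X^1_s,X_s;s)}{p_X(X_s;s)}\right]ds .$$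
   Context: $C^i_b(\mathbb{R}^d,\mathbb{R}^n)$ is the set of $i$ times (continuously) differentiable bounded functions with bounded derivatives. Points of $\mathbb{R}^{d+1}$ are written $(m,x)$ with $m\in\mathbb{R}$, $x=(x^1,\dots,x^d)\in\mathbb{R}^d$, and $\tilde x=(x^2,\dots,x^d)$; $\partial_m$ is the derivative in the first variable. $A^1(x)=(A^1_j(x))_{j=1,\dots,d}$ is the vector of coefficients driving the first component, i.e. $dX^1_t=B^1(X_t)dt+\sum_jA^1_j(X_t)dW^j_t$, and $\|A^1(x)\|^2=\sum_{j}(A^1_j(x))^2$. For $\Phi\in C^2(\mathbb{R}^{d+1},\mathbb{R})$, $\mathcal{L}(\Phi)(m,x)=\sum_iB^i(x)\partial_{x_i}\Phi(m,x)+\frac12\sum_{i,j}(AA^t)^{ij}(x)\partial^2_{x_ix_j}\Phi(m,x)$ (no derivative in $m$). It is known that, under the stated assumptions on $A,B$, for every $t>0$ the law of $V_t=(M_t,X_t)$ has a density $p_V(\cdot;t)$ with respect to Lebesgue measure on $\mathbb{R}^{d+1}$, supported in $\{(m,x): m\ge x^1\}$, and that $X_t$ has a positive density $p_X(\cdot;t)$ on $\mathbb{R}^d$. Hypothesis (H) on $p_V$ (for a suitable choice of version of the density): (i) for every $T>0$, the map $(t,m,\tilde x)\mapsto\sup_{u>0}p_V(m,m-u,\tilde x;t)$ belongs to $L^1([0,T]\times\mathbb{R}^d,dt\,dm\,d\tilde x)$; (ii) for all $t>0$, for Lebesgue-almost every $(m,\tilde x)\in\mathbb{R}^d$, $\lim_{u\to0^+}p_V(m,m-u,\tilde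 x;t)$ exists; it is denoted $p_V(m,m,\tilde x;t)$. Thus $p_V(X^1_s,X_s;s)$ means $p_V(m,m,\tilde x;s)$ at $(m,\tilde x)=X_s$. *)

theory Defs
  imports "HOL-Probability.Probability"
begin

section \<open>Bounded functions with bounded derivatives\<close>

definition C1_b :: "('a::real_normed_vector \<Rightarrow> 'b::real_normed_vector) \<Rightarrow> bool" where
  "C1_b f \<longleftrightarrow> bounded (range f) \<and>
     (\<exists>f' :: 'a \<Rightarrow> ('a \<Rightarrow>\<^sub>L 'b).
        (\<forall>x. (f has_derivative blinfun_apply (f' x)) (at x)) \<and>
        continuous_on UNIV f' \<and> bounded (range f'))"

definition C2_b :: "('a::real_normed_vector \<Rightarrow> 'b::real_normed_vector) \<Rightarrow> bool" where
  "C2_b f \<longleftrightarrow> bounded (range f) \<and>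
     (\<exists>f' :: 'a \<Rightarrow> ('a \<Rightarrow>\<^sub>L 'b).
        (\<forall>x. (f has_derivative blinfun_apply (f' x)) (at x)) \<and> C1_b f')"

definition partial_deriv :: "'a::real_normed_vector \<Rightarrow> ('a \<Rightarrow> real) \<Rightarrow> 'a \<Rightarrow> real" where
  "partial_deriv e f z = deriv (\<lambda>h. f (z + h *\<^sub>R e)) 0"

text \<open>
  Points \<open>(m, x)\<close> of the \<open>(d+1)\<close>-dimensional space have type \<open>real \<times> (real ^ 'n)\<close>, with
  \<open>d = CARD('n)\<close>. In \<open>A x $ i $ j\<close> the row \<open>i\<close> is the component of the process and the column \<open>j\<close>
  is the component of the Brownian motion.
\<close>

definition generator ::
  "(real ^ 'n \<Rightarrow> real ^ 'n) \<Rightarrow> (real ^ 'n \<Rightarrow> real ^ 'n ^ 'n) \<Rightarrow>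
   (real \<times> (real ^ 'n) \<Rightarrow> real) \<Rightarrow> real \<times> (real ^ 'n) \<Rightarrow> real" where
  "generator B A \<Phi> = (\<lambda>(m, x).
     (\<Sum>i\<in>UNIV. B x $ i * partial_deriv (0, axis i 1) \<Phi> (m, x)) +
     1 / 2 * (\<Sum>i\<in>UNIV. \<Sum>j\<in>UNIV. (A x ** transpose (A x)) $ i $ j *
        partial_deriv (0, axis i 1) (partial_deriv (0, axis j 1) \<Phi>) (m, x)))"

section \<open>Brownian motion and the Ito integral\<close>

definition brownian_motion :: "'a measure \<Rightarrow> (real \<Rightarrow> 'a \<Rightarrow> real ^ 'n) \<Rightarrow> bool" where
  "brownian_motion P W \<longleftrightarrow>
     (\<forall>t\<ge>0. W t \<in> borel_measurable P) \<and>
     (AE \<omega> in P. W 0 \<omega> = 0) \<and>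
     (\<forall>\<omega>\<in>space P. continuous_on {0..} (\<lambda>t. W t \<omega>)) \<and>
     (\<forall>s t. 0 \<le> s \<and> s < t \<longrightarrow>
        distributed P lborel (\<lambda>\<omega>. W t \<omega> - W s \<omega>)
          (\<lambda>x. ennreal (\<Prod>i\<in>UNIV. normal_density 0 (sqrt (t - s)) (x $ i)))) \<and>
     (\<forall>(n::nat) \<tau>. 0 \<le> \<tau> 0 \<and> (\<forall>k<n. \<tau> k < \<tau> (Suc k)) \<longrightarrow>
        prob_space.indep_vars P (\<lambda>_. borel) (\<lambda>k \<omega>. W (\<tau> (Suc k)) \<omega> - W (\<tau> k) \<omega>) {..<n})"

text \<open>
  The \<open>P\<close>-augmented filtration generated by an initial value \<open>\<xi>\<close> and by \<open>W\<close>. Only the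
  \<open>\<sigma>\<close>-algebras of these measure spaces are used.
\<close>

definition augmented_filtration ::
  "'a measure \<Rightarrow> ('a \<Rightarrow> real ^ 'n) \<Rightarrow> (real \<Rightarrow> 'a \<Rightarrow> real ^ 'n) \<Rightarrow> real \<Rightarrow> 'a measure" where
  "augmented_filtration P \<xi> W t = sigma (space P)
     ({\<xi> -` S \<inter> space P | S. S \<in> sets borel} \<union>
      {W s -` S \<inter> space P | s S. 0 \<le> s \<and> s \<le> t \<and> S \<in> sets borel} \<union>
      null_sets P)"

text \<open>
  The triple \<open>(n, \<tau>, \<xi>)\<close> encodes the simple process on \<open>[0, T]\<close> with value \<open>\<xi> k\<close> on the interval
  from \<open>\<tau> k\<close> (excluded) to \<open>\<tau> (k + 1)\<close> (included), \<open>k < n\<close>.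
\<close>

definition simple_integrand ::
  "(real \<Rightarrow> 'a measure) \<Rightarrow> real \<Rightarrow> nat \<Rightarrow> (nat \<Rightarrow> real) \<Rightarrow> (nat \<Rightarrow> 'a \<Rightarrow> real) \<Rightarrow> bool" where
  "simple_integrand \<F> T n \<tau> \<xi> \<longleftrightarrow>
     \<tau> 0 = 0 \<and> \<tau> n = T \<and> (\<forall>k<n. \<tau> k < \<tau> (Suc k)) \<and>
     (\<forall>k<n. \<xi> k \<in> borel_measurable (\<F> (\<tau> k)) \<and> bounded (\<xi> k ` space (\<F> (\<tau> k))))"

definition simple_process ::
  "nat \<Rightarrow> (nat \<Rightarrow> real) \<Rightarrow> (nat \<Rightarrow> 'a \<Rightarrow> real) \<Rightarrow> real \<Rightarrow> 'a \<Rightarrow> real" where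
  "simple_process n \<tau> \<xi> s \<omega> = (\<Sum>k<n. \<xi> k \<omega> * indicator {\<tau> k<..\<tau> (Suc k)} s)"

definition simple_integral ::
  "nat \<Rightarrow> (nat \<Rightarrow> real) \<Rightarrow> (nat \<Rightarrow> 'a \<Rightarrow> real) \<Rightarrow> (real \<Rightarrow> 'a \<Rightarrow> real) \<Rightarrow> 'a \<Rightarrow> real" where
  "simple_integral n \<tau> \<xi> w \<omega> = (\<Sum>k<n. \<xi> k \<omega> * (w (\<tau> (Suc k)) \<omega> - w (\<tau> k) \<omega>))"

text \<open>
  \<open>Y\<close> is a version of the Ito integral of \<open>H\<close> against \<open>w\<close> over \<open>[0, T]\<close>: the mean-square limit of
  the integrals of simple processes approximating \<open>H\<close> in mean square.
\<close>

definition has_ito_integral ::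
  "'a measure \<Rightarrow> (real \<Rightarrow> 'a measure) \<Rightarrow> (real \<Rightarrow> 'a \<Rightarrow> real) \<Rightarrow> (real \<Rightarrow> 'a \<Rightarrow> real) \<Rightarrow> real \<Rightarrow>
   ('a \<Rightarrow> real) \<Rightarrow> bool" where
  "has_ito_integral P \<F> w H T Y \<longleftrightarrow> Y \<in> borel_measurable P \<and>
     (\<exists>n \<tau> \<xi>. (\<forall>l::nat. simple_integrand \<F> T (n l) (\<tau> l) (\<xi> l)) \<and>
        (\<lambda>l. \<integral>\<^sup>+ \<omega>. (\<integral>\<^sup>+ s\<in>{0..T}.
            ennreal ((simple_process (n l) (\<tau> l) (\<xi> l) s \<omega> - H s \<omega>)\<^sup>2) \<partial>lborel) \<partial>P)
          \<longlonglongrightarrow> 0 \<and>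
        (\<lambda>l. \<integral>\<^sup>+ \<omega>. ennreal ((simple_integral (n l) (\<tau> l) (\<xi> l) w \<omega> - Y \<omega>)\<^sup>2) \<partial>P)
          \<longlonglongrightarrow> 0)"

section \<open>The stochastic differential equation\<close>

text \<open>\<open>dX\<^sub>t = B(X\<^sub>t) dt + A(X\<^sub>t) dW\<^sub>t\<close>, with the initial value independent of the whole path of \<open>W\<close>.\<close>

definition sde_solution ::
  "'a measure \<Rightarrow> (real \<Rightarrow> 'a \<Rightarrow> real ^ 'n) \<Rightarrow> (real ^ 'n \<Rightarrow> real ^ 'n) \<Rightarrow>
   (real ^ 'n \<Rightarrow> real ^ 'n ^ 'n) \<Rightarrow> (real \<Rightarrow> 'a \<Rightarrow> real ^ 'n) \<Rightarrow> bool" where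
  "sde_solution P W B A X \<longleftrightarrow>
     prob_space.indep_set P
       (sets (vimage_algebra (space P) (X 0) borel))
       (sets (vimage_algebra (space P) (\<lambda>\<omega>. \<lambda>t\<in>{0..}. W t \<omega>) (\<Pi>\<^sub>M t\<in>{0..}. borel))) \<and>
     (\<forall>t\<ge>0. X t \<in> borel_measurable (augmented_filtration P (X 0) W t)) \<and>
     (\<forall>\<omega>\<in>space P. continuous_on {0..} (\<lambda>t. X t \<omega>)) \<and>
     (\<forall>t\<ge>0. \<forall>i. \<exists>Y.
        (\<forall>j. has_ito_integral P (augmented_filtration P (X 0) W)
               (\<lambda>s \<omega>. W s \<omega> $ j) (\<lambda>s \<omega>. A (X s \<omega>) $ i $ j) t (Y j)) \<and>
        (AE \<omega> in P. X t \<omega> $ i =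
           X 0 \<omega> $ i + (LINT s:{0..t}|lborel. B (X s \<omega>) $ i) + (\<Sum>j\<in>UNIV. Y j \<omega>)))"

section \<open>The running supremum and the density on the diagonal\<close>

text \<open>
  The index \<open>i1\<close> marks the first coordinate. A point \<open>(m, x\<^sup>2, \<dots>, x\<^sup>d)\<close> is represented by the
  vector \<open>y\<close> with \<open>y $ i1 = m\<close> and the remaining coordinates \<open>x\<^sup>2, \<dots>, x\<^sup>d\<close>, so that
  \<open>below_diag i1 y u\<close> is \<open>(m, m - u, x\<^sup>2, \<dots>, x\<^sup>d)\<close>.
\<close>

definition running_sup :: "'n \<Rightarrow> (real \<Rightarrow> 'a \<Rightarrow> real ^ 'n) \<Rightarrow> real \<Rightarrow> 'a \<Rightarrow> real" where
  "running_sup i1 X t \<omega> = (SUP s\<in>{0..t}. X s \<omega> $ i1)"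

definition below_diag :: "'n \<Rightarrow> real ^ 'n \<Rightarrow> real \<Rightarrow> real \<times> (real ^ 'n)" where
  "below_diag i1 y u = (y $ i1, y - u *\<^sub>R axis i1 1)"

text \<open>
  The limit denoted \<open>p\<^sub>V(m, m, x\<^sup>2, \<dots>, x\<^sup>d; t)\<close>; it is unspecified where the limit does not exist.
\<close>

definition diag_density ::
  "'n \<Rightarrow> (real \<Rightarrow> real \<times> (real ^ 'n) \<Rightarrow> real) \<Rightarrow> real \<Rightarrow> real ^ 'n \<Rightarrow> real" where
  "diag_density i1 pV t y = Lim (at_right 0) (\<lambda>u. pV t (below_diag i1 y u))"

text \<open>
  The supremum may be infinite, hence the values in \<^typ>\<open>ennreal\<close>. The slice \<open>t = 0\<close>, where
  \<open>pV\<close> is arbitrary, is a null set.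
\<close>

definition hypothesis_H :: "'n \<Rightarrow> (real \<Rightarrow> real \<times> (real ^ 'n) \<Rightarrow> real) \<Rightarrow> bool" where
  "hypothesis_H i1 pV \<longleftrightarrow>
     (\<forall>T>0.
        (\<lambda>(t, y). SUP u\<in>{0<..}. ennreal (pV t (below_diag i1 y u)))
          \<in> borel_measurable (lebesgue_on ({0..T} \<times> UNIV)) \<and>
        (\<integral>\<^sup>+ (t, y). (SUP u\<in>{0<..}. ennreal (pV t (below_diag i1 y u)))
          \<partial>lebesgue_on ({0..T} \<times> UNIV)) < \<infinity>) \<and>
     (\<forall>t>0. AE y in lborel. \<exists>l. ((\<lambda>u. pV t (below_diag i1 y u)) \<longlongrightarrow> l) (at_right 0))"

end

theory Submission
  imports Defs
begin

text \<open>
  Write \<open>x\<close> for the first coordinate of the state. For \<open>N \<ge> 1\<close> let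
  \<open>w = m - arctan (N (m - x)) / N\<close> and replace \<open>m\<close> by \<open>N arctan (w / N)\<close> in \<open>F\<close>. The
  derivative of \<open>w\<close> in \<open>m\<close> vanishes at \<open>m = x\<close>, so the new function \<open>\<Psi>\<close> is flat in \<open>m\<close> on the
  diagonal. As \<open>M\<close> grows only at times when it equals the first component of the process, it
  contributes nothing to Ito's formula for \<open>\<Psi>\<close>.

  Under expectation, Ito's formula for \<open>\<Psi>\<close> only needs the conditional first and second moments
  of the increments of \<open>X\<close> up to \<open>o(h)\<close>. Along a partition, the increments of \<open>M\<close> contribute at
  most a constant times \<open>\<pi>\<close> times the oscillation of \<open>X\<close>; the outer \<open>arctan\<close> makes the
  \<open>m\<close>-derivative decay like \<open>1 / (1 + m\<^sup>2)\<close>, which bounds the total variation in \<open>m\<close> by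
  a multiple of \<open>\<pi>\<close> uniformly in the path.

  The second derivative of \<open>w\<close> in \<open>x\<close> is \<open>N \<kappa> (N (m - x))\<close> with \<open>\<kappa> v = 2 v / (1 + v\<^sup>2)\<^sup>2\<close>. On
  \<open>m > x\<close> this is an approximate identity at the diagonal, because \<open>\<kappa>\<close> has integral 1 over the
  positive half-line. As \<open>N \<rightarrow> \<infinity>\<close>, Hypothesis (H) turns its expectation into the integral of
  \<open>p\<^sub>V\<close> along the diagonal, and all other terms converge to those of \<open>F\<close>.
\<close>

section \<open>Gaussian moments\<close>

text \<open>The noise is known only through versions of its Ito integrals at fixed times. So it is
  never followed along a path: all estimates are moments over short intervals, and each interval is
  split into a move of \<open>X\<close> with \<open>M\<close> frozen and a move of \<open>M\<close>
  with \<open>X\<close> frozen. In the first move all errors are of order h^(3/2), except the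
  second-order Taylor remainder; its coefficient merely tends to zero, and fourth moments are used
  to exploit this. Without flatness on the diagonal the second move would leave an integral against
  dM, a measure about which nothing is known. Flatness trades it for a second derivative in the
  first component of x, which involves the law of the pair at single times only, and that is what a
  density describes. No moment of the initial law is assumed, so the variation of \<open>M\<close>
  need not have an expectation; this is the reason for a bounded scale in m. Part (i) of (H)
  dominates in time and space at once, part (ii) identifies the limit. That limit is unspecified on
  a null set, whence \<open>lebesgue\<close> and \<open>completion P\<close> in the
  conclusion.\<close>

lemma measurable_vec_lambda:
  "vec_lambda \<in> (\<Pi>\<^sub>M i\<in>(UNIV::'n::finite set). (lborel :: real measure)) \<rightarrow>\<^sub>M borel"
  by (subst borel_measurable_euclidean_space) (auto simp: Basis_vec_def inner_axis)

text \<open>Both measures give a box the product of its side lengths, and boxes determine Lebesgue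
  measure. The density of a Brownian increment is a product over coordinates, so its integrals are
  computed on the product measure space and transported by \<open>vec_lambda\<close>.\<close>

lemma lborel_eq_distr_vec:
  "(lborel :: (real^'n) measure) = distr (\<Pi>\<^sub>M i\<in>(UNIV::'n set). lborel) borel vec_lambda"
proof (rule lborel_eqI)
  fix l u :: "real^'n"
  assume lu: "\<And>b. b \<in> Basis \<Longrightarrow> l \<bullet> b \<le> u \<bullet> b"
  have le: "l $ i \<le> u $ i" for i
    using lu[of "axis i 1"] by (simp add: axis_in_Basis_iff cart_eq_inner_axis)
  interpret product_sigma_finite "\<lambda>i::'n. lborel :: real measure" ..
  note m = measurable_vec_lambda[where ?'n='n]
  have "vec_lambda -` box l u \<inter> space (\<Pi>\<^sub>M i\<in>(UNIV::'n set). lborel) = (\<Pi>\<^sub>E i\<in>UNIV. {l $ i <..< u $ i})"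
    by (auto simp: space_PiM mem_box_cart PiE_iff)
  then have "emeasure (distr (\<Pi>\<^sub>M i\<in>(UNIV::'n set). lborel) borel vec_lambda) (box l u)
     = (\<Prod>i\<in>UNIV. emeasure lborel {l $ i <..< u $ i})"
    using m by (simp add: emeasure_distr emeasure_PiM)
  also have "\<dots> = ennreal (\<Prod>i\<in>UNIV. (u - l) $ i)"
    using le by (subst prod_ennreal[symmetric]) auto
  also have "(\<Prod>i\<in>UNIV. (u - l) $ i) = (\<Prod>b\<in>Basis. (u - l) \<bullet> b)"
  proof -
    have B: "(Basis :: (real^'n) set) = (\<lambda>i. axis i 1) ` UNIV"
      by (auto simp: Basis_vec_def)
    have inj: "inj (\<lambda>i::'n. axis i (1::real))"
      by (auto simp: inj_def axis_eq_axis)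
    show ?thesis
      unfolding B prod.reindex[OF inj] by (simp add: inner_axis)
  qed
  finally show "emeasure (distr (\<Pi>\<^sub>M i\<in>(UNIV::'n set). lborel) borel vec_lambda) (box l u)
     = ennreal (\<Prod>b\<in>Basis. (u - l) \<bullet> b)" .
qed simp

lemma has_bochner_integral_prod_vec:
  fixes g :: "'n::finite \<Rightarrow> real \<Rightarrow> real"
  assumes "\<And>i. integrable lborel (g i)"
  shows "has_bochner_integral lborel (\<lambda>x::real^'n. \<Prod>i\<in>UNIV. g i (x $ i)) (\<Prod>i\<in>UNIV. LINT y|lborel. g i y)"
proof -
  interpret product_sigma_finite "\<lambda>i::'n. lborel :: real measure" ..
  note m = measurable_vec_lambda[where ?'n='n]
  have [measurable]: "g i \<in> borel_measurable borel" for i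
    using borel_measurable_integrable[OF assms[of i]] by simp
  have "has_bochner_integral (\<Pi>\<^sub>M i\<in>(UNIV::'n set). lborel) (\<lambda>x. \<Prod>i\<in>UNIV. g i (x i)) (\<Prod>i\<in>UNIV. LINT y|lborel. g i y)"
    using product_integrable_prod[of UNIV g] product_integral_prod[of UNIV g] assms
    by (simp add: has_bochner_integral_iff)
  then show ?thesis
    unfolding lborel_eq_distr_vec
    by (intro has_bochner_integral_distr) (auto intro: m)
qed

lemma (in prob_space) gaussian_monomial_moment:
  fixes D :: "'a \<Rightarrow> real^'n" and e :: "'n \<Rightarrow> nat"
  assumes D: "distributed M lborel D (\<lambda>x. ennreal (\<Prod>i\<in>UNIV. normal_density 0 \<sigma> (x $ i)))" and "0 < \<sigma>"
  shows "has_bochner_integral M (\<lambda>\<omega>. \<Prod>i\<in>UNIV. (D \<omega> $ i) ^ e i)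
    (\<Prod>i\<in>UNIV. LINT y|lborel. normal_density 0 \<sigma> y * y ^ e i)"
proof -
  have "has_bochner_integral lborel (\<lambda>x::real^'n. \<Prod>i\<in>UNIV. normal_density 0 \<sigma> (x $ i) * (x $ i) ^ e i)
     (\<Prod>i\<in>UNIV. LINT y|lborel. normal_density 0 \<sigma> y * y ^ e i)"
    using integrable_normal_moment[of \<sigma> 0] \<open>0 < \<sigma>\<close>
    by (intro has_bochner_integral_prod_vec) auto
  then have *: "has_bochner_integral lborel (\<lambda>x::real^'n. (\<Prod>i\<in>UNIV. normal_density 0 \<sigma> (x $ i)) * (\<Prod>i\<in>UNIV. (x $ i) ^ e i))
     (\<Prod>i\<in>UNIV. LINT y|lborel. normal_density 0 \<sigma> y * y ^ e i)"
    by (simp add: prod.distrib)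
  have m: "(\<lambda>x::real^'n. \<Prod>i\<in>UNIV. (x $ i) ^ e i) \<in> borel_measurable lborel" by measurable
  show ?thesis
    using * distributed_integral[OF D m] distributed_integrable[OF D m]
    by (simp add: has_bochner_integral_iff prod_nonneg)
qed

lemma normal_moments:
  assumes "0 < \<sigma>"
  shows "(LINT y|lborel. normal_density 0 \<sigma> y * y) = 0"
    "(LINT y|lborel. normal_density 0 \<sigma> y * y\<^sup>2) = \<sigma>\<^sup>2"
    "(LINT y|lborel. normal_density 0 \<sigma> y * y^4) = 3 * \<sigma>^4"
  using integral_normal_moment_odd[OF assms, of 0 0] integral_normal_moment_even[OF assms, of 0 1]
    integral_normal_moment_even[OF assms, of 0 2] by (simp_all add: fact_numeral power_divide)

text \<open>All three are instances of one product formula: a coordinate that does not occur in the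
  monomial contributes the total mass 1 of the normal density. The fourth moment is there for
  \<open>euler_weighted\<close>, where a squared increment meets a random weight that is not
  independent of it.\<close>

lemma (in prob_space) gaussian_moments:
  fixes D :: "'a \<Rightarrow> real^'n"
  assumes D: "distributed M lborel D (\<lambda>x. ennreal (\<Prod>i\<in>UNIV. normal_density 0 \<sigma> (x $ i)))" and \<sigma>: "0 < \<sigma>"
  shows "has_bochner_integral M (\<lambda>\<omega>. D \<omega> $ i) 0"
    "has_bochner_integral M (\<lambda>\<omega>. D \<omega> $ i * D \<omega> $ j) (if i = j then \<sigma>\<^sup>2 else 0)"
    "has_bochner_integral M (\<lambda>\<omega>. (D \<omega> $ i) ^ 4) (3 * \<sigma> ^ 4)"
proof -
  have p: "(\<Prod>k\<in>UNIV. x k ^ (if k = i then n else (0::nat))) = x i ^ n" for x :: "'n \<Rightarrow> real" and n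
  proof -
    have "(\<Prod>k\<in>UNIV. x k ^ (if k = i then n else 0)) = (\<Prod>k\<in>UNIV. if k = i then x k ^ n else 1)"
      by (intro prod.cong) auto
    then show ?thesis by (simp add: prod.delta)
  qed
  have q: "(\<Prod>k\<in>UNIV. LINT y|lborel. normal_density 0 \<sigma> y * y ^ (if k = i then n else (0::nat))) =
     (LINT y|lborel. normal_density 0 \<sigma> y * y ^ n)" for n
  proof -
    have "(\<Prod>k\<in>UNIV. LINT y|lborel. normal_density 0 \<sigma> y * y ^ (if k = i then n else 0)) =
      (\<Prod>k\<in>UNIV. if k = i then LINT y|lborel. normal_density 0 \<sigma> y * y ^ n else 1)"
      using \<sigma> by (intro prod.cong) auto
    then show ?thesis by (simp add: prod.delta)
  qed
  note G = gaussian_monomial_moment[OF D \<sigma>, of "\<lambda>k. if k = i then n else 0" for n, unfolded p q]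
  show 1: "has_bochner_integral M (\<lambda>\<omega>. D \<omega> $ i) 0"
    using G[of 1] normal_moments[OF \<sigma>] by simp
  show "has_bochner_integral M (\<lambda>\<omega>. (D \<omega> $ i) ^ 4) (3 * \<sigma> ^ 4)"
    using G[of 4] normal_moments[OF \<sigma>] by simp
  show "has_bochner_integral M (\<lambda>\<omega>. D \<omega> $ i * D \<omega> $ j) (if i = j then \<sigma>\<^sup>2 else 0)"
  proof (cases "i = j")
    case True
    then show ?thesis using G[of 2] normal_moments[OF \<sigma>] by (simp add: power2_eq_square)
  next
    case False
    let ?e = "\<lambda>k. if k = i \<or> k = j then 1 else (0::nat)"
    have "(\<Prod>k\<in>UNIV. x k ^ ?e k) = x i * x j" for x :: "'n \<Rightarrow> real"
    proof -
      have "(\<Prod>k\<in>UNIV. x k ^ ?e k) = (\<Prod>k\<in>{i,j}. x k ^ ?e k)"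
        by (rule prod.mono_neutral_right) auto
      then show ?thesis using False by simp
    qed
    moreover have "(\<Prod>k\<in>UNIV. LINT y|lborel. normal_density 0 \<sigma> y * y ^ ?e k) = 0"
      using normal_moments(1)[OF \<sigma>] by (subst prod_zero_iff) (auto intro!: exI[of _ i])
    ultimately show ?thesis
      using gaussian_monomial_moment[OF D \<sigma>, of ?e] False by (simp only: if_False)
  qed
qed

section \<open>The driving filtration\<close>

locale diffusion = prob_space P for P :: "'a measure" +
  fixes W X :: "real \<Rightarrow> 'a \<Rightarrow> real ^ 'n"
    and B :: "real ^ 'n \<Rightarrow> real ^ 'n"
    and A :: "real ^ 'n \<Rightarrow> real ^ 'n ^ 'n"
  assumes W: "brownian_motion P W" and X: "sde_solution P W B A X"
begin

abbreviation F :: "real \<Rightarrow> 'a measure" where "F \<equiv> augmented_filtration P (X 0) W"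

lemma W_measurable[measurable]: "0 \<le> t \<Longrightarrow> W t \<in> borel_measurable P"
  and W_0: "AE \<omega> in P. W 0 \<omega> = 0"
  and W_distributed: "0 \<le> s \<Longrightarrow> s < t \<Longrightarrow> distributed P lborel (\<lambda>\<omega>. W t \<omega> - W s \<omega>)
          (\<lambda>x. ennreal (\<Prod>i\<in>UNIV. normal_density 0 (sqrt (t - s)) (x $ i)))"
  and W_indep: "0 \<le> \<tau> 0 \<Longrightarrow> (\<And>k. k < n \<Longrightarrow> \<tau> k < \<tau> (Suc k)) \<Longrightarrow>
        indep_vars (\<lambda>_. borel) (\<lambda>k \<omega>. W (\<tau> (Suc k)) \<omega> - W (\<tau> k) \<omega>) {..<n}"
  using W unfolding brownian_motion_def by auto

lemma X_F: "0 \<le> t \<Longrightarrow> X t \<in> borel_measurable (F t)"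
  and X_continuous: "\<omega> \<in> space P \<Longrightarrow> continuous_on {0..} (\<lambda>t. X t \<omega>)"
  and X_indep: "indep_set (sets (vimage_algebra (space P) (X 0) borel))
       (sets (vimage_algebra (space P) (\<lambda>\<omega>. \<lambda>t\<in>{0..}. W t \<omega>) (\<Pi>\<^sub>M t\<in>{0..}. borel)))"
  using X unfolding sde_solution_def by auto

text \<open>Measurability of the initial value with respect to \<open>P\<close> is hidden in the
  independence condition, since independent families consist of events. It has to precede any use of
  the filtration, whose generators include preimages under \<open>X 0\<close>.\<close>

lemma X_0_measurable: "X 0 \<in> borel_measurable P"
proof (rule measurableI)
  fix S :: "(real^'n) set" assume "S \<in> sets borel"
  then have "X 0 -` S \<inter> space P \<in> sets (vimage_algebra (space P) (X 0) borel)"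
    by (rule in_vimage_algebra)
  then show "X 0 -` S \<inter> space P \<in> sets P"
    using X_indep unfolding indep_sets2_eq by blast
qed simp

lemma F_gen_subset: "{X 0 -` S \<inter> space P | S. S \<in> sets borel} \<union>
      {W s -` S \<inter> space P | s S. 0 \<le> s \<and> s \<le> t \<and> S \<in> sets borel} \<union> null_sets P \<subseteq> sets P"
  by (auto intro: measurable_sets[OF W_measurable] measurable_sets[OF X_0_measurable])

lemma space_F[simp]: "space (F t) = space P"
  unfolding augmented_filtration_def by (rule space_measure_of_conv)

lemma sets_F: "sets (F t) = sigma_sets (space P) ({X 0 -` S \<inter> space P | S. S \<in> sets borel} \<union>
      {W s -` S \<inter> space P | s S. 0 \<le> s \<and> s \<le> t \<and> S \<in> sets borel} \<union> null_sets P)"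
  unfolding augmented_filtration_def
  by (rule sets_measure_of) (rule order_trans[OF F_gen_subset sets.space_closed])

lemma sets_F_subset: "sets (F t) \<subseteq> sets P"
  unfolding sets_F by (rule sets.sigma_sets_subset[OF F_gen_subset])

lemma F_mono: "s \<le> t \<Longrightarrow> sets (F s) \<subseteq> sets (F t)"
  unfolding sets_F by (intro sigma_sets_mono' Un_mono) (auto intro: order_trans)

lemma measurable_F_mono: "f \<in> measurable (F s) N \<Longrightarrow> s \<le> t \<Longrightarrow> f \<in> measurable (F t) N"
  using F_mono[of s t] by (auto simp: measurable_def)

lemma measurable_F_P: "f \<in> measurable (F s) N \<Longrightarrow> f \<in> measurable P N"
  using sets_F_subset[of s] by (auto simp: measurable_def)

lemma X_measurable[measurable]: "0 \<le> t \<Longrightarrow> X t \<in> borel_measurable P"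
  by (rule measurable_F_P[OF X_F])

lemma W_F: "0 \<le> s \<Longrightarrow> s \<le> t \<Longrightarrow> W s \<in> borel_measurable (F t)"
proof (rule measurableI)
  fix S :: "(real^'n) set" assume "0 \<le> s" "s \<le> t" "S \<in> sets borel"
  then show "W s -` S \<inter> space (F t) \<in> sets (F t)"
    unfolding sets_F space_F by (intro sigma_sets.Basic) auto
qed simp

text \<open>Independence of increments is available along strictly increasing finite sequences of
  times. The times in \<open>I\<close> are therefore sorted, completed by 0 and \<open>a\<close>,
  and followed by \<open>b\<close>; the values of \<open>W\<close> at these times are partial sums
  of all increments but the last.\<close>

lemma W_cylinder_indep:
  assumes I: "finite I" "I \<subseteq> {0..a}" and ab: "0 \<le> a" "a < b"
    and S: "\<And>s. S s \<in> sets borel" and D: "D \<in> sets borel"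
  shows "prob {\<omega>\<in>space P. (\<forall>s\<in>I. W s \<omega> \<in> S s) \<and> W b \<omega> - W a \<omega> \<in> D} =
    prob {\<omega>\<in>space P. \<forall>s\<in>I. W s \<omega> \<in> S s} * prob {\<omega>\<in>space P. W b \<omega> - W a \<omega> \<in> D}"
proof -
  define L where "L = sorted_list_of_set (insert 0 (insert a I))"
  define n where "n = length L - 1"
  \<comment> \<open>\<open>n\<close> is the position of \<open>a\<close>, the largest entry of
    \<open>L\<close>; index \<open>Suc n\<close> falls outside the list and yields \<open>b\<close>.
    Hence the increments with index below \<open>n\<close> make up the past, and the one with index
    \<open>n\<close> is the increment from \<open>a\<close> to \<open>b\<close>.\<close>
  define \<tau> where "\<tau> k = (if k < length L then L ! k else b)" for k
  have setL: "set L = insert 0 (insert a I)" and sL: "sorted L" and dL: "distinct L"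
    using I unfolding L_def by (simp_all del: sorted_list_of_set_insert_remove)
  have len: "length L = Suc n"
  proof -
    have "length L \<noteq> 0" using setL by (metis insert_not_empty length_0_conv list.set(1))
    then show ?thesis unfolding n_def by simp
  qed
  have range: "L ! k \<in> {0..a}" if "k \<le> n" for k
  proof -
    have "L ! k \<in> set L" using that len by simp
    moreover have "set L \<subseteq> {0..a}" unfolding setL using I ab by simp
    ultimately show ?thesis by blast
  qed
  have \<tau>0: "\<tau> 0 = 0"
  proof -
    have "0 \<in> set L" using setL by simp
    then obtain i where i: "i < length L" "L ! i = 0"
      unfolding in_set_conv_nth by blast
    then have "i \<le> n" using len by simp
    moreover have "L ! 0 \<le> L ! i" by (rule sorted_nth_mono[OF sL]) (use \<open>i \<le> n\<close> len in simp_all)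
    ultimately have "L ! 0 = 0" using range[of 0] i by simp
    then show ?thesis using len by (simp add: \<tau>_def)
  qed
  have \<tau>n: "\<tau> n = a"
  proof -
    have "a \<in> set L" using setL by simp
    then obtain i where i: "i < length L" "L ! i = a"
      unfolding in_set_conv_nth by blast
    then have "i \<le> n" using len by simp
    moreover have "L ! i \<le> L ! n" by (rule sorted_nth_mono[OF sL]) (use \<open>i \<le> n\<close> len in simp_all)
    ultimately have "L ! n = a" using range[of n] i by simp
    then show ?thesis using len by (simp add: \<tau>_def)
  qed
  have \<tau>Sn: "\<tau> (Suc n) = b" by (simp add: \<tau>_def len)
  have inc: "\<tau> k < \<tau> (Suc k)" if "k < Suc n" for k
  proof (cases "k = n")
    case True then show ?thesis using \<tau>n \<tau>Sn ab by simp
  next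
    case False
    then have k: "Suc k < length L" using that len by simp
    have "L ! k \<le> L ! Suc k" by (rule sorted_nth_mono[OF sL]) (use k in simp_all)
    moreover have "L ! k \<noteq> L ! Suc k" using dL k by (simp add: nth_eq_iff_index_eq)
    ultimately show ?thesis using k by (simp add: \<tau>_def)
  qed
  have \<tau>_ge: "0 \<le> \<tau> k" for k
    using range[of k] ab by (simp add: \<tau>_def len)
  define J where "J k \<omega> = W (\<tau> (Suc k)) \<omega> - W (\<tau> k) \<omega>" for k \<omega>
  have "indep_vars (\<lambda>_. borel) J {..<Suc n}"
    unfolding J_def by (rule W_indep) (auto simp: \<tau>0 inc)
  then have iv: "indep_var (Pi\<^sub>M {..<n} (\<lambda>_. borel)) (\<lambda>\<omega>. \<lambda>i\<in>{..<n}. J i \<omega>)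
      (Pi\<^sub>M {n} (\<lambda>_. borel)) (\<lambda>\<omega>. \<lambda>i\<in>{n}. J i \<omega>)"
    by (rule indep_var_restrict) auto
  have Jm[measurable]: "J k \<in> borel_measurable P" for k
    unfolding J_def using \<tau>_ge by (intro borel_measurable_diff W_measurable)
  define Q where "Q = {x\<in>space (Pi\<^sub>M {..<n} (\<lambda>_. borel :: (real^'n) measure)).
     \<forall>k\<in>{..n}. \<tau> k \<in> I \<longrightarrow> (\<Sum>i\<in>{..<k}. x i) \<in> S (\<tau> k)}"
  define R where "R = {x\<in>space (Pi\<^sub>M {n} (\<lambda>_. borel :: (real^'n) measure)). x n \<in> D}"
  have sm: "(\<lambda>x. \<Sum>i\<in>{..<k}. x i) \<in> borel_measurable (Pi\<^sub>M {..<n} (\<lambda>_. borel :: (real^'n) measure))" if "k \<le> n" for k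
    using that by (intro borel_measurable_sum measurable_component_singleton) auto
  have Qs: "Q \<in> sets (Pi\<^sub>M {..<n} (\<lambda>_. borel))"
    unfolding Q_def
  proof (rule sets.sets_Collect_finite_All)
    fix k assume k: "k \<in> {..n}"
    have "(\<lambda>x. \<Sum>i\<in>{..<k}. x i) -` S (\<tau> k) \<inter> space (Pi\<^sub>M {..<n} (\<lambda>_. borel :: (real^'n) measure)) \<in> sets (Pi\<^sub>M {..<n} (\<lambda>_. borel))"
      using k by (intro measurable_sets[OF sm] S) auto
    then have "{x \<in> space (Pi\<^sub>M {..<n} (\<lambda>_. borel :: (real^'n) measure)). (\<Sum>i\<in>{..<k}. x i) \<in> S (\<tau> k)} \<in> sets (Pi\<^sub>M {..<n} (\<lambda>_. borel))"
      by (simp add: vimage_def Int_def conj_commute)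
    then show "{x \<in> space (Pi\<^sub>M {..<n} (\<lambda>_. borel :: (real^'n) measure)). \<tau> k \<in> I \<longrightarrow> (\<Sum>i\<in>{..<k}. x i) \<in> S (\<tau> k)} \<in> sets (Pi\<^sub>M {..<n} (\<lambda>_. borel))"
      by (cases "\<tau> k \<in> I") auto
  qed auto
  have Rs: "R \<in> sets (Pi\<^sub>M {n} (\<lambda>_. borel))"
    unfolding R_def using D by measurable
  have tele: "(\<Sum>i<k. J i \<omega>) = W (\<tau> k) \<omega> - W 0 \<omega>" for k \<omega>
    by (induction k) (simp_all add: J_def \<tau>0)
  have memI: "s \<in> I \<longleftrightarrow> (\<exists>k\<le>n. \<tau> k = s \<and> \<tau> k \<in> I)" for s
  proof
    assume s: "s \<in> I"
    then have "s \<in> set L" using setL by simp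
    then obtain k where "k < length L" "L ! k = s" unfolding in_set_conv_nth by auto
    then show "\<exists>k\<le>n. \<tau> k = s \<and> \<tau> k \<in> I" using s len by (intro exI[of _ k]) (auto simp: \<tau>_def)
  qed auto
  \<comment> \<open>The sums telescope to \<open>W (\<tau> k) - W 0\<close>, and
    \<open>W 0 = 0\<close> holds only almost surely; the two events agree up to a null set.\<close>
  have Qeq: "AE \<omega> in P. (\<lambda>i\<in>{..<n}. J i \<omega>) \<in> Q \<longleftrightarrow> (\<forall>s\<in>I. W s \<omega> \<in> S s)"
    using W_0
  proof eventually_elim
    case (elim \<omega>)
    have "(\<lambda>i\<in>{..<n}. J i \<omega>) \<in> Q \<longleftrightarrow> (\<forall>k\<le>n. \<tau> k \<in> I \<longrightarrow> (\<Sum>i<k. J i \<omega>) \<in> S (\<tau> k))"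
      by (auto simp: Q_def space_PiM)
    also have "\<dots> \<longleftrightarrow> (\<forall>k\<le>n. \<tau> k \<in> I \<longrightarrow> W (\<tau> k) \<omega> \<in> S (\<tau> k))"
      by (simp add: tele elim)
    also have "\<dots> \<longleftrightarrow> (\<forall>s\<in>I. W s \<omega> \<in> S s)"
      using memI by metis
    finally show ?case .
  qed
  have Req: "(\<lambda>i\<in>{n}. J i \<omega>) \<in> R \<longleftrightarrow> W b \<omega> - W a \<omega> \<in> D" for \<omega>
    by (auto simp: R_def space_PiM J_def \<tau>n \<tau>Sn)
  have JQ: "(\<lambda>\<omega>. \<lambda>i\<in>{..<n}. J i \<omega>) \<in> P \<rightarrow>\<^sub>M Pi\<^sub>M {..<n} (\<lambda>_. borel)"
    by (rule measurable_restrict) simp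
  have JR: "(\<lambda>\<omega>. \<lambda>i\<in>{n}. J i \<omega>) \<in> P \<rightarrow>\<^sub>M Pi\<^sub>M {n} (\<lambda>_. borel)"
    by (rule measurable_restrict) simp
  have Wm: "W s \<in> borel_measurable P" if "s \<in> I" for s
    using that I by (intro W_measurable) auto
  have Ipm: "{\<omega>\<in>space P. \<forall>s\<in>I. W s \<omega> \<in> S s} \<in> sets P"
  proof (rule sets.sets_Collect_finite_All[OF _ I(1)])
    fix s assume "s \<in> I"
    from measurable_sets_Collect[OF Wm[OF this], of "\<lambda>x. x \<in> S s"] S
    show "{\<omega>\<in>space P. W s \<omega> \<in> S s} \<in> sets P" by simp
  qed
  have Dm: "{\<omega>\<in>space P. W b \<omega> - W a \<omega> \<in> D} \<in> sets P"
    using measurable_sets_Collect[OF borel_measurable_diff[OF W_measurable W_measurable], of b a "\<lambda>x. x \<in> D"] ab D by simp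
  have "{\<omega>\<in>space P. (\<forall>s\<in>I. W s \<omega> \<in> S s) \<and> W b \<omega> - W a \<omega> \<in> D} =
     {\<omega>\<in>space P. \<forall>s\<in>I. W s \<omega> \<in> S s} \<inter> {\<omega>\<in>space P. W b \<omega> - W a \<omega> \<in> D}" by auto
  then have both: "{\<omega>\<in>space P. (\<forall>s\<in>I. W s \<omega> \<in> S s) \<and> W b \<omega> - W a \<omega> \<in> D} \<in> sets P"
    using sets.Int[OF Ipm Dm] by simp
  have Qm: "{\<omega>\<in>space P. (\<lambda>i\<in>{..<n}. J i \<omega>) \<in> Q} \<in> sets P"
    using measurable_sets[OF JQ Qs] by (simp add: vimage_def Int_def conj_commute)
  have Rm: "{\<omega>\<in>space P. (\<lambda>i\<in>{n}. J i \<omega>) \<in> R} \<in> sets P"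
    using measurable_sets[OF JR Rs] by (simp add: vimage_def Int_def conj_commute)
  have QRm: "{\<omega>\<in>space P. (\<lambda>i\<in>{..<n}. J i \<omega>) \<in> Q \<and> (\<lambda>i\<in>{n}. J i \<omega>) \<in> R} \<in> sets P"
    using sets.sets_Collect_conj[OF Rm Qm] by (simp add: conj_commute)
  have 1: "prob {\<omega>\<in>space P. (\<lambda>i\<in>{..<n}. J i \<omega>) \<in> Q \<and> (\<lambda>i\<in>{n}. J i \<omega>) \<in> R} =
     prob {\<omega>\<in>space P. (\<lambda>i\<in>{..<n}. J i \<omega>) \<in> Q} * prob {\<omega>\<in>space P. (\<lambda>i\<in>{n}. J i \<omega>) \<in> R}"
    using indep_varD[OF iv Qs Rs] by (simp only: vimage_def Int_def mem_Times_iff fst_conv snd_conv mem_Collect_eq conj_commute conj_assoc)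
  have 2: "prob {\<omega>\<in>space P. (\<lambda>i\<in>{..<n}. J i \<omega>) \<in> Q \<and> (\<lambda>i\<in>{n}. J i \<omega>) \<in> R} =
     prob {\<omega>\<in>space P. (\<forall>s\<in>I. W s \<omega> \<in> S s) \<and> W b \<omega> - W a \<omega> \<in> D}"
    using Qeq by (intro finite_measure_eq_AE QRm both) (auto simp: Req elim!: eventually_mono)
  have 3: "prob {\<omega>\<in>space P. (\<lambda>i\<in>{..<n}. J i \<omega>) \<in> Q} = prob {\<omega>\<in>space P. \<forall>s\<in>I. W s \<omega> \<in> S s}"
    using Qeq by (intro finite_measure_eq_AE Qm Ipm) (auto elim!: eventually_mono)
  show ?thesis using 1 unfolding 2 3 by (simp add: Req)
qed

text \<open>The sigma-algebra at time \<open>a\<close> is generated by an intersection-stable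
  family: cylinder events in \<open>X 0\<close> and finitely many \<open>W s\<close>, together with
  all null sets. The null sets belong to the family because the filtration is augmented; they are
  independent of every event.\<close>

lemma indep_F_increment:
  fixes \<zeta> :: "'a \<Rightarrow> real" and g :: "real^'n \<Rightarrow> real"
  assumes ab: "0 \<le> a" "a < b" and \<zeta>: "\<zeta> \<in> borel_measurable (F a)" and g: "g \<in> borel_measurable borel"
  shows "indep_var borel \<zeta> borel (\<lambda>\<omega>. g (W b \<omega> - W a \<omega>))"
proof -
  define \<A> where "\<A> = null_sets P \<union> {{\<omega>\<in>space P. X 0 \<omega> \<in> S0 \<and> (\<forall>s\<in>I. W s \<omega> \<in> S s)} | S0 I S.
     S0 \<in> sets borel \<and> finite I \<and> I \<subseteq> {0..a} \<and> (\<forall>s. S s \<in> sets borel)}"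
  define \<B> where "\<B> = {{\<omega>\<in>space P. W b \<omega> - W a \<omega> \<in> D} | D. D \<in> sets borel}"
  have Wm: "W s \<in> borel_measurable P" if "0 \<le> s" for s using that by simp
  have cyl: "{\<omega>\<in>space P. \<forall>s\<in>I. W s \<omega> \<in> S s} \<in> sets P" if "finite I" "I \<subseteq> {0..a}" "\<And>s. S s \<in> sets borel" for I S
  proof (rule sets.sets_Collect_finite_All[OF _ that(1)])
    fix s assume "s \<in> I"
    then have "0 \<le> s" using that by auto
    from measurable_sets_Collect[OF Wm[OF this], of "\<lambda>x. x \<in> S s"] that(3)
    show "{\<omega>\<in>space P. W s \<omega> \<in> S s} \<in> sets P" by simp
  qed
  have \<A>sub: "\<A> \<subseteq> sets P"
  proof
    fix E assume "E \<in> \<A>"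
    then consider "E \<in> null_sets P" | S0 I S where "E = {\<omega>\<in>space P. X 0 \<omega> \<in> S0 \<and> (\<forall>s\<in>I. W s \<omega> \<in> S s)}"
        "S0 \<in> sets borel" "finite I" "I \<subseteq> {0..a}" "\<forall>s. S s \<in> sets borel"
      unfolding \<A>_def by blast
    then show "E \<in> sets P"
    proof cases
      case 2
      then have "E = (X 0 -` S0 \<inter> space P) \<inter> {\<omega>\<in>space P. \<forall>s\<in>I. W s \<omega> \<in> S s}" by auto
      then show ?thesis using cyl 2 measurable_sets[OF X_0_measurable] by auto
    qed auto
  qed
  have \<B>sub: "\<B> \<subseteq> sets P"
    unfolding \<B>_def using ab by (auto intro!: measurable_sets_Collect[OF borel_measurable_diff[OF Wm Wm]])
  have "indep_set \<A> \<B>"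
  proof (rule indep_setI[OF \<A>sub \<B>sub])
    fix E G assume "E \<in> \<A>" "G \<in> \<B>"
    then obtain D where G: "G = {\<omega>\<in>space P. W b \<omega> - W a \<omega> \<in> D}" and D: "D \<in> sets borel" unfolding \<B>_def by auto
    have Gm: "G \<in> sets P" using \<B>sub \<open>G \<in> \<B>\<close> by auto
    consider "E \<in> null_sets P" | S0 I S where "E = {\<omega>\<in>space P. X 0 \<omega> \<in> S0 \<and> (\<forall>s\<in>I. W s \<omega> \<in> S s)}"
        "S0 \<in> sets borel" "finite I" "I \<subseteq> {0..a}" "\<forall>s. S s \<in> sets borel"
      using \<open>E \<in> \<A>\<close> unfolding \<A>_def by blast
    then show "prob (E \<inter> G) = prob E * prob G"
    proof cases
      case 1
      then show ?thesis using Gm null_set_Int2[of E P G] by (simp add: measure_eq_0_null_sets)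
    next
      case 2
      let ?V = "vimage_algebra (space P) (\<lambda>\<omega>. \<lambda>t\<in>{0..}. W t \<omega>) (\<Pi>\<^sub>M t\<in>{0..}. borel)"
      have Wv: "W s \<in> borel_measurable ?V" if "0 \<le> s" for s
      proof -
        have "(\<lambda>\<omega>. \<lambda>t\<in>{0..}. W t \<omega>) \<in> ?V \<rightarrow>\<^sub>M (\<Pi>\<^sub>M t\<in>{0..}. borel)"
          by (rule measurable_vimage_algebra1) (auto simp: space_PiM)
        from measurable_component_singleton[THEN measurable_compose[OF this], of s] that
        show ?thesis by simp
      qed
      have V1: "{\<omega>\<in>space P. \<forall>s\<in>I. W s \<omega> \<in> S s} \<in> sets ?V"
      proof -
        have "{\<omega>\<in>space ?V. \<forall>s\<in>I. W s \<omega> \<in> S s} \<in> sets ?V"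
        proof (rule sets.sets_Collect_finite_All[OF _ 2(3)])
          fix s assume "s \<in> I"
          then have "0 \<le> s" using 2 by auto
          from measurable_sets_Collect[OF Wv[OF this], of "\<lambda>x. x \<in> S s"] 2
          show "{\<omega>\<in>space ?V. W s \<omega> \<in> S s} \<in> sets ?V" by simp
        qed
        then show ?thesis by simp
      qed
      have V2: "{\<omega>\<in>space P. W b \<omega> - W a \<omega> \<in> D} \<in> sets ?V"
        using measurable_sets_Collect[OF borel_measurable_diff[OF Wv Wv], of b a "\<lambda>x. x \<in> D"] ab D by simp
      have S0: "X 0 -` S0 \<inter> space P \<in> sets (vimage_algebra (space P) (X 0) borel)"
        using 2 by (intro in_vimage_algebra) auto
      \<comment> \<open>Independence is used twice: \<open>X 0\<close> is split off from the whole
        path of \<open>W\<close>, then the past of \<open>W\<close> from its increment. Afterwards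
        the first two factors are put together again.\<close>
      have "prob (E \<inter> G) = prob ((X 0 -` S0 \<inter> space P) \<inter> ({\<omega>\<in>space P. \<forall>s\<in>I. W s \<omega> \<in> S s} \<inter> {\<omega>\<in>space P. W b \<omega> - W a \<omega> \<in> D}))"
        unfolding 2 G by (rule arg_cong[of _ _ prob]) auto
      also have "\<dots> = prob (X 0 -` S0 \<inter> space P) * prob ({\<omega>\<in>space P. \<forall>s\<in>I. W s \<omega> \<in> S s} \<inter> {\<omega>\<in>space P. W b \<omega> - W a \<omega> \<in> D})"
        by (rule indep_setD[OF X_indep S0 sets.Int[OF V1 V2]])
      also have "{\<omega>\<in>space P. \<forall>s\<in>I. W s \<omega> \<in> S s} \<inter> {\<omega>\<in>space P. W b \<omega> - W a \<omega> \<in> D} =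
          {\<omega>\<in>space P. (\<forall>s\<in>I. W s \<omega> \<in> S s) \<and> W b \<omega> - W a \<omega> \<in> D}" by auto
      also have "prob \<dots> = prob {\<omega>\<in>space P. \<forall>s\<in>I. W s \<omega> \<in> S s} * prob G"
        unfolding G using 2 ab D by (intro W_cylinder_indep) auto
      also have "prob (X 0 -` S0 \<inter> space P) * (prob {\<omega>\<in>space P. \<forall>s\<in>I. W s \<omega> \<in> S s} * prob G)
         = prob ((X 0 -` S0 \<inter> space P) \<inter> {\<omega>\<in>space P. \<forall>s\<in>I. W s \<omega> \<in> S s}) * prob G"
        using indep_setD[OF X_indep S0 V1] by simp
      also have "(X 0 -` S0 \<inter> space P) \<inter> {\<omega>\<in>space P. \<forall>s\<in>I. W s \<omega> \<in> S s} = E"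
        unfolding 2 by auto
      finally show ?thesis .
    qed
  qed
  moreover have "Int_stable \<A>"
  proof (rule Int_stableI)
    fix E G assume EG: "E \<in> \<A>" "G \<in> \<A>"
    show "E \<inter> G \<in> \<A>"
    proof (cases "E \<in> null_sets P \<or> G \<in> null_sets P")
      case True
      then have "E \<inter> G \<in> null_sets P" using EG \<A>sub by (auto intro: null_set_Int1 null_set_Int2)
      then show ?thesis by (simp add: \<A>_def)
    next
      case False
      obtain S0 I S where E: "E = {\<omega>\<in>space P. X 0 \<omega> \<in> S0 \<and> (\<forall>s\<in>I. W s \<omega> \<in> S s)}"
        "S0 \<in> sets borel" "finite I" "I \<subseteq> {0..a}" "\<forall>s. S s \<in> sets borel"
        using EG False unfolding \<A>_def by blast
      obtain S0' I' S' where G: "G = {\<omega>\<in>space P. X 0 \<omega> \<in> S0' \<and> (\<forall>s\<in>I'. W s \<omega> \<in> S' s)}"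
        "S0' \<in> sets borel" "finite I'" "I' \<subseteq> {0..a}" "\<forall>s. S' s \<in> sets borel"
        using EG False unfolding \<A>_def by blast
      \<comment> \<open>A time that occurs in one of the cylinders only is constrained by
        \<open>UNIV\<close> on behalf of the other.\<close>
      have "E \<inter> G = {\<omega>\<in>space P. X 0 \<omega> \<in> S0 \<inter> S0' \<and>
         (\<forall>s\<in>I \<union> I'. W s \<omega> \<in> (if s \<in> I then S s else UNIV) \<inter> (if s \<in> I' then S' s else UNIV))}"
        unfolding E G by auto
      moreover have "S0 \<inter> S0' \<in> sets borel" "finite (I \<union> I')" "I \<union> I' \<subseteq> {0..a}"
        "\<forall>s. (if s \<in> I then S s else UNIV) \<inter> (if s \<in> I' then S' s else UNIV) \<in> sets borel"
        using E G by auto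
      ultimately show ?thesis
        unfolding \<A>_def
        by (intro UnI2 CollectI exI[of _ "S0 \<inter> S0'"] exI[of _ "I \<union> I'"]
          exI[of _ "\<lambda>s. (if s \<in> I then S s else UNIV) \<inter> (if s \<in> I' then S' s else UNIV)"] conjI)
    qed
  qed
  moreover have "Int_stable \<B>"
  proof (rule Int_stableI)
    fix E G assume "E \<in> \<B>" "G \<in> \<B>"
    then obtain D D' where "E = {\<omega>\<in>space P. W b \<omega> - W a \<omega> \<in> D}" "G = {\<omega>\<in>space P. W b \<omega> - W a \<omega> \<in> D'}"
      "D \<in> sets borel" "D' \<in> sets borel" unfolding \<B>_def by auto
    then show "E \<inter> G \<in> \<B>"
      unfolding \<B>_def by (intro CollectI exI[of _ "D \<inter> D'"]) auto
  qed
  ultimately have ind: "indep_set (sigma_sets (space P) \<A>) (sigma_sets (space P) \<B>)"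
    by (rule indep_set_sigma_sets)
  have FA: "sets (F a) \<subseteq> sigma_sets (space P) \<A>"
    unfolding sets_F
  proof (rule sigma_sets_mono', safe)
    fix S :: "(real^'n) set" assume "S \<in> sets borel"
    then show "X 0 -` S \<inter> space P \<in> \<A>"
      unfolding \<A>_def by (intro UnI2 CollectI exI[of _ S] exI[of _ "{}"] exI[of _ "\<lambda>_. UNIV"]) auto
  next
    fix S :: "(real^'n) set" and s assume "S \<in> sets borel" "0 \<le> s" "s \<le> a"
    then show "W s -` S \<inter> space P \<in> \<A>"
      unfolding \<A>_def by (intro UnI2 CollectI exI[of _ UNIV] exI[of _ "{s}"] exI[of _ "\<lambda>_. S"]) auto
  next
    fix N assume "N \<in> null_sets P" then show "N \<in> \<A>" by (simp add: \<A>_def)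
  qed
  have dm: "(\<lambda>\<omega>. W b \<omega> - W a \<omega>) \<in> borel_measurable P" by (intro borel_measurable_diff Wm) (use ab in simp_all)
  show ?thesis
    unfolding indep_var_eq
  proof (intro conjI)
    show "random_variable borel \<zeta>" by (rule measurable_F_P[OF \<zeta>])
    show "random_variable borel (\<lambda>\<omega>. g (W b \<omega> - W a \<omega>))" using dm g by measurable
    have "sigma_sets (space P) {\<zeta> -` C \<inter> space P |C. C \<in> sets borel} \<subseteq> sigma_sets (space P) \<A>"
      using measurable_sets[OF \<zeta>] FA by (intro sigma_sets_mono) (auto simp del: sets_F)
    moreover have "sigma_sets (space P) {(\<lambda>\<omega>. g (W b \<omega> - W a \<omega>)) -` C \<inter> space P |C. C \<in> sets borel} \<subseteq> sigma_sets (space P) \<B>"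
    proof (rule sigma_sets_mono', safe)
      fix C :: "real set" assume "C \<in> sets borel"
      then show "(\<lambda>\<omega>. g (W b \<omega> - W a \<omega>)) -` C \<inter> space P \<in> \<B>"
        using measurable_sets_borel[OF g] unfolding \<B>_def by (intro CollectI exI[of _ "g -` C"]) auto
    qed
    ultimately show "indep_set (sigma_sets (space P) {\<zeta> -` C \<inter> space P |C. C \<in> sets borel})
       (sigma_sets (space P) {(\<lambda>\<omega>. g (W b \<omega> - W a \<omega>)) -` C \<inter> space P |C. C \<in> sets borel})"
      using ind unfolding indep_sets2_eq by blast
  qed
qed

end

section \<open>Elementary stochastic integrals\<close>

context diffusion
begin

lemma W_moments:
  assumes "0 \<le> a" "a \<le> b"
  shows "has_bochner_integral P (\<lambda>\<omega>. W b \<omega> $ i - W a \<omega> $ i) 0"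
    "has_bochner_integral P (\<lambda>\<omega>. (W b \<omega> $ i - W a \<omega> $ i) * (W b \<omega> $ j - W a \<omega> $ j)) (if i = j then b - a else 0)"
    "has_bochner_integral P (\<lambda>\<omega>. (W b \<omega> $ i - W a \<omega> $ i) ^ 4) (3 * (b - a)\<^sup>2)"
proof -
  have "has_bochner_integral P (\<lambda>\<omega>. W b \<omega> $ i - W a \<omega> $ i) 0 \<and>
    has_bochner_integral P (\<lambda>\<omega>. (W b \<omega> $ i - W a \<omega> $ i) * (W b \<omega> $ j - W a \<omega> $ j)) (if i = j then b - a else 0) \<and>
    has_bochner_integral P (\<lambda>\<omega>. (W b \<omega> $ i - W a \<omega> $ i) ^ 4) (3 * (b - a)\<^sup>2)"
  proof (cases "a = b")
    case False
    then have "a < b" using assms by simp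
    moreover have "sqrt (b - a) ^ 4 = (b - a)\<^sup>2"
      using \<open>a < b\<close> by (simp add: power4_eq_xxxx power2_eq_square)
    ultimately show ?thesis
      using gaussian_moments(1)[OF W_distributed[OF assms(1) \<open>a < b\<close>], of i]
        gaussian_moments(2)[OF W_distributed[OF assms(1) \<open>a < b\<close>], of i j]
        gaussian_moments(3)[OF W_distributed[OF assms(1) \<open>a < b\<close>], of i] \<open>a < b\<close>
      by (cases "i = j") simp_all
  qed (simp add: has_bochner_integral_zero)
  then show "has_bochner_integral P (\<lambda>\<omega>. W b \<omega> $ i - W a \<omega> $ i) 0"
    "has_bochner_integral P (\<lambda>\<omega>. (W b \<omega> $ i - W a \<omega> $ i) * (W b \<omega> $ j - W a \<omega> $ j)) (if i = j then b - a else 0)"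
    "has_bochner_integral P (\<lambda>\<omega>. (W b \<omega> $ i - W a \<omega> $ i) ^ 4) (3 * (b - a)\<^sup>2)" by auto
qed

lemma has_bochner_integral_mult_increment:
  fixes \<zeta> :: "'a \<Rightarrow> real"
  assumes ab: "0 \<le> a" "a \<le> b" and \<zeta>: "\<zeta> \<in> borel_measurable (F a)" "integrable P \<zeta>"
    and g: "g \<in> borel_measurable borel" "has_bochner_integral P (\<lambda>\<omega>. g (W b \<omega> - W a \<omega>)) c"
    and g0: "a = b \<Longrightarrow> g 0 = 0"
  shows "has_bochner_integral P (\<lambda>\<omega>. \<zeta> \<omega> * g (W b \<omega> - W a \<omega>)) (expectation \<zeta> * c)"
proof (cases "a = b")
  case False
  then have "indep_var borel \<zeta> borel (\<lambda>\<omega>. g (W b \<omega> - W a \<omega>))"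
    using indep_F_increment[OF ab(1) _ \<zeta>(1) g(1), of b] ab by simp
  from indep_var_lebesgue_integral[OF this \<zeta>(2)] indep_var_integrable[OF this \<zeta>(2)] g
  show ?thesis by (simp add: has_bochner_integral_iff)
next
  case True
  then have "c = 0" using g g0 by (auto simp: has_bochner_integral_iff)
  then show ?thesis using True g0 by (simp add: has_bochner_integral_zero)
qed

lemma E_mult_increment:
  assumes "0 \<le> a" "a \<le> b" "\<zeta> \<in> borel_measurable (F a)" "integrable P \<zeta>"
  shows "has_bochner_integral P (\<lambda>\<omega>. \<zeta> \<omega> * (W b \<omega> $ j - W a \<omega> $ j)) 0"
  using has_bochner_integral_mult_increment[OF assms, of "\<lambda>x. x $ j" 0] W_moments(1)[OF assms(1,2), of j] by simp

lemma E_mult_increment2: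
  assumes "0 \<le> a" "a \<le> b" "\<zeta> \<in> borel_measurable (F a)" "integrable P \<zeta>"
  shows "has_bochner_integral P (\<lambda>\<omega>. \<zeta> \<omega> * ((W b \<omega> $ i - W a \<omega> $ i) * (W b \<omega> $ j - W a \<omega> $ j)))
     (expectation \<zeta> * (if i = j then b - a else 0))"
  using has_bochner_integral_mult_increment[OF assms, of "\<lambda>x. x $ i * x $ j"] W_moments(2)[OF assms(1,2), of i j] by simp

definition bounded_F :: "real \<Rightarrow> ('a \<Rightarrow> real) \<Rightarrow> bool" where
  "bounded_F a \<zeta> \<longleftrightarrow> \<zeta> \<in> borel_measurable (F a) \<and> (\<exists>C. \<forall>\<omega>\<in>space P. \<bar>\<zeta> \<omega>\<bar> \<le> C)"

lemma bounded_FD: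
  assumes "bounded_F a \<zeta>"
  shows "\<zeta> \<in> borel_measurable (F a)" "\<zeta> \<in> borel_measurable P" "integrable P \<zeta>"
    and bounded_F_bound: "\<exists>C. \<forall>\<omega>\<in>space P. \<bar>\<zeta> \<omega>\<bar> \<le> C"
proof -
  show "\<zeta> \<in> borel_measurable (F a)" "\<exists>C. \<forall>\<omega>\<in>space P. \<bar>\<zeta> \<omega>\<bar> \<le> C" using assms by (auto simp: bounded_F_def)
  then show m: "\<zeta> \<in> borel_measurable P" by (rule_tac measurable_F_P)
  obtain C where "\<forall>\<omega>\<in>space P. \<bar>\<zeta> \<omega>\<bar> \<le> C" using assms by (auto simp: bounded_F_def)
  then show "integrable P \<zeta>" using m by (intro integrable_const_bound[of _ C]) auto
qed

lemma bounded_F_mono: "bounded_F a \<zeta> \<Longrightarrow> a \<le> b \<Longrightarrow> bounded_F b \<zeta>"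
  unfolding bounded_F_def using measurable_F_mono[of \<zeta> a borel b] by blast

lemma bounded_F_mult:
  assumes "bounded_F a f" "bounded_F a g"
  shows "bounded_F a (\<lambda>\<omega>. f \<omega> * g \<omega>)"
proof -
  obtain C D where "\<forall>\<omega>\<in>space P. \<bar>f \<omega>\<bar> \<le> C" "\<forall>\<omega>\<in>space P. \<bar>g \<omega>\<bar> \<le> D"
    using assms unfolding bounded_F_def by blast
  then have "\<bar>f \<omega> * g \<omega>\<bar> \<le> C * D" if "\<omega> \<in> space P" for \<omega>
    unfolding abs_mult using that by (intro mult_mono) (auto intro: order_trans[OF abs_ge_zero])
  moreover have "(\<lambda>\<omega>. f \<omega> * g \<omega>) \<in> borel_measurable (F a)"
    using assms unfolding bounded_F_def by (intro borel_measurable_times) blast+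
  ultimately show ?thesis unfolding bounded_F_def by blast
qed

lemma bounded_F_uminus: "bounded_F a f \<Longrightarrow> bounded_F a (\<lambda>\<omega>. - f \<omega>)"
  unfolding bounded_F_def by (simp add: borel_measurable_uminus)

lemma W_diff_F:
  assumes "0 \<le> a" "a \<le> c" "0 \<le> b" "b \<le> c"
  shows "(\<lambda>\<omega>. W b \<omega> $ j - W a \<omega> $ j) \<in> borel_measurable (F c)"
  by (intro borel_measurable_diff measurable_compose[OF W_F borel_measurable_nth]) (use assms in auto)

text \<open>The earlier increment is known at time \<open>a'\<close>, so together with
  \<open>\<rho>\<close> it forms an integrable factor that the later increment, centred and
  independent of the past, averages out.\<close>

lemma E_bounded_F_increments:
  assumes ab: "0 \<le> a" "a \<le> b" "b \<le> a'" "a' \<le> b'" and \<rho>: "bounded_F a' \<rho>"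
  shows "has_bochner_integral P (\<lambda>\<omega>. \<rho> \<omega> * (W b \<omega> $ j - W a \<omega> $ j) * (W b' \<omega> $ j - W a' \<omega> $ j)) 0"
proof (rule E_mult_increment)
  show "(\<lambda>\<omega>. \<rho> \<omega> * (W b \<omega> $ j - W a \<omega> $ j)) \<in> borel_measurable (F a')"
    using bounded_FD(1)[OF \<rho>] W_diff_F[of a a' b j] ab by (intro borel_measurable_times) auto
  obtain C where C: "\<forall>\<omega>\<in>space P. \<bar>\<rho> \<omega>\<bar> \<le> C" using bounded_F_bound[OF \<rho>] by auto
  have i: "integrable P (\<lambda>\<omega>. W b \<omega> $ j - W a \<omega> $ j)"
    using W_moments(1)[of a b j] ab by (auto simp: has_bochner_integral_iff)
  show "integrable P (\<lambda>\<omega>. \<rho> \<omega> * (W b \<omega> $ j - W a \<omega> $ j))"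
  proof (rule Bochner_Integration.integrable_bound[OF integrable_mult_right[OF i, of C]])
    show "(\<lambda>\<omega>. \<rho> \<omega> * (W b \<omega> $ j - W a \<omega> $ j)) \<in> borel_measurable P"
      using i bounded_FD(2)[OF \<rho>] by (intro borel_measurable_times) auto
    show "AE \<omega> in P. norm (\<rho> \<omega> * (W b \<omega> $ j - W a \<omega> $ j)) \<le> norm (C * (W b \<omega> $ j - W a \<omega> $ j))"
      using C by (intro AE_I2) (auto simp: abs_mult intro!: mult_right_mono)
  qed
qed (use ab in auto)

text \<open>Both intervals are cut at \<open>a'\<close> and at the smaller right end point
  \<open>m\<close>. Products over disjoint pieces average to zero, the square over the common piece
  gives its length, and the product of the two pieces beyond \<open>m\<close> vanishes since one of
  them is empty.\<close>

lemma E_increments_overlap: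
  assumes ab: "0 \<le> a" "a \<le> b" "a \<le> a'" "a' \<le> b'" and \<rho>: "bounded_F a' \<rho>"
  shows "has_bochner_integral P (\<lambda>\<omega>. \<rho> \<omega> * (W b \<omega> $ j - W a \<omega> $ j) * (W b' \<omega> $ j - W a' \<omega> $ j))
     (expectation \<rho> * max 0 (min b b' - a'))"
proof (cases "b \<le> a'")
  case True
  then show ?thesis using E_bounded_F_increments[OF ab(1,2) True ab(4) \<rho>] by simp
next
  case False
  define m where "m = min b b'"
  have m: "a' \<le> m" "m \<le> b" "m \<le> b'" "0 \<le> a'" using ab False by (auto simp: m_def)
  let ?w = "\<lambda>t \<omega>. W t \<omega> $ j"
  have \<rho>m: "bounded_F m \<rho>" using \<rho> m by (auto intro: bounded_F_mono)
  have s1: "has_bochner_integral P (\<lambda>\<omega>. \<rho> \<omega> * (?w a' \<omega> - ?w a \<omega>) * (?w b' \<omega> - ?w a' \<omega>)) 0"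
    by (rule E_bounded_F_increments) (use ab \<rho> in auto)
  have s2: "has_bochner_integral P (\<lambda>\<omega>. \<rho> \<omega> * ((?w m \<omega> - ?w a' \<omega>) * (?w m \<omega> - ?w a' \<omega>))) (expectation \<rho> * (m - a'))"
    using E_mult_increment2[OF m(4,1) bounded_FD(1,3)[OF \<rho>], of j j] by simp
  have s3: "has_bochner_integral P (\<lambda>\<omega>. \<rho> \<omega> * (?w m \<omega> - ?w a' \<omega>) * (?w b' \<omega> - ?w m \<omega>)) 0"
    by (rule E_bounded_F_increments) (use m \<rho>m in auto)
  have s4: "has_bochner_integral P (\<lambda>\<omega>. \<rho> \<omega> * (?w m \<omega> - ?w a' \<omega>) * (?w b \<omega> - ?w m \<omega>)) 0"
    by (rule E_bounded_F_increments) (use m \<rho>m in auto)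
  have z: "(?w b \<omega> - ?w m \<omega>) * (?w b' \<omega> - ?w m \<omega>) = 0" for \<omega>
    by (auto simp: m_def min_def)
  have "\<rho> \<omega> * (?w b \<omega> - ?w a \<omega>) * (?w b' \<omega> - ?w a' \<omega>) =
     \<rho> \<omega> * (?w a' \<omega> - ?w a \<omega>) * (?w b' \<omega> - ?w a' \<omega>) + (\<rho> \<omega> * ((?w m \<omega> - ?w a' \<omega>) * (?w m \<omega> - ?w a' \<omega>))
     + (\<rho> \<omega> * (?w m \<omega> - ?w a' \<omega>) * (?w b' \<omega> - ?w m \<omega>) + \<rho> \<omega> * (?w m \<omega> - ?w a' \<omega>) * (?w b \<omega> - ?w m \<omega>)))" for \<omega>
  proof -
    have "\<rho> \<omega> * (?w b \<omega> - ?w a \<omega>) * (?w b' \<omega> - ?w a' \<omega>) =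
     \<rho> \<omega> * (?w a' \<omega> - ?w a \<omega>) * (?w b' \<omega> - ?w a' \<omega>) + (\<rho> \<omega> * ((?w m \<omega> - ?w a' \<omega>) * (?w m \<omega> - ?w a' \<omega>))
     + (\<rho> \<omega> * (?w m \<omega> - ?w a' \<omega>) * (?w b' \<omega> - ?w m \<omega>) + \<rho> \<omega> * (?w m \<omega> - ?w a' \<omega>) * (?w b \<omega> - ?w m \<omega>)))
     + \<rho> \<omega> * ((?w b \<omega> - ?w m \<omega>) * (?w b' \<omega> - ?w m \<omega>))" by (simp add: algebra_simps)
    then show ?thesis unfolding z by simp
  qed
  moreover have "expectation \<rho> * max 0 (min b b' - a') = 0 + (expectation \<rho> * (m - a') + (0 + 0))"
    using m by (simp add: m_def max_def)
  ultimately show ?thesis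
    using has_bochner_integral_add[OF s1 has_bochner_integral_add[OF s2 has_bochner_integral_add[OF s3 s4]]]
    by (simp only:)
qed

lemma E_elementary_mult:
  assumes "0 \<le> a" "a \<le> b" "bounded_F a \<xi>" "0 \<le> a'" "a' \<le> b'" "bounded_F a' \<xi>'"
  shows "has_bochner_integral P (\<lambda>\<omega>. (\<xi> \<omega> * (W b \<omega> $ j - W a \<omega> $ j)) * (\<xi>' \<omega> * (W b' \<omega> $ j - W a' \<omega> $ j)))
     (expectation (\<lambda>\<omega>. \<xi> \<omega> * \<xi>' \<omega>) * max 0 (min b b' - max a a'))"
proof (cases "a \<le> a'")
  case True
  have "bounded_F a' (\<lambda>\<omega>. \<xi> \<omega> * \<xi>' \<omega>)" using assms True by (auto intro: bounded_F_mult bounded_F_mono)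
  from E_increments_overlap[OF assms(1,2) True assms(5) this, of j] True show ?thesis
    by (simp add: max_def mult_ac)
next
  case False
  then have *: "a' \<le> a" by simp
  have "bounded_F a (\<lambda>\<omega>. \<xi> \<omega> * \<xi>' \<omega>)" using assms * by (auto intro: bounded_F_mult bounded_F_mono)
  from E_increments_overlap[OF assms(4,5) * assms(2) this, of j] * show ?thesis
    by (simp add: max_def mult_ac min.commute split: if_splits)
qed

lemma has_bochner_integral_indicator_Ioc_mult:
  fixes a b a' b' :: real
  shows "has_bochner_integral lborel (\<lambda>s. indicator {a<..b} s * indicator {a'<..b'} s :: real) (max 0 (min b b' - max a a'))"
proof -
  have *: "indicator {a<..b} s * indicator {a'<..b'} s = (indicator {max a a'<..min b b'} s :: real)" for s
    by (auto simp: indicator_def)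
  show ?thesis unfolding *
    using has_bochner_integral_real_indicator[of "{max a a'<..min b b'}" lborel]
    by (cases "max a a' \<le> min b b'") auto
qed

text \<open>Both sides expand into the same double sum, weighted by the lengths of pairwise
  overlaps. As the intervals may overlap in any way, differences of simple integrals over unrelated
  partitions are covered without a common refinement.\<close>

lemma elementary_isometry:
  fixes a b :: "'i \<Rightarrow> real" and \<xi> :: "'i \<Rightarrow> 'a \<Rightarrow> real" and j :: 'n
  assumes I: "finite I" and e: "\<And>i. i \<in> I \<Longrightarrow> 0 \<le> a i \<and> a i \<le> b i \<and> bounded_F (a i) (\<xi> i)"
  defines "U \<equiv> \<lambda>\<omega>. \<Sum>i\<in>I. \<xi> i \<omega> * (W (b i) \<omega> $ j - W (a i) \<omega> $ j)"
    and "u \<equiv> \<lambda>s \<omega>. \<Sum>i\<in>I. \<xi> i \<omega> * indicator {a i<..b i} s"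
  shows "U \<in> borel_measurable P" "integrable P (\<lambda>\<omega>. (U \<omega>)\<^sup>2)"
    "(\<integral>\<^sup>+ \<omega>. ennreal ((U \<omega>)\<^sup>2) \<partial>P) = (\<integral>\<^sup>+ \<omega>. (\<integral>\<^sup>+ s. ennreal ((u s \<omega>)\<^sup>2) \<partial>lborel) \<partial>P)"
proof -
  let ?l = "\<lambda>i k. max 0 (min (b i) (b k) - max (a i) (a k))"
  have U2: "(U \<omega>)\<^sup>2 = (\<Sum>i\<in>I. \<Sum>k\<in>I. (\<xi> i \<omega> * (W (b i) \<omega> $ j - W (a i) \<omega> $ j)) * (\<xi> k \<omega> * (W (b k) \<omega> $ j - W (a k) \<omega> $ j)))" for \<omega>
    unfolding U_def power2_eq_square by (rule sum_product)
  have h1: "has_bochner_integral P (\<lambda>\<omega>. (U \<omega>)\<^sup>2) (\<Sum>i\<in>I. \<Sum>k\<in>I. expectation (\<lambda>\<omega>. \<xi> i \<omega> * \<xi> k \<omega>) * ?l i k)"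
    unfolding U2 using e by (intro has_bochner_integral_sum E_elementary_mult) auto
  have h2: "has_bochner_integral lborel (\<lambda>s. (u s \<omega>)\<^sup>2) (\<Sum>i\<in>I. \<Sum>k\<in>I. \<xi> i \<omega> * \<xi> k \<omega> * ?l i k)" for \<omega>
  proof -
    have "(u s \<omega>)\<^sup>2 = (\<Sum>i\<in>I. \<Sum>k\<in>I. (\<xi> i \<omega> * \<xi> k \<omega>) * (indicator {a i<..b i} s * indicator {a k<..b k} s))" for s
      unfolding u_def power2_eq_square sum_product by (simp add: mult_ac)
    then show ?thesis
      by (simp only:) (intro has_bochner_integral_sum has_bochner_integral_mult_right has_bochner_integral_indicator_Ioc_mult)
  qed
  have h3: "has_bochner_integral P (\<lambda>\<omega>. \<Sum>i\<in>I. \<Sum>k\<in>I. \<xi> i \<omega> * \<xi> k \<omega> * ?l i k) (\<Sum>i\<in>I. \<Sum>k\<in>I. expectation (\<lambda>\<omega>. \<xi> i \<omega> * \<xi> k \<omega>) * ?l i k)"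
  proof (intro has_bochner_integral_sum has_bochner_integral_mult_left)
    fix i k assume ik: "i \<in> I" "k \<in> I"
    have "bounded_F (max (a i) (a k)) (\<lambda>\<omega>. \<xi> i \<omega> * \<xi> k \<omega>)"
      using e[OF ik(1)] e[OF ik(2)] by (auto intro!: bounded_F_mult intro: bounded_F_mono)
    then show "has_bochner_integral P (\<lambda>\<omega>. \<xi> i \<omega> * \<xi> k \<omega>) (expectation (\<lambda>\<omega>. \<xi> i \<omega> * \<xi> k \<omega>))"
      by (intro has_bochner_integral_integrable bounded_FD(3))
  qed
  show Um: "U \<in> borel_measurable P"
    unfolding U_def using e
    by (intro borel_measurable_sum borel_measurable_times bounded_FD(2) measurable_F_P[OF W_diff_F[OF _ _ _ order_refl]])
       (auto intro: order_trans)
  show "integrable P (\<lambda>\<omega>. (U \<omega>)\<^sup>2)" using h1 by (auto simp: has_bochner_integral_iff)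
  have "(\<integral>\<^sup>+ \<omega>. ennreal ((U \<omega>)\<^sup>2) \<partial>P) = ennreal (\<Sum>i\<in>I. \<Sum>k\<in>I. expectation (\<lambda>\<omega>. \<xi> i \<omega> * \<xi> k \<omega>) * ?l i k)"
    using h1 by (subst nn_integral_eq_integral) (auto simp: has_bochner_integral_iff)
  moreover have "(\<integral>\<^sup>+ s. ennreal ((u s \<omega>)\<^sup>2) \<partial>lborel) = ennreal (\<Sum>i\<in>I. \<Sum>k\<in>I. \<xi> i \<omega> * \<xi> k \<omega> * ?l i k)"
    "0 \<le> (\<Sum>i\<in>I. \<Sum>k\<in>I. \<xi> i \<omega> * \<xi> k \<omega> * ?l i k)" for \<omega>
  proof -
    have i: "integrable lborel (\<lambda>s. (u s \<omega>)\<^sup>2)" and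
      e: "(LINT s|lborel. (u s \<omega>)\<^sup>2) = (\<Sum>i\<in>I. \<Sum>k\<in>I. \<xi> i \<omega> * \<xi> k \<omega> * ?l i k)"
      using h2[of \<omega>] unfolding has_bochner_integral_iff by blast+
    show "(\<integral>\<^sup>+ s. ennreal ((u s \<omega>)\<^sup>2) \<partial>lborel) = ennreal (\<Sum>i\<in>I. \<Sum>k\<in>I. \<xi> i \<omega> * \<xi> k \<omega> * ?l i k)"
      unfolding e[symmetric] by (rule nn_integral_eq_integral[OF i]) simp
    show "0 \<le> (\<Sum>i\<in>I. \<Sum>k\<in>I. \<xi> i \<omega> * \<xi> k \<omega> * ?l i k)"
      unfolding e[symmetric] by (rule Bochner_Integration.integral_nonneg) simp
  qed
  moreover have "(\<integral>\<^sup>+ \<omega>. ennreal (\<Sum>i\<in>I. \<Sum>k\<in>I. \<xi> i \<omega> * \<xi> k \<omega> * ?l i k) \<partial>P) = ennreal (\<Sum>i\<in>I. \<Sum>k\<in>I. expectation (\<lambda>\<omega>. \<xi> i \<omega> * \<xi> k \<omega>) * ?l i k)"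
    using h3 calculation(3) by (subst nn_integral_eq_integral) (auto simp: has_bochner_integral_iff)
  ultimately show "(\<integral>\<^sup>+ \<omega>. ennreal ((U \<omega>)\<^sup>2) \<partial>P) = (\<integral>\<^sup>+ \<omega>. (\<integral>\<^sup>+ s. ennreal ((u s \<omega>)\<^sup>2) \<partial>lborel) \<partial>P)"
    by simp
qed

lemma elementary_martingale:
  assumes I: "finite I" and e: "\<And>i. i \<in> I \<Longrightarrow> c \<le> a i \<and> a i \<le> b i \<and> bounded_F (a i) (\<xi> i)"
    and "0 \<le> c" "bounded_F c \<zeta>"
  shows "has_bochner_integral P (\<lambda>\<omega>. \<zeta> \<omega> * (\<Sum>i\<in>I. \<xi> i \<omega> * (W (b i) \<omega> $ j - W (a i) \<omega> $ j))) 0"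
proof -
  have "has_bochner_integral P (\<lambda>\<omega>. \<Sum>i\<in>I. (\<zeta> \<omega> * \<xi> i \<omega>) * (W (b i) \<omega> $ j - W (a i) \<omega> $ j)) (\<Sum>i\<in>I. 0)"
  proof (intro has_bochner_integral_sum)
    fix i assume "i \<in> I"
    from e[OF this] have "bounded_F (a i) (\<lambda>\<omega>. \<zeta> \<omega> * \<xi> i \<omega>)" "0 \<le> a i" "a i \<le> b i"
      using assms by (auto intro!: bounded_F_mult intro: bounded_F_mono)
    then show "has_bochner_integral P (\<lambda>\<omega>. (\<zeta> \<omega> * \<xi> i \<omega>) * (W (b i) \<omega> $ j - W (a i) \<omega> $ j)) 0"
      by (intro E_mult_increment bounded_FD)
  qed
  then show ?thesis by (simp add: sum_distrib_left mult_ac)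
qed

end

section \<open>Increments of the Ito integral\<close>

text \<open>Time is rounded up to a multiple of 1 / (n + 1), which leaves countably many values at
  each stage, and continuity of the path gives the limit. The truncation \<open>max 0\<close> makes
  the process total in time, as nothing is known about it at negative times.\<close>

lemma measurable_continuous_process:
  fixes Y :: "real \<Rightarrow> 'a \<Rightarrow> 'b::metric_space"
  assumes Y: "\<And>s. 0 \<le> s \<Longrightarrow> Y s \<in> borel_measurable M"
    and c: "\<And>\<omega>. \<omega> \<in> space M \<Longrightarrow> continuous_on {0..} (\<lambda>s. Y s \<omega>)"
  shows "(\<lambda>(s, \<omega>). Y (max 0 s) \<omega>) \<in> borel_measurable (borel \<Otimes>\<^sub>M M)"
proof (rule borel_measurable_LIMSEQ_metric[where
    f = "\<lambda>n z. Y (real (nat \<lceil>real (Suc n) * max 0 (fst z)\<rceil>) / real (Suc n)) (snd z)"])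
  fix n :: nat
  let ?g = "\<lambda>z::real \<times> 'a. nat \<lceil>real (Suc n) * max 0 (fst z)\<rceil>"
  have "(\<lambda>z. Y (real (?g z) / real (Suc n)) (snd z)) \<in> borel_measurable (borel \<Otimes>\<^sub>M M)"
  proof (rule measurable_compose_countable[where f = "\<lambda>i z. Y (real i / real (Suc n)) (snd z)" and g = ?g])
    show "(\<lambda>z. Y (real i / real (Suc n)) (snd z)) \<in> borel_measurable (borel \<Otimes>\<^sub>M M)" for i
      by (rule measurable_compose[OF measurable_snd Y]) simp
    show "?g \<in> borel \<Otimes>\<^sub>M M \<rightarrow>\<^sub>M count_space UNIV" by measurable
  qed
  then show "(\<lambda>z. Y (real (?g z) / real (Suc n)) (snd z)) \<in> borel_measurable (borel \<Otimes>\<^sub>M M)" .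
next
  fix z :: "real \<times> 'a" assume "z \<in> space (borel \<Otimes>\<^sub>M M)"
  then have w: "snd z \<in> space M" by (auto simp: space_pair_measure)
  define s where "s = max 0 (fst z)"
  have s: "0 \<le> s" by (simp add: s_def)
  have eq: "real (nat \<lceil>real (Suc n) * s\<rceil>) = real_of_int \<lceil>real (Suc n) * s\<rceil>" for n
  proof -
    have "0 \<le> real (Suc n) * s" using s by simp
    then have "0 \<le> \<lceil>real (Suc n) * s\<rceil>" by linarith
    then show ?thesis by simp
  qed
  have lim: "(\<lambda>n. real (nat \<lceil>real (Suc n) * s\<rceil>) / real (Suc n)) \<longlonglongrightarrow> s"
  proof (rule real_tendsto_sandwich)
    show "\<forall>\<^sub>F n in sequentially. s \<le> real (nat \<lceil>real (Suc n) * s\<rceil>) / real (Suc n)"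
      unfolding eq by (intro always_eventually allI) (simp add: field_simps del: of_nat_Suc)
    show "\<forall>\<^sub>F n in sequentially. real (nat \<lceil>real (Suc n) * s\<rceil>) / real (Suc n) \<le> s + 1 / real (Suc n)"
    proof (intro always_eventually allI)
      fix n
      have "real_of_int \<lceil>real (Suc n) * s\<rceil> \<le> real (Suc n) * s + 1" by linarith
      then show "real (nat \<lceil>real (Suc n) * s\<rceil>) / real (Suc n) \<le> s + 1 / real (Suc n)"
        unfolding eq by (simp add: field_simps del: of_nat_Suc)
    qed
    show "(\<lambda>n. s + 1 / real (Suc n)) \<longlonglongrightarrow> s"
      using tendsto_add[OF tendsto_const[of s] LIMSEQ_inverse_real_of_nat] by (simp add: inverse_eq_divide)
  qed simp
  have "(\<lambda>n. Y (real (nat \<lceil>real (Suc n) * s\<rceil>) / real (Suc n)) (snd z)) \<longlonglongrightarrow> Y s (snd z)"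
  proof (rule continuous_on_tendsto_compose[OF c[OF w] lim])
    show "\<forall>\<^sub>F n in sequentially. real (nat \<lceil>real (Suc n) * s\<rceil>) / real (Suc n) \<in> {0..}"
      by (intro always_eventually allI) (simp del: of_nat_Suc of_nat_nat)
  qed (use s in simp)
  then show "(\<lambda>n. Y (real (nat \<lceil>real (Suc n) * max 0 (fst z)\<rceil>) / real (Suc n)) (snd z)) \<longlonglongrightarrow> (case z of (s, \<omega>) \<Rightarrow> Y (max 0 s) \<omega>)"
    by (simp add: s_def split_beta)
qed

lemma square_sum_le2: "(x + y)\<^sup>2 \<le> 2 * x\<^sup>2 + 2 * y\<^sup>2" for x y :: real
  using sum_squares_bound[of x y] by (simp add: power2_sum)

lemma square_sum_le4: "(x + y + z + u)\<^sup>2 \<le> 2 * u\<^sup>2 + (6 * x\<^sup>2 + (6 * y\<^sup>2 + 6 * z\<^sup>2))" for x y z u :: real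
proof -
  have "(x + y + z)\<^sup>2 \<le> 3 * (x\<^sup>2 + y\<^sup>2 + z\<^sup>2)"
    using sum_squares_bound[of x y] sum_squares_bound[of x z] sum_squares_bound[of y z]
    by (simp add: power2_eq_square algebra_simps)
  then show ?thesis using square_sum_le2[of "x + y + z" u] by simp
qed

context diffusion
begin

lemma simple_integrandD:
  assumes "simple_integrand F T n \<tau> \<xi>" "k < n"
  shows "0 \<le> \<tau> k" "\<tau> k < \<tau> (Suc k)" "\<tau> (Suc k) \<le> T" "bounded_F (\<tau> k) (\<xi> k)"
proof -
  have lt: "\<And>k. k < n \<Longrightarrow> \<tau> k < \<tau> (Suc k)" and 0: "\<tau> 0 = 0" and n: "\<tau> n = T"
    and \<xi>: "\<xi> k \<in> borel_measurable (F (\<tau> k))" "bounded (\<xi> k ` space (F (\<tau> k)))"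
    using assms unfolding simple_integrand_def by auto
  have mono: "\<tau> i \<le> \<tau> j" if "i \<le> j" "j \<le> n" for i j
    using that
  proof (induction j rule: nat_induct)
    case (Suc j)
    then show ?case using lt[of j] by (cases "i = Suc j") auto
  qed simp
  show "\<tau> k < \<tau> (Suc k)" using lt assms(2) .
  show "0 \<le> \<tau> k" using mono[of 0 k] assms(2) 0 by simp
  show "\<tau> (Suc k) \<le> T" using mono[of "Suc k" n] assms(2) n by simp
  show "bounded_F (\<tau> k) (\<xi> k)"
    using \<xi> unfolding bounded_F_def bounded_iff by auto
qed

text \<open>\<open>G\<close> integrates the simple process for \<open>[0, b]\<close> over the times
  after \<open>a\<close>. The integrals up to \<open>b\<close> and up to \<open>a\<close> are
  approximated by unrelated simple processes, so the difference of the simple integrals deviates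
  from \<open>G\<close> by the integral over \<open>[0, a]\<close> of the difference of the two
  processes. The isometry makes this small, because both are close to \<open>H\<close>
  there.\<close>

lemma ito_increment_step:
  fixes j :: 'n and H :: "real \<Rightarrow> 'a \<Rightarrow> real"
  assumes ab: "0 \<le> a" "a \<le> b"
    and S: "simple_integrand F b n \<tau> \<xi>" and Z: "simple_integrand F a m \<sigma> \<eta>"
    and H: "(\<lambda>(\<omega>, s). H s \<omega> * indicator {0..} s) \<in> borel_measurable (P \<Otimes>\<^sub>M lborel)"
  defines "w \<equiv> \<lambda>s \<omega>. W s \<omega> $ j"
    and "\<alpha> \<equiv> \<integral>\<^sup>+ \<omega>. (\<integral>\<^sup>+ s\<in>{0..b}. ennreal ((simple_process n \<tau> \<xi> s \<omega> - H s \<omega>)\<^sup>2) \<partial>lborel) \<partial>P"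
    and "\<beta> \<equiv> \<integral>\<^sup>+ \<omega>. (\<integral>\<^sup>+ s\<in>{0..a}. ennreal ((simple_process m \<sigma> \<eta> s \<omega> - H s \<omega>)\<^sup>2) \<partial>lborel) \<partial>P"
  obtains G where "G \<in> borel_measurable P" "integrable P (\<lambda>\<omega>. (G \<omega>)\<^sup>2)"
    "\<And>\<zeta>. bounded_F a \<zeta> \<Longrightarrow> has_bochner_integral P (\<lambda>\<omega>. \<zeta> \<omega> * G \<omega>) 0"
    "(\<integral>\<^sup>+ \<omega>. ennreal ((simple_integral n \<tau> \<xi> w \<omega> - simple_integral m \<sigma> \<eta> w \<omega> - G \<omega>)\<^sup>2) \<partial>P) \<le> 2 * \<alpha> + 2 * \<beta>"
    "\<And>\<zeta>. bounded_F a \<zeta> \<Longrightarrow> (\<integral>\<^sup>+ \<omega>. ennreal ((G \<omega> - \<zeta> \<omega> * (w b \<omega> - w a \<omega>))\<^sup>2) \<partial>P) \<le>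
       2 * \<alpha> + 2 * (\<integral>\<^sup>+ \<omega>. (\<integral>\<^sup>+ s\<in>{a<..b}. ennreal ((H s \<omega> - \<zeta> \<omega>)\<^sup>2) \<partial>lborel) \<partial>P)"
    "simple_integral n \<tau> \<xi> w \<in> borel_measurable P" "simple_integral m \<sigma> \<eta> w \<in> borel_measurable P"
proof -
  note Sk = simple_integrandD[OF S] and Zk = simple_integrandD[OF Z]
  define G where "G \<omega> = (\<Sum>k<n. \<xi> k \<omega> * (w (max a (\<tau> (Suc k))) \<omega> - w (max a (\<tau> k)) \<omega>))" for \<omega>
  have eS: "0 \<le> \<tau> k \<and> \<tau> k \<le> \<tau> (Suc k) \<and> bounded_F (\<tau> k) (\<xi> k)" if "k < n" for k
    using Sk[OF that] by simp
  have eZ: "0 \<le> \<sigma> k \<and> \<sigma> k \<le> \<sigma> (Suc k) \<and> bounded_F (\<sigma> k) (\<eta> k)" if "k < m" for k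
    using Zk[OF that] by simp
  have e: "a \<le> max a (\<tau> k) \<and> max a (\<tau> k) \<le> max a (\<tau> (Suc k)) \<and> bounded_F (max a (\<tau> k)) (\<xi> k)" if "k < n" for k
  proof (intro conjI)
    show "bounded_F (max a (\<tau> k)) (\<xi> k)" using Sk(4)[OF that] by (rule bounded_F_mono) simp
    show "max a (\<tau> k) \<le> max a (\<tau> (Suc k))" using Sk(2)[OF that] by (intro max.mono) simp_all
  qed simp
  have e0: "0 \<le> max a (\<tau> k) \<and> max a (\<tau> k) \<le> max a (\<tau> (Suc k)) \<and> bounded_F (max a (\<tau> k)) (\<xi> k)" if "k < n" for k
    using e[OF that] ab(1) by (meson order_trans)
  have e': "a \<le> max a (\<tau> k) \<and> max a (\<tau> k) \<le> max a (\<tau> (Suc k)) \<and> bounded_F (max a (\<tau> k)) (\<xi> k)" if "k \<in> {..<n}" for k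
    using e[of k] that by blast
  have e0': "0 \<le> max a (\<tau> k) \<and> max a (\<tau> k) \<le> max a (\<tau> (Suc k)) \<and> bounded_F (max a (\<tau> k)) (\<xi> k)" if "k \<in> {..<n}" for k
    using e0[of k] that by blast
  have G1: "G \<in> borel_measurable P" "integrable P (\<lambda>\<omega>. (G \<omega>)\<^sup>2)"
    unfolding G_def w_def
    by (rule elementary_isometry(1)[OF finite_lessThan e0'], assumption)
       (rule elementary_isometry(2)[OF finite_lessThan e0'], assumption)
  have G2: "has_bochner_integral P (\<lambda>\<omega>. \<zeta> \<omega> * G \<omega>) 0" if "bounded_F a \<zeta>" for \<zeta>
    unfolding G_def w_def by (rule elementary_martingale[OF finite_lessThan e' ab(1) that], assumption)
  have si1: "simple_integral n \<tau> \<xi> w \<in> borel_measurable P"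
    unfolding simple_integral_def[abs_def] w_def by (rule elementary_isometry(1)[OF finite_lessThan]) (simp add: eS)
  have si2: "simple_integral m \<sigma> \<eta> w \<in> borel_measurable P"
    unfolding simple_integral_def[abs_def] w_def by (rule elementary_isometry(1)[OF finite_lessThan]) (simp add: eZ)
  let ?S = "simple_process n \<tau> \<xi>" and ?Z = "simple_process m \<sigma> \<eta>"
  \<comment> \<open>Raising both end points to at least \<open>a\<close> restricts the process to
    later times; an interval that ends before \<open>a\<close> collapses to the empty one.\<close>
  have cut: "(\<Sum>k<n. \<xi> k \<omega> * indicator {max a (\<tau> k)<..max a (\<tau> (Suc k))} s) = indicator {a<..} s * ?S s \<omega>" for s \<omega>
    unfolding simple_process_def sum_distrib_left
    by (intro sum.cong) (auto simp: indicator_def)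
  have S0: "?S s \<omega> = 0" if "s \<notin> {0..b}" for s \<omega>
    unfolding simple_process_def
  proof (intro sum.neutral ballI)
    fix k assume "k \<in> {..<n}"
    then have "s \<notin> {\<tau> k<..\<tau> (Suc k)}" using that Sk(1)[of k] Sk(3)[of k] by (cases "0 \<le> s") auto
    then show "\<xi> k \<omega> * indicator {\<tau> k<..\<tau> (Suc k)} s = 0" by simp
  qed
  have Z0: "?Z s \<omega> = 0" if "s \<notin> {0..a}" for s \<omega>
    unfolding simple_process_def
  proof (intro sum.neutral ballI)
    fix k assume "k \<in> {..<m}"
    then have "s \<notin> {\<sigma> k<..\<sigma> (Suc k)}" using that Zk(1)[of k] Zk(3)[of k] by (cases "0 \<le> s") auto
    then show "\<eta> k \<omega> * indicator {\<sigma> k<..\<sigma> (Suc k)} s = 0" by simp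
  qed
  have spm: "(\<lambda>(\<omega>, s). simple_process n \<tau> \<xi> s \<omega>) \<in> borel_measurable (P \<Otimes>\<^sub>M lborel)"
    if "simple_integrand F T n \<tau> \<xi>" for T n \<tau> \<xi>
  proof -
    have [measurable]: "\<xi> k \<in> borel_measurable P" if "k < n" for k
      using simple_integrandD(4)[OF \<open>simple_integrand F T n \<tau> \<xi>\<close> that] bounded_FD by blast
    show ?thesis unfolding simple_process_def split_beta
      by (intro borel_measurable_sum) measurable
  qed
  have SH: "(\<lambda>(\<omega>, s). ennreal ((?S s \<omega> - H s \<omega>)\<^sup>2) * indicator {0..b} s) \<in> borel_measurable (P \<Otimes>\<^sub>M lborel)"
  proof -
    have "(\<lambda>(\<omega>, s). ennreal ((?S s \<omega> - H s \<omega> * indicator {0..} s)\<^sup>2) * indicator {0..b} s) \<in> borel_measurable (P \<Otimes>\<^sub>M lborel)"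
      using spm[OF S] H unfolding split_beta by measurable
    moreover have "ennreal ((?S s \<omega> - H s \<omega> * indicator {0..} s)\<^sup>2) * indicator {0..b} s = ennreal ((?S s \<omega> - H s \<omega>)\<^sup>2) * indicator {0..b} s" for s \<omega>
      by (simp add: indicator_def)
    ultimately show ?thesis by simp
  qed
  have ZH: "(\<lambda>(\<omega>, s). ennreal ((?Z s \<omega> - H s \<omega>)\<^sup>2) * indicator {0..a} s) \<in> borel_measurable (P \<Otimes>\<^sub>M lborel)"
  proof -
    have "(\<lambda>(\<omega>, s). ennreal ((?Z s \<omega> - H s \<omega> * indicator {0..} s)\<^sup>2) * indicator {0..a} s) \<in> borel_measurable (P \<Otimes>\<^sub>M lborel)"
      using spm[OF Z] H unfolding split_beta by measurable
    moreover have "ennreal ((?Z s \<omega> - H s \<omega> * indicator {0..} s)\<^sup>2) * indicator {0..a} s = ennreal ((?Z s \<omega> - H s \<omega>)\<^sup>2) * indicator {0..a} s" for s \<omega>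
      by (simp add: indicator_def)
    ultimately show ?thesis by simp
  qed
  have bound: "(\<integral>\<^sup>+ \<omega>. (\<integral>\<^sup>+ s. f \<omega> s \<partial>lborel) \<partial>P) \<le>
      2 * (\<integral>\<^sup>+ \<omega>. (\<integral>\<^sup>+ s. g \<omega> s \<partial>lborel) \<partial>P) + 2 * (\<integral>\<^sup>+ \<omega>. (\<integral>\<^sup>+ s. h \<omega> s \<partial>lborel) \<partial>P)"
    if le: "\<And>\<omega> s. \<omega> \<in> space P \<Longrightarrow> f \<omega> s \<le> 2 * g \<omega> s + 2 * h \<omega> s"
      and [measurable]: "(\<lambda>(\<omega>, s). g \<omega> s) \<in> borel_measurable (P \<Otimes>\<^sub>M lborel)" "(\<lambda>(\<omega>, s). h \<omega> s) \<in> borel_measurable (P \<Otimes>\<^sub>M lborel)"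
    for f g h :: "'a \<Rightarrow> real \<Rightarrow> ennreal"
  proof -
    have "(\<integral>\<^sup>+ \<omega>. (\<integral>\<^sup>+ s. f \<omega> s \<partial>lborel) \<partial>P) \<le> (\<integral>\<^sup>+ \<omega>. (\<integral>\<^sup>+ s. 2 * g \<omega> s + 2 * h \<omega> s \<partial>lborel) \<partial>P)"
      by (intro nn_integral_mono le)
    also have "\<dots> = (\<integral>\<^sup>+ \<omega>. 2 * (\<integral>\<^sup>+ s. g \<omega> s \<partial>lborel) + 2 * (\<integral>\<^sup>+ s. h \<omega> s \<partial>lborel) \<partial>P)"
      by (intro nn_integral_cong) (subst nn_integral_add; simp add: nn_integral_cmult)
    also have "\<dots> = 2 * (\<integral>\<^sup>+ \<omega>. (\<integral>\<^sup>+ s. g \<omega> s \<partial>lborel) \<partial>P) + 2 * (\<integral>\<^sup>+ \<omega>. (\<integral>\<^sup>+ s. h \<omega> s \<partial>lborel) \<partial>P)"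
      by (subst nn_integral_add) (simp_all add: nn_integral_cmult)
    finally show ?thesis .
  qed
  have sq2: "ennreal ((x - y)\<^sup>2) \<le> 2 * ennreal ((x - z)\<^sup>2) + 2 * ennreal ((z - y)\<^sup>2)" for x y z :: real
  proof -
    have "ennreal ((x - y)\<^sup>2) \<le> ennreal (2 * (x - z)\<^sup>2 + 2 * (z - y)\<^sup>2)"
      using square_sum_le2[of "x - z" "z - y"] by (intro ennreal_leI) simp
    then show ?thesis by (simp add: ennreal_mult)
  qed
  have D: "(\<integral>\<^sup>+ \<omega>. ennreal ((simple_integral n \<tau> \<xi> w \<omega> - simple_integral m \<sigma> \<eta> w \<omega> - G \<omega>)\<^sup>2) \<partial>P) \<le> 2 * \<alpha> + 2 * \<beta>"
  proof -
    \<comment> \<open>Three families of intervals are merged into one sum over a disjoint union, so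
      that the isometry applies to the whole difference at once.\<close>
    define I where "I = {..<n} <+> ({..<m} <+> {..<n})"
    define p where "p = case_sum \<tau> (case_sum \<sigma> (\<lambda>k. max a (\<tau> k)))"
    define q where "q = case_sum (\<lambda>k. \<tau> (Suc k)) (case_sum (\<lambda>k. \<sigma> (Suc k)) (\<lambda>k. max a (\<tau> (Suc k))))"
    define x where "x = case_sum \<xi> (case_sum (\<lambda>k \<omega>. - \<eta> k \<omega>) (\<lambda>k \<omega>. - \<xi> k \<omega>))"
    have fI: "finite I" by (simp add: I_def)
    have eI: "0 \<le> p i \<and> p i \<le> q i \<and> bounded_F (p i) (x i)" if "i \<in> I" for i
    proof -
      consider (1) k where "i = Inl k" "k < n" | (2) k where "i = Inr (Inl k)" "k < m" | (3) k where "i = Inr (Inr k)" "k < n"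
        using \<open>i \<in> I\<close> unfolding I_def by auto
      then show ?thesis
      proof cases
        case 1 then show ?thesis using eS[of k] by (simp add: p_def q_def x_def)
      next
        case 2 then show ?thesis using eZ[of k] bounded_F_uminus by (simp add: p_def q_def x_def)
      next
        case 3 then show ?thesis using e0[of k] bounded_F_uminus by (simp add: p_def q_def x_def)
      qed
    qed
    have "(\<integral>\<^sup>+ \<omega>. ennreal ((\<Sum>i\<in>I. x i \<omega> * (W (q i) \<omega> $ j - W (p i) \<omega> $ j))\<^sup>2) \<partial>P) =
        (\<integral>\<^sup>+ \<omega>. (\<integral>\<^sup>+ s. ennreal ((\<Sum>i\<in>I. x i \<omega> * indicator {p i<..q i} s)\<^sup>2) \<partial>lborel) \<partial>P)"
      by (rule elementary_isometry(3)[OF fI eI])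
    also have "(\<lambda>\<omega>. \<Sum>i\<in>I. x i \<omega> * (W (q i) \<omega> $ j - W (p i) \<omega> $ j)) =
       (\<lambda>\<omega>. simple_integral n \<tau> \<xi> w \<omega> - simple_integral m \<sigma> \<eta> w \<omega> - G \<omega>)"
      unfolding I_def p_def q_def x_def G_def simple_integral_def w_def
      by (simp add: sum.Plus sum_negf fun_eq_iff)
    also have "(\<integral>\<^sup>+ \<omega>. (\<integral>\<^sup>+ s. ennreal ((\<Sum>i\<in>I. x i \<omega> * indicator {p i<..q i} s)\<^sup>2) \<partial>lborel) \<partial>P) \<le> 2 * \<alpha> + 2 * \<beta>"
      unfolding \<alpha>_def \<beta>_def
    proof (rule bound)
      fix \<omega> s
      have "(\<Sum>i\<in>I. x i \<omega> * indicator {p i<..q i} s) = ?S s \<omega> - ?Z s \<omega> - indicator {a<..} s * ?S s \<omega>"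
        unfolding cut[symmetric] unfolding I_def p_def q_def x_def simple_process_def
        by (simp only: sum.Plus finite_Plus finite_lessThan o_def sum.case mult_minus_left sum_negf diff_conv_add_uminus add.assoc)
      also have "\<dots> = indicator {0..a} s * (?S s \<omega> - ?Z s \<omega>)"
        using S0[of s \<omega>] Z0[of s \<omega>] by (cases "s \<in> {0..a}"; cases "s < 0") auto
      finally show "ennreal ((\<Sum>i\<in>I. x i \<omega> * indicator {p i<..q i} s)\<^sup>2) \<le>
         2 * (ennreal ((?S s \<omega> - H s \<omega>)\<^sup>2) * indicator {0..b} s) + 2 * (ennreal ((?Z s \<omega> - H s \<omega>)\<^sup>2) * indicator {0..a} s)"
        using sq2[of "?S s \<omega>" "?Z s \<omega>" "H s \<omega>"] ab
        by (cases "s \<in> {0..a}") (auto simp: power2_commute[of "H s \<omega>"])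
    qed (rule SH, rule ZH)
    finally show ?thesis by simp
  qed
  have R: "(\<integral>\<^sup>+ \<omega>. ennreal ((G \<omega> - \<zeta> \<omega> * (w b \<omega> - w a \<omega>))\<^sup>2) \<partial>P) \<le>
       2 * \<alpha> + 2 * (\<integral>\<^sup>+ \<omega>. (\<integral>\<^sup>+ s\<in>{a<..b}. ennreal ((H s \<omega> - \<zeta> \<omega>)\<^sup>2) \<partial>lborel) \<partial>P)"
    if \<zeta>: "bounded_F a \<zeta>" for \<zeta>
  proof -
    \<comment> \<open>The product of \<open>\<zeta>\<close> with the increment of \<open>w\<close>
      is itself elementary: one extra term, on the interval from \<open>a\<close> to
      \<open>b\<close> and with coefficient \<open>- \<zeta>\<close>.\<close>
    define I where "I = {..<n} <+> {()}"
    define p where "p = case_sum (\<lambda>k. max a (\<tau> k)) (\<lambda>_::unit. a)"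
    define q where "q = case_sum (\<lambda>k. max a (\<tau> (Suc k))) (\<lambda>_::unit. b)"
    define x where "x = case_sum \<xi> (\<lambda>(_::unit) \<omega>. - \<zeta> \<omega>)"
    have fI: "finite I" by (simp add: I_def)
    have eI: "0 \<le> p i \<and> p i \<le> q i \<and> bounded_F (p i) (x i)" if "i \<in> I" for i
    proof -
      consider (1) k where "i = Inl k" "k < n" | (2) "i = Inr ()"
        using \<open>i \<in> I\<close> unfolding I_def by auto
      then show ?thesis
      proof cases
        case 1 then show ?thesis using e0[of k] by (simp add: p_def q_def x_def)
      next
        case 2 then show ?thesis using ab bounded_F_uminus[OF \<zeta>] by (simp add: p_def q_def x_def)
      qed
    qed
    have [measurable]: "\<zeta> \<in> borel_measurable P" using bounded_FD(2)[OF \<zeta>] .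
    have HZ: "(\<lambda>(\<omega>, s). ennreal ((H s \<omega> - \<zeta> \<omega>)\<^sup>2) * indicator {a<..b} s) \<in> borel_measurable (P \<Otimes>\<^sub>M lborel)"
    proof -
      have "(\<lambda>(\<omega>, s). ennreal ((H s \<omega> * indicator {0..} s - \<zeta> \<omega>)\<^sup>2) * indicator {a<..b} s) \<in> borel_measurable (P \<Otimes>\<^sub>M lborel)"
        using H unfolding split_beta by measurable
      moreover have "ennreal ((H s \<omega> * indicator {0..} s - \<zeta> \<omega>)\<^sup>2) * indicator {a<..b} s = ennreal ((H s \<omega> - \<zeta> \<omega>)\<^sup>2) * indicator {a<..b} s" for s \<omega>
        using ab by (simp add: indicator_def)
      ultimately show ?thesis by simp
    qed
    have "(\<integral>\<^sup>+ \<omega>. ennreal ((\<Sum>i\<in>I. x i \<omega> * (W (q i) \<omega> $ j - W (p i) \<omega> $ j))\<^sup>2) \<partial>P) =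
        (\<integral>\<^sup>+ \<omega>. (\<integral>\<^sup>+ s. ennreal ((\<Sum>i\<in>I. x i \<omega> * indicator {p i<..q i} s)\<^sup>2) \<partial>lborel) \<partial>P)"
      by (rule elementary_isometry(3)[OF fI eI])
    also have "(\<lambda>\<omega>. \<Sum>i\<in>I. x i \<omega> * (W (q i) \<omega> $ j - W (p i) \<omega> $ j)) =
       (\<lambda>\<omega>. G \<omega> - \<zeta> \<omega> * (w b \<omega> - w a \<omega>))"
      unfolding I_def p_def q_def x_def G_def w_def
      by (simp add: sum.Plus fun_eq_iff)
    also have "(\<integral>\<^sup>+ \<omega>. (\<integral>\<^sup>+ s. ennreal ((\<Sum>i\<in>I. x i \<omega> * indicator {p i<..q i} s)\<^sup>2) \<partial>lborel) \<partial>P) \<le>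
       2 * \<alpha> + 2 * (\<integral>\<^sup>+ \<omega>. (\<integral>\<^sup>+ s\<in>{a<..b}. ennreal ((H s \<omega> - \<zeta> \<omega>)\<^sup>2) \<partial>lborel) \<partial>P)"
      unfolding \<alpha>_def
    proof (rule bound)
      fix \<omega> s
      have "(\<Sum>i\<in>I. x i \<omega> * indicator {p i<..q i} s) = indicator {a<..} s * ?S s \<omega> - \<zeta> \<omega> * indicator {a<..b} s"
        unfolding cut[symmetric] unfolding I_def p_def q_def x_def simple_process_def
        by (simp only: sum.Plus finite.intros finite_lessThan o_def sum.case) simp
      also have "\<dots> = indicator {a<..b} s * (?S s \<omega> - \<zeta> \<omega>)"
        using S0[of s \<omega>] by (cases "s \<in> {a<..b}"; cases "s \<le> a") auto
      finally show "ennreal ((\<Sum>i\<in>I. x i \<omega> * indicator {p i<..q i} s)\<^sup>2) \<le>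
         2 * (ennreal ((?S s \<omega> - H s \<omega>)\<^sup>2) * indicator {0..b} s) + 2 * (ennreal ((H s \<omega> - \<zeta> \<omega>)\<^sup>2) * indicator {a<..b} s)"
        using sq2[of "?S s \<omega>" "\<zeta> \<omega>" "H s \<omega>"] ab
        by (cases "s \<in> {a<..b}") auto
    qed (rule SH, rule HZ)
    finally show ?thesis by simp
  qed
  show thesis by (rule that[OF G1 G2 D R si1 si2])
qed

text \<open>The approximations drop out in the limit. The factor 4 arises from two uses of (x + y)^2
  \<le> 2 x^2 + 2 y^2, once to pass from the increment to \<open>G\<close> and once to pass from
  \<open>G\<close> to the integrand. Comparing with a value frozen at time \<open>a\<close> is what
  the Euler estimates are built on.\<close>

lemma ito_increment:
  fixes j :: 'n and H :: "real \<Rightarrow> 'a \<Rightarrow> real"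
  assumes ab: "0 \<le> a" "a \<le> b"
    and Ya: "has_ito_integral P F (\<lambda>s \<omega>. W s \<omega> $ j) H a Ya"
    and Yb: "has_ito_integral P F (\<lambda>s \<omega>. W s \<omega> $ j) H b Yb"
    and H: "(\<lambda>(\<omega>, s). H s \<omega> * indicator {0..} s) \<in> borel_measurable (P \<Otimes>\<^sub>M lborel)"
    and \<zeta>: "bounded_F a \<zeta>"
  shows "(\<integral>\<^sup>+ \<omega>. ennreal ((Yb \<omega> - Ya \<omega> - \<zeta> \<omega> * (W b \<omega> $ j - W a \<omega> $ j))\<^sup>2) \<partial>P) \<le>
       4 * (\<integral>\<^sup>+ \<omega>. (\<integral>\<^sup>+ s\<in>{a<..b}. ennreal ((H s \<omega> - \<zeta> \<omega>)\<^sup>2) \<partial>lborel) \<partial>P)" (is "?L \<le> 4 * ?R")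
    and "integrable P (\<lambda>\<omega>. (Yb \<omega> - Ya \<omega>)\<^sup>2) \<Longrightarrow> expectation (\<lambda>\<omega>. \<zeta> \<omega> * (Yb \<omega> - Ya \<omega>)) = 0"
proof -
  let ?w = "\<lambda>s \<omega>. W s \<omega> $ j"
  obtain n \<tau> \<xi> where S: "\<And>l. simple_integrand F b (n l) (\<tau> l) (\<xi> l)"
    and \<alpha>: "(\<lambda>l. \<integral>\<^sup>+ \<omega>. (\<integral>\<^sup>+ s\<in>{0..b}. ennreal ((simple_process (n l) (\<tau> l) (\<xi> l) s \<omega> - H s \<omega>)\<^sup>2) \<partial>lborel) \<partial>P) \<longlonglongrightarrow> 0"
    and r: "(\<lambda>l. \<integral>\<^sup>+ \<omega>. ennreal ((simple_integral (n l) (\<tau> l) (\<xi> l) ?w \<omega> - Yb \<omega>)\<^sup>2) \<partial>P) \<longlonglongrightarrow> 0"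
    using Yb unfolding has_ito_integral_def by blast
  obtain m \<sigma> \<eta> where Z: "\<And>l. simple_integrand F a (m l) (\<sigma> l) (\<eta> l)"
    and \<beta>: "(\<lambda>l. \<integral>\<^sup>+ \<omega>. (\<integral>\<^sup>+ s\<in>{0..a}. ennreal ((simple_process (m l) (\<sigma> l) (\<eta> l) s \<omega> - H s \<omega>)\<^sup>2) \<partial>lborel) \<partial>P) \<longlonglongrightarrow> 0"
    and r': "(\<lambda>l. \<integral>\<^sup>+ \<omega>. ennreal ((simple_integral (m l) (\<sigma> l) (\<eta> l) ?w \<omega> - Ya \<omega>)\<^sup>2) \<partial>P) \<longlonglongrightarrow> 0"
    using Ya unfolding has_ito_integral_def by blast
  have [measurable]: "Ya \<in> borel_measurable P" "Yb \<in> borel_measurable P"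
    using Ya Yb unfolding has_ito_integral_def by auto
  define \<alpha>' where "\<alpha>' l = (\<integral>\<^sup>+ \<omega>. (\<integral>\<^sup>+ s\<in>{0..b}. ennreal ((simple_process (n l) (\<tau> l) (\<xi> l) s \<omega> - H s \<omega>)\<^sup>2) \<partial>lborel) \<partial>P)" for l
  define \<beta>' where "\<beta>' l = (\<integral>\<^sup>+ \<omega>. (\<integral>\<^sup>+ s\<in>{0..a}. ennreal ((simple_process (m l) (\<sigma> l) (\<eta> l) s \<omega> - H s \<omega>)\<^sup>2) \<partial>lborel) \<partial>P)" for l
  define IS where "IS l = simple_integral (n l) (\<tau> l) (\<xi> l) ?w" for l
  define IZ where "IZ l = simple_integral (m l) (\<sigma> l) (\<eta> l) ?w" for l
  define Q where "Q l G \<longleftrightarrow> G \<in> borel_measurable P \<and> integrable P (\<lambda>\<omega>. (G \<omega>)\<^sup>2) \<and>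
      (\<forall>\<zeta>. bounded_F a \<zeta> \<longrightarrow> has_bochner_integral P (\<lambda>\<omega>. \<zeta> \<omega> * G \<omega>) 0) \<and>
      (\<integral>\<^sup>+ \<omega>. ennreal ((IS l \<omega> - IZ l \<omega> - G \<omega>)\<^sup>2) \<partial>P) \<le> 2 * \<alpha>' l + 2 * \<beta>' l \<and>
      (\<forall>\<zeta>. bounded_F a \<zeta> \<longrightarrow> (\<integral>\<^sup>+ \<omega>. ennreal ((G \<omega> - \<zeta> \<omega> * (?w b \<omega> - ?w a \<omega>))\<^sup>2) \<partial>P) \<le>
       2 * \<alpha>' l + 2 * (\<integral>\<^sup>+ \<omega>. (\<integral>\<^sup>+ s\<in>{a<..b}. ennreal ((H s \<omega> - \<zeta> \<omega>)\<^sup>2) \<partial>lborel) \<partial>P)) \<and>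
      IS l \<in> borel_measurable P \<and> IZ l \<in> borel_measurable P" for l G
  have "\<exists>G. Q l G" for l
    by (rule ito_increment_step[OF ab S[of l] Z[of l] H, of j])
       (rule exI, unfold Q_def IS_def IZ_def \<alpha>'_def \<beta>'_def, intro conjI allI impI)
  then have "\<exists>G. \<forall>l. Q l (G l)" by (intro choice allI)
  then obtain G where QG: "\<And>l. Q l (G l)" by blast
  note G = QG[unfolded Q_def]
  have [measurable]: "G l \<in> borel_measurable P" "IS l \<in> borel_measurable P" "IZ l \<in> borel_measurable P" for l
    using G[of l] by simp_all
  define \<epsilon> where "\<epsilon> l = 6 * (\<integral>\<^sup>+ \<omega>. ennreal ((IS l \<omega> - Yb \<omega>)\<^sup>2) \<partial>P) +
     (6 * (\<integral>\<^sup>+ \<omega>. ennreal ((IZ l \<omega> - Ya \<omega>)\<^sup>2) \<partial>P) + 6 * (2 * \<alpha>' l + 2 * \<beta>' l))" for l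
  have \<alpha>0: "\<alpha>' \<longlonglongrightarrow> 0" and \<beta>0: "\<beta>' \<longlonglongrightarrow> 0"
    using \<alpha> \<beta> unfolding \<alpha>'_def \<beta>'_def by auto
  have \<epsilon>0: "\<epsilon> \<longlonglongrightarrow> 0"
  proof -
    have "\<epsilon> \<longlonglongrightarrow> 6 * 0 + (6 * 0 + 6 * (2 * 0 + 2 * 0))"
      unfolding \<epsilon>_def
      by (intro tendsto_add ennreal_tendsto_cmult \<alpha>0 \<beta>0 r[folded IS_def] r'[folded IZ_def]) auto
    then show ?thesis by simp
  qed
  have split: "(\<integral>\<^sup>+ \<omega>. ennreal ((Yb \<omega> - Ya \<omega> - U \<omega>)\<^sup>2) \<partial>P) \<le> 2 * (\<integral>\<^sup>+ \<omega>. ennreal ((G l \<omega> - U \<omega>)\<^sup>2) \<partial>P) + \<epsilon> l"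
    if [measurable]: "U \<in> borel_measurable P" for U l
  proof -
    have "ennreal ((Yb \<omega> - Ya \<omega> - U \<omega>)\<^sup>2) \<le> 2 * ennreal ((G l \<omega> - U \<omega>)\<^sup>2) + (6 * ennreal ((IS l \<omega> - Yb \<omega>)\<^sup>2) +
       (6 * ennreal ((IZ l \<omega> - Ya \<omega>)\<^sup>2) + 6 * ennreal ((IS l \<omega> - IZ l \<omega> - G l \<omega>)\<^sup>2)))" for \<omega>
    proof -
      have "(Yb \<omega> - Ya \<omega> - U \<omega>)\<^sup>2 \<le> 2 * (G l \<omega> - U \<omega>)\<^sup>2 + (6 * (IS l \<omega> - Yb \<omega>)\<^sup>2 +
       (6 * (IZ l \<omega> - Ya \<omega>)\<^sup>2 + 6 * (IS l \<omega> - IZ l \<omega> - G l \<omega>)\<^sup>2))"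
        using square_sum_le4[of "- (IS l \<omega> - Yb \<omega>)" "IZ l \<omega> - Ya \<omega>" "IS l \<omega> - IZ l \<omega> - G l \<omega>" "G l \<omega> - U \<omega>"]
        by (simp only: power2_minus) (simp add: algebra_simps)
      from ennreal_leI[OF this] show ?thesis by (simp add: ennreal_mult)
    qed
    then have "(\<integral>\<^sup>+ \<omega>. ennreal ((Yb \<omega> - Ya \<omega> - U \<omega>)\<^sup>2) \<partial>P) \<le>
       (\<integral>\<^sup>+ \<omega>. 2 * ennreal ((G l \<omega> - U \<omega>)\<^sup>2) + (6 * ennreal ((IS l \<omega> - Yb \<omega>)\<^sup>2) +
       (6 * ennreal ((IZ l \<omega> - Ya \<omega>)\<^sup>2) + 6 * ennreal ((IS l \<omega> - IZ l \<omega> - G l \<omega>)\<^sup>2))) \<partial>P)"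
      by (intro nn_integral_mono)
    also have "\<dots> = 2 * (\<integral>\<^sup>+ \<omega>. ennreal ((G l \<omega> - U \<omega>)\<^sup>2) \<partial>P) + (6 * (\<integral>\<^sup>+ \<omega>. ennreal ((IS l \<omega> - Yb \<omega>)\<^sup>2) \<partial>P) +
     (6 * (\<integral>\<^sup>+ \<omega>. ennreal ((IZ l \<omega> - Ya \<omega>)\<^sup>2) \<partial>P) + 6 * (\<integral>\<^sup>+ \<omega>. ennreal ((IS l \<omega> - IZ l \<omega> - G l \<omega>)\<^sup>2) \<partial>P)))"
      by (simp add: nn_integral_add nn_integral_cmult)
    also have "\<dots> \<le> 2 * (\<integral>\<^sup>+ \<omega>. ennreal ((G l \<omega> - U \<omega>)\<^sup>2) \<partial>P) + \<epsilon> l"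
      unfolding \<epsilon>_def using G[of l] by (intro add_mono order_refl mult_left_mono) auto
    finally show ?thesis .
  qed
  have [measurable]: "\<zeta> \<in> borel_measurable P" using bounded_FD(2)[OF \<zeta>] .
  have [measurable]: "(\<lambda>\<omega>. W a \<omega> $ j) \<in> borel_measurable P" "(\<lambda>\<omega>. W b \<omega> $ j) \<in> borel_measurable P"
    using ab by (auto intro: measurable_compose[OF W_measurable borel_measurable_nth])
  show "?L \<le> 4 * ?R"
  proof (rule LIMSEQ_le_const)
    have "(\<lambda>l. 2 * (2 * \<alpha>' l + 2 * ?R) + \<epsilon> l) \<longlonglongrightarrow> 2 * (2 * 0 + 2 * ?R) + 0"
      by (intro tendsto_add ennreal_tendsto_cmult \<alpha>0 \<epsilon>0 tendsto_const) auto
    then show "(\<lambda>l. 2 * (2 * \<alpha>' l + 2 * ?R) + \<epsilon> l) \<longlonglongrightarrow> 4 * ?R" by (simp add: mult.assoc[symmetric])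
    have "?L \<le> 2 * (2 * \<alpha>' l + 2 * ?R) + \<epsilon> l" for l
    proof -
      have "?L \<le> 2 * (\<integral>\<^sup>+ \<omega>. ennreal ((G l \<omega> - \<zeta> \<omega> * (?w b \<omega> - ?w a \<omega>))\<^sup>2) \<partial>P) + \<epsilon> l"
        by (rule split) measurable
      also have "\<dots> \<le> 2 * (2 * \<alpha>' l + 2 * ?R) + \<epsilon> l"
        using G[of l] \<zeta> by (intro add_mono order_refl mult_left_mono) auto
      finally show ?thesis .
    qed
    then show "\<exists>N. \<forall>l\<ge>N. ?L \<le> 2 * (2 * \<alpha>' l + 2 * ?R) + \<epsilon> l" by blast
  qed
  show "expectation (\<lambda>\<omega>. \<zeta> \<omega> * (Yb \<omega> - Ya \<omega>)) = 0" if i2: "integrable P (\<lambda>\<omega>. (Yb \<omega> - Ya \<omega>)\<^sup>2)"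
  proof -
    obtain C where C: "\<forall>\<omega>\<in>space P. \<bar>\<zeta> \<omega>\<bar> \<le> C" using bounded_F_bound[OF \<zeta>] by auto
    let ?E = "expectation (\<lambda>\<omega>. \<zeta> \<omega> * (Yb \<omega> - Ya \<omega>))"
    have i1: "integrable P (\<lambda>\<omega>. \<zeta> \<omega> * (Yb \<omega> - Ya \<omega>))"
    proof (rule Bochner_Integration.integrable_bound)
      show "integrable P (\<lambda>\<omega>. C * (1 + (Yb \<omega> - Ya \<omega>)\<^sup>2))" using i2 by simp
      have "\<bar>x\<bar> \<le> 1 + x\<^sup>2" for x :: real
        using sum_squares_bound[of "\<bar>x\<bar>" 1] by simp
      then have "\<bar>\<zeta> \<omega>\<bar> * \<bar>Yb \<omega> - Ya \<omega>\<bar> \<le> \<bar>C\<bar> * (1 + (Yb \<omega> - Ya \<omega>)\<^sup>2)" if "\<omega> \<in> space P" for \<omega>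
        using C that by (intro mult_mono) (auto intro: order_trans[OF _ abs_ge_self])
      then show "AE \<omega> in P. norm (\<zeta> \<omega> * (Yb \<omega> - Ya \<omega>)) \<le> norm (C * (1 + (Yb \<omega> - Ya \<omega>)\<^sup>2))"
        by (intro AE_I2) (simp add: abs_mult)
    qed measurable
    have "ennreal (?E\<^sup>2) \<le> ennreal (C\<^sup>2) * \<epsilon> l" for l
    proof -
      \<comment> \<open>Since \<open>\<zeta> * G l\<close> is centred, \<open>?f\<close> has the
        mean \<open>?E\<close>. A variance is nonnegative, so the square of this mean is at most the
        second moment of \<open>?f\<close>, which is controlled by
        \<open>\<epsilon> l\<close>.\<close>
      let ?f = "\<lambda>\<omega>. \<zeta> \<omega> * (Yb \<omega> - Ya \<omega> - G l \<omega>)"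
      have zG: "has_bochner_integral P (\<lambda>\<omega>. \<zeta> \<omega> * G l \<omega>) 0" using G \<zeta> by auto
      have f: "integrable P ?f" "expectation ?f = ?E"
        using i1 zG by (auto simp: has_bochner_integral_iff right_diff_distrib)
      have f2: "integrable P (\<lambda>\<omega>. (?f \<omega>)\<^sup>2)"
      proof (rule Bochner_Integration.integrable_bound)
        show "integrable P (\<lambda>\<omega>. C\<^sup>2 * (2 * (Yb \<omega> - Ya \<omega>)\<^sup>2 + 2 * (G l \<omega>)\<^sup>2))" using i2 G[of l] by simp
        have "(\<zeta> \<omega>)\<^sup>2 * (Yb \<omega> - Ya \<omega> - G l \<omega>)\<^sup>2 \<le> C\<^sup>2 * (2 * (Yb \<omega> - Ya \<omega>)\<^sup>2 + 2 * (G l \<omega>)\<^sup>2)" if "\<omega> \<in> space P" for \<omega>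
          using C that square_sum_le2[of "Yb \<omega> - Ya \<omega>" "- G l \<omega>"]
          by (intro mult_mono) (auto simp: abs_le_square_iff[symmetric] intro: order_trans[OF _ abs_ge_self])
        then show "AE \<omega> in P. norm ((?f \<omega>)\<^sup>2) \<le> norm (C\<^sup>2 * (2 * (Yb \<omega> - Ya \<omega>)\<^sup>2 + 2 * (G l \<omega>)\<^sup>2))"
          by (intro AE_I2) (auto simp: power_mult_distrib abs_mult)
      qed measurable
      have "?E\<^sup>2 \<le> expectation (\<lambda>\<omega>. (?f \<omega>)\<^sup>2)"
        using variance_eq[OF f(1) f2] variance_positive[of ?f] f(2) by simp
      then have "ennreal (?E\<^sup>2) \<le> ennreal (expectation (\<lambda>\<omega>. (?f \<omega>)\<^sup>2))" by (rule ennreal_leI)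
      also have "\<dots> = (\<integral>\<^sup>+ \<omega>. ennreal ((?f \<omega>)\<^sup>2) \<partial>P)" using f2 by (simp add: nn_integral_eq_integral)
      also have "\<dots> \<le> (\<integral>\<^sup>+ \<omega>. ennreal (C\<^sup>2) * ennreal ((Yb \<omega> - Ya \<omega> - G l \<omega>)\<^sup>2) \<partial>P)"
      proof (intro nn_integral_mono)
        fix \<omega> assume "\<omega> \<in> space P"
        then have "\<bar>\<zeta> \<omega>\<bar> \<le> \<bar>C\<bar>" using C by (auto intro: order_trans[OF _ abs_ge_self])
        then have "(\<zeta> \<omega>)\<^sup>2 \<le> C\<^sup>2" by (simp add: abs_le_square_iff)
        then have "(\<zeta> \<omega>)\<^sup>2 * (Yb \<omega> - Ya \<omega> - G l \<omega>)\<^sup>2 \<le> C\<^sup>2 * (Yb \<omega> - Ya \<omega> - G l \<omega>)\<^sup>2"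
          by (rule mult_right_mono) simp
        then show "ennreal ((?f \<omega>)\<^sup>2) \<le> ennreal (C\<^sup>2) * ennreal ((Yb \<omega> - Ya \<omega> - G l \<omega>)\<^sup>2)"
          by (simp add: power_mult_distrib ennreal_mult[symmetric] ennreal_leI)
      qed
      also have "\<dots> = ennreal (C\<^sup>2) * (\<integral>\<^sup>+ \<omega>. ennreal ((Yb \<omega> - Ya \<omega> - G l \<omega>)\<^sup>2) \<partial>P)"
        by (rule nn_integral_cmult) measurable
      also have "\<dots> \<le> ennreal (C\<^sup>2) * \<epsilon> l"
        using split[of "G l" l] by (intro mult_left_mono) auto
      finally show ?thesis .
    qed
    moreover have "(\<lambda>l. ennreal (C\<^sup>2) * \<epsilon> l) \<longlonglongrightarrow> ennreal (C\<^sup>2) * 0"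
      by (intro ennreal_tendsto_cmult \<epsilon>0) auto
    ultimately have "ennreal (?E\<^sup>2) \<le> 0"
      by (intro LIMSEQ_le_const[where X = "\<lambda>l. ennreal (C\<^sup>2) * \<epsilon> l"]) auto
    then show ?thesis by (simp add: ennreal_eq_0_iff)
  qed
qed

end

section \<open>Diffusions with bounded coefficients\<close>

definition square_integrable :: "'a measure \<Rightarrow> ('a \<Rightarrow> real) \<Rightarrow> bool" where
  "square_integrable M f \<longleftrightarrow> f \<in> borel_measurable M \<and> integrable M (\<lambda>x. (f x)\<^sup>2)"

lemma square_integrableI_nn_integral:
  assumes "f \<in> borel_measurable M" "(\<integral>\<^sup>+ x. ennreal ((f x)\<^sup>2) \<partial>M) \<le> ennreal c" "0 \<le> c"
  shows "square_integrable M f" "(\<integral> x. (f x)\<^sup>2 \<partial>M) \<le> c"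
proof -
  have i: "integrable M (\<lambda>x. (f x)\<^sup>2)"
    using assms by (intro integrableI_bounded) (auto intro: le_less_trans)
  then show "square_integrable M f" using assms by (simp add: square_integrable_def)
  have "ennreal (\<integral> x. (f x)\<^sup>2 \<partial>M) = (\<integral>\<^sup>+ x. ennreal ((f x)\<^sup>2) \<partial>M)"
    using i by (simp add: nn_integral_eq_integral)
  then have "ennreal (\<integral> x. (f x)\<^sup>2 \<partial>M) \<le> ennreal c" using assms(2) by simp
  then show "(\<integral> x. (f x)\<^sup>2 \<partial>M) \<le> c" using assms(3) by (simp add: ennreal_le_iff)
qed

lemma square_integrable_mult:
  assumes "square_integrable M f" "square_integrable M g"
  shows "integrable M (\<lambda>x. f x * g x)"
proof (rule Bochner_Integration.integrable_bound)
  show "integrable M (\<lambda>x. (f x)\<^sup>2 + (g x)\<^sup>2)"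
    using assms by (simp add: square_integrable_def)
  show "(\<lambda>x. f x * g x) \<in> borel_measurable M"
    using assms by (auto simp: square_integrable_def)
  have "\<bar>f x * g x\<bar> \<le> (f x)\<^sup>2 + (g x)\<^sup>2" for x
  proof -
    have "2 * (\<bar>f x\<bar> * \<bar>g x\<bar>) \<le> (f x)\<^sup>2 + (g x)\<^sup>2"
      using sum_squares_bound[of "\<bar>f x\<bar>" "\<bar>g x\<bar>"] unfolding power2_abs by linarith
    moreover have "0 \<le> \<bar>f x\<bar> * \<bar>g x\<bar>" by simp
    ultimately show ?thesis unfolding abs_mult by linarith
  qed
  from order_trans[OF this abs_ge_self]
  show "AE x in M. norm (f x * g x) \<le> norm ((f x)\<^sup>2 + (g x)\<^sup>2)"
    unfolding real_norm_def by (intro AE_I2)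
qed

lemma square_integrable_bounded_mult:
  assumes f: "square_integrable M f" and g: "g \<in> borel_measurable M" "\<And>x. x \<in> space M \<Longrightarrow> \<bar>g x\<bar> \<le> c"
  shows "square_integrable M (\<lambda>x. g x * f x)"
  unfolding square_integrable_def
proof
  have fm: "f \<in> borel_measurable M" using f by (simp add: square_integrable_def)
  then show m: "(\<lambda>x. g x * f x) \<in> borel_measurable M" using g by auto
  show "integrable M (\<lambda>x. (g x * f x)\<^sup>2)"
  proof (rule Bochner_Integration.integrable_bound)
    show "integrable M (\<lambda>x. c\<^sup>2 * (f x)\<^sup>2)" using f by (simp add: square_integrable_def)
    show "(\<lambda>x. (g x * f x)\<^sup>2) \<in> borel_measurable M" using m by auto
    show "AE x in M. norm ((g x * f x)\<^sup>2) \<le> norm (c\<^sup>2 * (f x)\<^sup>2)"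
    proof (rule AE_I2)
      fix x assume "x \<in> space M"
      then have "(g x)\<^sup>2 \<le> c\<^sup>2" using g(2)[of x] by (simp add: abs_le_square_iff[symmetric])
      then show "norm ((g x * f x)\<^sup>2) \<le> norm (c\<^sup>2 * (f x)\<^sup>2)"
        by (simp add: power_mult_distrib mult_right_mono)
    qed
  qed
qed

lemma (in prob_space) square_integrable_integrable:
  assumes "square_integrable M f" shows "integrable M f"
  using square_integrable_mult[OF assms, of "\<lambda>_. 1"] by (simp add: square_integrable_def)

lemma power2_sum_le: "(\<Sum>i\<in>(UNIV::'n set). f i)\<^sup>2 \<le> real CARD('n) * (\<Sum>i\<in>UNIV. (f i)\<^sup>2)" for f :: "'n::finite \<Rightarrow> real"
  using sum_squared_le_sum_of_squares[of f "UNIV::'n set"] by (simp add: mult.commute)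

lemma power4_sum_le: "(\<Sum>i\<in>(UNIV::'n set). f i) ^ 4 \<le> real CARD('n) ^ 3 * (\<Sum>i\<in>UNIV. (f i) ^ 4)" for f :: "'n::finite \<Rightarrow> real"
proof -
  let ?d = "real CARD('n)"
  have "(\<Sum>i\<in>UNIV. f i) ^ 4 = ((\<Sum>i\<in>UNIV. f i)\<^sup>2)\<^sup>2" by simp
  also have "\<dots> \<le> (?d * (\<Sum>i\<in>UNIV. (f i)\<^sup>2))\<^sup>2"
    by (rule power_mono[OF power2_sum_le]) simp
  also have "\<dots> = ?d\<^sup>2 * (\<Sum>i\<in>UNIV. (f i)\<^sup>2)\<^sup>2" by (simp add: power_mult_distrib)
  also have "\<dots> \<le> ?d\<^sup>2 * (?d * (\<Sum>i\<in>UNIV. ((f i)\<^sup>2)\<^sup>2))"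
    by (rule mult_left_mono[OF power2_sum_le]) simp
  also have "\<dots> = ?d ^ 3 * (\<Sum>i\<in>UNIV. (f i) ^ 4)"
    by (simp add: power_mult[symmetric] power3_eq_cube power2_eq_square[of "real CARD('n)"])
  finally show ?thesis .
qed

lemma norm_power2_vec: "(norm x)\<^sup>2 = (\<Sum>i\<in>UNIV. (x $ i)\<^sup>2)" for x :: "real^'n"
  unfolding power2_norm_eq_inner inner_vec_def by (simp add: power2_eq_square)

text \<open>The free weight takes the place of the Cauchy-Schwarz inequality: chosen as a power of
  the step length, it balances two moments of different order.\<close>

lemma weighted_am_gm: "0 < l \<Longrightarrow> \<bar>x * y\<bar> \<le> (l * x\<^sup>2 + y\<^sup>2 / l) / 2" for x y l :: real
proof -
  assume l: "0 < l"
  have "0 \<le> (l * \<bar>x\<bar> - \<bar>y\<bar>)\<^sup>2 / l" using l by simp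
  also have "(l * \<bar>x\<bar> - \<bar>y\<bar>)\<^sup>2 / l = l * x\<^sup>2 + y\<^sup>2 / l - 2 * (\<bar>x\<bar> * \<bar>y\<bar>)"
    using l by (simp add: power2_eq_square field_simps)
  finally show ?thesis by (simp add: abs_mult)
qed

text \<open>One constant bounds both coefficients and serves as their Lipschitz constant. The matrix
  is controlled entry by entry, as each Ito integral involves a single entry.\<close>

locale bounded_diffusion = diffusion P W X B A
  for P :: "'a measure" and W X :: "real \<Rightarrow> 'a \<Rightarrow> real ^ 'n"
    and B :: "real ^ 'n \<Rightarrow> real ^ 'n" and A :: "real ^ 'n \<Rightarrow> real ^ 'n ^ 'n" +
  fixes K :: real
  assumes B_bounded: "norm (B x) \<le> K" and B_lipschitz: "norm (B x - B y) \<le> K * norm (x - y)"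
    and A_bounded: "\<bar>A x $ i $ j\<bar> \<le> K" and A_lipschitz: "\<bar>A x $ i $ j - A y $ i $ j\<bar> \<le> K * norm (x - y)"
begin

lemma K_nonneg: "0 \<le> K"
  using B_bounded[of 0] norm_ge_zero[of "B 0"] by linarith

lemma A_continuous: "continuous_on UNIV (\<lambda>x. A x $ i $ j)"
  using A_lipschitz K_nonneg by (intro lipschitz_on_continuous_on[where L = K] lipschitz_onI) (auto simp: dist_norm)

lemma B_continuous: "continuous_on UNIV B"
  using B_lipschitz K_nonneg by (intro lipschitz_on_continuous_on[where L = K] lipschitz_onI) (auto simp: dist_norm)

lemma B_nth_continuous: "continuous_on UNIV (\<lambda>x. B x $ i)"
  by (intro continuous_on_component B_continuous)

lemma A_measurable[measurable]: "(\<lambda>x. A x $ i $ j) \<in> borel_measurable borel"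
  and B_measurable[measurable]: "B \<in> borel_measurable borel"
  using A_continuous B_continuous by (auto intro: borel_measurable_continuous_onI)

lemma B_nth_bounded: "\<bar>B x $ i\<bar> \<le> K"
  using component_le_norm_cart[of "B x" i] B_bounded[of x] by linarith

lemma B_nth_lipschitz: "\<bar>B x $ i - B y $ i\<bar> \<le> K * norm (x - y)"
  using component_le_norm_cart[of "B x - B y" i] B_lipschitz[of x y] by simp

lemma X_joint: "(\<lambda>(s, \<omega>). X (max 0 s) \<omega>) \<in> borel_measurable (borel \<Otimes>\<^sub>M P)"
  by (rule measurable_continuous_process) (auto intro: X_continuous)

lemma X_joint': "(\<lambda>(\<omega>, s). X (max 0 s) \<omega>) \<in> borel_measurable (P \<Otimes>\<^sub>M lborel)"
  using measurable_compose[OF measurable_pair_swap' X_joint]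
  by (simp add: split_beta cong: measurable_cong_sets sets_pair_measure_cong)

definition drift :: "real \<Rightarrow> real \<Rightarrow> 'n \<Rightarrow> 'a \<Rightarrow> real" where
  "drift a b i \<omega> = (LINT s:{a<..b}|lborel. B (X s \<omega>) $ i)"

lemma B_X_integrable:
  assumes "\<omega> \<in> space P" "0 \<le> a"
  shows "set_integrable lborel {a..b} (\<lambda>s. B (X s \<omega>) $ i)" "set_integrable lborel {a<..b} (\<lambda>s. B (X s \<omega>) $ i)"
proof -
  have "continuous_on {a..b} (\<lambda>s. B (X s \<omega>) $ i)"
    by (rule continuous_on_compose2[OF B_nth_continuous continuous_on_subset[OF X_continuous[OF assms(1)]]])
       (use assms in auto)
  then show *: "set_integrable lborel {a..b} (\<lambda>s. B (X s \<omega>) $ i)"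
    by (rule borel_integrable_atLeastAtMost')
  show "set_integrable lborel {a<..b} (\<lambda>s. B (X s \<omega>) $ i)"
    by (rule set_integrable_subset[OF *]) auto
qed

lemma drift_measurable: "0 \<le> a \<Longrightarrow> drift a b i \<in> borel_measurable P"
proof -
  assume a: "0 \<le> a"
  have "(\<lambda>\<omega>. LINT s|lborel. indicator {a<..b} s * B (X (max 0 s) \<omega>) $ i) \<in> borel_measurable P"
  proof (rule lborel.borel_measurable_lebesgue_integral)
    have [measurable]: "(\<lambda>(\<omega>, s). B (X (max 0 s) \<omega>) $ i) \<in> borel_measurable (P \<Otimes>\<^sub>M lborel)"
      using measurable_compose[OF measurable_compose[OF X_joint' B_measurable] borel_measurable_nth[of i]]
      by (simp add: split_beta)
    show "(\<lambda>(\<omega>, s). indicator {a<..b} s * B (X (max 0 s) \<omega>) $ i) \<in> borel_measurable (P \<Otimes>\<^sub>M lborel)"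
      by measurable
  qed
  also have "(\<lambda>\<omega>. LINT s|lborel. indicator {a<..b} s * B (X (max 0 s) \<omega>) $ i) = drift a b i"
    unfolding drift_def set_lebesgue_integral_def
    by (intro ext Bochner_Integration.integral_cong) (use a in \<open>auto simp: indicator_def max_def\<close>)
  finally show ?thesis .
qed

lemma drift_bound:
  assumes "\<omega> \<in> space P" "0 \<le> a" "a \<le> b"
  shows "\<bar>drift a b i \<omega>\<bar> \<le> K * (b - a)"
proof -
  have "\<bar>drift a b i \<omega>\<bar> \<le> (LINT s:{a<..b}|lborel. \<bar>B (X s \<omega>) $ i\<bar>)"
    unfolding drift_def using set_integral_norm_bound[OF B_X_integrable(2)[OF assms(1,2), of b i]] by simp
  also have "\<dots> \<le> (LINT s:{a<..b}|lborel. K)"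
  proof (rule set_integral_mono[OF set_integrable_abs[OF B_X_integrable(2)[OF assms(1,2)]]])
    have "set_integrable lborel {a..b} (\<lambda>s. K)" by (rule borel_integrable_atLeastAtMost') simp
    then show "set_integrable lborel {a<..b} (\<lambda>s. K)" by (rule set_integrable_subset) auto
  qed (rule B_nth_bounded)
  also have "\<dots> = K * (b - a)" using assms by (simp add: set_lebesgue_integral_def)
  finally show ?thesis .
qed

text \<open>
  \<open>N i j\<close> plays the role of the integral of \<open>A i j\<close> against \<open>W j\<close> over \<open>[a, b]\<close>.
\<close>

definition noise_increment :: "real \<Rightarrow> real \<Rightarrow> ('n \<Rightarrow> 'n \<Rightarrow> 'a \<Rightarrow> real) \<Rightarrow> bool" where
  "noise_increment a b N \<longleftrightarrow>
    (\<forall>i j. N i j \<in> borel_measurable P) \<and>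
    (\<forall>i j \<zeta>. bounded_F a \<zeta> \<longrightarrow> integrable P (\<lambda>\<omega>. (N i j \<omega>)\<^sup>2) \<longrightarrow> expectation (\<lambda>\<omega>. \<zeta> \<omega> * N i j \<omega>) = 0) \<and>
    (\<forall>i j \<zeta>. bounded_F a \<zeta> \<longrightarrow>
      (\<integral>\<^sup>+ \<omega>. ennreal ((N i j \<omega> - \<zeta> \<omega> * (W b \<omega> $ j - W a \<omega> $ j))\<^sup>2) \<partial>P) \<le>
       4 * (\<integral>\<^sup>+ \<omega>. (\<integral>\<^sup>+ s\<in>{a<..b}. ennreal ((A (X s \<omega>) $ i $ j - \<zeta> \<omega>)\<^sup>2) \<partial>lborel) \<partial>P)) \<and>
    (\<forall>i. AE \<omega> in P. X b \<omega> $ i - X a \<omega> $ i = drift a b i \<omega> + (\<Sum>j\<in>UNIV. N i j \<omega>))"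

text \<open>The equation holds at each time with its own versions of the integrals. Differences of
  the versions at \<open>b\<close> and at \<open>a\<close> represent the noise, and the estimates
  hold for whatever versions were chosen.\<close>

lemma X_increment:
  assumes ab: "0 \<le> a" "a \<le> b"
  obtains N where "noise_increment a b N"
proof -
  have "\<exists>Y. (\<forall>j. has_ito_integral P F (\<lambda>s \<omega>. W s \<omega> $ j) (\<lambda>s \<omega>. A (X s \<omega>) $ i $ j) t (Y j)) \<and>
        (AE \<omega> in P. X t \<omega> $ i =
           X 0 \<omega> $ i + (LINT s:{0..t}|lborel. B (X s \<omega>) $ i) + (\<Sum>j\<in>UNIV. Y j \<omega>))" if "0 \<le> t" for t i
    using X that unfolding sde_solution_def by blast
  then have "\<exists>Y. \<forall>i. (\<forall>j. has_ito_integral P F (\<lambda>s \<omega>. W s \<omega> $ j) (\<lambda>s \<omega>. A (X s \<omega>) $ i $ j) t (Y i j)) \<and>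
        (AE \<omega> in P. X t \<omega> $ i =
           X 0 \<omega> $ i + (LINT s:{0..t}|lborel. B (X s \<omega>) $ i) + (\<Sum>j\<in>UNIV. Y i j \<omega>))" if "0 \<le> t" for t
    using that by (intro choice allI)
  from this[of a] this[of b] ab obtain Ya Yb where
    Ya: "\<And>i j. has_ito_integral P F (\<lambda>s \<omega>. W s \<omega> $ j) (\<lambda>s \<omega>. A (X s \<omega>) $ i $ j) a (Ya i j)"
      "\<And>i. AE \<omega> in P. X a \<omega> $ i = X 0 \<omega> $ i + (LINT s:{0..a}|lborel. B (X s \<omega>) $ i) + (\<Sum>j\<in>UNIV. Ya i j \<omega>)" and
    Yb: "\<And>i j. has_ito_integral P F (\<lambda>s \<omega>. W s \<omega> $ j) (\<lambda>s \<omega>. A (X s \<omega>) $ i $ j) b (Yb i j)"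
      "\<And>i. AE \<omega> in P. X b \<omega> $ i = X 0 \<omega> $ i + (LINT s:{0..b}|lborel. B (X s \<omega>) $ i) + (\<Sum>j\<in>UNIV. Yb i j \<omega>)"
    by fastforce
  define N where "N i j \<omega> = Yb i j \<omega> - Ya i j \<omega>" for i j \<omega>
  have Am: "(\<lambda>(\<omega>, s). A (X s \<omega>) $ i $ j * indicator {0..} s) \<in> borel_measurable (P \<Otimes>\<^sub>M lborel)" for i j
  proof -
    have "(\<lambda>(\<omega>, s). A (X (max 0 s) \<omega>) $ i $ j) \<in> borel_measurable (P \<Otimes>\<^sub>M lborel)"
      using measurable_compose[OF X_joint' A_measurable[of i j]] by (simp add: split_beta)
    then have "(\<lambda>(\<omega>, s). A (X (max 0 s) \<omega>) $ i $ j * indicator {0..} s) \<in> borel_measurable (P \<Otimes>\<^sub>M lborel)"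
      unfolding split_beta by measurable
    also have "(\<lambda>(\<omega>, s). A (X (max 0 s) \<omega>) $ i $ j * indicator {0..} s) = (\<lambda>(\<omega>, s). A (X s \<omega>) $ i $ j * indicator {0..} s)"
      by (auto simp: fun_eq_iff indicator_def max_def)
    finally show ?thesis .
  qed
  have m: "Ya i j \<in> borel_measurable P" "Yb i j \<in> borel_measurable P" for i j
    using Ya(1)[of j i] Yb(1)[of j i] unfolding has_ito_integral_def by auto
  show thesis
  proof (rule that[of N], unfold noise_increment_def, intro conjI allI impI)
    show "N i j \<in> borel_measurable P" for i j unfolding N_def using m by measurable
    show "expectation (\<lambda>\<omega>. \<zeta> \<omega> * N i j \<omega>) = 0" if "bounded_F a \<zeta>" "integrable P (\<lambda>\<omega>. (N i j \<omega>)\<^sup>2)" for i j \<zeta>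
      using ito_increment(2)[OF ab Ya(1) Yb(1) Am that(1)] that(2) unfolding N_def by simp
    show "(\<integral>\<^sup>+ \<omega>. ennreal ((N i j \<omega> - \<zeta> \<omega> * (W b \<omega> $ j - W a \<omega> $ j))\<^sup>2) \<partial>P) \<le>
       4 * (\<integral>\<^sup>+ \<omega>. (\<integral>\<^sup>+ s\<in>{a<..b}. ennreal ((A (X s \<omega>) $ i $ j - \<zeta> \<omega>)\<^sup>2) \<partial>lborel) \<partial>P)"
      if "bounded_F a \<zeta>" for i j \<zeta>
      unfolding N_def by (rule ito_increment(1)[OF ab Ya(1) Yb(1) Am that])
    show "AE \<omega> in P. X b \<omega> $ i - X a \<omega> $ i = drift a b i \<omega> + (\<Sum>j\<in>UNIV. N i j \<omega>)" for i
      using Ya(2)[of i] Yb(2)[of i] AE_space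
    proof eventually_elim
      case (elim \<omega>)
      have "{0..b} = {0..a} \<union> {a<..b}" using ab by auto
      then have "(LINT s:{0..b}|lborel. B (X s \<omega>) $ i) = (LINT s:{0..a}|lborel. B (X s \<omega>) $ i) + drift a b i \<omega>"
        unfolding drift_def using B_X_integrable[OF elim(3), of _ _ i] ab
        by (simp only:) (rule set_integral_Un, auto)
      then show ?case using elim by (simp add: N_def sum_subtractf)
    qed
  qed
qed

end

lemma sum_ennreal_const: "0 \<le> c \<Longrightarrow> (\<Sum>i\<in>(UNIV::'n::finite set). ennreal c) = ennreal (real CARD('n) * c)"
  by (simp add: ennreal_mult ennreal_of_nat_eq_real_of_nat)

context bounded_diffusion
begin

text \<open>With d = \<open>CARD('n)\<close>, the drift contributes 2 d K^2, and each of the d^2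
  noise terms contributes 2 d times its second moment constant 4 K^2. In \<open>C1\<close>, which
  bounds a single component, d noise terms enter with 2 d times 4 K^2 \<open>C0\<close>.\<close>

definition C0 :: real where "C0 = 2 * real CARD('n) * K\<^sup>2 + 8 * real CARD('n) ^ 3 * K\<^sup>2"

definition C1 :: real where "C1 = 2 * K\<^sup>2 + 8 * (real CARD('n))\<^sup>2 * K\<^sup>2 * C0"

lemma C0_nonneg: "0 \<le> C0" and C1_nonneg: "0 \<le> C1"
  by (auto simp: C0_def C1_def)

lemma noise_incrementD:
  assumes "noise_increment a b N"
  shows "N i j \<in> borel_measurable P"
    "bounded_F a \<zeta> \<Longrightarrow> integrable P (\<lambda>\<omega>. (N i j \<omega>)\<^sup>2) \<Longrightarrow> expectation (\<lambda>\<omega>. \<zeta> \<omega> * N i j \<omega>) = 0"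
    "bounded_F a \<zeta> \<Longrightarrow>
      (\<integral>\<^sup>+ \<omega>. ennreal ((N i j \<omega> - \<zeta> \<omega> * (W b \<omega> $ j - W a \<omega> $ j))\<^sup>2) \<partial>P) \<le>
       4 * (\<integral>\<^sup>+ \<omega>. (\<integral>\<^sup>+ s\<in>{a<..b}. ennreal ((A (X s \<omega>) $ i $ j - \<zeta> \<omega>)\<^sup>2) \<partial>lborel) \<partial>P)"
    "AE \<omega> in P. X b \<omega> $ i - X a \<omega> $ i = drift a b i \<omega> + (\<Sum>j\<in>UNIV. N i j \<omega>)"
  using assms unfolding noise_increment_def by blast+

lemma nn_integral_N:
  assumes ab: "0 \<le> a" "a \<le> b" and N: "noise_increment a b N"
  shows "(\<integral>\<^sup>+ \<omega>. ennreal ((N i j \<omega>)\<^sup>2) \<partial>P) \<le> ennreal (4 * K\<^sup>2 * (b - a))"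
proof -
  have "bounded_F a (\<lambda>_. 0)" by (auto simp: bounded_F_def)
  from noise_incrementD(3)[OF N this] have "(\<integral>\<^sup>+ \<omega>. ennreal ((N i j \<omega>)\<^sup>2) \<partial>P) \<le>
     4 * (\<integral>\<^sup>+ \<omega>. (\<integral>\<^sup>+ s\<in>{a<..b}. ennreal ((A (X s \<omega>) $ i $ j)\<^sup>2) \<partial>lborel) \<partial>P)" by simp
  also have "(\<integral>\<^sup>+ \<omega>. (\<integral>\<^sup>+ s\<in>{a<..b}. ennreal ((A (X s \<omega>) $ i $ j)\<^sup>2) \<partial>lborel) \<partial>P) \<le>
     (\<integral>\<^sup>+ \<omega>. (\<integral>\<^sup>+ s\<in>{a<..b}. ennreal (K\<^sup>2) \<partial>lborel) \<partial>P)"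
    using A_bounded K_nonneg
    by (intro nn_integral_mono mult_right_mono ennreal_leI) (auto simp: abs_le_square_iff[symmetric])
  also have "(\<integral>\<^sup>+ \<omega>. (\<integral>\<^sup>+ s\<in>{a<..b}. ennreal (K\<^sup>2) \<partial>lborel) \<partial>P) = ennreal (K\<^sup>2 * (b - a))"
    using ab by (simp add: nn_integral_cmult_indicator ennreal_mult emeasure_space_1)
  also have "4 * ennreal (K\<^sup>2 * (b - a)) = ennreal (4 * K\<^sup>2 * (b - a))"
    using ab by (simp add: ennreal_mult mult.assoc)
  finally show ?thesis by (simp add: mult_left_mono)
qed

text \<open>Drift and noise are estimated separately. On intervals of length at most 1 the squared
  drift, of order h^2, is absorbed into the order h of the noise.\<close>

lemma X_moment:
  assumes ab: "0 \<le> a" "a \<le> b" "b \<le> a + 1"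
  shows "(\<integral>\<^sup>+ \<omega>. ennreal ((norm (X b \<omega> - X a \<omega>))\<^sup>2) \<partial>P) \<le> ennreal (C0 * (b - a))"
proof -
  let ?d = "real CARD('n)" and ?h = "b - a"
  obtain N where N: "noise_increment a b N" by (rule X_increment[OF ab(1,2)])
  note [measurable] = noise_incrementD(1)[OF N]
  have "AE \<omega> in P. \<forall>i\<in>UNIV. X b \<omega> $ i - X a \<omega> $ i = drift a b i \<omega> + (\<Sum>j\<in>UNIV. N i j \<omega>)"
    by (rule AE_finite_allI) (auto intro: noise_incrementD(4)[OF N])
  then have "AE \<omega> in P. ennreal ((norm (X b \<omega> - X a \<omega>))\<^sup>2) \<le> ennreal (2 * ?d * K\<^sup>2 * ?h) +
      (\<Sum>i\<in>UNIV. \<Sum>j\<in>UNIV. ennreal (2 * ?d) * ennreal ((N i j \<omega>)\<^sup>2))"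
    using AE_space
  proof eventually_elim
    case (elim \<omega>)
    have "(X b \<omega> $ i - X a \<omega> $ i)\<^sup>2 \<le> 2 * K\<^sup>2 * ?h + 2 * ?d * (\<Sum>j\<in>UNIV. (N i j \<omega>)\<^sup>2)" for i
    proof -
      have "(drift a b i \<omega>)\<^sup>2 \<le> (K * ?h)\<^sup>2"
        using drift_bound[OF elim(2) ab(1,2), of i] abs_le_square_iff[of "drift a b i \<omega>" "K * ?h"] K_nonneg ab
        by (simp add: abs_mult)
      also have "\<dots> = K\<^sup>2 * (?h * ?h)" by (simp add: power_mult_distrib power2_eq_square)
      also have "\<dots> \<le> K\<^sup>2 * (?h * 1)" using ab by (intro mult_left_mono) auto
      finally have 1: "(drift a b i \<omega>)\<^sup>2 \<le> K\<^sup>2 * ?h" by simp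
      have "X b \<omega> $ i - X a \<omega> $ i = drift a b i \<omega> + (\<Sum>j\<in>UNIV. N i j \<omega>)" using elim(1) by simp
      then show ?thesis
        using square_sum_le2[of "drift a b i \<omega>" "\<Sum>j\<in>UNIV. N i j \<omega>"] power2_sum_le[of "\<lambda>j. N i j \<omega>"] 1
        by simp
    qed
    then have "(norm (X b \<omega> - X a \<omega>))\<^sup>2 \<le> (\<Sum>i\<in>UNIV. 2 * K\<^sup>2 * ?h + 2 * ?d * (\<Sum>j\<in>UNIV. (N i j \<omega>)\<^sup>2))"
      unfolding norm_power2_vec by (intro sum_mono) simp
    also have "\<dots> = 2 * ?d * K\<^sup>2 * ?h + (\<Sum>i\<in>UNIV. \<Sum>j\<in>UNIV. 2 * ?d * (N i j \<omega>)\<^sup>2)"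
      by (simp add: sum.distrib sum_distrib_left mult_ac)
    finally have "ennreal ((norm (X b \<omega> - X a \<omega>))\<^sup>2) \<le> ennreal (2 * ?d * K\<^sup>2 * ?h + (\<Sum>i\<in>UNIV. \<Sum>j\<in>UNIV. 2 * ?d * (N i j \<omega>)\<^sup>2))"
      by (rule ennreal_leI)
    also have "\<dots> = ennreal (2 * ?d * K\<^sup>2 * ?h) + (\<Sum>i\<in>UNIV. \<Sum>j\<in>UNIV. ennreal (2 * ?d) * ennreal ((N i j \<omega>)\<^sup>2))"
      using ab by (subst ennreal_plus) (auto simp: sum_ennreal[symmetric] ennreal_mult sum_nonneg simp del: sum_ennreal intro!: sum_nonneg)
    finally show ?case .
  qed
  then have "(\<integral>\<^sup>+ \<omega>. ennreal ((norm (X b \<omega> - X a \<omega>))\<^sup>2) \<partial>P) \<le>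
     (\<integral>\<^sup>+ \<omega>. ennreal (2 * ?d * K\<^sup>2 * ?h) + (\<Sum>i\<in>UNIV. \<Sum>j\<in>UNIV. ennreal (2 * ?d) * ennreal ((N i j \<omega>)\<^sup>2)) \<partial>P)"
    by (rule nn_integral_mono_AE)
  also have "\<dots> = ennreal (2 * ?d * K\<^sup>2 * ?h) + (\<Sum>i\<in>UNIV. \<Sum>j\<in>UNIV. ennreal (2 * ?d) * (\<integral>\<^sup>+ \<omega>. ennreal ((N i j \<omega>)\<^sup>2) \<partial>P))"
    by (simp add: nn_integral_add nn_integral_sum nn_integral_cmult emeasure_space_1)
  also have "\<dots> \<le> ennreal (2 * ?d * K\<^sup>2 * ?h) + (\<Sum>i\<in>(UNIV::'n set). \<Sum>j\<in>(UNIV::'n set). ennreal (2 * ?d) * ennreal (4 * K\<^sup>2 * ?h))"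
    using ab by (intro add_left_mono sum_mono mult_left_mono nn_integral_N N) auto
  also have "(\<Sum>i\<in>(UNIV::'n set). \<Sum>j\<in>(UNIV::'n set). ennreal (2 * ?d) * ennreal (4 * K\<^sup>2 * ?h)) =
     ennreal (?d * (?d * (2 * ?d * (4 * K\<^sup>2 * ?h))))"
    using ab by (subst ennreal_mult[symmetric], simp, simp) ((subst sum_ennreal_const, simp)+, rule refl)
  also have "ennreal (2 * ?d * K\<^sup>2 * ?h) + \<dots> = ennreal (2 * ?d * K\<^sup>2 * ?h + ?d * (?d * (2 * ?d * (4 * K\<^sup>2 * ?h))))"
    using ab by (intro ennreal_plus[symmetric]) simp_all
  also have "2 * ?d * K\<^sup>2 * ?h + ?d * (?d * (2 * ?d * (4 * K\<^sup>2 * ?h))) = C0 * ?h"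
    by (simp add: C0_def power3_eq_cube algebra_simps)
  finally show ?thesis .
qed

lemma X_diff_joint:
  assumes "0 \<le> a"
  shows "(\<lambda>(\<omega>, s). ennreal ((norm (X s \<omega> - X a \<omega>))\<^sup>2) * indicator {a<..b} s) \<in> borel_measurable (P \<Otimes>\<^sub>M lborel)"
proof -
  have [measurable]: "X a \<in> borel_measurable P" using assms by simp
  have [measurable]: "(\<lambda>z. X (max 0 (snd z)) (fst z)) \<in> borel_measurable (P \<Otimes>\<^sub>M lborel)"
    using X_joint' by (simp add: split_beta)
  have "(\<lambda>(\<omega>, s). ennreal ((norm (X (max 0 s) \<omega> - X a \<omega>))\<^sup>2) * indicator {a<..b} s) \<in> borel_measurable (P \<Otimes>\<^sub>M lborel)"
    unfolding split_beta by measurable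
  also have "(\<lambda>(\<omega>, s). ennreal ((norm (X (max 0 s) \<omega> - X a \<omega>))\<^sup>2) * indicator {a<..b} s) =
     (\<lambda>(\<omega>, s). ennreal ((norm (X s \<omega> - X a \<omega>))\<^sup>2) * indicator {a<..b} s)"
    using assms by (auto simp: fun_eq_iff indicator_def max_def)
  finally show ?thesis .
qed

lemma X_oscillation:
  assumes ab: "0 \<le> a" "a \<le> b" "b \<le> a + 1"
  shows "(\<integral>\<^sup>+ \<omega>. (\<integral>\<^sup>+ s\<in>{a<..b}. ennreal ((norm (X s \<omega> - X a \<omega>))\<^sup>2) \<partial>lborel) \<partial>P) \<le> ennreal (C0 * (b - a)\<^sup>2)"
proof -
  interpret PL: pair_sigma_finite P lborel ..
  have "(\<integral>\<^sup>+ \<omega>. (\<integral>\<^sup>+ s\<in>{a<..b}. ennreal ((norm (X s \<omega> - X a \<omega>))\<^sup>2) \<partial>lborel) \<partial>P) =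
     (\<integral>\<^sup>+ s. (\<integral>\<^sup>+ \<omega>. ennreal ((norm (X s \<omega> - X a \<omega>))\<^sup>2) * indicator {a<..b} s \<partial>P) \<partial>lborel)"
    using PL.Fubini'[OF X_diff_joint[OF ab(1), of b]] by simp
  also have "\<dots> \<le> (\<integral>\<^sup>+ s\<in>{a<..b}. ennreal (C0 * (b - a)) \<partial>lborel)"
  proof (intro nn_integral_mono)
    fix s
    have "(\<integral>\<^sup>+ \<omega>. ennreal ((norm (X s \<omega> - X a \<omega>))\<^sup>2) \<partial>P) \<le> ennreal (C0 * (b - a))" if "s \<in> {a<..b}"
    proof -
      have "(\<integral>\<^sup>+ \<omega>. ennreal ((norm (X s \<omega> - X a \<omega>))\<^sup>2) \<partial>P) \<le> ennreal (C0 * (s - a))"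
        using that ab by (intro X_moment) auto
      also have "\<dots> \<le> ennreal (C0 * (b - a))"
        using that C0_nonneg by (intro ennreal_leI mult_left_mono) auto
      finally show ?thesis .
    qed
    then show "(\<integral>\<^sup>+ \<omega>. ennreal ((norm (X s \<omega> - X a \<omega>))\<^sup>2) * indicator {a<..b} s \<partial>P) \<le> ennreal (C0 * (b - a)) * indicator {a<..b} s"
      by (cases "s \<in> {a<..b}") auto
  qed
  also have "\<dots> = ennreal (C0 * (b - a)\<^sup>2)"
    using ab C0_nonneg by (simp add: nn_integral_cmult_indicator ennreal_mult[symmetric] power2_eq_square)
  finally show ?thesis .
qed

text \<open>The stochastic part of an Euler step, with the coefficient frozen at time
  \<open>a\<close>. \<open>R\<close> collects the rest, drift included; in the mean square norm it
  is of order h, against h^(1/2) for \<open>U\<close>.\<close>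

definition U :: "real \<Rightarrow> real \<Rightarrow> 'n \<Rightarrow> 'a \<Rightarrow> real" where
  "U a b i \<omega> = (\<Sum>j\<in>UNIV. A (X a \<omega>) $ i $ j * (W b \<omega> $ j - W a \<omega> $ j))"

definition R :: "real \<Rightarrow> real \<Rightarrow> 'n \<Rightarrow> 'a \<Rightarrow> real" where
  "R a b i \<omega> = X b \<omega> $ i - X a \<omega> $ i - U a b i \<omega>"

lemma A_X_bounded_F: "0 \<le> a \<Longrightarrow> bounded_F a (\<lambda>\<omega>. A (X a \<omega>) $ i $ j)"
  unfolding bounded_F_def using A_bounded measurable_compose[OF X_F A_measurable] by blast

lemma W_diff_measurable: "0 \<le> a \<Longrightarrow> a \<le> b \<Longrightarrow> (\<lambda>\<omega>. W b \<omega> $ j - W a \<omega> $ j) \<in> borel_measurable P"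
  by (rule measurable_F_P[OF W_diff_F[of a b b]]) auto

lemma X_diff_measurable: "0 \<le> a \<Longrightarrow> a \<le> b \<Longrightarrow> (\<lambda>\<omega>. X b \<omega> $ j - X a \<omega> $ j) \<in> borel_measurable P"
  by (intro borel_measurable_diff measurable_compose[OF X_measurable borel_measurable_nth]) auto

lemma U_measurable: "0 \<le> a \<Longrightarrow> a \<le> b \<Longrightarrow> U a b i \<in> borel_measurable P"
  unfolding U_def by (intro borel_measurable_sum borel_measurable_times W_diff_measurable bounded_FD(2)[OF A_X_bounded_F]) auto

lemma remainder_bound:
  assumes ab: "0 \<le> a" "a \<le> b" "b \<le> a + 1"
  shows "square_integrable P (R a b i)" "expectation (\<lambda>\<omega>. (R a b i \<omega>)\<^sup>2) \<le> C1 * (b - a)\<^sup>2"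
proof -
  let ?d = "real CARD('n)" and ?h = "b - a"
  obtain N where N: "noise_increment a b N" by (rule X_increment[OF ab(1,2)])
  define D where "D j \<omega> = N i j \<omega> - A (X a \<omega>) $ i $ j * (W b \<omega> $ j - W a \<omega> $ j)" for j \<omega>
  have [measurable]: "D j \<in> borel_measurable P" for j
    unfolding D_def using noise_incrementD(1)[OF N] W_diff_measurable[OF ab(1,2)] bounded_FD(2)[OF A_X_bounded_F[OF ab(1)]]
    by (intro borel_measurable_diff[OF _ borel_measurable_times]) auto
  have D: "(\<integral>\<^sup>+ \<omega>. ennreal ((D j \<omega>)\<^sup>2) \<partial>P) \<le> ennreal (4 * K\<^sup>2 * C0 * ?h\<^sup>2)" for j
  proof -
    have "(\<integral>\<^sup>+ \<omega>. ennreal ((D j \<omega>)\<^sup>2) \<partial>P) \<le>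
      4 * (\<integral>\<^sup>+ \<omega>. (\<integral>\<^sup>+ s\<in>{a<..b}. ennreal ((A (X s \<omega>) $ i $ j - A (X a \<omega>) $ i $ j)\<^sup>2) \<partial>lborel) \<partial>P)"
      unfolding D_def by (rule noise_incrementD(3)[OF N A_X_bounded_F[OF ab(1)]])
    also have "\<dots> \<le> 4 * (\<integral>\<^sup>+ \<omega>. (\<integral>\<^sup>+ s. ennreal (K\<^sup>2) * (ennreal ((norm (X s \<omega> - X a \<omega>))\<^sup>2) * indicator {a<..b} s) \<partial>lborel) \<partial>P)"
    proof (intro mult_left_mono nn_integral_mono)
      fix \<omega> s
      have "(A (X s \<omega>) $ i $ j - A (X a \<omega>) $ i $ j)\<^sup>2 \<le> (K * norm (X s \<omega> - X a \<omega>))\<^sup>2"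
        using A_lipschitz[of "X s \<omega>" i j "X a \<omega>"] K_nonneg by (simp add: abs_le_square_iff[symmetric] abs_mult)
      from ennreal_leI[OF this]
      show "ennreal ((A (X s \<omega>) $ i $ j - A (X a \<omega>) $ i $ j)\<^sup>2) * indicator {a<..b} s \<le>
         ennreal (K\<^sup>2) * (ennreal ((norm (X s \<omega> - X a \<omega>))\<^sup>2) * indicator {a<..b} s)"
        by (cases "s \<in> {a<..b}") (auto simp: power_mult_distrib ennreal_mult)
    qed auto
    also have "(\<integral>\<^sup>+ \<omega>. (\<integral>\<^sup>+ s. ennreal (K\<^sup>2) * (ennreal ((norm (X s \<omega> - X a \<omega>))\<^sup>2) * indicator {a<..b} s) \<partial>lborel) \<partial>P) =
       (\<integral>\<^sup>+ \<omega>. ennreal (K\<^sup>2) * (\<integral>\<^sup>+ s. (ennreal ((norm (X s \<omega> - X a \<omega>))\<^sup>2) * indicator {a<..b} s) \<partial>lborel) \<partial>P)"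
    proof (intro nn_integral_cong nn_integral_cmult)
      fix \<omega> assume "\<omega> \<in> space P"
      from measurable_Pair2[OF X_diff_joint[OF ab(1), of b] this]
      show "(\<lambda>s. ennreal ((norm (X s \<omega> - X a \<omega>))\<^sup>2) * indicator {a<..b} s) \<in> borel_measurable lborel" by simp
    qed
    also have "\<dots> = ennreal (K\<^sup>2) * (\<integral>\<^sup>+ \<omega>. (\<integral>\<^sup>+ s. (ennreal ((norm (X s \<omega> - X a \<omega>))\<^sup>2) * indicator {a<..b} s) \<partial>lborel) \<partial>P)"
      by (intro nn_integral_cmult lborel.borel_measurable_nn_integral X_diff_joint ab)
    also have "4 * \<dots> \<le> 4 * (ennreal (K\<^sup>2) * ennreal (C0 * ?h\<^sup>2))"
      using X_oscillation[OF ab] by (intro mult_left_mono) auto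
    also have "\<dots> = ennreal (4 * K\<^sup>2 * C0 * ?h\<^sup>2)"
      using C0_nonneg by (simp add: ennreal_mult mult.assoc)
    finally show ?thesis .
  qed
  have "AE \<omega> in P. ennreal ((R a b i \<omega>)\<^sup>2) \<le> ennreal (2 * K\<^sup>2 * ?h\<^sup>2) + (\<Sum>j\<in>UNIV. ennreal (2 * ?d) * ennreal ((D j \<omega>)\<^sup>2))"
    using noise_incrementD(4)[OF N, of i] AE_space
  proof eventually_elim
    case (elim \<omega>)
    have 1: "(drift a b i \<omega>)\<^sup>2 \<le> K\<^sup>2 * ?h\<^sup>2"
      using drift_bound[OF elim(2) ab(1,2), of i] abs_le_square_iff[of "drift a b i \<omega>" "K * ?h"] K_nonneg ab
      by (simp add: power_mult_distrib abs_mult)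
    have "R a b i \<omega> = drift a b i \<omega> + (\<Sum>j\<in>UNIV. D j \<omega>)"
      unfolding R_def U_def D_def elim(1) by (simp add: sum_subtractf)
    then have "(R a b i \<omega>)\<^sup>2 \<le> 2 * K\<^sup>2 * ?h\<^sup>2 + 2 * ?d * (\<Sum>j\<in>UNIV. (D j \<omega>)\<^sup>2)"
      using square_sum_le2[of "drift a b i \<omega>" "\<Sum>j\<in>UNIV. D j \<omega>"] power2_sum_le[of "\<lambda>j. D j \<omega>"] 1
      by simp
    also have "\<dots> = 2 * K\<^sup>2 * ?h\<^sup>2 + (\<Sum>j\<in>UNIV. 2 * ?d * (D j \<omega>)\<^sup>2)"
      by (simp add: sum_distrib_left)
    finally have "ennreal ((R a b i \<omega>)\<^sup>2) \<le> ennreal (2 * K\<^sup>2 * ?h\<^sup>2 + (\<Sum>j\<in>UNIV. 2 * ?d * (D j \<omega>)\<^sup>2))" by (rule ennreal_leI)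
    also have "\<dots> = ennreal (2 * K\<^sup>2 * ?h\<^sup>2) + (\<Sum>j\<in>UNIV. ennreal (2 * ?d) * ennreal ((D j \<omega>)\<^sup>2))"
      by (subst ennreal_plus) (auto simp: sum_ennreal[symmetric] ennreal_mult simp del: sum_ennreal intro!: sum_nonneg)
    finally show ?case .
  qed
  then have "(\<integral>\<^sup>+ \<omega>. ennreal ((R a b i \<omega>)\<^sup>2) \<partial>P) \<le>
     (\<integral>\<^sup>+ \<omega>. ennreal (2 * K\<^sup>2 * ?h\<^sup>2) + (\<Sum>j\<in>UNIV. ennreal (2 * ?d) * ennreal ((D j \<omega>)\<^sup>2)) \<partial>P)"
    by (rule nn_integral_mono_AE)
  also have "\<dots> = ennreal (2 * K\<^sup>2 * ?h\<^sup>2) + (\<Sum>j\<in>UNIV. ennreal (2 * ?d) * (\<integral>\<^sup>+ \<omega>. ennreal ((D j \<omega>)\<^sup>2) \<partial>P))"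
    by (simp add: nn_integral_add nn_integral_sum nn_integral_cmult emeasure_space_1)
  also have "\<dots> \<le> ennreal (2 * K\<^sup>2 * ?h\<^sup>2) + (\<Sum>j\<in>(UNIV::'n set). ennreal (2 * ?d) * ennreal (4 * K\<^sup>2 * C0 * ?h\<^sup>2))"
    by (intro add_left_mono sum_mono mult_left_mono D) auto
  also have "(\<Sum>j\<in>(UNIV::'n set). ennreal (2 * ?d) * ennreal (4 * K\<^sup>2 * C0 * ?h\<^sup>2)) =
     ennreal (?d * (2 * ?d * (4 * K\<^sup>2 * C0 * ?h\<^sup>2)))"
    using C0_nonneg by (subst ennreal_mult[symmetric], simp, simp) (subst sum_ennreal_const, simp_all)
  also have "ennreal (2 * K\<^sup>2 * ?h\<^sup>2) + \<dots> = ennreal (2 * K\<^sup>2 * ?h\<^sup>2 + ?d * (2 * ?d * (4 * K\<^sup>2 * C0 * ?h\<^sup>2)))"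
    using C0_nonneg by (intro ennreal_plus[symmetric]) simp_all
  also have "2 * K\<^sup>2 * ?h\<^sup>2 + ?d * (2 * ?d * (4 * K\<^sup>2 * C0 * ?h\<^sup>2)) = C1 * ?h\<^sup>2"
    by (simp add: C1_def power2_eq_square[of ?d] algebra_simps)
  finally have le: "(\<integral>\<^sup>+ \<omega>. ennreal ((R a b i \<omega>)\<^sup>2) \<partial>P) \<le> ennreal (C1 * ?h\<^sup>2)" .
  have m: "R a b i \<in> borel_measurable P"
    unfolding R_def using ab by (intro borel_measurable_diff[OF X_diff_measurable U_measurable]) auto
  show "square_integrable P (R a b i)" "expectation (\<lambda>\<omega>. (R a b i \<omega>)\<^sup>2) \<le> C1 * (b - a)\<^sup>2"
    using square_integrableI_nn_integral[OF m le] C1_nonneg by auto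
qed

end

section \<open>Euler estimates\<close>

context bounded_diffusion
begin

text \<open>Cauchy-Schwarz in time yields a factor h in front of the oscillation integral, which is
  of order h^2. The squared error is thus smaller by one power of h than the squared drift
  itself.\<close>

lemma drift_error:
  assumes ab: "0 \<le> a" "a \<le> b" "b \<le> a + 1"
  shows "square_integrable P (\<lambda>\<omega>. drift a b i \<omega> - (b - a) * B (X a \<omega>) $ i)"
    "expectation (\<lambda>\<omega>. (drift a b i \<omega> - (b - a) * B (X a \<omega>) $ i)\<^sup>2) \<le> K\<^sup>2 * C0 * (b - a) ^ 3"
proof -
  let ?h = "b - a" and ?D = "\<lambda>\<omega>. drift a b i \<omega> - (b - a) * B (X a \<omega>) $ i"
  let ?o = "\<lambda>\<omega> s. ennreal ((norm (X s \<omega> - X a \<omega>))\<^sup>2) * indicator {a<..b} s"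
  have om: "?o \<omega> \<in> borel_measurable lborel" if "\<omega> \<in> space P" for \<omega>
    using measurable_Pair2[OF X_diff_joint[OF ab(1), of b] that] by simp
  have D: "ennreal ((?D \<omega>)\<^sup>2) \<le> ennreal (K\<^sup>2 * ?h) * (\<integral>\<^sup>+ s. ?o \<omega> s \<partial>lborel)" if \<omega>: "\<omega> \<in> space P" for \<omega>
  proof -
    have i: "set_integrable lborel {a<..b} (\<lambda>s. B (X s \<omega>) $ i - B (X a \<omega>) $ i)"
    proof (rule set_integral_diff(1)[OF B_X_integrable(2)[OF \<omega> ab(1)]])
      have "set_integrable lborel {a..b} (\<lambda>s. B (X a \<omega>) $ i)" by (rule borel_integrable_atLeastAtMost') simp
      then show "set_integrable lborel {a<..b} (\<lambda>s. B (X a \<omega>) $ i)" by (rule set_integrable_subset) auto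
    qed
    have "(LINT s:{a<..b}|lborel. B (X a \<omega>) $ i) = ?h * B (X a \<omega>) $ i"
      using ab by (simp add: set_lebesgue_integral_def)
    moreover have "set_integrable lborel {a<..b} (\<lambda>s. B (X a \<omega>) $ i)"
    proof -
      have "set_integrable lborel {a..b} (\<lambda>s. B (X a \<omega>) $ i)" by (rule borel_integrable_atLeastAtMost') simp
      then show ?thesis by (rule set_integrable_subset) auto
    qed
    ultimately have "?D \<omega> = (LINT s:{a<..b}|lborel. B (X s \<omega>) $ i - B (X a \<omega>) $ i)"
      unfolding drift_def by (subst set_integral_diff(2)[OF B_X_integrable(2)[OF \<omega> ab(1)]]) simp_all
    then have "ennreal \<bar>?D \<omega>\<bar> \<le> ennreal (LINT s:{a<..b}|lborel. \<bar>B (X s \<omega>) $ i - B (X a \<omega>) $ i\<bar>)"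
      using set_integral_norm_bound[OF i] by (intro ennreal_leI) simp
    also have "\<dots> = (\<integral>\<^sup>+ s. ennreal (indicator {a<..b} s *\<^sub>R \<bar>B (X s \<omega>) $ i - B (X a \<omega>) $ i\<bar>) \<partial>lborel)"
      unfolding set_lebesgue_integral_def
      by (rule nn_integral_eq_integral[symmetric]) (use set_integrable_abs[OF i] in \<open>auto simp: set_integrable_def\<close>)
    also have "\<dots> = (\<integral>\<^sup>+ s\<in>{a<..b}. ennreal \<bar>B (X s \<omega>) $ i - B (X a \<omega>) $ i\<bar> \<partial>lborel)"
      by (intro nn_integral_cong) (simp add: indicator_def)
    \<comment> \<open>The indicator is written twice, once for each factor of the Cauchy-Schwarz
      inequality that follows.\<close>
    also have "\<dots> \<le> (\<integral>\<^sup>+ s. (ennreal K * (ennreal (norm (X s \<omega> - X a \<omega>)) * indicator {a<..b} s)) * indicator {a<..b} s \<partial>lborel)"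
    proof (intro nn_integral_mono)
      fix s
      have "ennreal \<bar>B (X s \<omega>) $ i - B (X a \<omega>) $ i\<bar> \<le> ennreal (K * norm (X s \<omega> - X a \<omega>))"
        by (intro ennreal_leI B_nth_lipschitz)
      then show "ennreal \<bar>B (X s \<omega>) $ i - B (X a \<omega>) $ i\<bar> * indicator {a<..b} s \<le>
          (ennreal K * (ennreal (norm (X s \<omega> - X a \<omega>)) * indicator {a<..b} s)) * indicator {a<..b} s"
        using K_nonneg by (cases "s \<in> {a<..b}") (auto simp: ennreal_mult)
    qed
    finally have le: "ennreal \<bar>?D \<omega>\<bar> \<le> \<dots>" .
    have Xm: "(\<lambda>s. ennreal (norm (X s \<omega> - X a \<omega>)) * indicator {a<..b} s) \<in> borel_measurable lborel"
    proof -
      have "(\<lambda>s. X (max 0 s) \<omega>) \<in> borel_measurable lborel"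
        using measurable_Pair2[OF X_joint' \<omega>] by simp
      then have "(\<lambda>s. ennreal (norm (X (max 0 s) \<omega> - X a \<omega>)) * indicator {a<..b} s) \<in> borel_measurable lborel"
        by measurable
      also have "(\<lambda>s. ennreal (norm (X (max 0 s) \<omega> - X a \<omega>)) * indicator {a<..b} s) =
         (\<lambda>s. ennreal (norm (X s \<omega> - X a \<omega>)) * indicator {a<..b} s)"
        using ab by (auto simp: fun_eq_iff indicator_def max_def)
      finally show ?thesis .
    qed
    have "ennreal ((?D \<omega>)\<^sup>2) = (ennreal \<bar>?D \<omega>\<bar>)\<^sup>2" by (simp add: ennreal_power)
    also have "\<dots> \<le> (\<integral>\<^sup>+ s. (ennreal K * (ennreal (norm (X s \<omega> - X a \<omega>)) * indicator {a<..b} s)) * indicator {a<..b} s \<partial>lborel)\<^sup>2"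
      by (rule power_mono[OF le]) simp
    also have "\<dots> \<le> (\<integral>\<^sup>+ s. (ennreal K * (ennreal (norm (X s \<omega> - X a \<omega>)) * indicator {a<..b} s))\<^sup>2 \<partial>lborel) *
        (\<integral>\<^sup>+ s. (indicator {a<..b} s)\<^sup>2 \<partial>lborel)"
      using Xm by (intro Cauchy_Schwarz_nn_integral) auto
    also have "(\<integral>\<^sup>+ s. (indicator {a<..b} s)\<^sup>2 \<partial>lborel) = ennreal ?h"
    proof -
      have "(\<lambda>s. (indicator {a<..b} s :: ennreal)\<^sup>2) = indicator {a<..b}"
        by (auto simp: fun_eq_iff indicator_def power2_eq_square)
      then show ?thesis using ab by simp
    qed
    also have "(\<lambda>s. (ennreal K * (ennreal (norm (X s \<omega> - X a \<omega>)) * indicator {a<..b} s))\<^sup>2) = (\<lambda>s. ennreal (K\<^sup>2) * ?o \<omega> s)"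
      using K_nonneg by (auto simp: fun_eq_iff power_mult_distrib ennreal_power indicator_def)
    also have "(\<integral>\<^sup>+ s. ennreal (K\<^sup>2) * ?o \<omega> s \<partial>lborel) = ennreal (K\<^sup>2) * (\<integral>\<^sup>+ s. ?o \<omega> s \<partial>lborel)"
      by (rule nn_integral_cmult[OF om[OF \<omega>]])
    also have "\<dots> * ennreal ?h = ennreal (K\<^sup>2 * ?h) * (\<integral>\<^sup>+ s. ?o \<omega> s \<partial>lborel)"
      using ab by (simp add: ennreal_mult mult_ac)
    finally show ?thesis .
  qed
  have "(\<integral>\<^sup>+ \<omega>. ennreal ((?D \<omega>)\<^sup>2) \<partial>P) \<le> (\<integral>\<^sup>+ \<omega>. ennreal (K\<^sup>2 * ?h) * (\<integral>\<^sup>+ s. ?o \<omega> s \<partial>lborel) \<partial>P)"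
    by (intro nn_integral_mono D)
  also have "\<dots> = ennreal (K\<^sup>2 * ?h) * (\<integral>\<^sup>+ \<omega>. (\<integral>\<^sup>+ s. ?o \<omega> s \<partial>lborel) \<partial>P)"
    by (intro nn_integral_cmult lborel.borel_measurable_nn_integral X_diff_joint ab)
  also have "\<dots> \<le> ennreal (K\<^sup>2 * ?h) * ennreal (C0 * ?h\<^sup>2)"
    by (intro mult_left_mono X_oscillation ab) simp
  also have "\<dots> = ennreal (K\<^sup>2 * ?h * (C0 * ?h\<^sup>2))"
    using ab C0_nonneg by (intro ennreal_mult[symmetric]) auto
  also have "K\<^sup>2 * ?h * (C0 * ?h\<^sup>2) = K\<^sup>2 * C0 * ?h ^ 3"
    by (simp add: power2_eq_square power3_eq_cube)
  finally have le: "(\<integral>\<^sup>+ \<omega>. ennreal ((?D \<omega>)\<^sup>2) \<partial>P) \<le> ennreal (K\<^sup>2 * C0 * ?h ^ 3)" .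
  have m: "?D \<in> borel_measurable P"
    using ab by (intro borel_measurable_diff drift_measurable borel_measurable_times borel_measurable_const
      measurable_compose[OF measurable_compose[OF X_measurable B_measurable] borel_measurable_nth]) auto
  show "square_integrable P ?D" "expectation (\<lambda>\<omega>. (?D \<omega>)\<^sup>2) \<le> K\<^sup>2 * C0 * (b - a) ^ 3"
    using square_integrableI_nn_integral[OF m le] ab C0_nonneg by auto
qed

lemma bounded_F_times_square_integrable:
  assumes "bounded_F a \<zeta>" "square_integrable P f"
  shows "square_integrable P (\<lambda>\<omega>. \<zeta> \<omega> * f \<omega>)"
proof -
  obtain C where "\<forall>\<omega>\<in>space P. \<bar>\<zeta> \<omega>\<bar> \<le> C" using bounded_F_bound[OF assms(1)] by auto
  then show ?thesis by (intro square_integrable_bounded_mult[OF assms(2) bounded_FD(2)[OF assms(1)], of C]) auto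
qed

lemma X_diff_square_integrable:
  assumes ab: "0 \<le> a" "a \<le> b" "b \<le> a + 1"
  shows "square_integrable P (\<lambda>\<omega>. X b \<omega> $ i - X a \<omega> $ i)"
proof (rule square_integrableI_nn_integral(1))
  have "(\<integral>\<^sup>+ \<omega>. ennreal ((X b \<omega> $ i - X a \<omega> $ i)\<^sup>2) \<partial>P) \<le> (\<integral>\<^sup>+ \<omega>. ennreal ((norm (X b \<omega> - X a \<omega>))\<^sup>2) \<partial>P)"
  proof (intro nn_integral_mono ennreal_leI)
    fix \<omega>
    show "(X b \<omega> $ i - X a \<omega> $ i)\<^sup>2 \<le> (norm (X b \<omega> - X a \<omega>))\<^sup>2"
      using component_le_norm_cart[of "X b \<omega> - X a \<omega>" i] by (simp add: abs_le_square_iff[symmetric])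
  qed
  also have "\<dots> \<le> ennreal (C0 * (b - a))" by (rule X_moment[OF ab])
  finally show "(\<integral>\<^sup>+ \<omega>. ennreal ((X b \<omega> $ i - X a \<omega> $ i)\<^sup>2) \<partial>P) \<le> ennreal (C0 * (b - a))" .
qed (use ab C0_nonneg X_diff_measurable in auto)

definition C2 :: real where "C2 = (1 + K\<^sup>2 * C0) / 2"

text \<open>The noise is centred given the past and disappears; what remains is the drift error, of
  size h^(3/2) in the mean square norm.\<close>

lemma euler_first_order:
  assumes ab: "0 \<le> a" "a < b" "b \<le> a + 1" and \<zeta>: "bounded_F a \<zeta>" and c: "\<And>\<omega>. \<omega> \<in> space P \<Longrightarrow> \<bar>\<zeta> \<omega>\<bar> \<le> c"
  shows "\<bar>expectation (\<lambda>\<omega>. \<zeta> \<omega> * (X b \<omega> $ i - X a \<omega> $ i)) - (b - a) * expectation (\<lambda>\<omega>. \<zeta> \<omega> * B (X a \<omega>) $ i)\<bar>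
     \<le> c * C2 * ((b - a) * sqrt (b - a))"
proof -
  have ab': "0 \<le> a" "a \<le> b" "b \<le> a + 1" using ab by auto
  obtain N where N: "noise_increment a b N" by (rule X_increment[OF ab'(1,2)])
  let ?D = "\<lambda>\<omega>. drift a b i \<omega> - (b - a) * B (X a \<omega>) $ i"
  note D = drift_error[OF ab', of i]
  have Nsq: "square_integrable P (N i j)" for j
    using nn_integral_N[OF ab'(1,2) N] ab
    by (intro square_integrableI_nn_integral(1)[OF noise_incrementD(1)[OF N], of _ _ "4 * K\<^sup>2 * (b - a)"]) auto
  have N0: "expectation (\<lambda>\<omega>. \<zeta> \<omega> * N i j \<omega>) = 0" for j
    using noise_incrementD(2)[OF N \<zeta>] Nsq unfolding square_integrable_def by auto
  have Ni: "integrable P (\<lambda>\<omega>. \<zeta> \<omega> * N i j \<omega>)" for j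
    by (intro square_integrable_integrable bounded_F_times_square_integrable[OF \<zeta> Nsq])
  have Di: "integrable P (\<lambda>\<omega>. \<zeta> \<omega> * ?D \<omega>)"
    by (intro square_integrable_integrable bounded_F_times_square_integrable[OF \<zeta> D(1)])
  have Bb: "bounded_F a (\<lambda>\<omega>. B (X a \<omega>) $ i)"
    unfolding bounded_F_def
    using measurable_compose[OF measurable_compose[OF X_F[OF ab(1)] B_measurable] borel_measurable_nth[of i]] B_nth_bounded by blast
  have Bi: "integrable P (\<lambda>\<omega>. \<zeta> \<omega> * B (X a \<omega>) $ i)"
    by (rule bounded_FD(3)[OF bounded_F_mult[OF \<zeta> Bb]])
  have "expectation (\<lambda>\<omega>. \<zeta> \<omega> * (X b \<omega> $ i - X a \<omega> $ i)) =
     expectation (\<lambda>\<omega>. \<zeta> \<omega> * ?D \<omega> + ((b - a) * (\<zeta> \<omega> * B (X a \<omega>) $ i) + (\<Sum>j\<in>UNIV. \<zeta> \<omega> * N i j \<omega>)))"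
  proof (rule integral_cong_AE)
    show "AE \<omega> in P. \<zeta> \<omega> * (X b \<omega> $ i - X a \<omega> $ i) = \<zeta> \<omega> * ?D \<omega> + ((b - a) * (\<zeta> \<omega> * B (X a \<omega>) $ i) + (\<Sum>j\<in>UNIV. \<zeta> \<omega> * N i j \<omega>))"
      using noise_incrementD(4)[OF N, of i]
      by eventually_elim (simp add: algebra_simps sum_distrib_left)
    show "(\<lambda>\<omega>. \<zeta> \<omega> * (X b \<omega> $ i - X a \<omega> $ i)) \<in> borel_measurable P"
      by (intro borel_measurable_times bounded_FD(2)[OF \<zeta>] X_diff_measurable ab')
    show "(\<lambda>\<omega>. \<zeta> \<omega> * ?D \<omega> + ((b - a) * (\<zeta> \<omega> * B (X a \<omega>) $ i) + (\<Sum>j\<in>UNIV. \<zeta> \<omega> * N i j \<omega>))) \<in> borel_measurable P"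
      by (intro borel_measurable_integrable Bochner_Integration.integrable_add Di integrable_mult_right Bi Bochner_Integration.integrable_sum Ni)
  qed
  also have "\<dots> = expectation (\<lambda>\<omega>. \<zeta> \<omega> * ?D \<omega>) + (b - a) * expectation (\<lambda>\<omega>. \<zeta> \<omega> * B (X a \<omega>) $ i)"
    using Di Bi Ni N0 by (simp add: Bochner_Integration.integral_add Bochner_Integration.integral_sum)
  finally have eq: "expectation (\<lambda>\<omega>. \<zeta> \<omega> * (X b \<omega> $ i - X a \<omega> $ i)) - (b - a) * expectation (\<lambda>\<omega>. \<zeta> \<omega> * B (X a \<omega>) $ i)
     = expectation (\<lambda>\<omega>. \<zeta> \<omega> * ?D \<omega>)" by simp
  define q where "q = sqrt (b - a)"
  have q: "0 < q" "b - a = q\<^sup>2" using ab by (auto simp: q_def)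
  have c0: "0 \<le> c" using c not_empty abs_ge_zero order_trans by (metis ex_in_conv)
  have D2: "integrable P (\<lambda>\<omega>. (?D \<omega>)\<^sup>2)" using D(1) by (simp add: square_integrable_def)
  have "\<bar>expectation (\<lambda>\<omega>. \<zeta> \<omega> * ?D \<omega>)\<bar> \<le> expectation (\<lambda>\<omega>. \<bar>\<zeta> \<omega> * ?D \<omega>\<bar>)"
    by (rule integral_abs_bound)
  \<comment> \<open>The weight q^3 = h^(3/2) matches the size of the drift error, so that both terms
    have this order; they account for the two summands of \<open>C2\<close>.\<close>
  also have "\<dots> \<le> expectation (\<lambda>\<omega>. c * ((q ^ 3 + (?D \<omega>)\<^sup>2 / q ^ 3) / 2))"
  proof (rule integral_mono)
    show "integrable P (\<lambda>\<omega>. \<bar>\<zeta> \<omega> * ?D \<omega>\<bar>)" using Di by auto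
    show "integrable P (\<lambda>\<omega>. c * ((q ^ 3 + (?D \<omega>)\<^sup>2 / q ^ 3) / 2))" using D2 by simp
    fix \<omega> assume "\<omega> \<in> space P"
    then show "\<bar>\<zeta> \<omega> * ?D \<omega>\<bar> \<le> c * ((q ^ 3 + (?D \<omega>)\<^sup>2 / q ^ 3) / 2)"
      unfolding abs_mult using c c0 weighted_am_gm[of "q ^ 3" 1 "?D \<omega>"] q by (intro mult_mono) auto
  qed
  also have "\<dots> = c * ((q ^ 3 + expectation (\<lambda>\<omega>. (?D \<omega>)\<^sup>2) / q ^ 3) / 2)"
    using D2 by (simp add: prob_space add_divide_distrib)
  also have "\<dots> \<le> c * ((q ^ 3 + K\<^sup>2 * C0 * (b - a) ^ 3 / q ^ 3) / 2)"
    using D(2) c0 q by (intro mult_left_mono divide_right_mono add_left_mono) auto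
  also have "\<dots> = c * C2 * (q\<^sup>2 * q)"
    using q(1) unfolding q(2) C2_def by (simp add: field_simps power_mult[symmetric] power_add[symmetric] eval_nat_numeral)
  finally show ?thesis unfolding eq q_def[symmetric] by (simp add: q(2))
qed

lemma U_moments:
  assumes ab: "0 \<le> a" "a \<le> b"
  shows "square_integrable P (U a b i)" "expectation (\<lambda>\<omega>. (U a b i \<omega>)\<^sup>2) \<le> (real CARD('n))\<^sup>2 * K\<^sup>2 * (b - a)"
    "integrable P (\<lambda>\<omega>. (U a b i \<omega>) ^ 4)" "expectation (\<lambda>\<omega>. (U a b i \<omega>) ^ 4) \<le> 3 * real CARD('n) ^ 4 * K ^ 4 * (b - a)\<^sup>2"
proof -
  let ?d = "real CARD('n)" and ?w = "\<lambda>j \<omega>. W b \<omega> $ j - W a \<omega> $ j"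
  have w2: "has_bochner_integral P (\<lambda>\<omega>. (?w j \<omega>)\<^sup>2) (b - a)" for j
    using W_moments(2)[OF ab, of j j] by (simp add: power2_eq_square)
  have w4: "has_bochner_integral P (\<lambda>\<omega>. (?w j \<omega>) ^ 4) (3 * (b - a)\<^sup>2)" for j
    by (rule W_moments(3)[OF ab])
  have 2: "(U a b i \<omega>)\<^sup>2 \<le> ?d * (\<Sum>j\<in>UNIV. K\<^sup>2 * (?w j \<omega>)\<^sup>2)" for \<omega>
  proof -
    have "(U a b i \<omega>)\<^sup>2 \<le> ?d * (\<Sum>j\<in>UNIV. (A (X a \<omega>) $ i $ j * ?w j \<omega>)\<^sup>2)"
      unfolding U_def by (rule power2_sum_le)
    also have "\<dots> \<le> ?d * (\<Sum>j\<in>UNIV. K\<^sup>2 * (?w j \<omega>)\<^sup>2)"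
      using A_bounded K_nonneg unfolding power_mult_distrib
      by (intro mult_left_mono sum_mono mult_right_mono) (auto simp: abs_le_square_iff[symmetric])
    finally show ?thesis .
  qed
  have 4: "(U a b i \<omega>) ^ 4 \<le> ?d ^ 3 * (\<Sum>j\<in>UNIV. K ^ 4 * (?w j \<omega>) ^ 4)" for \<omega>
  proof -
    have "(U a b i \<omega>) ^ 4 \<le> ?d ^ 3 * (\<Sum>j\<in>UNIV. (A (X a \<omega>) $ i $ j * ?w j \<omega>) ^ 4)"
      unfolding U_def by (rule power4_sum_le)
    also have "\<dots> \<le> ?d ^ 3 * (\<Sum>j\<in>UNIV. K ^ 4 * (?w j \<omega>) ^ 4)"
    proof (intro mult_left_mono sum_mono)
      fix j
      have "(A (X a \<omega>) $ i $ j) ^ 4 \<le> K ^ 4"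
        using power_mono[OF A_bounded[of "X a \<omega>" i j] abs_ge_zero, of 4] by (simp add: power_even_abs)
      then show "(A (X a \<omega>) $ i $ j * ?w j \<omega>) ^ 4 \<le> K ^ 4 * (?w j \<omega>) ^ 4"
        unfolding power_mult_distrib by (intro mult_right_mono) auto
    qed simp
    finally show ?thesis .
  qed
  have i2: "has_bochner_integral P (\<lambda>\<omega>. ?d * (\<Sum>j\<in>UNIV. K\<^sup>2 * (?w j \<omega>)\<^sup>2)) (?d * (\<Sum>j\<in>(UNIV::'n set). K\<^sup>2 * (b - a)))"
    by (intro has_bochner_integral_mult_right has_bochner_integral_sum w2)
  have i4: "has_bochner_integral P (\<lambda>\<omega>. ?d ^ 3 * (\<Sum>j\<in>UNIV. K ^ 4 * (?w j \<omega>) ^ 4)) (?d ^ 3 * (\<Sum>j\<in>(UNIV::'n set). K ^ 4 * (3 * (b - a)\<^sup>2)))"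
    by (intro has_bochner_integral_mult_right has_bochner_integral_sum w4)
  note m = U_measurable[OF ab, of i]
  have I2: "integrable P (\<lambda>\<omega>. (U a b i \<omega>)\<^sup>2)"
    by (rule Bochner_Integration.integrable_bound[of P "\<lambda>\<omega>. ?d * (\<Sum>j\<in>UNIV. K\<^sup>2 * (?w j \<omega>)\<^sup>2)"])
       (use i2 m 2 in \<open>auto simp: has_bochner_integral_iff intro!: AE_I2 intro: order_trans[OF _ abs_ge_self]\<close>)
  show I4: "integrable P (\<lambda>\<omega>. (U a b i \<omega>) ^ 4)"
    by (rule Bochner_Integration.integrable_bound[of P "\<lambda>\<omega>. ?d ^ 3 * (\<Sum>j\<in>UNIV. K ^ 4 * (?w j \<omega>) ^ 4)"])
       (use i4 m 4 in \<open>auto simp: has_bochner_integral_iff intro!: AE_I2 intro: order_trans[OF _ abs_ge_self]\<close>)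
  show "square_integrable P (U a b i)" using I2 m by (simp add: square_integrable_def)
  have "expectation (\<lambda>\<omega>. (U a b i \<omega>)\<^sup>2) \<le> ?d * (\<Sum>j\<in>(UNIV::'n set). K\<^sup>2 * (b - a))"
    using integral_mono[OF I2 i2[unfolded has_bochner_integral_iff, THEN conjunct1] 2] has_bochner_integral_integral_eq[OF i2] by simp
  then show "expectation (\<lambda>\<omega>. (U a b i \<omega>)\<^sup>2) \<le> ?d\<^sup>2 * K\<^sup>2 * (b - a)" by (simp add: power2_eq_square)
  have "expectation (\<lambda>\<omega>. (U a b i \<omega>) ^ 4) \<le> ?d ^ 3 * (\<Sum>j\<in>(UNIV::'n set). K ^ 4 * (3 * (b - a)\<^sup>2))"
    using integral_mono[OF I4 i4[unfolded has_bochner_integral_iff, THEN conjunct1] 4] has_bochner_integral_integral_eq[OF i4] by simp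
  then show "expectation (\<lambda>\<omega>. (U a b i \<omega>) ^ 4) \<le> 3 * ?d ^ 4 * K ^ 4 * (b - a)\<^sup>2" by (simp add: eval_nat_numeral mult_ac)
qed

definition C3 :: real where "C3 = (real CARD('n))\<^sup>2 * K\<^sup>2 + 2 * C1"

lemma euler_second_order:
  assumes ab: "0 \<le> a" "a < b" "b \<le> a + 1" and \<zeta>: "bounded_F a \<zeta>" and c: "\<And>\<omega>. \<omega> \<in> space P \<Longrightarrow> \<bar>\<zeta> \<omega>\<bar> \<le> c"
  shows "\<bar>expectation (\<lambda>\<omega>. \<zeta> \<omega> * ((X b \<omega> $ i - X a \<omega> $ i) * (X b \<omega> $ k - X a \<omega> $ k))) -
      (b - a) * expectation (\<lambda>\<omega>. \<zeta> \<omega> * (\<Sum>j\<in>UNIV. A (X a \<omega>) $ i $ j * A (X a \<omega>) $ k $ j))\<bar>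
     \<le> c * C3 * ((b - a) * sqrt (b - a))"
proof -
  have ab': "0 \<le> a" "a \<le> b" "b \<le> a + 1" using ab by auto
  let ?w = "\<lambda>j \<omega>. W b \<omega> $ j - W a \<omega> $ j" and ?d = "real CARD('n)"
  note R = remainder_bound[OF ab'] and U = U_moments[OF ab'(1,2)]
  have UU: "has_bochner_integral P (\<lambda>\<omega>. \<zeta> \<omega> * (U a b i \<omega> * U a b k \<omega>))
     ((b - a) * expectation (\<lambda>\<omega>. \<zeta> \<omega> * (\<Sum>j\<in>UNIV. A (X a \<omega>) $ i $ j * A (X a \<omega>) $ k $ j)))"
  proof -
    let ?z = "\<lambda>j l \<omega>. \<zeta> \<omega> * (A (X a \<omega>) $ i $ j * A (X a \<omega>) $ k $ l)"
    have z: "bounded_F a (?z j l)" for j l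
      by (intro bounded_F_mult \<zeta> A_X_bounded_F ab)
    have "has_bochner_integral P (\<lambda>\<omega>. \<Sum>j\<in>UNIV. \<Sum>l\<in>UNIV. ?z j l \<omega> * (?w j \<omega> * ?w l \<omega>))
       (\<Sum>j\<in>UNIV. \<Sum>l\<in>UNIV. expectation (?z j l) * (if j = l then b - a else 0))"
      by (intro has_bochner_integral_sum E_mult_increment2 ab' bounded_FD(1)[OF z] bounded_FD(3)[OF z])
    moreover have "(\<Sum>j\<in>UNIV. \<Sum>l\<in>UNIV. ?z j l \<omega> * (?w j \<omega> * ?w l \<omega>)) = \<zeta> \<omega> * (U a b i \<omega> * U a b k \<omega>)" for \<omega>
    proof -
      have "U a b i \<omega> * U a b k \<omega> = (\<Sum>j\<in>UNIV. \<Sum>l\<in>UNIV. (A (X a \<omega>) $ i $ j * ?w j \<omega>) * (A (X a \<omega>) $ k $ l * ?w l \<omega>))"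
        unfolding U_def by (rule sum_product)
      then show ?thesis by (simp only: sum_distrib_left mult_ac)
    qed
    moreover have "(\<Sum>j\<in>UNIV. \<Sum>l\<in>UNIV. expectation (?z j l) * (if j = l then b - a else 0)) =
       (b - a) * expectation (\<lambda>\<omega>. \<zeta> \<omega> * (\<Sum>j\<in>UNIV. A (X a \<omega>) $ i $ j * A (X a \<omega>) $ k $ j))"
    proof -
      have "(\<Sum>j\<in>UNIV. \<Sum>l\<in>UNIV. expectation (?z j l) * (if j = l then b - a else 0)) = (\<Sum>j\<in>UNIV. expectation (?z j j) * (b - a))"
        by (intro sum.cong refl) (simp add: if_distrib cong: if_cong)
      also have "\<dots> = (b - a) * (\<Sum>j\<in>UNIV. expectation (?z j j))" by (simp add: sum_distrib_left mult.commute)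
      also have "(\<Sum>j\<in>UNIV. expectation (?z j j)) = expectation (\<lambda>\<omega>. \<Sum>j\<in>UNIV. ?z j j \<omega>)"
        by (rule Bochner_Integration.integral_sum[symmetric]) (rule bounded_FD(3)[OF z])
      finally show ?thesis by (simp add: sum_distrib_left)
    qed
    ultimately show ?thesis by simp
  qed
  define q where "q = sqrt (b - a)"
  have q: "0 < q" "b - a = q\<^sup>2" "q \<le> 1" using ab by (auto simp: q_def)
  let ?e = "\<lambda>\<omega>. \<zeta> \<omega> * (U a b i \<omega> * R a b k \<omega> + (R a b i \<omega> * U a b k \<omega> + R a b i \<omega> * R a b k \<omega>))"
  have ei: "integrable P ?e"
    unfolding distrib_left mult.assoc[symmetric]
    by (intro Bochner_Integration.integrable_add square_integrable_mult bounded_F_times_square_integrable[OF \<zeta>] R U)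
  have X: "\<zeta> \<omega> * ((X b \<omega> $ i - X a \<omega> $ i) * (X b \<omega> $ k - X a \<omega> $ k)) = \<zeta> \<omega> * (U a b i \<omega> * U a b k \<omega>) + ?e \<omega>" for \<omega>
    unfolding R_def by (simp add: algebra_simps)
  have eq: "expectation (\<lambda>\<omega>. \<zeta> \<omega> * ((X b \<omega> $ i - X a \<omega> $ i) * (X b \<omega> $ k - X a \<omega> $ k))) -
      (b - a) * expectation (\<lambda>\<omega>. \<zeta> \<omega> * (\<Sum>j\<in>UNIV. A (X a \<omega>) $ i $ j * A (X a \<omega>) $ k $ j)) = expectation ?e"
    unfolding X using UU ei by (simp add: has_bochner_integral_iff)
  have c0: "0 \<le> c" using c not_empty abs_ge_zero order_trans by (metis ex_in_conv)
  \<comment> \<open>With weight q = h^(1/2) the second moments of \<open>U\<close> and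
    \<open>R\<close>, of orders h and h^2, both end up at order h^(3/2). The product of two
    \<open>R\<close> is already of order h^2 and gets weight 1.\<close>
  let ?g = "\<lambda>\<omega>. (q * (U a b i \<omega>)\<^sup>2 + (R a b k \<omega>)\<^sup>2 / q) / 2 + ((q * (U a b k \<omega>)\<^sup>2 + (R a b i \<omega>)\<^sup>2 / q) / 2 + ((R a b i \<omega>)\<^sup>2 + (R a b k \<omega>)\<^sup>2) / 2)"
  have sq: "integrable P (\<lambda>\<omega>. (U a b l \<omega>)\<^sup>2)" "integrable P (\<lambda>\<omega>. (R a b l \<omega>)\<^sup>2)" for l
    using R(1)[of l] U(1)[of l] by (auto simp: square_integrable_def)
  have "\<bar>expectation ?e\<bar> \<le> expectation (\<lambda>\<omega>. \<bar>?e \<omega>\<bar>)"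
    by (rule integral_abs_bound)
  also have "\<dots> \<le> expectation (\<lambda>\<omega>. c * ?g \<omega>)"
  proof (rule integral_mono)
    show "integrable P (\<lambda>\<omega>. \<bar>?e \<omega>\<bar>)" using ei by auto
    show "integrable P (\<lambda>\<omega>. c * ?g \<omega>)" using sq by simp
    fix \<omega> assume "\<omega> \<in> space P"
    have "\<bar>U a b i \<omega> * R a b k \<omega> + (R a b i \<omega> * U a b k \<omega> + R a b i \<omega> * R a b k \<omega>)\<bar> \<le> ?g \<omega>"
    proof -
      have "\<bar>R a b i \<omega> * R a b k \<omega>\<bar> \<le> ((R a b i \<omega>)\<^sup>2 + (R a b k \<omega>)\<^sup>2) / 2"
        using weighted_am_gm[of 1 "R a b i \<omega>" "R a b k \<omega>"] by simp
      then show ?thesis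
        using weighted_am_gm[OF q(1), of "U a b i \<omega>" "R a b k \<omega>"] weighted_am_gm[OF q(1), of "U a b k \<omega>" "R a b i \<omega>"]
        unfolding mult.commute[of "R a b i \<omega>" "U a b k \<omega>"] by linarith
    qed
    then show "\<bar>?e \<omega>\<bar> \<le> c * ?g \<omega>"
      unfolding abs_mult[of "\<zeta> \<omega>"] using c[OF \<open>\<omega> \<in> space P\<close>] c0 by (intro mult_mono) auto
  qed
  also have "\<dots> = c * ((q * expectation (\<lambda>\<omega>. (U a b i \<omega>)\<^sup>2) + expectation (\<lambda>\<omega>. (R a b k \<omega>)\<^sup>2) / q) / 2 +
     ((q * expectation (\<lambda>\<omega>. (U a b k \<omega>)\<^sup>2) + expectation (\<lambda>\<omega>. (R a b i \<omega>)\<^sup>2) / q) / 2 +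
      (expectation (\<lambda>\<omega>. (R a b i \<omega>)\<^sup>2) + expectation (\<lambda>\<omega>. (R a b k \<omega>)\<^sup>2)) / 2))"
    using sq by (simp add: Bochner_Integration.integral_add)
  also have "\<dots> \<le> c * ((q * (?d\<^sup>2 * K\<^sup>2 * (b - a)) + (C1 * (b - a)\<^sup>2) / q) / 2 +
     ((q * (?d\<^sup>2 * K\<^sup>2 * (b - a)) + (C1 * (b - a)\<^sup>2) / q) / 2 +
      ((C1 * (b - a)\<^sup>2) + (C1 * (b - a)\<^sup>2)) / 2))"
    using c0 q(1) by (intro mult_left_mono divide_right_mono add_mono R(2) U(2)) auto
  also have "\<dots> = c * (?d\<^sup>2 * K\<^sup>2 * q ^ 3 + C1 * q ^ 3 + C1 * q ^ 3 * q)"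
    using q(1) unfolding q(2) by (simp add: field_simps eval_nat_numeral)
  also have "\<dots> \<le> c * (?d\<^sup>2 * K\<^sup>2 * q ^ 3 + C1 * q ^ 3 + C1 * q ^ 3 * 1)"
    using c0 q C1_nonneg by (intro mult_left_mono add_left_mono) auto
  also have "\<dots> = c * C3 * (q\<^sup>2 * q)" unfolding C3_def by (simp add: algebra_simps eval_nat_numeral)
  finally show ?thesis unfolding eq q_def[symmetric] by (simp add: q(2))
qed

definition C4 :: real where "C4 = real CARD('n) * (1 + 3 * real CARD('n) ^ 4 * K ^ 4 + 2 * C1)"

text \<open>The weight \<open>\<eta>\<close> may depend on the future, so conditioning on the past
  does not help. A fourth moment separates it from the increment; the bound becomes useful when
  \<open>l\<close> is fixed first and the mean of \<open>\<eta>\<close> tends to zero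
  afterwards.\<close>

lemma euler_weighted:
  assumes ab: "0 \<le> a" "a < b" "b \<le> a + 1" and \<eta>: "\<eta> \<in> borel_measurable P" "\<And>\<omega>. \<omega> \<in> space P \<Longrightarrow> 0 \<le> \<eta> \<omega> \<and> \<eta> \<omega> \<le> 1"
    and l: "0 < l"
  shows "integrable P (\<lambda>\<omega>. (norm (X b \<omega> - X a \<omega>))\<^sup>2 * \<eta> \<omega>)"
    "expectation (\<lambda>\<omega>. (norm (X b \<omega> - X a \<omega>))\<^sup>2 * \<eta> \<omega>) \<le> C4 * (b - a) * (l + expectation \<eta> / l + (b - a))"
proof -
  have ab': "0 \<le> a" "a \<le> b" "b \<le> a + 1" using ab by auto
  let ?d = "real CARD('n)" and ?h = "b - a"
  have h: "0 < ?h" using ab by simp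
  note R = remainder_bound[OF ab'] and U = U_moments[OF ab'(1,2)]
  have \<eta>i: "integrable P \<eta>" using \<eta> by (intro integrable_const_bound[of _ 1]) auto
  let ?g = "\<lambda>\<omega>. \<Sum>i\<in>UNIV. l / ?h * (U a b i \<omega>) ^ 4 + (?h / l) * \<eta> \<omega> + 2 * (R a b i \<omega>)\<^sup>2"
  have gi: "integrable P ?g"
    using R(1) U(3) \<eta>i by (intro Bochner_Integration.integrable_sum Bochner_Integration.integrable_add integrable_mult_right) (auto simp: square_integrable_def)
  have le: "(norm (X b \<omega> - X a \<omega>))\<^sup>2 * \<eta> \<omega> \<le> ?g \<omega>" if \<omega>: "\<omega> \<in> space P" for \<omega>
    unfolding norm_power2_vec sum_distrib_right
  proof (rule sum_mono)
    fix i
    have e: "0 \<le> \<eta> \<omega>" "\<eta> \<omega> \<le> 1" using \<eta>(2)[OF \<omega>] by auto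
    have "(X b \<omega> $ i - X a \<omega> $ i)\<^sup>2 \<le> 2 * (U a b i \<omega>)\<^sup>2 + 2 * (R a b i \<omega>)\<^sup>2"
      using square_sum_le2[of "U a b i \<omega>" "R a b i \<omega>"] by (simp add: R_def)
    then have "((X b \<omega> - X a \<omega>) $ i)\<^sup>2 * \<eta> \<omega> \<le> (2 * (U a b i \<omega>)\<^sup>2 + 2 * (R a b i \<omega>)\<^sup>2) * \<eta> \<omega>"
      using e by (intro mult_right_mono) auto
    also have "\<dots> = 2 * ((U a b i \<omega>)\<^sup>2 * \<eta> \<omega>) + 2 * (R a b i \<omega>)\<^sup>2 * \<eta> \<omega>" by (simp add: algebra_simps)
    finally have s1: "((X b \<omega> - X a \<omega>) $ i)\<^sup>2 * \<eta> \<omega> \<le> 2 * ((U a b i \<omega>)\<^sup>2 * \<eta> \<omega>) + 2 * (R a b i \<omega>)\<^sup>2 * \<eta> \<omega>" .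
    have s2: "2 * (R a b i \<omega>)\<^sup>2 * \<eta> \<omega> \<le> 2 * (R a b i \<omega>)\<^sup>2"
      using e mult_left_mono[of "\<eta> \<omega>" 1 "2 * (R a b i \<omega>)\<^sup>2"] by simp
    \<comment> \<open>The fourth moment of \<open>U\<close> is of order h^2. With weight l / h the
      first term is therefore of order l h, and the second is at most h / l times
      \<open>\<eta>\<close>.\<close>
    have "2 * ((U a b i \<omega>)\<^sup>2 * \<eta> \<omega>) \<le> l / ?h * ((U a b i \<omega>)\<^sup>2)\<^sup>2 + (\<eta> \<omega>)\<^sup>2 / (l / ?h)"
      using weighted_am_gm[of "l / ?h" "(U a b i \<omega>)\<^sup>2" "\<eta> \<omega>"] l h by (simp only: abs_le_iff) simp
    also have "(\<eta> \<omega>)\<^sup>2 / (l / ?h) = (?h / l) * (\<eta> \<omega>)\<^sup>2" by simp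
    also have "((U a b i \<omega>)\<^sup>2)\<^sup>2 = (U a b i \<omega>) ^ 4" by simp
    finally have s3: "2 * ((U a b i \<omega>)\<^sup>2 * \<eta> \<omega>) \<le> l / ?h * (U a b i \<omega>) ^ 4 + (?h / l) * (\<eta> \<omega>)\<^sup>2" .
    have "(\<eta> \<omega>)\<^sup>2 \<le> \<eta> \<omega>" using e mult_left_mono[of "\<eta> \<omega>" 1 "\<eta> \<omega>"] by (simp add: power2_eq_square)
    then have s4: "(?h / l) * (\<eta> \<omega>)\<^sup>2 \<le> (?h / l) * \<eta> \<omega>" using h l by (intro mult_left_mono) auto
    show "((X b \<omega> - X a \<omega>) $ i)\<^sup>2 * \<eta> \<omega> \<le> l / ?h * (U a b i \<omega>) ^ 4 + (?h / l) * \<eta> \<omega> + 2 * (R a b i \<omega>)\<^sup>2"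
      using s1 s2 s3 s4 by linarith
  qed
  show I: "integrable P (\<lambda>\<omega>. (norm (X b \<omega> - X a \<omega>))\<^sup>2 * \<eta> \<omega>)"
  proof (rule Bochner_Integration.integrable_bound[OF gi])
    have "X b \<in> borel_measurable P" "X a \<in> borel_measurable P" using ab by auto
    then show "(\<lambda>\<omega>. (norm (X b \<omega> - X a \<omega>))\<^sup>2 * \<eta> \<omega>) \<in> borel_measurable P" using \<eta>(1) by measurable
    show "AE \<omega> in P. norm ((norm (X b \<omega> - X a \<omega>))\<^sup>2 * \<eta> \<omega>) \<le> norm (?g \<omega>)"
    proof (rule AE_I2)
      fix \<omega> assume \<omega>: "\<omega> \<in> space P"
      have "norm ((norm (X b \<omega> - X a \<omega>))\<^sup>2 * \<eta> \<omega>) = (norm (X b \<omega> - X a \<omega>))\<^sup>2 * \<eta> \<omega>"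
        using \<eta>(2)[OF \<omega>] by simp
      also have "\<dots> \<le> norm (?g \<omega>)" using le[OF \<omega>] unfolding real_norm_def by (rule order_trans[OF _ abs_ge_self])
      finally show "norm ((norm (X b \<omega> - X a \<omega>))\<^sup>2 * \<eta> \<omega>) \<le> norm (?g \<omega>)" .
    qed
  qed
  have "expectation (\<lambda>\<omega>. (norm (X b \<omega> - X a \<omega>))\<^sup>2 * \<eta> \<omega>) \<le> expectation ?g"
    by (rule integral_mono[OF I gi le])
  also have "\<dots> = (\<Sum>i\<in>UNIV. l / ?h * expectation (\<lambda>\<omega>. (U a b i \<omega>) ^ 4) + (?h / l) * expectation \<eta> + 2 * expectation (\<lambda>\<omega>. (R a b i \<omega>)\<^sup>2))"
    using R(1) U(3) \<eta>i by (subst Bochner_Integration.integral_sum) (auto simp: square_integrable_def)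
  also have "\<dots> \<le> (\<Sum>i\<in>(UNIV::'n set). l / ?h * (3 * ?d ^ 4 * K ^ 4 * ?h\<^sup>2) + (?h / l) * expectation \<eta> + 2 * (C1 * ?h\<^sup>2))"
    using l h by (intro sum_mono add_mono mult_left_mono R(2) U(4)) auto
  also have "\<dots> = ?d * ?h * ((3 * ?d ^ 4 * K ^ 4) * l + 1 * (expectation \<eta> / l) + (2 * C1) * ?h)"
    using h by (simp add: field_simps power2_eq_square)
  also have "\<dots> \<le> ?d * ?h * ((1 + 3 * ?d ^ 4 * K ^ 4 + 2 * C1) * l + (1 + 3 * ?d ^ 4 * K ^ 4 + 2 * C1) * (expectation \<eta> / l) + (1 + 3 * ?d ^ 4 * K ^ 4 + 2 * C1) * ?h)"
  proof -
    have "0 \<le> expectation \<eta>" using \<eta> by (intro Bochner_Integration.integral_nonneg_AE) auto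
    then show ?thesis using h l C1_nonneg by (intro mult_left_mono add_mono mult_right_mono) auto
  qed
  also have "\<dots> = C4 * ?h * (l + expectation \<eta> / l + ?h)"
  proof -
    have "d * h * (c * l + c * e + c * h) = d * c * h * (l + e + h)" for d h c e :: real by algebra
    then show ?thesis unfolding C4_def .
  qed
  finally show "expectation (\<lambda>\<omega>. (norm (X b \<omega> - X a \<omega>))\<^sup>2 * \<eta> \<omega>) \<le> C4 * (b - a) * (l + expectation \<eta> / l + (b - a))" .
qed

end

section \<open>Running maximum\<close>

text \<open>The increment claim is the essential one: if the supremum changes over an interval, its
  new value is attained inside it. This expresses that the maximum grows only where the path reaches
  it, and it also lets the supremum inherit continuity from the path.\<close>

lemma running_max:
  fixes g :: "real \<Rightarrow> real"
  assumes g: "continuous_on {0..} g"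
  defines "S \<equiv> \<lambda>t. SUP s\<in>{0..t}. g s"
  shows running_max_ge: "0 \<le> s \<Longrightarrow> s \<le> t \<Longrightarrow> g s \<le> S t"
    and running_max_attained: "0 \<le> t \<Longrightarrow> \<exists>s\<in>{0..t}. S t = g s"
    and running_max_mono: "0 \<le> s \<Longrightarrow> s \<le> t \<Longrightarrow> S s \<le> S t"
    and running_max_increment: "0 \<le> s \<Longrightarrow> s \<le> t \<Longrightarrow> S t = S s \<or> (\<exists>r\<in>{s..t}. S t = g r)"
    and running_max_continuous: "continuous_on {0..} S"
proof -
  have bdd: "bdd_above (g ` {0..t})" for t
    using compact_continuous_image[OF continuous_on_subset[OF g, of "{0..t}"]]
    by (auto intro!: bounded_imp_bdd_above compact_imp_bounded)
  show ge: "0 \<le> s \<Longrightarrow> s \<le> t \<Longrightarrow> g s \<le> S t" for s t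
    unfolding S_def by (rule cSUP_upper[OF _ bdd]) simp
  show att: "0 \<le> t \<Longrightarrow> \<exists>s\<in>{0..t}. S t = g s" for t
  proof -
    assume t: "0 \<le> t"
    obtain s where s: "s \<in> {0..t}" "\<And>r. r \<in> {0..t} \<Longrightarrow> g r \<le> g s"
      using continuous_attains_sup[of "{0..t}" g] continuous_on_subset[OF g, of "{0..t}"] t by auto
    then have "S t \<le> g s" unfolding S_def using t by (intro cSUP_least) auto
    with ge[of s t] s show ?thesis by (intro bexI[of _ s]) auto
  qed
  show mono: "0 \<le> s \<Longrightarrow> s \<le> t \<Longrightarrow> S s \<le> S t" for s t
    using att[of s] ge[of _ t] by force
  show inc: "0 \<le> s \<Longrightarrow> s \<le> t \<Longrightarrow> S t = S s \<or> (\<exists>r\<in>{s..t}. S t = g r)" for s t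
  proof -
    assume st: "0 \<le> s" "s \<le> t"
    obtain r where r: "r \<in> {0..t}" "S t = g r" using att[of t] st by auto
    show ?thesis
    proof (cases "r \<le> s")
      case True
      then have "S t \<le> S s" using ge[of r s] r by simp
      then show ?thesis using mono[OF st] by simp
    next
      case False
      then show ?thesis using r by (intro disjI2 bexI[of _ r]) auto
    qed
  qed
  show "continuous_on {0..} S"
    unfolding continuous_on_iff
  proof (intro ballI allI impI)
    fix t e :: real assume t: "t \<in> {0..}" and e: "0 < e"
    then obtain d where d: "0 < d" "\<And>s. s \<in> {0..} \<Longrightarrow> dist s t < d \<Longrightarrow> dist (g s) (g t) < e / 2"
      using g unfolding continuous_on_iff by (meson half_gt_zero)
    have *: "S b - S a < e" if ab: "0 \<le> a" "a \<le> b" "dist a t < d" "dist b t < d" for a b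
    proof -
      consider "S b = S a" | r where "r \<in> {a..b}" "S b = g r" using inc[OF ab(1,2)] by auto
      then show ?thesis
      proof cases
        case 2
        then have "dist r t < d" using ab by (auto simp: dist_real_def)
        then have "dist (g r) (g t) < e / 2" "dist (g a) (g t) < e / 2" using d(2)[of r] d(2)[of a] 2 ab by auto
        moreover have "g a \<le> S a" using ge[of a a] ab by simp
        ultimately show ?thesis using 2 unfolding dist_real_def by linarith
      qed (use e in simp)
    qed
    show "\<exists>d>0. \<forall>s\<in>{0..}. dist s t < d \<longrightarrow> dist (S s) (S t) < e"
    proof (intro exI[of _ d] conjI ballI impI d(1))
      fix s assume s: "s \<in> {0..}" "dist s t < d"
      show "dist (S s) (S t) < e"
      proof (cases "s \<le> t")
        case True
        then show ?thesis using *[of s t] mono[of s t] s t d(1) by (simp add: dist_real_def)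
      next
        case False
        then show ?thesis using *[of t s] mono[of t s] s t d(1) by (simp add: dist_real_def)
      qed
    qed
  qed
qed

section \<open>Grid approximation, Riemann sums and Taylor's formula\<close>

lemma LIMSEQ_floor_grid:
  fixes u :: real
  assumes "0 \<le> u" "u \<le> 1"
  shows "(\<lambda>n. real (nat \<lfloor>u * real (Suc n)\<rfloor>) / real (Suc n)) \<longlonglongrightarrow> u" "nat \<lfloor>u * real (Suc n)\<rfloor> \<le> Suc n"
proof -
  have eq: "real (nat \<lfloor>u * real (Suc n)\<rfloor>) = real_of_int \<lfloor>u * real (Suc n)\<rfloor>" for n
  proof -
    have "0 \<le> u * real (Suc n)" using assms by simp
    then have "0 \<le> \<lfloor>u * real (Suc n)\<rfloor>" by simp
    then show ?thesis by simp
  qed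
  show "(\<lambda>n. real (nat \<lfloor>u * real (Suc n)\<rfloor>) / real (Suc n)) \<longlonglongrightarrow> u"
  proof (rule real_tendsto_sandwich)
    show "\<forall>\<^sub>F n in sequentially. u - 1 / real (Suc n) \<le> real (nat \<lfloor>u * real (Suc n)\<rfloor>) / real (Suc n)"
    proof (intro always_eventually allI)
      fix n
      have "u * real (Suc n) - 1 \<le> real_of_int \<lfloor>u * real (Suc n)\<rfloor>" by linarith
      then have "(u * real (Suc n) - 1) / real (Suc n) \<le> real_of_int \<lfloor>u * real (Suc n)\<rfloor> / real (Suc n)"
        by (rule divide_right_mono) simp
      then show "u - 1 / real (Suc n) \<le> real (nat \<lfloor>u * real (Suc n)\<rfloor>) / real (Suc n)"
        unfolding eq by (simp add: diff_divide_distrib del: of_nat_Suc)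
    qed
    show "\<forall>\<^sub>F n in sequentially. real (nat \<lfloor>u * real (Suc n)\<rfloor>) / real (Suc n) \<le> u"
    proof (intro always_eventually allI)
      fix n
      have "real_of_int \<lfloor>u * real (Suc n)\<rfloor> \<le> u * real (Suc n)" by linarith
      then show "real (nat \<lfloor>u * real (Suc n)\<rfloor>) / real (Suc n) \<le> u"
        unfolding eq by (simp add: field_simps del: of_nat_Suc)
    qed
    show "(\<lambda>n. u - 1 / real (Suc n)) \<longlonglongrightarrow> u"
      using tendsto_diff[OF tendsto_const[of u] LIMSEQ_inverse_real_of_nat] by (simp add: inverse_eq_divide)
  qed simp
  have "u * real (Suc n) \<le> 1 * real (Suc n)" using assms by (intro mult_right_mono) auto
  then have "real_of_int \<lfloor>u * real (Suc n)\<rfloor> \<le> real_of_int (int (Suc n))"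
    unfolding of_int_of_nat_eq mult_1 by (rule order_trans[OF of_int_floor_le])
  then have "\<lfloor>u * real (Suc n)\<rfloor> \<le> int (Suc n)" by (simp only: of_int_le_iff)
  then show "nat \<lfloor>u * real (Suc n)\<rfloor> \<le> Suc n" by (simp only: nat_le_iff)
qed

text \<open>On each cell the mean value theorem represents the increment of the antiderivative by a
  value of \<open>g\<close> inside the cell, which uniform continuity compares with the value at the
  left end point.\<close>

lemma riemann_sum_LIMSEQ:
  fixes g :: "real \<Rightarrow> real"
  assumes t: "0 < t" and g: "continuous_on {0..t} g"
  shows "(\<lambda>n. \<Sum>k<Suc n. t / real (Suc n) * g (t * real k / real (Suc n))) \<longlonglongrightarrow> (LINT s:{0..t}|lborel. g s)"
proof -
  define G where "G u = integral {0..u} g" for u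
  have G: "(G has_real_derivative g x) (at x within {0..t})" if "x \<in> {0..t}" for x
    unfolding G_def by (rule integral_has_real_derivative[OF g that])
  have int: "(LINT s:{0..t}|lborel. g s) = G t"
    unfolding G_def by (rule set_borel_integral_eq_integral(2)[OF borel_integrable_atLeastAtMost'[OF g]])
  show ?thesis
  proof (rule LIMSEQ_I)
    fix e :: real assume e: "0 < e"
    have "uniformly_continuous_on {0..t} g" by (rule compact_uniformly_continuous[OF g]) simp
    moreover have "0 < e / (2 * t)" using e t by simp
    ultimately obtain d where d: "0 < d" "\<And>x y. x \<in> {0..t} \<Longrightarrow> y \<in> {0..t} \<Longrightarrow> dist y x < d \<Longrightarrow> dist (g y) (g x) < e / (2 * t)"
      unfolding uniformly_continuous_on_def by blast
    obtain n0 where n0: "t / d < real n0" using reals_Archimedean2 by blast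
    show "\<exists>no. \<forall>n\<ge>no. norm ((\<Sum>k<Suc n. t / real (Suc n) * g (t * real k / real (Suc n))) - (LINT s:{0..t}|lborel. g s)) < e"
    proof (intro exI[of _ n0] allI impI)
      fix n assume n: "n0 \<le> n"
      define h where "h = t / real (Suc n)"
      have "t < d * real n0" using n0 d(1) by (simp add: field_simps)
      also have "\<dots> \<le> d * real (Suc n)" using n d(1) by (intro mult_left_mono) auto
      finally have h: "0 < h" "h < d"
        using t by (simp_all add: h_def field_simps del: of_nat_Suc)
      define T where "T k = t * real k / real (Suc n)" for k
      have TS: "T (Suc k) = T k + h" for k
        unfolding T_def h_def add_divide_distrib[symmetric] by (simp add: distrib_left add.commute)
      have T: "0 \<le> T k" for k using t by (simp add: T_def)
      have Tt: "T k \<le> t" if "k \<le> Suc n" for k using mult_left_mono[of "real k" "real (Suc n)" t] t that by (simp add: T_def divide_le_eq del: of_nat_Suc)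
      have step: "\<bar>h * g (T k) - (G (T (Suc k)) - G (T k))\<bar> \<le> h * (e / (2 * t))" if "k < Suc n" for k
      proof -
        have sub: "{T k..T (Suc k)} \<subseteq> {0..t}" using T[of k] Tt[of "Suc k"] that by auto
        have "\<exists>x\<in>{T k<..<T (Suc k)}. G (T (Suc k)) - G (T k) = g x * (T (Suc k) - T k)"
        proof (rule mvt_simple)
          show "T k < T (Suc k)" using h by (simp add: TS)
          fix x assume "T k \<le> x" "x \<le> T (Suc k)"
          then have "x \<in> {0..t}" using sub by auto
          from DERIV_subset[OF G[OF this] sub]
          show "(G has_derivative (*) (g x)) (at x within {T k..T (Suc k)})"
            by (simp add: has_field_derivative_def)
        qed
        then obtain x where x: "T k < x" "x < T (Suc k)" "G (T (Suc k)) - G (T k) = h * g x" by (auto simp: TS)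
        have "dist (g (T k)) (g x) < e / (2 * t)"
          using x T[of k] Tt[of "Suc k"] that h by (intro d(2)) (auto simp: dist_real_def TS)
        then have "h * \<bar>g (T k) - g x\<bar> \<le> h * (e / (2 * t))"
          using h by (intro mult_left_mono) (auto simp: dist_real_def)
        then show ?thesis using x h by (simp add: abs_mult right_diff_distrib[symmetric])
      qed
      have tele: "(\<Sum>k<Suc n. G (T (Suc k)) - G (T k)) = G t"
        by (subst sum_lessThan_telescope) (simp add: T_def G_def)
      have "\<bar>(\<Sum>k<Suc n. h * g (T k)) - G t\<bar> = \<bar>\<Sum>k<Suc n. h * g (T k) - (G (T (Suc k)) - G (T k))\<bar>"
        unfolding sum_subtractf[of "\<lambda>k. h * g (T k)"] tele ..
      also have "\<dots> \<le> (\<Sum>k<Suc n. h * (e / (2 * t)))"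
        by (rule order_trans[OF sum_abs sum_mono]) (use step in auto)
      also have "\<dots> = e / 2" using t by (simp add: h_def del: of_nat_Suc)
      also have "\<dots> < e" using e by simp
      finally show "norm ((\<Sum>k<Suc n. t / real (Suc n) * g (t * real k / real (Suc n))) - (LINT s:{0..t}|lborel. g s)) < e"
        unfolding int real_norm_def T_def h_def .
    qed
  qed
qed

text \<open>This is the one-dimensional formula along the segment from \<open>x\<close> to
  \<open>y\<close>. Lagrange's form of the remainder is kept, because it is the oscillation of the
  second derivative along the segment that becomes small.\<close>

lemma taylor2_vec:
  fixes f :: "'b::real_normed_vector \<Rightarrow> real" and p :: "'b \<Rightarrow> 'b \<Rightarrow>\<^sub>L real" and q :: "'b \<Rightarrow> 'b \<Rightarrow>\<^sub>L 'b \<Rightarrow>\<^sub>L real"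
  assumes p: "\<And>x. (f has_derivative p x) (at x)" and q: "\<And>x. (p has_derivative q x) (at x)"
  obtains \<theta> where "0 < \<theta>" "\<theta> < 1"
    "f y = f x + p x (y - x) + 1 / 2 * q (x + \<theta> *\<^sub>R (y - x)) (y - x) (y - x)"
proof -
  let ?v = "y - x" and ?l = "\<lambda>\<theta>::real. x + \<theta> *\<^sub>R (y - x)"
  define D where "D k = (if k = 0 then (\<lambda>\<theta>. f (?l \<theta>)) else if k = Suc 0 then (\<lambda>\<theta>. p (?l \<theta>) ?v) else (\<lambda>\<theta>. q (?l \<theta>) ?v ?v))" for k :: nat
  have l: "(?l has_derivative (\<lambda>h. h *\<^sub>R ?v)) (at \<theta>)" for \<theta> by (auto intro!: derivative_eq_intros)
  have "((\<lambda>\<theta>. f (?l \<theta>)) has_derivative (\<lambda>h. p (?l \<theta>) (h *\<^sub>R ?v))) (at \<theta>)" for \<theta>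
    by (rule has_derivative_compose[OF l p])
  then have d0: "((\<lambda>\<theta>. f (?l \<theta>)) has_real_derivative p (?l \<theta>) ?v) (at \<theta>)" for \<theta>
    by (simp add: has_field_derivative_def blinfun.scaleR_right mult.commute[of _ "blinfun_apply _ _"])
  have "((\<lambda>\<theta>. p (?l \<theta>)) has_derivative (\<lambda>h. q (?l \<theta>) (h *\<^sub>R ?v))) (at \<theta>)" for \<theta>
    by (rule has_derivative_compose[OF l q])
  then have "((\<lambda>\<theta>. p (?l \<theta>) ?v) has_derivative (\<lambda>h. q (?l \<theta>) (h *\<^sub>R ?v) ?v)) (at \<theta>)" for \<theta>
    by (auto intro!: derivative_eq_intros simp: blinfun.zero_right)
  then have d1: "((\<lambda>\<theta>. p (?l \<theta>) ?v) has_real_derivative q (?l \<theta>) ?v ?v) (at \<theta>)" for \<theta>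
    by (simp add: has_field_derivative_def blinfun.scaleR_right blinfun.scaleR_left mult.commute[of _ "blinfun_apply _ _"])
  have "\<exists>\<theta>>0. \<theta> < 1 \<and> D 0 1 = (\<Sum>k<2. D k 0 / fact k * 1 ^ k) + D 2 \<theta> / fact 2 * 1 ^ 2"
    by (rule Maclaurin) (auto simp: D_def less_Suc_eq numeral_2_eq_2 intro: d0 d1)
  then obtain \<theta> where \<theta>: "0 < \<theta>" "\<theta> < 1" "D 0 1 = (\<Sum>k<2. D k 0 / fact k * 1 ^ k) + D 2 \<theta> / fact 2 * 1 ^ 2" by blast
  then show thesis
    by (intro that[of \<theta>]) (auto simp: D_def numeral_2_eq_2)
qed

section \<open>The running supremum and the pair as adapted continuous processes\<close>

context bounded_diffusion
begin

lemma X_nth_continuous: "\<omega> \<in> space P \<Longrightarrow> continuous_on {0..} (\<lambda>s. X s \<omega> $ i)"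
  by (intro continuous_on_component X_continuous)

lemmas sup_X = running_max[OF X_nth_continuous, folded running_sup_def]

lemma running_sup_0: "running_sup i X 0 \<omega> = X 0 \<omega> $ i"
  by (simp add: running_sup_def)

text \<open>Maxima over finite grids of \<open>[0, t]\<close> are adapted, and they converge because
  grid points approach a time at which the supremum is attained.\<close>

lemma running_sup_F: "0 \<le> t \<Longrightarrow> running_sup i X t \<in> borel_measurable (F t)"
proof -
  assume t: "0 \<le> t"
  let ?T = "\<lambda>n k. t * (real k / real (Suc n))"
  let ?M = "\<lambda>n \<omega>. Max ((\<lambda>k. X (?T n k) \<omega> $ i) ` {..Suc n})"
  have T: "0 \<le> ?T n k \<and> ?T n k \<le> t" if "k \<le> Suc n" for n k
    using t that mult_left_mono[of "real k / real (Suc n)" 1 t] by simp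
  show ?thesis
  proof (rule borel_measurable_LIMSEQ_real)
    show "?M n \<in> borel_measurable (F t)" for n
    proof (rule borel_measurable_Max)
      fix k assume "k \<in> {..Suc n}"
      then show "(\<lambda>\<omega>. X (?T n k) \<omega> $ i) \<in> borel_measurable (F t)"
        using T[of k n] by (intro measurable_compose[OF measurable_F_mono[OF X_F] borel_measurable_nth]) auto
    qed simp
    fix \<omega> assume "\<omega> \<in> space (F t)"
    then have \<omega>: "\<omega> \<in> space P" by simp
    obtain s where s: "s \<in> {0..t}" "running_sup i X t \<omega> = X s \<omega> $ i"
      using sup_X(2)[OF \<omega> t] by blast
    define u where "u = (if t = 0 then 0 else s / t)"
    have u: "0 \<le> u" "u \<le> 1" "t * u = s" using s t by (auto simp: u_def field_simps)
    let ?k = "\<lambda>n. nat \<lfloor>u * real (Suc n)\<rfloor>"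
    have k: "?k n \<le> Suc n" for n by (rule LIMSEQ_floor_grid(2)[OF u(1,2)])
    show "(\<lambda>n. ?M n \<omega>) \<longlonglongrightarrow> running_sup i X t \<omega>"
    proof (rule real_tendsto_sandwich)
      show "\<forall>\<^sub>F n in sequentially. X (?T n (?k n)) \<omega> $ i \<le> ?M n \<omega>"
        using k by (intro always_eventually allI Max_ge) auto
      show "\<forall>\<^sub>F n in sequentially. ?M n \<omega> \<le> running_sup i X t \<omega>"
        using T by (intro always_eventually allI Max.boundedI) (auto intro!: sup_X(1)[OF \<omega>])
      have "(\<lambda>n. t * (real (?k n) / real (Suc n))) \<longlonglongrightarrow> t * u"
        by (intro tendsto_mult tendsto_const LIMSEQ_floor_grid(1)[OF u(1,2)])
      then show "(\<lambda>n. X (?T n (?k n)) \<omega> $ i) \<longlonglongrightarrow> running_sup i X t \<omega>"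
        unfolding s(2) u(3) using s(1) T[OF k]
        by (intro continuous_on_tendsto_compose[OF X_nth_continuous[OF \<omega>]]) auto
    qed simp
  qed
qed

definition V :: "'n \<Rightarrow> real \<Rightarrow> 'a \<Rightarrow> real \<times> (real^'n)" where
  "V i t \<omega> = (running_sup i X t \<omega>, X t \<omega>)"

lemma V_F: "0 \<le> t \<Longrightarrow> V i t \<in> borel_measurable (F t)"
  unfolding V_def by (intro borel_measurable_Pair running_sup_F X_F)

lemma V_measurable: "0 \<le> t \<Longrightarrow> V i t \<in> borel_measurable P"
  by (rule measurable_F_P[OF V_F])

lemma V_continuous: "\<omega> \<in> space P \<Longrightarrow> continuous_on {0..} (\<lambda>t. V i t \<omega>)"
  unfolding V_def by (intro continuous_on_Pair X_continuous sup_X(5))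

lemma bounded_F_V:
  assumes "continuous_on UNIV g" "\<And>z. \<bar>g z\<bar> \<le> c" "0 \<le> a"
  shows "bounded_F a (\<lambda>\<omega>. g (V i a \<omega>))"
  unfolding bounded_F_def
  using assms measurable_compose[OF V_F[OF assms(3)] borel_measurable_continuous_onI[OF assms(1)]] by blast

text \<open>Path continuity and bounded convergence. The time integrals of the mollified formula
  thus have continuous integrands, which supplies measurability in time as well as convergence of
  Riemann sums.\<close>

lemma E_V_continuous:
  assumes g: "continuous_on UNIV g" "\<And>z. \<bar>g z :: real\<bar> \<le> c"
  shows "continuous_on {0..} (\<lambda>s. expectation (\<lambda>\<omega>. g (V i s \<omega>)))"
proof -
  have gm: "g \<in> borel_measurable borel" by (rule borel_measurable_continuous_onI[OF g(1)])
  show ?thesis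
    unfolding continuous_on_sequentially comp_def
  proof (intro ballI allI impI, elim conjE)
    fix a :: "nat \<Rightarrow> real" and s assume s: "s \<in> {0..}" and a: "\<forall>n. a n \<in> {0..}" and lim: "a \<longlonglongrightarrow> s"
    show "(\<lambda>n. expectation (\<lambda>\<omega>. g (V i (a n) \<omega>))) \<longlonglongrightarrow> expectation (\<lambda>\<omega>. g (V i s \<omega>))"
    proof (rule integral_dominated_convergence[where w = "\<lambda>_. c"])
      show "(\<lambda>\<omega>. g (V i s \<omega>)) \<in> borel_measurable P" "(\<lambda>\<omega>. g (V i (a n) \<omega>)) \<in> borel_measurable P" for n
        using s a by (auto intro!: measurable_compose[OF V_measurable gm])
      show "AE \<omega> in P. (\<lambda>n. g (V i (a n) \<omega>)) \<longlonglongrightarrow> g (V i s \<omega>)"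
      proof (rule AE_I2)
        fix \<omega> assume \<omega>: "\<omega> \<in> space P"
        have "(\<lambda>n. V i (a n) \<omega>) \<longlonglongrightarrow> V i s \<omega>"
          using s a by (intro continuous_on_tendsto_compose[OF V_continuous[OF \<omega>] lim]) (auto simp: always_eventually)
        then show "(\<lambda>n. g (V i (a n) \<omega>)) \<longlonglongrightarrow> g (V i s \<omega>)"
          by (intro continuous_on_tendsto_compose[OF g(1)]) auto
      qed
    qed (use g in auto)
  qed
qed

end

section \<open>Ito formula for functions flat on the diagonal\<close>

lemma blinfun_eq_sum_axis: "blinfun_apply p x = (\<Sum>i\<in>UNIV. x $ i *\<^sub>R blinfun_apply p (axis i 1))" for p :: "(real^'n) \<Rightarrow>\<^sub>L 'b::real_normed_vector"
proof -
  have "x = (\<Sum>i\<in>UNIV. x $ i *\<^sub>R axis i 1)"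
    using basis_expansion[of x] by (simp add: scalar_mult_eq_scaleR)
  then have "blinfun_apply p x = blinfun_apply p (\<Sum>i\<in>UNIV. x $ i *\<^sub>R axis i 1)" by simp
  then show ?thesis by (simp add: blinfun.sum_right blinfun.scaleR_right)
qed

lemma blinfun_eq_sum_axis2: "blinfun_apply (blinfun_apply q x) x = (\<Sum>i\<in>UNIV. \<Sum>k\<in>UNIV. blinfun_apply (blinfun_apply q (axis i 1)) (axis k 1) * (x $ i * x $ k))"
  for q :: "(real^'n) \<Rightarrow>\<^sub>L (real^'n) \<Rightarrow>\<^sub>L real"
proof -
  have "blinfun_apply (blinfun_apply q x) x = (\<Sum>i\<in>UNIV. x $ i * blinfun_apply (blinfun_apply q (axis i 1)) x)"
    by (subst blinfun_eq_sum_axis[of q x]) (simp add: blinfun.sum_left blinfun.scaleR_left)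
  also have "\<dots> = (\<Sum>i\<in>UNIV. x $ i * (\<Sum>k\<in>UNIV. x $ k * blinfun_apply (blinfun_apply q (axis i 1)) (axis k 1)))"
    by (subst (2) blinfun_eq_sum_axis) simp
  finally show ?thesis by (simp add: sum_distrib_left mult_ac)
qed

text \<open>\<open>D * arctan\<close> dominates \<open>f\<close> in the sense that its sum and its
  difference with \<open>f\<close> are nondecreasing. The arctangent measures the travel of the
  maximum on a scale of total length \<open>pi\<close>, whatever the path does.\<close>

lemma arctan_increment_bound:
  assumes "u \<le> v" and f: "\<And>m. u \<le> m \<Longrightarrow> m \<le> v \<Longrightarrow> (f has_real_derivative r m) (at m)"
    and r: "\<And>m. u \<le> m \<Longrightarrow> m \<le> v \<Longrightarrow> \<bar>r m\<bar> \<le> D / (1 + m\<^sup>2)"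
  shows "\<bar>f v - f u\<bar> \<le> D * (arctan v - arctan u)"
proof -
  have "D * arctan u - f u \<le> D * arctan v - f v"
  proof (rule DERIV_nonneg_imp_nondecreasing[OF \<open>u \<le> v\<close>])
    fix m assume m: "u \<le> m" "m \<le> v"
    have "((\<lambda>m. D * arctan m - f m) has_real_derivative D * inverse (1 + m\<^sup>2) - r m) (at m)"
      by (intro DERIV_diff DERIV_cmult DERIV_arctan f m)
    then show "\<exists>y. ((\<lambda>m. D * arctan m - f m) has_real_derivative y) (at m) \<and> 0 \<le> y"
      using r[OF m] by (intro exI conjI) (auto simp: divide_inverse abs_le_iff)
  qed
  moreover have "D * arctan u + f u \<le> D * arctan v + f v"
  proof (rule DERIV_nonneg_imp_nondecreasing[OF \<open>u \<le> v\<close>])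
    fix m assume m: "u \<le> m" "m \<le> v"
    have "((\<lambda>m. D * arctan m + f m) has_real_derivative D * inverse (1 + m\<^sup>2) + r m) (at m)"
      by (intro DERIV_add DERIV_cmult DERIV_arctan f m)
    then show "\<exists>y. ((\<lambda>m. D * arctan m + f m) has_real_derivative y) (at m) \<and> 0 \<le> y"
      using r[OF m] by (intro exI conjI) (auto simp: divide_inverse abs_le_iff)
  qed
  ultimately show ?thesis by (simp add: abs_le_iff right_diff_distrib)
qed

lemma norm_blinfun2: "\<bar>blinfun_apply (blinfun_apply q x) y\<bar> \<le> norm q * norm x * norm y"
  for q :: "'a::real_normed_vector \<Rightarrow>\<^sub>L 'b::real_normed_vector \<Rightarrow>\<^sub>L real"
proof -
  have "\<bar>blinfun_apply (blinfun_apply q x) y\<bar> \<le> norm (blinfun_apply q x) * norm y"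
    using norm_blinfun[of "blinfun_apply q x" y] by simp
  also have "\<dots> \<le> (norm q * norm x) * norm y" by (intro mult_right_mono norm_blinfun) simp
  finally show ?thesis .
qed

text \<open>
  \<open>p\<close> and \<open>q\<close> are the first two derivatives of \<open>\<Psi>\<close> in \<open>x\<close>, and \<open>r\<close> is its derivative in \<open>m\<close>.
\<close>

locale regular_function = bounded_diffusion P W X B A K
  for P :: "'a measure" and W X :: "real \<Rightarrow> 'a \<Rightarrow> real ^ 'n"
    and B :: "real ^ 'n \<Rightarrow> real ^ 'n" and A :: "real ^ 'n \<Rightarrow> real ^ 'n ^ 'n" and K :: real +
  fixes i1 :: 'n and \<Psi> :: "real \<times> (real^'n) \<Rightarrow> real"
    and p :: "real \<times> (real^'n) \<Rightarrow> (real^'n) \<Rightarrow>\<^sub>L real"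
    and q :: "real \<times> (real^'n) \<Rightarrow> (real^'n) \<Rightarrow>\<^sub>L (real^'n) \<Rightarrow>\<^sub>L real"
    and r :: "real \<Rightarrow> real^'n \<Rightarrow> real" and C :: real
  assumes \<Psi>c: "continuous_on UNIV \<Psi>" and pc: "continuous_on UNIV p" and qc: "continuous_on UNIV q"
    and C1: "1 \<le> C" and \<Psi>b: "\<bar>\<Psi> z\<bar> \<le> C" and pb: "norm (p z) \<le> C" and qb: "norm (q z) \<le> C"
    and \<Psi>p: "((\<lambda>x. \<Psi> (m, x)) has_derivative p (m, x)) (at x)"
    and pq: "((\<lambda>x. p (m, x)) has_derivative q (m, x)) (at x)"
    and \<Psi>r: "((\<lambda>m. \<Psi> (m, x)) has_real_derivative r m x) (at m)"
    and rb: "\<bar>r m x\<bar> \<le> C * min 1 \<bar>m - x $ i1\<bar> / (1 + m\<^sup>2)"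
begin

abbreviation M :: "real \<Rightarrow> 'a \<Rightarrow> real" where "M \<equiv> running_sup i1 X"

text \<open>The generator applied to \<open>\<Psi>\<close>; the inner sum over \<open>j\<close> is
  an entry of \<open>A A^t\<close>.\<close>

definition G :: "real \<times> (real^'n) \<Rightarrow> real" where
  "G z = (\<Sum>i\<in>UNIV. p z (axis i 1) * B (snd z) $ i) +
     1 / 2 * (\<Sum>i\<in>UNIV. \<Sum>k\<in>UNIV. q z (axis i 1) (axis k 1) * (\<Sum>j\<in>UNIV. A (snd z) $ i $ j * A (snd z) $ k $ j))"

lemma p_bounded: "\<bar>p z (axis i 1)\<bar> \<le> C"
  using norm_blinfun[of "p z" "axis i 1"] pb[of z] by (simp add: norm_axis_1)

lemma q_bounded: "\<bar>q z (axis i 1) (axis k 1)\<bar> \<le> C"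
  using norm_blinfun2[of "q z" "axis i 1" "axis k 1"] qb[of z] by (simp add: norm_axis_1)

lemma p_continuous: "continuous_on UNIV (\<lambda>z. p z (axis i 1))"
  by (intro continuous_intros pc)

lemma q_continuous: "continuous_on UNIV (\<lambda>z. q z (axis i 1) (axis k 1))"
  by (intro continuous_intros qc)

lemma B_snd_continuous: "continuous_on UNIV (\<lambda>z::real \<times> (real^'n). B (snd z) $ i)"
  by (rule continuous_on_compose2[OF B_nth_continuous]) (auto intro!: continuous_intros)

lemma A_snd_continuous: "continuous_on UNIV (\<lambda>z::real \<times> (real^'n). A (snd z) $ i $ j)"
  by (rule continuous_on_compose2[OF A_continuous]) (auto intro!: continuous_intros)

lemma G_continuous: "continuous_on UNIV G"
  unfolding G_def by (intro continuous_intros p_continuous q_continuous B_snd_continuous A_snd_continuous)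

lemma G_bounded: "\<bar>G z\<bar> \<le> real CARD('n) * (C * K) + (real CARD('n))\<^sup>2 * (C * (real CARD('n) * K\<^sup>2))"
proof -
  have C0: "0 \<le> C" using C1 by simp
  have 1: "\<bar>\<Sum>i\<in>UNIV. p z (axis i 1) * B (snd z) $ i\<bar> \<le> (\<Sum>i\<in>(UNIV::'n set). C * K)"
    by (rule order_trans[OF sum_abs sum_mono]) (auto simp: abs_mult intro!: mult_mono p_bounded B_nth_bounded C0)
  have a: "\<bar>\<Sum>j\<in>UNIV. A (snd z) $ i $ j * A (snd z) $ k $ j\<bar> \<le> real CARD('n) * K\<^sup>2" for i k
  proof -
    have "\<bar>\<Sum>j\<in>UNIV. A (snd z) $ i $ j * A (snd z) $ k $ j\<bar> \<le> (\<Sum>j\<in>(UNIV::'n set). K * K)"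
      by (rule order_trans[OF sum_abs sum_mono]) (auto simp: abs_mult intro!: mult_mono A_bounded K_nonneg)
    then show ?thesis by (simp add: power2_eq_square)
  qed
  have 2: "\<bar>\<Sum>i\<in>UNIV. \<Sum>k\<in>UNIV. q z (axis i 1) (axis k 1) * (\<Sum>j\<in>UNIV. A (snd z) $ i $ j * A (snd z) $ k $ j)\<bar> \<le>
     (\<Sum>i\<in>(UNIV::'n set). \<Sum>k\<in>(UNIV::'n set). C * (real CARD('n) * K\<^sup>2))"
    by (intro order_trans[OF sum_abs sum_mono]) (auto simp: abs_mult intro!: mult_mono q_bounded a C0)
  have "0 \<le> (real CARD('n))\<^sup>2 * (C * (real CARD('n) * K\<^sup>2))" using C0 by simp
  then show ?thesis using 1 2 unfolding G_def by (simp add: power2_eq_square mult.assoc)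
qed

text \<open>Remainder of the second-order expansion in \<open>x\<close> with the maximum frozen at
  time \<open>a\<close>. The move of the maximum from \<open>M a\<close> to \<open>M b\<close> is
  accounted for separately, with \<open>X\<close> already at time \<open>b\<close>.\<close>

definition rem :: "real \<Rightarrow> real \<Rightarrow> 'a \<Rightarrow> real" where
  "rem a b \<omega> = \<Psi> (M a \<omega>, X b \<omega>) - \<Psi> (V i1 a \<omega>) - p (V i1 a \<omega>) (X b \<omega> - X a \<omega>)
     - 1 / 2 * q (V i1 a \<omega>) (X b \<omega> - X a \<omega>) (X b \<omega> - X a \<omega>)"

lemma rem_taylor:
  obtains \<theta> where "0 < \<theta>" "\<theta> < 1"
    "\<bar>rem a b \<omega>\<bar> \<le> 1 / 2 * norm (q (M a \<omega>, X a \<omega> + \<theta> *\<^sub>R (X b \<omega> - X a \<omega>)) - q (M a \<omega>, X a \<omega>)) * (norm (X b \<omega> - X a \<omega>))\<^sup>2"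
proof -
  let ?v = "X b \<omega> - X a \<omega>"
  obtain \<theta> where \<theta>: "0 < \<theta>" "\<theta> < 1" "\<Psi> (M a \<omega>, X b \<omega>) = \<Psi> (M a \<omega>, X a \<omega>) + p (M a \<omega>, X a \<omega>) ?v + 1 / 2 * q (M a \<omega>, X a \<omega> + \<theta> *\<^sub>R ?v) ?v ?v"
    by (rule taylor2_vec[OF \<Psi>p pq, of "M a \<omega>" "X b \<omega>" "X a \<omega>"])
  have "rem a b \<omega> = 1 / 2 * (q (M a \<omega>, X a \<omega> + \<theta> *\<^sub>R ?v) - q (M a \<omega>, X a \<omega>)) ?v ?v"
    unfolding rem_def V_def \<theta>(3) by (simp add: blinfun.diff_left right_diff_distrib)
  also have "\<bar>\<dots>\<bar> \<le> 1 / 2 * (norm (q (M a \<omega>, X a \<omega> + \<theta> *\<^sub>R ?v) - q (M a \<omega>, X a \<omega>)) * norm ?v * norm ?v)"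
    using norm_blinfun2[of "q (M a \<omega>, X a \<omega> + \<theta> *\<^sub>R ?v) - q (M a \<omega>, X a \<omega>)" ?v ?v] by simp
  finally show thesis using \<theta>(1,2) by (intro that[of \<theta>]) (auto simp: power2_eq_square mult.assoc)
qed

lemma MX_measurable: "0 \<le> a \<Longrightarrow> 0 \<le> b \<Longrightarrow> (\<lambda>\<omega>. \<Psi> (M a \<omega>, X b \<omega>)) \<in> borel_measurable P"
  by (rule measurable_compose[OF borel_measurable_Pair borel_measurable_continuous_onI[OF \<Psi>c]])
     (auto intro: measurable_F_P[OF running_sup_F])

lemma MX_integrable: "0 \<le> a \<Longrightarrow> 0 \<le> b \<Longrightarrow> integrable P (\<lambda>\<omega>. \<Psi> (M a \<omega>, X b \<omega>))"
  by (rule integrable_const_bound[of _ C]) (auto intro: MX_measurable \<Psi>b)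

lemma V_integrable: "0 \<le> a \<Longrightarrow> integrable P (\<lambda>\<omega>. \<Psi> (V i1 a \<omega>))"
  using MX_integrable[of a a] by (simp add: V_def)

text \<open>The Taylor terms of first and second order become h times the generator up to an error
  of order h^(3/2), which vanishes when summed over t / h steps. The Taylor remainder is left in a
  form whose limit is taken in two stages, first in the mesh and then in \<open>l\<close>.\<close>

lemma one_step:
  assumes ab: "0 \<le> a" "a < b" "b \<le> a + 1" and \<eta>: "\<eta> \<in> borel_measurable P" "\<And>\<omega>. \<omega> \<in> space P \<Longrightarrow> 0 \<le> \<eta> \<omega> \<and> \<eta> \<omega> \<le> 1"
    and rem: "\<And>\<omega>. \<omega> \<in> space P \<Longrightarrow> \<bar>rem a b \<omega>\<bar> \<le> C * ((norm (X b \<omega> - X a \<omega>))\<^sup>2 * \<eta> \<omega>)" and l: "0 < l"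
  shows "\<bar>expectation (\<lambda>\<omega>. \<Psi> (M a \<omega>, X b \<omega>)) - expectation (\<lambda>\<omega>. \<Psi> (V i1 a \<omega>)) - (b - a) * expectation (\<lambda>\<omega>. G (V i1 a \<omega>))\<bar>
    \<le> (real CARD('n) * (C * C2) + (real CARD('n))\<^sup>2 * (C * C3)) * ((b - a) * sqrt (b - a)) +
       C * (C4 * (b - a) * (l + expectation \<eta> / l + (b - a)))"
proof -
  have ab': "0 \<le> a" "a \<le> b" "b \<le> a + 1" "0 \<le> b" using ab by auto
  let ?d = "real CARD('n)" and ?h = "b - a"
  let ?s = "(b - a) * sqrt (b - a)"
  define z where "z i \<omega> = p (V i1 a \<omega>) (axis i 1)" for i \<omega>
  define y where "y i k \<omega> = q (V i1 a \<omega>) (axis i 1) (axis k 1)" for i k \<omega>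
  let ?D = "\<lambda>i \<omega>. X b \<omega> $ i - X a \<omega> $ i"
  let ?a = "\<lambda>i k \<omega>. \<Sum>j\<in>UNIV. A (X a \<omega>) $ i $ j * A (X a \<omega>) $ k $ j"
  have z: "bounded_F a (z i)" for i unfolding z_def by (rule bounded_F_V[OF p_continuous p_bounded ab(1)])
  have y: "bounded_F a (y i k)" for i k unfolding y_def by (rule bounded_F_V[OF q_continuous q_bounded ab(1)])
  have zi: "integrable P (\<lambda>\<omega>. z i \<omega> * ?D i \<omega>)" for i
    by (intro square_integrable_integrable bounded_F_times_square_integrable[OF z X_diff_square_integrable[OF ab'(1-3)]])
  have yi: "integrable P (\<lambda>\<omega>. y i k \<omega> * (?D i \<omega> * ?D k \<omega>))" for i k
    using square_integrable_mult[OF bounded_F_times_square_integrable[OF y X_diff_square_integrable[OF ab'(1-3)]] X_diff_square_integrable[OF ab'(1-3)], of i k i k]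
    by (simp add: mult.assoc)
  have Bb: "bounded_F a (\<lambda>\<omega>. B (X a \<omega>) $ i)" for i
    unfolding bounded_F_def
    using measurable_compose[OF measurable_compose[OF X_F[OF ab(1)] B_measurable] borel_measurable_nth[of i]] B_nth_bounded by blast
  have zB: "integrable P (\<lambda>\<omega>. z i \<omega> * B (X a \<omega>) $ i)" for i by (rule bounded_FD(3)[OF bounded_F_mult[OF z Bb]])
  have yA: "integrable P (\<lambda>\<omega>. y i k \<omega> * ?a i k \<omega>)" for i k
    unfolding sum_distrib_left
    by (intro Bochner_Integration.integrable_sum bounded_FD(3)[OF bounded_F_mult[OF y bounded_F_mult]] A_X_bounded_F ab')
  let ?P1 = "\<lambda>\<omega>. \<Sum>i\<in>UNIV. z i \<omega> * ?D i \<omega>"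
  let ?P2 = "\<lambda>\<omega>. \<Sum>i\<in>UNIV. \<Sum>k\<in>UNIV. y i k \<omega> * (?D i \<omega> * ?D k \<omega>)"
  have P1: "integrable P ?P1" by (intro Bochner_Integration.integrable_sum zi)
  have P2: "integrable P ?P2" by (intro Bochner_Integration.integrable_sum yi)
  have rem_eq: "rem a b \<omega> = \<Psi> (M a \<omega>, X b \<omega>) - \<Psi> (V i1 a \<omega>) - ?P1 \<omega> - 1 / 2 * ?P2 \<omega>" for \<omega>
    unfolding rem_def z_def y_def blinfun_eq_sum_axis2[of "q (V i1 a \<omega>)"] blinfun_eq_sum_axis[of "p (V i1 a \<omega>)" "X b \<omega> - X a \<omega>"]
    by (simp add: mult.commute)
  have ri: "integrable P (rem a b)"
    unfolding rem_eq[abs_def] using MX_integrable[OF ab'(1,4)] V_integrable[OF ab'(1)] P1 P2 by simp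
  have E1: "expectation (\<lambda>\<omega>. \<Psi> (M a \<omega>, X b \<omega>)) - expectation (\<lambda>\<omega>. \<Psi> (V i1 a \<omega>)) =
     (\<Sum>i\<in>UNIV. expectation (\<lambda>\<omega>. z i \<omega> * ?D i \<omega>)) + 1 / 2 * (\<Sum>i\<in>UNIV. \<Sum>k\<in>UNIV. expectation (\<lambda>\<omega>. y i k \<omega> * (?D i \<omega> * ?D k \<omega>))) + expectation (rem a b)"
  proof -
    have "expectation (rem a b) = expectation (\<lambda>\<omega>. \<Psi> (M a \<omega>, X b \<omega>)) - expectation (\<lambda>\<omega>. \<Psi> (V i1 a \<omega>)) - expectation ?P1 - 1 / 2 * expectation ?P2"
      unfolding rem_eq[abs_def] using MX_integrable[OF ab'(1,4)] V_integrable[OF ab'(1)] P1 P2 by simp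
    moreover have "expectation ?P1 = (\<Sum>i\<in>UNIV. expectation (\<lambda>\<omega>. z i \<omega> * ?D i \<omega>))"
      by (rule Bochner_Integration.integral_sum[OF zi])
    moreover have "expectation ?P2 = (\<Sum>i\<in>UNIV. \<Sum>k\<in>UNIV. expectation (\<lambda>\<omega>. y i k \<omega> * (?D i \<omega> * ?D k \<omega>)))"
      by (subst Bochner_Integration.integral_sum, intro Bochner_Integration.integrable_sum yi)
         (intro sum.cong refl Bochner_Integration.integral_sum yi)
    ultimately show ?thesis by simp
  qed
  have E2: "expectation (\<lambda>\<omega>. G (V i1 a \<omega>)) = (\<Sum>i\<in>UNIV. expectation (\<lambda>\<omega>. z i \<omega> * B (X a \<omega>) $ i)) +
     1 / 2 * (\<Sum>i\<in>UNIV. \<Sum>k\<in>UNIV. expectation (\<lambda>\<omega>. y i k \<omega> * ?a i k \<omega>))"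
  proof -
    have eq: "G (V i1 a \<omega>) = (\<Sum>i\<in>UNIV. z i \<omega> * B (X a \<omega>) $ i) + 1 / 2 * (\<Sum>i\<in>UNIV. \<Sum>k\<in>UNIV. y i k \<omega> * ?a i k \<omega>)" for \<omega>
      unfolding G_def z_def y_def by (simp add: V_def)
    have "expectation (\<lambda>\<omega>. G (V i1 a \<omega>)) = expectation (\<lambda>\<omega>. \<Sum>i\<in>UNIV. z i \<omega> * B (X a \<omega>) $ i) +
       1 / 2 * expectation (\<lambda>\<omega>. \<Sum>i\<in>UNIV. \<Sum>k\<in>UNIV. y i k \<omega> * ?a i k \<omega>)"
      unfolding eq by (subst Bochner_Integration.integral_add)
        (intro Bochner_Integration.integrable_sum integrable_mult_right zB yA, intro Bochner_Integration.integrable_sum integrable_mult_right zB yA, simp)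
    moreover have "expectation (\<lambda>\<omega>. \<Sum>i\<in>UNIV. z i \<omega> * B (X a \<omega>) $ i) = (\<Sum>i\<in>UNIV. expectation (\<lambda>\<omega>. z i \<omega> * B (X a \<omega>) $ i))"
      by (rule Bochner_Integration.integral_sum[OF zB])
    moreover have "expectation (\<lambda>\<omega>. \<Sum>i\<in>UNIV. \<Sum>k\<in>UNIV. y i k \<omega> * ?a i k \<omega>) = (\<Sum>i\<in>UNIV. \<Sum>k\<in>UNIV. expectation (\<lambda>\<omega>. y i k \<omega> * ?a i k \<omega>))"
      by (subst Bochner_Integration.integral_sum, intro Bochner_Integration.integrable_sum yA)
         (intro sum.cong refl Bochner_Integration.integral_sum yA)
    ultimately show ?thesis by simp
  qed
  let ?e1 = "\<lambda>i. expectation (\<lambda>\<omega>. z i \<omega> * ?D i \<omega>) - ?h * expectation (\<lambda>\<omega>. z i \<omega> * B (X a \<omega>) $ i)"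
  let ?e2 = "\<lambda>i k. expectation (\<lambda>\<omega>. y i k \<omega> * (?D i \<omega> * ?D k \<omega>)) - ?h * expectation (\<lambda>\<omega>. y i k \<omega> * ?a i k \<omega>)"
  have e1: "\<bar>\<Sum>i\<in>UNIV. ?e1 i\<bar> \<le> ?d * (C * C2 * ?s)"
  proof -
    have "\<bar>\<Sum>i\<in>UNIV. ?e1 i\<bar> \<le> (\<Sum>i\<in>(UNIV::'n set). C * C2 * ?s)"
      by (rule order_trans[OF sum_abs sum_mono]) (rule euler_first_order[OF ab z], simp add: z_def p_bounded)
    then show ?thesis by simp
  qed
  have e2: "\<bar>\<Sum>i\<in>UNIV. \<Sum>k\<in>UNIV. ?e2 i k\<bar> \<le> ?d\<^sup>2 * (C * C3 * ?s)"
  proof -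
    have "\<bar>\<Sum>i\<in>UNIV. \<Sum>k\<in>UNIV. ?e2 i k\<bar> \<le> (\<Sum>i\<in>(UNIV::'n set). \<Sum>k\<in>(UNIV::'n set). C * C3 * ?s)"
      by (intro order_trans[OF sum_abs sum_mono]) (rule euler_second_order[OF ab y], simp add: y_def q_bounded)
    then show ?thesis by (simp add: power2_eq_square mult.assoc)
  qed
  have e3: "\<bar>expectation (rem a b)\<bar> \<le> C * (C4 * ?h * (l + expectation \<eta> / l + ?h))"
  proof -
    note w = euler_weighted[OF ab \<eta> l]
    have "\<bar>expectation (rem a b)\<bar> \<le> expectation (\<lambda>\<omega>. \<bar>rem a b \<omega>\<bar>)" by (rule integral_abs_bound)
    also have "\<dots> \<le> expectation (\<lambda>\<omega>. C * ((norm (X b \<omega> - X a \<omega>))\<^sup>2 * \<eta> \<omega>))"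
      using ri w(1) by (intro integral_mono rem) auto
    also have "\<dots> = C * expectation (\<lambda>\<omega>. (norm (X b \<omega> - X a \<omega>))\<^sup>2 * \<eta> \<omega>)" by simp
    also have "\<dots> \<le> C * (C4 * ?h * (l + expectation \<eta> / l + ?h))" using C1 by (intro mult_left_mono w(2)) auto
    finally show ?thesis .
  qed
  have "expectation (\<lambda>\<omega>. \<Psi> (M a \<omega>, X b \<omega>)) - expectation (\<lambda>\<omega>. \<Psi> (V i1 a \<omega>)) - ?h * expectation (\<lambda>\<omega>. G (V i1 a \<omega>)) =
     (\<Sum>i\<in>UNIV. ?e1 i) + 1 / 2 * (\<Sum>i\<in>UNIV. \<Sum>k\<in>UNIV. ?e2 i k) + expectation (rem a b)"
  proof -
    have "x + 1 / 2 * y + r - h * (x' + 1 / 2 * y') = (x - h * x') + 1 / 2 * (y - h * y') + r" for x y r h x' y' :: real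
      by (simp add: field_simps)
    then show ?thesis unfolding E1 E2 by (simp only: sum_subtractf sum_distrib_left[symmetric])
  qed
  moreover have "(?d * (C * C2) + ?d\<^sup>2 * (C * C3)) * ?s = ?d * (C * C2 * ?s) + ?d\<^sup>2 * (C * C3 * ?s)" by (simp add: algebra_simps)
  ultimately show ?thesis using e1 e2 e3 by linarith
qed

end

section \<open>Uniform partitions and the limit of vanishing mesh\<close>

definition grid :: "real \<Rightarrow> nat \<Rightarrow> nat \<Rightarrow> real" where
  "grid t n k = t * real k / real (Suc n)"

lemma grid_0: "grid t n 0 = 0"
  by (simp add: grid_def)

lemma grid_end: "grid t n (Suc n) = t"
  by (simp add: grid_def)

lemma grid_Suc: "grid t n (Suc k) = grid t n k + t / real (Suc n)"
  unfolding grid_def add_divide_distrib[symmetric] by (simp add: distrib_left add.commute)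

lemma grid_nonneg: "0 < t \<Longrightarrow> 0 \<le> grid t n k"
  by (simp add: grid_def)

lemma grid_le: "0 < t \<Longrightarrow> k \<le> Suc n \<Longrightarrow> grid t n k \<le> t"
  using mult_left_mono[of "real k" "real (Suc n)" t] by (simp add: grid_def divide_le_eq del: of_nat_Suc)

lemma mesh_LIMSEQ: "(\<lambda>n. t / real (Suc n)) \<longlonglongrightarrow> 0"
  using tendsto_mult[OF tendsto_const[of t] LIMSEQ_inverse_real_of_nat] by (simp add: divide_inverse)

context regular_function
begin

lemma path_mesh:
  assumes \<omega>: "\<omega> \<in> space P" and t: "0 < t" and e: "0 < e"
  shows "\<forall>\<^sub>F n in sequentially. \<forall>k<Suc n. \<forall>u\<in>{grid t n k..grid t n (Suc k)}. \<forall>v\<in>{grid t n k..grid t n (Suc k)}.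
     norm (X u \<omega> - X v \<omega>) < e"
proof -
  have "uniformly_continuous_on {0..t} (\<lambda>s. X s \<omega>)"
    by (rule compact_uniformly_continuous[OF continuous_on_subset[OF X_continuous[OF \<omega>]]]) auto
  then obtain d where d: "0 < d" "\<And>x y. x \<in> {0..t} \<Longrightarrow> y \<in> {0..t} \<Longrightarrow> dist y x < d \<Longrightarrow> dist (X y \<omega>) (X x \<omega>) < e"
    unfolding uniformly_continuous_on_def using e by blast
  have "\<forall>\<^sub>F n in sequentially. t / real (Suc n) < d"
    using order_tendstoD(2)[OF mesh_LIMSEQ d(1)] .
  then show ?thesis
  proof eventually_elim
    case (elim n)
    show ?case
    proof (intro allI impI ballI)
      fix k u v assume k: "k < Suc n" and u: "u \<in> {grid t n k..grid t n (Suc k)}" and v: "v \<in> {grid t n k..grid t n (Suc k)}"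
      have "grid t n (Suc k) \<le> t" using grid_le[OF t, of "Suc k" n] k by simp
      then have "u \<in> {0..t}" "v \<in> {0..t}" using u v grid_nonneg[OF t, of n k] by auto
      moreover have "dist u v < d" using u v elim unfolding grid_Suc dist_real_def by auto
      ultimately show "norm (X u \<omega> - X v \<omega>) < e" using d(2)[of v u] by (simp add: dist_norm)
    qed
  qed
qed

text \<open>If the maximum moves, its new value is the first component of \<open>X s\<close> at some
  \<open>s\<close> in the interval, while its old value is at least that of \<open>X a\<close>. All
  values in between lie within \<open>\<delta>\<close> of the first component of \<open>X b\<close>,
  where flatness on the diagonal makes the derivative in \<open>m\<close> at most
  \<open>C * min 1 \<delta> / (1 + m^2)\<close>.\<close>

lemma boundary_step:
  assumes \<omega>: "\<omega> \<in> space P" and ab: "0 \<le> a" "a \<le> b" and \<delta>: "\<And>u. u \<in> {a..b} \<Longrightarrow> norm (X u \<omega> - X b \<omega>) \<le> \<delta>"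
  shows "\<bar>\<Psi> (V i1 b \<omega>) - \<Psi> (M a \<omega>, X b \<omega>)\<bar> \<le> C * min 1 \<delta> * (arctan (M b \<omega>) - arctan (M a \<omega>))"
proof (cases "M b \<omega> = M a \<omega>")
  case True
  then show ?thesis by (simp add: V_def)
next
  case False
  then obtain s where s: "s \<in> {a..b}" "M b \<omega> = X s \<omega> $ i1" using sup_X(4)[OF \<omega> ab] by blast
  have n: "\<bar>X u \<omega> $ i1 - X b \<omega> $ i1\<bar> \<le> \<delta>" if "u \<in> {a..b}" for u
    using component_le_norm_cart[of "X u \<omega> - X b \<omega>" i1] \<delta>[OF that] by simp
  have "X a \<omega> $ i1 \<le> M a \<omega>" using sup_X(1)[OF \<omega>, of a a] ab by simp
  have "\<bar>\<Psi> (M b \<omega>, X b \<omega>) - \<Psi> (M a \<omega>, X b \<omega>)\<bar> \<le> C * min 1 \<delta> * (arctan (M b \<omega>) - arctan (M a \<omega>))"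
  proof (rule arctan_increment_bound[where f = "\<lambda>m. \<Psi> (m, X b \<omega>)" and r = "\<lambda>m. r m (X b \<omega>)"])
    show "M a \<omega> \<le> M b \<omega>" by (rule sup_X(3)[OF \<omega> ab])
    show "((\<lambda>m. \<Psi> (m, X b \<omega>)) has_real_derivative r m (X b \<omega>)) (at m)" for m by (rule \<Psi>r)
    fix m assume m: "M a \<omega> \<le> m" "m \<le> M b \<omega>"
    have "\<bar>m - X b \<omega> $ i1\<bar> \<le> \<delta>"
      using n[of a] n[of s] s m \<open>X a \<omega> $ i1 \<le> M a \<omega>\<close> ab by (auto simp: abs_le_iff)
    then have "C * min 1 \<bar>m - X b \<omega> $ i1\<bar> / (1 + m\<^sup>2) \<le> C * min 1 \<delta> / (1 + m\<^sup>2)"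
      using C1 by (intro divide_right_mono mult_left_mono) auto
    with rb[of m "X b \<omega>"] show "\<bar>r m (X b \<omega>)\<bar> \<le> C * min 1 \<delta> / (1 + m\<^sup>2)" by linarith
  qed
  then show ?thesis by (simp add: V_def)
qed

text \<open>The arctangents telescope, so neither the number of steps nor the height reached by the
  path enters the bound.\<close>

lemma boundary_sum:
  assumes \<omega>: "\<omega> \<in> space P" and t: "0 < t" and D: "0 \<le> D"
    and step: "\<And>k. k < Suc n \<Longrightarrow> \<bar>\<Psi> (V i1 (grid t n (Suc k)) \<omega>) - \<Psi> (M (grid t n k) \<omega>, X (grid t n (Suc k)) \<omega>)\<bar> \<le>
      C * D * (arctan (M (grid t n (Suc k)) \<omega>) - arctan (M (grid t n k) \<omega>))"
  shows "\<bar>\<Sum>k<Suc n. \<Psi> (V i1 (grid t n (Suc k)) \<omega>) - \<Psi> (M (grid t n k) \<omega>, X (grid t n (Suc k)) \<omega>)\<bar> \<le> C * D * pi"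
proof -
  have "\<bar>\<Sum>k<Suc n. \<Psi> (V i1 (grid t n (Suc k)) \<omega>) - \<Psi> (M (grid t n k) \<omega>, X (grid t n (Suc k)) \<omega>)\<bar>
    \<le> (\<Sum>k<Suc n. C * D * (arctan (M (grid t n (Suc k)) \<omega>) - arctan (M (grid t n k) \<omega>)))"
    by (rule order_trans[OF sum_abs sum_mono]) (use step in auto)
  also have "\<dots> = C * D * (arctan (M (grid t n (Suc n)) \<omega>) - arctan (M (grid t n 0) \<omega>))"
    unfolding sum_distrib_left[symmetric]
    by (subst sum_lessThan_telescope[of "\<lambda>k. arctan (M (grid t n k) \<omega>)"]) simp
  also have "\<dots> \<le> C * D * pi"
    using arctan_bounded[of "M (grid t n (Suc n)) \<omega>"] arctan_bounded[of "M (grid t n 0) \<omega>"] C1 D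
    by (intro mult_left_mono) auto
  finally show ?thesis .
qed

text \<open>One estimate serves twice: with \<open>D = 1\<close> it dominates all sums by a
  constant, and with \<open>D = \<delta>\<close> for fine partitions it gives the limit along each
  path.\<close>

lemma boundary_LIMSEQ:
  assumes t: "0 < t"
  defines "S \<equiv> \<lambda>n \<omega>. \<Sum>k<Suc n. \<Psi> (V i1 (grid t n (Suc k)) \<omega>) - \<Psi> (M (grid t n k) \<omega>, X (grid t n (Suc k)) \<omega>)"
  shows "(\<lambda>n. expectation (S n)) \<longlonglongrightarrow> 0"
proof -
  have "(\<lambda>n. expectation (S n)) \<longlonglongrightarrow> expectation (\<lambda>\<omega>. 0)"
  proof (rule integral_dominated_convergence[where w = "\<lambda>_. C * 1 * pi"])
    show "S n \<in> borel_measurable P" for n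
      unfolding S_def V_def by (intro borel_measurable_sum borel_measurable_diff MX_measurable grid_nonneg t)
    show "AE \<omega> in P. norm (S n \<omega>) \<le> C * 1 * pi" for n
    proof (rule AE_I2)
      fix \<omega> assume \<omega>: "\<omega> \<in> space P"
      show "norm (S n \<omega>) \<le> C * 1 * pi"
        unfolding S_def real_norm_def
      proof (rule boundary_sum[OF \<omega> t])
        fix k assume "k < Suc n"
        let ?a = "grid t n k" and ?b = "grid t n (Suc k)"
        have ab: "0 \<le> ?a" "?a \<le> ?b" using grid_nonneg[OF t] t by (auto simp: grid_Suc)
        \<comment> \<open>Any bound on the oscillation will do here, as
          \<open>min 1 \<delta>\<close> caps it at 1.\<close>
        obtain \<delta> where "\<And>u. u \<in> {?a..?b} \<Longrightarrow> norm (X u \<omega> - X ?b \<omega>) \<le> \<delta>"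
        proof -
          have "compact ((\<lambda>u. norm (X u \<omega> - X ?b \<omega>)) ` {?a..?b})"
            by (intro compact_continuous_image continuous_intros continuous_on_subset[OF X_continuous[OF \<omega>]]) (use ab in auto)
          from compact_imp_bounded[OF this] show ?thesis
            unfolding bounded_iff by (auto intro: that)
        qed
        from boundary_step[OF \<omega> ab this]
        have "\<bar>\<Psi> (V i1 ?b \<omega>) - \<Psi> (M ?a \<omega>, X ?b \<omega>)\<bar> \<le> C * min 1 \<delta> * (arctan (M ?b \<omega>) - arctan (M ?a \<omega>))" by simp
        also have "\<dots> \<le> C * 1 * (arctan (M ?b \<omega>) - arctan (M ?a \<omega>))"
          using C1 sup_X(3)[OF \<omega> ab] by (intro mult_right_mono mult_left_mono) (auto simp: arctan_le_iff)
        finally show "\<bar>\<Psi> (V i1 ?b \<omega>) - \<Psi> (M ?a \<omega>, X ?b \<omega>)\<bar> \<le> C * 1 * (arctan (M ?b \<omega>) - arctan (M ?a \<omega>))" .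
      qed simp
    qed
    show "AE \<omega> in P. (\<lambda>n. S n \<omega>) \<longlonglongrightarrow> 0"
    proof (rule AE_I2, rule LIMSEQ_I)
      fix \<omega> and e :: real assume \<omega>: "\<omega> \<in> space P" and e: "0 < e"
      define \<delta> where "\<delta> = e / (2 * C * pi)"
      have \<delta>: "0 < \<delta>" using e C1 by (simp add: \<delta>_def)
      have "\<forall>\<^sub>F n in sequentially. norm (S n \<omega> - 0) < e"
        using path_mesh[OF \<omega> t \<delta>]
      proof eventually_elim
        case (elim n)
        have "\<bar>S n \<omega>\<bar> \<le> C * \<delta> * pi"
          unfolding S_def
        proof (rule boundary_sum[OF \<omega> t])
          fix k assume k: "k < Suc n"
          let ?a = "grid t n k" and ?b = "grid t n (Suc k)"
          have ab: "0 \<le> ?a" "?a \<le> ?b" using grid_nonneg[OF t] t by (auto simp: grid_Suc)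
          have "\<bar>\<Psi> (V i1 ?b \<omega>) - \<Psi> (M ?a \<omega>, X ?b \<omega>)\<bar> \<le> C * min 1 \<delta> * (arctan (M ?b \<omega>) - arctan (M ?a \<omega>))"
            using elim k ab by (intro boundary_step[OF \<omega> ab]) (auto intro: less_imp_le)
          also have "\<dots> \<le> C * \<delta> * (arctan (M ?b \<omega>) - arctan (M ?a \<omega>))"
            using C1 sup_X(3)[OF \<omega> ab] by (intro mult_right_mono mult_left_mono) (auto simp: arctan_le_iff)
          finally show "\<bar>\<Psi> (V i1 ?b \<omega>) - \<Psi> (M ?a \<omega>, X ?b \<omega>)\<bar> \<le> C * \<delta> * (arctan (M ?b \<omega>) - arctan (M ?a \<omega>))" .
        qed (use \<delta> in simp)
        also have "\<dots> = e / 2" using C1 by (simp add: \<delta>_def)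
        also have "\<dots> < e" using e by simp
        finally show ?case by simp
      qed
      then show "\<exists>no. \<forall>n\<ge>no. norm (S n \<omega> - 0) < e" by (simp add: eventually_sequentially)
    qed
  qed auto
  then show ?thesis by simp
qed

lemma rem_measurable:
  assumes "0 \<le> a" "a \<le> b"
  shows "rem a b \<in> borel_measurable P"
proof -
  \<comment> \<open>In coordinates the linear maps become finite sums of products whose factors are
    measurable one by one.\<close>
  have eq: "rem a b \<omega> = \<Psi> (M a \<omega>, X b \<omega>) - \<Psi> (M a \<omega>, X a \<omega>) - (\<Sum>i\<in>UNIV. p (V i1 a \<omega>) (axis i 1) * (X b \<omega> $ i - X a \<omega> $ i))
     - 1 / 2 * (\<Sum>i\<in>UNIV. \<Sum>k\<in>UNIV. q (V i1 a \<omega>) (axis i 1) (axis k 1) * ((X b \<omega> $ i - X a \<omega> $ i) * (X b \<omega> $ k - X a \<omega> $ k)))" for \<omega>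
    unfolding rem_def blinfun_eq_sum_axis2[of "q (V i1 a \<omega>)"] blinfun_eq_sum_axis[of "p (V i1 a \<omega>)" "X b \<omega> - X a \<omega>"]
    by (simp add: mult.commute V_def)
  show ?thesis
    unfolding eq[abs_def] using assms
    by (intro borel_measurable_diff[OF borel_measurable_diff[OF borel_measurable_diff]] borel_measurable_sum borel_measurable_times
      borel_measurable_const MX_measurable X_diff_measurable bounded_FD(2)[OF bounded_F_V[OF p_continuous p_bounded]] bounded_FD(2)[OF bounded_F_V[OF q_continuous q_bounded]]) auto
qed

text \<open>
  The ratio is at most 1 by boundedness of \<open>q\<close> and tends to 0 along the partition by continuity
  of \<open>q\<close>. Where \<open>X\<close> does not move, \<open>rem\<close> vanishes too and the ratio is \<open>0 / 0 = 0\<close>.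
\<close>

definition rem_ratio :: "real \<Rightarrow> real \<Rightarrow> 'a \<Rightarrow> real" where
  "rem_ratio a b \<omega> = \<bar>rem a b \<omega>\<bar> / (C * (norm (X b \<omega> - X a \<omega>))\<^sup>2)"

lemma rem_ratio_bounds:
  "0 \<le> rem_ratio a b \<omega>" "rem_ratio a b \<omega> \<le> 1" "\<bar>rem a b \<omega>\<bar> = C * ((norm (X b \<omega> - X a \<omega>))\<^sup>2 * rem_ratio a b \<omega>)"
  "\<exists>\<theta>. 0 < \<theta> \<and> \<theta> < 1 \<and> rem_ratio a b \<omega> \<le> norm (q (M a \<omega>, X a \<omega> + \<theta> *\<^sub>R (X b \<omega> - X a \<omega>)) - q (M a \<omega>, X a \<omega>))"
proof -
  let ?N = "(norm (X b \<omega> - X a \<omega>))\<^sup>2"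
  have C: "0 < C" using C1 by simp
  show "0 \<le> rem_ratio a b \<omega>" using C by (simp add: rem_ratio_def)
  obtain \<theta> where \<theta>: "0 < \<theta>" "\<theta> < 1" and
    le: "\<bar>rem a b \<omega>\<bar> \<le> 1 / 2 * norm (q (M a \<omega>, X a \<omega> + \<theta> *\<^sub>R (X b \<omega> - X a \<omega>)) - q (M a \<omega>, X a \<omega>)) * ?N"
    by (rule rem_taylor)
  let ?Q = "norm (q (M a \<omega>, X a \<omega> + \<theta> *\<^sub>R (X b \<omega> - X a \<omega>)) - q (M a \<omega>, X a \<omega>))"
  have Q: "?Q \<le> 2 * C"
    using norm_triangle_ineq4[of "q (M a \<omega>, X a \<omega> + \<theta> *\<^sub>R (X b \<omega> - X a \<omega>))" "q (M a \<omega>, X a \<omega>)"]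
      qb[of "(M a \<omega>, X a \<omega> + \<theta> *\<^sub>R (X b \<omega> - X a \<omega>))"] qb[of "(M a \<omega>, X a \<omega>)"] by linarith
  show "\<bar>rem a b \<omega>\<bar> = C * (?N * rem_ratio a b \<omega>)"
    using C le by (cases "X b \<omega> = X a \<omega>") (auto simp: rem_ratio_def)
  have z: "rem_ratio a b \<omega> \<le> ?Q / (2 * C)"
  proof (cases "X b \<omega> = X a \<omega>")
    case True then show ?thesis using C by (simp add: rem_ratio_def)
  next
    case False
    then have "0 < C * ?N" using C by simp
    then show ?thesis using le C False unfolding rem_ratio_def by (simp add: divide_le_eq)
  qed
  also have "\<dots> \<le> 1" using Q C by (simp add: divide_le_eq)
  finally show "rem_ratio a b \<omega> \<le> 1" .
  have "?Q / (2 * C) \<le> ?Q / 1" using C1 by (intro divide_left_mono) auto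
  with z have "rem_ratio a b \<omega> \<le> ?Q" by simp
  with \<theta> show "\<exists>\<theta>. 0 < \<theta> \<and> \<theta> < 1 \<and> rem_ratio a b \<omega> \<le> norm (q (M a \<omega>, X a \<omega> + \<theta> *\<^sub>R (X b \<omega> - X a \<omega>)) - q (M a \<omega>, X a \<omega>))"
    by blast
qed

lemma rem_ratio_measurable: "0 \<le> a \<Longrightarrow> a \<le> b \<Longrightarrow> rem_ratio a b \<in> borel_measurable P"
proof -
  assume ab: "0 \<le> a" "a \<le> b"
  have [measurable]: "X a \<in> borel_measurable P" "X b \<in> borel_measurable P" "rem a b \<in> borel_measurable P"
    using ab rem_measurable by auto
  show ?thesis unfolding rem_ratio_def by measurable
qed

text \<open>One weight for a whole partition: the steps then share a single expectation, which tends
  to zero, instead of having one for each step.\<close>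

definition max_rem_ratio :: "real \<Rightarrow> nat \<Rightarrow> 'a \<Rightarrow> real" where
  "max_rem_ratio t n \<omega> = Max ((\<lambda>k. rem_ratio (grid t n k) (grid t n (Suc k)) \<omega>) ` {..<Suc n})"

lemma max_rem_ratio_ge: "k < Suc n \<Longrightarrow> rem_ratio (grid t n k) (grid t n (Suc k)) \<omega> \<le> max_rem_ratio t n \<omega>"
  unfolding max_rem_ratio_def by (intro Max_ge) auto

lemma max_rem_ratio_bounds: "0 \<le> max_rem_ratio t n \<omega>" "max_rem_ratio t n \<omega> \<le> 1"
proof -
  show "0 \<le> max_rem_ratio t n \<omega>" using max_rem_ratio_ge[of 0 n t \<omega>] rem_ratio_bounds(1) order_trans by blast
  show "max_rem_ratio t n \<omega> \<le> 1" unfolding max_rem_ratio_def by (intro Max.boundedI) (auto intro: rem_ratio_bounds)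
qed

lemma max_rem_ratio_measurable: "0 < t \<Longrightarrow> max_rem_ratio t n \<in> borel_measurable P"
  unfolding max_rem_ratio_def by (intro borel_measurable_Max rem_ratio_measurable grid_nonneg) (auto simp: grid_Suc)

lemma max_rem_ratio_LIMSEQ:
  assumes t: "0 < t"
  shows "(\<lambda>n. expectation (max_rem_ratio t n)) \<longlonglongrightarrow> 0"
proof -
  have "(\<lambda>n. expectation (max_rem_ratio t n)) \<longlonglongrightarrow> expectation (\<lambda>\<omega>. 0)"
  proof (rule integral_dominated_convergence[where w = "\<lambda>_. 1"])
    show "max_rem_ratio t n \<in> borel_measurable P" for n by (rule max_rem_ratio_measurable[OF t])
    show "AE \<omega> in P. norm (max_rem_ratio t n \<omega>) \<le> 1" for n using max_rem_ratio_bounds by simp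
    show "AE \<omega> in P. (\<lambda>n. max_rem_ratio t n \<omega>) \<longlonglongrightarrow> 0"
    proof (rule AE_I2, rule LIMSEQ_I)
      fix \<omega> and e :: real assume \<omega>: "\<omega> \<in> space P" and e: "0 < e"
      have "bounded ((\<lambda>s. V i1 s \<omega>) ` {0..t})"
        by (intro compact_imp_bounded compact_continuous_image continuous_on_subset[OF V_continuous[OF \<omega>]]) auto
      then obtain \<rho> where "\<forall>z\<in>(\<lambda>s. V i1 s \<omega>) ` {0..t}. norm z \<le> \<rho>"
        unfolding bounded_iff by blast
      then have \<rho>: "\<And>s. s \<in> {0..t} \<Longrightarrow> norm (V i1 s \<omega>) \<le> \<rho>" by blast
      \<comment> \<open>\<open>q\<close> is evaluated on segments that start on the path, and their
        points stay within distance 1 of it once the increments are below 1. The ball of radius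
        \<open>\<rho> + 1\<close> contains them and is compact.\<close>
      have "uniformly_continuous_on (cball 0 (\<rho> + 1)) q"
        by (rule compact_uniformly_continuous[OF continuous_on_subset[OF qc]]) auto
      moreover have "0 < e / 2" using e by simp
      ultimately obtain d where d: "0 < d" "\<And>x y. x \<in> cball 0 (\<rho> + 1) \<Longrightarrow> y \<in> cball 0 (\<rho> + 1) \<Longrightarrow> dist y x < d \<Longrightarrow> dist (q y) (q x) < e / 2"
        unfolding uniformly_continuous_on_def by blast
      have "0 < min d 1" using d(1) by simp
      have "\<forall>\<^sub>F n in sequentially. norm (max_rem_ratio t n \<omega> - 0) < e"
        using path_mesh[OF \<omega> t \<open>0 < min d 1\<close>]
      proof eventually_elim
        case (elim n)
        have "rem_ratio (grid t n k) (grid t n (Suc k)) \<omega> \<le> e / 2" if k: "k < Suc n" for k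
        proof -
          let ?a = "grid t n k" and ?b = "grid t n (Suc k)"
          have ab: "0 \<le> ?a" "?a \<le> ?b" "?a \<le> t" using grid_nonneg[OF t] t grid_le[OF t, of k n] k by (auto simp: grid_Suc)
          have v: "norm (X ?b \<omega> - X ?a \<omega>) < min d 1" using elim k ab by auto
          obtain \<theta> where \<theta>: "0 < \<theta>" "\<theta> < 1" and z: "rem_ratio ?a ?b \<omega> \<le> norm (q (M ?a \<omega>, X ?a \<omega> + \<theta> *\<^sub>R (X ?b \<omega> - X ?a \<omega>)) - q (M ?a \<omega>, X ?a \<omega>))"
            using rem_ratio_bounds(4) by blast
          define x0 where "x0 = (M ?a \<omega>, X ?a \<omega>)"
          define x1 where "x1 = (M ?a \<omega>, X ?a \<omega> + \<theta> *\<^sub>R (X ?b \<omega> - X ?a \<omega>))"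
          have "norm (x1 - x0) = \<theta> * norm (X ?b \<omega> - X ?a \<omega>)"
            unfolding x0_def x1_def using \<theta> by (simp add: norm_Pair)
          also have "\<dots> \<le> 1 * norm (X ?b \<omega> - X ?a \<omega>)" using \<theta> by (intro mult_right_mono) auto
          finally have dist: "norm (x1 - x0) < min d 1" using v by simp
          have in0: "norm x0 \<le> \<rho>" using \<rho>[of ?a] ab by (simp add: V_def x0_def)
          have "norm x1 \<le> \<rho> + 1" using norm_triangle_ineq2[of x1 x0] dist in0 by linarith
          then have "dist (q x1) (q x0) < e / 2"
            using dist in0 by (intro d(2)) (simp_all add: dist_norm)
          then show ?thesis using z by (simp add: dist_norm x0_def x1_def)
        qed
        then have "max_rem_ratio t n \<omega> \<le> e / 2" unfolding max_rem_ratio_def by (intro Max.boundedI) auto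
        then show ?case using max_rem_ratio_bounds(1)[of t n \<omega>] e by simp
      qed
      then show "\<exists>no. \<forall>n\<ge>no. norm (max_rem_ratio t n \<omega> - 0) < e" by (simp add: eventually_sequentially)
    qed
  qed auto
  then show ?thesis by simp
qed

text \<open>The difference of the two sides is made up of boundary terms, the Riemann sum error and
  the one-step errors. For fixed \<open>l\<close>, everything but a multiple of \<open>l\<close>
  disappears as the mesh tends to zero; then \<open>l\<close> is arbitrary.\<close>

theorem ito_expectation:
  assumes t: "0 < t"
  shows "expectation (\<lambda>\<omega>. \<Psi> (V i1 t \<omega>)) = expectation (\<lambda>\<omega>. \<Psi> (V i1 0 \<omega>)) +
     (LINT s:{0..t}|lborel. expectation (\<lambda>\<omega>. G (V i1 s \<omega>)))"
proof -
  let ?g = "\<lambda>s. expectation (\<lambda>\<omega>. G (V i1 s \<omega>))"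
  let ?I = "LINT s:{0..t}|lborel. ?g s"
  define S where "S n \<omega> = (\<Sum>k<Suc n. \<Psi> (V i1 (grid t n (Suc k)) \<omega>) - \<Psi> (M (grid t n k) \<omega>, X (grid t n (Suc k)) \<omega>))" for n \<omega>
  define Q where "Q = expectation (\<lambda>\<omega>. \<Psi> (V i1 t \<omega>)) - expectation (\<lambda>\<omega>. \<Psi> (V i1 0 \<omega>)) - ?I"
  define h where "h n = t / real (Suc n)" for n
  define D where "D = real CARD('n) * (C * C2) + (real CARD('n))\<^sup>2 * (C * C3)"
  have h: "0 < h n" for n using t by (simp add: h_def)
  have R: "(\<lambda>n. \<Sum>k<Suc n. h n * ?g (grid t n k)) \<longlonglongrightarrow> ?I"
    unfolding h_def grid_def
    by (rule riemann_sum_LIMSEQ[OF t continuous_on_subset[OF E_V_continuous[OF G_continuous G_bounded]]]) auto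
  have bound: "\<bar>Q\<bar> \<le> C * C4 * t * l" if l: "0 < l" for l
  proof -
    define u where "u n = \<bar>expectation (S n)\<bar> + \<bar>(\<Sum>k<Suc n. h n * ?g (grid t n k)) - ?I\<bar> +
       (D * (t * sqrt (h n)) + C * (C4 * t * (l + expectation (max_rem_ratio t n) / l + h n)))" for n
    have "u \<longlonglongrightarrow> \<bar>0\<bar> + \<bar>?I - ?I\<bar> + (D * (t * sqrt 0) + C * (C4 * t * (l + 0 / l + 0)))"
      unfolding u_def
      using l by (intro tendsto_add tendsto_rabs tendsto_mult tendsto_const tendsto_diff tendsto_divide tendsto_real_sqrt
        R max_rem_ratio_LIMSEQ[OF t] mesh_LIMSEQ[of t, folded h_def] boundary_LIMSEQ[OF t, folded S_def]) auto
    then have "u \<longlonglongrightarrow> C * C4 * t * l" by (simp add: mult.assoc)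
    moreover have "\<forall>\<^sub>F n in sequentially. \<bar>Q\<bar> \<le> u n"
    proof -
      have "\<forall>\<^sub>F n in sequentially. h n < 1"
        using order_tendstoD(2)[OF mesh_LIMSEQ[of t, folded h_def], of 1] by simp
      then show ?thesis
      proof eventually_elim
        case (elim n)
        let ?T = "grid t n"
        have T: "0 \<le> ?T k" "?T k < ?T (Suc k)" "?T (Suc k) \<le> ?T k + 1" "?T (Suc k) - ?T k = h n" for k
          using grid_nonneg[OF t] h[of n] elim by (auto simp: grid_Suc h_def)
        let ?e = "\<lambda>k. expectation (\<lambda>\<omega>. \<Psi> (V i1 (?T k) \<omega>))"
        let ?f = "\<lambda>k. expectation (\<lambda>\<omega>. \<Psi> (M (?T k) \<omega>, X (?T (Suc k)) \<omega>))"
        have step: "\<bar>?f k - ?e k - h n * ?g (?T k)\<bar> \<le> D * (h n * sqrt (h n)) + C * (C4 * h n * (l + expectation (max_rem_ratio t n) / l + h n))"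
          if k: "k < Suc n" for k
          unfolding T(4)[symmetric, of k] D_def
        proof (rule one_step[OF T(1-3) max_rem_ratio_measurable[OF t] _ _ l])
          fix \<omega>
          show "0 \<le> max_rem_ratio t n \<omega> \<and> max_rem_ratio t n \<omega> \<le> 1" using max_rem_ratio_bounds by simp
          show "\<bar>rem (?T k) (?T (Suc k)) \<omega>\<bar> \<le> C * ((norm (X (?T (Suc k)) \<omega> - X (?T k) \<omega>))\<^sup>2 * max_rem_ratio t n \<omega>)"
            unfolding rem_ratio_bounds(3) using C1 max_rem_ratio_ge[OF k] by (intro mult_left_mono) auto
        qed
        have ES: "expectation (S n) = (\<Sum>k<Suc n. ?e (Suc k) - ?f k)"
        proof -
          have "expectation (S n) = (\<Sum>k<Suc n. expectation (\<lambda>\<omega>. \<Psi> (V i1 (?T (Suc k)) \<omega>) - \<Psi> (M (?T k) \<omega>, X (?T (Suc k)) \<omega>)))"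
            unfolding S_def
            by (rule Bochner_Integration.integral_sum)
               (intro Bochner_Integration.integrable_diff V_integrable MX_integrable T)
          also have "\<dots> = (\<Sum>k<Suc n. ?e (Suc k) - ?f k)"
            by (intro sum.cong refl Bochner_Integration.integral_diff V_integrable MX_integrable T)
          finally show ?thesis .
        qed
        have "(\<Sum>k<Suc n. ?e (Suc k) - ?e k) = expectation (\<lambda>\<omega>. \<Psi> (V i1 t \<omega>)) - expectation (\<lambda>\<omega>. \<Psi> (V i1 0 \<omega>))"
          using sum_lessThan_telescope[of ?e "Suc n"] unfolding grid_end grid_0 .
        \<comment> \<open>Each step passes through the intermediate mean \<open>?f k\<close>, with
          the maximum still at the left end point and \<open>X\<close> already at the right
          one.\<close>
        moreover have "(\<Sum>k<Suc n. ?e (Suc k) - ?e k) = expectation (S n) + (\<Sum>k<Suc n. ?f k - ?e k - h n * ?g (?T k)) + (\<Sum>k<Suc n. h n * ?g (?T k))"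
          unfolding ES sum.distrib[symmetric] by (intro sum.cong) auto
        ultimately have Qeq: "Q = expectation (S n) + (\<Sum>k<Suc n. ?f k - ?e k - h n * ?g (?T k)) + ((\<Sum>k<Suc n. h n * ?g (?T k)) - ?I)"
          unfolding Q_def by linarith
        have "\<bar>\<Sum>k<Suc n. ?f k - ?e k - h n * ?g (?T k)\<bar> \<le> (\<Sum>k<Suc n. D * (h n * sqrt (h n)) + C * (C4 * h n * (l + expectation (max_rem_ratio t n) / l + h n)))"
          by (rule order_trans[OF sum_abs sum_mono]) (use step in auto)
        also have "\<dots> = (real (Suc n) * h n) * (D * sqrt (h n) + C * (C4 * (l + expectation (max_rem_ratio t n) / l + h n)))"
          by (simp add: algebra_simps del: of_nat_Suc sum.lessThan_Suc)
        also have "real (Suc n) * h n = t" by (simp add: h_def)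
        also have "t * (D * sqrt (h n) + C * (C4 * (l + expectation (max_rem_ratio t n) / l + h n))) =
            D * (t * sqrt (h n)) + C * (C4 * t * (l + expectation (max_rem_ratio t n) / l + h n))" by (simp add: algebra_simps)
        finally show ?case unfolding Qeq u_def by linarith
      qed
    qed
    ultimately show ?thesis
      by (intro tendsto_lowerbound[of u]) auto
  qed
  have "Q = 0"
  proof (rule ccontr)
    assume "Q \<noteq> 0"
    then have Q: "0 < \<bar>Q\<bar>" by simp
    \<comment> \<open>\<open>c\<close> exceeds the constant of the bound, so the choice
      \<open>l = \<bar>Q\<bar> / c\<close> makes \<open>\<bar>Q\<bar>\<close> smaller than
      itself.\<close>
    define c where "c = \<bar>C * C4 * t\<bar> + 1"
    have c: "0 < c" "C * C4 * t < c" by (auto simp: c_def)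
    have "\<bar>Q\<bar> \<le> C * C4 * t * (\<bar>Q\<bar> / c)" using Q c by (intro bound) simp
    also have "\<dots> < c * (\<bar>Q\<bar> / c)" using Q c by (intro mult_strict_right_mono) auto
    also have "\<dots> = \<bar>Q\<bar>" using c by simp
    finally show False by simp
  qed
  then show ?thesis unfolding Q_def by simp
qed

end

section \<open>Concentration at the diagonal\<close>

lemma below_diag_measurable: "(\<lambda>(u, y). below_diag i y (c * u)) \<in> borel_measurable (borel \<Otimes>\<^sub>M (borel :: (real^'n) measure))"
proof -
  have "continuous_on UNIV (\<lambda>z::real \<times> (real^'n). below_diag i (snd z) (c * fst z))"
    unfolding below_diag_def by (intro continuous_intros)
  from borel_measurable_continuous_onI[OF this] show ?thesis by (simp add: split_beta borel_prod)
qed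

text \<open>The new variables are the distance \<open>u\<close> of m from the first coordinate of x,
  and the vector \<open>y\<close> obtained from x by replacing that coordinate by m. The map is a
  shear, so two translations suffice: one of m by that coordinate, then one of x along the axis
  \<open>i\<close>.\<close>

lemma nn_integral_below_diag:
  fixes f :: "real \<times> (real^'n) \<Rightarrow> ennreal"
  assumes f[measurable]: "f \<in> borel_measurable borel"
  shows "(\<integral>\<^sup>+ z. f z \<partial>lborel) = (\<integral>\<^sup>+ u. (\<integral>\<^sup>+ y. f (below_diag i y u) \<partial>lborel) \<partial>lborel)"
proof -
  have fm: "f \<in> borel_measurable (borel \<Otimes>\<^sub>M borel)" using f by (simp add: borel_prod)
  have "(\<integral>\<^sup>+ z. f z \<partial>lborel) = (\<integral>\<^sup>+ z. f z \<partial>(lborel \<Otimes>\<^sub>M lborel))"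
    by (simp add: lborel_prod)
  also have "\<dots> = (\<integral>\<^sup>+ x. (\<integral>\<^sup>+ m. f (m, x) \<partial>lborel) \<partial>lborel)"
    using fm by (subst lborel_pair.nn_integral_snd[symmetric]) auto
  also have "\<dots> = (\<integral>\<^sup>+ x. (\<integral>\<^sup>+ u. f (x $ i + u, x) \<partial>lborel) \<partial>lborel)"
  proof (rule nn_integral_cong)
    fix x :: "real^'n"
    have "(\<integral>\<^sup>+ m. f (m, x) \<partial>lborel) = (\<integral>\<^sup>+ m. f (m, x) \<partial>(distr lborel borel ((+) (x $ i))))"
      by (simp only: lborel_distr_plus)
    also have "\<dots> = (\<integral>\<^sup>+ u. f (x $ i + u, x) \<partial>lborel)"
      using fm by (subst nn_integral_distr) (auto intro: measurable_Pair1)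
    finally show "(\<integral>\<^sup>+ m. f (m, x) \<partial>lborel) = (\<integral>\<^sup>+ u. f (x $ i + u, x) \<partial>lborel)" .
  qed
  also have "\<dots> = (\<integral>\<^sup>+ u. (\<integral>\<^sup>+ x. f (x $ i + u, x) \<partial>lborel) \<partial>lborel)"
  proof (rule lborel_pair.Fubini')
    have "continuous_on UNIV (\<lambda>z::real \<times> (real^'n). (snd z $ i + fst z, snd z))"
      by (intro continuous_intros)
    from measurable_compose[OF borel_measurable_continuous_onI[OF this] f]
    show "(\<lambda>(u, x). f (x $ i + u, x)) \<in> borel_measurable (lborel \<Otimes>\<^sub>M (lborel :: (real^'n) measure))"
      unfolding lborel_prod by (simp add: case_prod_beta')
  qed
  also have "\<dots> = (\<integral>\<^sup>+ u. (\<integral>\<^sup>+ y. f (below_diag i y u) \<partial>lborel) \<partial>lborel)"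
  proof (rule nn_integral_cong)
    fix u :: real
    let ?c = "- (u *\<^sub>R axis i 1) :: real^'n"
    have "continuous_on UNIV (\<lambda>x::real^'n. (x $ i + u, x))" by (intro continuous_intros)
    note m = measurable_compose[OF borel_measurable_continuous_onI[OF this] f]
    have "(\<integral>\<^sup>+ x. f (x $ i + u, x) \<partial>lborel) = (\<integral>\<^sup>+ x. f (x $ i + u, x) \<partial>(distr lborel borel ((+) ?c)))"
      by (simp only: lborel_distr_plus)
    also have "\<dots> = (\<integral>\<^sup>+ y. f ((?c + y) $ i + u, ?c + y) \<partial>lborel)"
      using m by (subst nn_integral_distr) auto
    also have "\<dots> = (\<integral>\<^sup>+ y. f (below_diag i y u) \<partial>lborel)"
      by (simp add: below_diag_def axis_def)
    finally show "(\<integral>\<^sup>+ x. f (x $ i + u, x) \<partial>lborel) = (\<integral>\<^sup>+ y. f (below_diag i y u) \<partial>lborel)" .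
  qed
  finally show ?thesis .
qed

text \<open>The distance from the diagonal is rescaled by \<open>c\<close>, with Jacobian
  \<open>c\<close>. An identity of measures carries over to Bochner integrals whatever the sign of
  the integrand.\<close>

lemma lborel_eq_density_below_diag:
  assumes c: "0 < c"
  shows "(lborel :: (real \<times> (real^'n)) measure) =
    density (distr (lborel \<Otimes>\<^sub>M lborel) borel (\<lambda>(v, y). below_diag i y (c * v))) (\<lambda>_. ennreal c)"
proof (rule measure_eqI)
  let ?T = "\<lambda>(v, y::real^'n). below_diag i y (c * v)"
  have T: "?T \<in> borel_measurable (lborel \<Otimes>\<^sub>M lborel)"
    using below_diag_measurable[of i c] by (simp cong: measurable_cong_sets sets_pair_measure_cong)
  fix S :: "(real \<times> (real^'n)) set" assume "S \<in> sets lborel"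
  then have S: "S \<in> sets borel" by simp
  have m: "(\<lambda>(v, y). indicator S (below_diag i y (c * v)) :: ennreal) \<in> borel_measurable (lborel \<Otimes>\<^sub>M lborel)"
    using measurable_compose[OF T borel_measurable_indicator[OF S]] by (simp add: case_prod_beta')
  have m1: "(\<lambda>u. \<integral>\<^sup>+ y. indicator S (below_diag i y u) \<partial>lborel) \<in> borel_measurable borel"
  proof -
    have "(\<lambda>(v, y). indicator S (below_diag i y (1 * v)) :: ennreal) \<in> borel_measurable (lborel \<Otimes>\<^sub>M lborel)"
      using measurable_compose[OF below_diag_measurable[of i 1] borel_measurable_indicator[OF S]]
      by (simp add: case_prod_beta' cong: measurable_cong_sets sets_pair_measure_cong)
    from lborel.borel_measurable_nn_integral[OF this] show ?thesis by simp
  qed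
  have "emeasure lborel S = (\<integral>\<^sup>+ z. indicator S z \<partial>lborel)" using S by simp
  also have "\<dots> = (\<integral>\<^sup>+ u. (\<integral>\<^sup>+ y. indicator S (below_diag i y u) \<partial>lborel) \<partial>lborel)"
    by (rule nn_integral_below_diag) (use S in simp)
  also have "\<dots> = \<bar>c\<bar> * (\<integral>\<^sup>+ v. (\<integral>\<^sup>+ y. indicator S (below_diag i y (0 + c * v)) \<partial>lborel) \<partial>lborel)"
    by (rule nn_integral_real_affine[OF m1]) (use c in simp)
  also have "\<dots> = ennreal c * (\<integral>\<^sup>+ z. indicator S (?T z) \<partial>(lborel \<Otimes>\<^sub>M lborel))"
    using c lborel.nn_integral_fst[OF m] by (simp add: case_prod_beta')
  also have "(\<integral>\<^sup>+ z. indicator S (?T z) \<partial>(lborel \<Otimes>\<^sub>M lborel)) = (\<integral>\<^sup>+ z. indicator S z \<partial>(distr (lborel \<Otimes>\<^sub>M lborel) borel ?T))"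
    using T by (rule nn_integral_distr[symmetric]) (use S in simp)
  also have "ennreal c * \<dots> = emeasure (density (distr (lborel \<Otimes>\<^sub>M lborel) borel ?T) (\<lambda>_. ennreal c)) S"
    using S by (simp add: emeasure_density nn_integral_cmult)
  finally show "emeasure lborel S = emeasure (density (distr (lborel \<Otimes>\<^sub>M lborel) borel ?T) (\<lambda>_. ennreal c)) S" .
qed simp

lemma integral_below_diag:
  fixes f :: "real \<times> (real^'n) \<Rightarrow> real"
  assumes f: "f \<in> borel_measurable borel" and c: "0 < c"
  shows "(\<integral> z. f z \<partial>lborel) = (\<integral> (v, y). c * f (below_diag i y (c * v)) \<partial>(lborel \<Otimes>\<^sub>M lborel))"
proof -
  let ?T = "\<lambda>(v, y::real^'n). below_diag i y (c * v)"
  have T: "?T \<in> borel_measurable (lborel \<Otimes>\<^sub>M lborel)"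
    using below_diag_measurable[of i c] by (simp cong: measurable_cong_sets sets_pair_measure_cong)
  have "(\<integral> z. f z \<partial>lborel) = (\<integral> z. f z \<partial>(density (distr (lborel \<Otimes>\<^sub>M lborel) borel ?T) (\<lambda>_. ennreal c)))"
    by (subst lborel_eq_density_below_diag[OF c]) (rule refl)
  also have "\<dots> = (\<integral> z. c *\<^sub>R f z \<partial>(distr (lborel \<Otimes>\<^sub>M lborel) borel ?T))"
    using f c by (intro integral_density) auto
  also have "\<dots> = (\<integral> z. c * f (?T z) \<partial>(lborel \<Otimes>\<^sub>M lborel))"
    using f T by (subst integral_distr) auto
  finally show ?thesis by (simp add: case_prod_beta')
qed

text \<open>The function \<kappa> of the overview: minus the derivative of 1 / (1 + v^2).\<close>

definition lorentz_slope :: "real \<Rightarrow> real" where "lorentz_slope v = 2 * v / (1 + v\<^sup>2)\<^sup>2"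

lemma lorentz_slope_bound: "0 \<le> v \<Longrightarrow> 0 \<le> lorentz_slope v" "\<bar>lorentz_slope v\<bar> \<le> 1"
proof -
  show "0 \<le> v \<Longrightarrow> 0 \<le> lorentz_slope v" by (simp add: lorentz_slope_def)
  have "2 * \<bar>v\<bar> \<le> 1 + v\<^sup>2" using sum_squares_bound[of "\<bar>v\<bar>" 1] by simp
  also have "\<dots> * 1 \<le> (1 + v\<^sup>2) * (1 + v\<^sup>2)" by (intro mult_left_mono) auto
  finally have "2 * \<bar>v\<bar> \<le> (1 + v\<^sup>2)\<^sup>2" by (simp add: power2_eq_square[of "1 + v\<^sup>2"])
  moreover have "0 < (1 + v\<^sup>2)\<^sup>2" using zero_le_power2[of v] by (intro zero_less_power) linarith
  ultimately show "\<bar>lorentz_slope v\<bar> \<le> 1" by (simp add: lorentz_slope_def abs_mult divide_le_eq)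
qed

lemma lorentz_slope_measurable[measurable]: "lorentz_slope \<in> borel_measurable borel"
  unfolding lorentz_slope_def by measurable

text \<open>The antiderivative - 1 / (1 + v^2) rises from -1 to 0. The value 1 is what leaves the
  factor 1 / 2 of the second-order term unchanged in front of the diagonal term.\<close>

lemma has_bochner_integral_lorentz_slope: "has_bochner_integral lborel (\<lambda>v. indicator {0..} v * lorentz_slope v) 1"
proof -
  have "(\<integral>\<^sup>+ v\<in>{0..}. ennreal (lorentz_slope v) \<partial>lborel) = ennreal (0 - (- (1 / (1 + 0\<^sup>2))))"
  proof (rule nn_integral_FTC_atLeast)
    fix v :: real assume "0 \<le> v"
    have "1 + v\<^sup>2 \<noteq> 0" using sum_power2_gt_zero_iff[of 1 v] by auto
    then show "((\<lambda>v. - (1 / (1 + v\<^sup>2))) has_real_derivative lorentz_slope v) (at v)"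
      unfolding lorentz_slope_def by (auto intro!: derivative_eq_intros simp: power2_eq_square[of "1 + v\<^sup>2"])
    show "0 \<le> lorentz_slope v" by (rule lorentz_slope_bound) fact
  next
    have "((\<lambda>v::real. 1 / (1 + v\<^sup>2)) \<longlongrightarrow> 0) at_top"
      by (intro tendsto_divide_0[OF tendsto_const] filterlim_at_top_imp_at_infinity
        filterlim_tendsto_add_at_top[OF tendsto_const] filterlim_pow_at_top) (auto simp: filterlim_ident)
    from tendsto_minus[OF this] show "((\<lambda>v::real. - (1 / (1 + v\<^sup>2))) \<longlongrightarrow> 0) at_top" by simp
  qed simp
  then have "(\<integral>\<^sup>+ v. ennreal (indicator {0..} v * lorentz_slope v) \<partial>lborel) = ennreal 1"
    by (subst nn_integral_cong[of lborel _ "\<lambda>v. ennreal (lorentz_slope v) * indicator {0..} v"]) (auto simp: indicator_def)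
  then show ?thesis
    by (intro has_bochner_integral_nn_integral) (auto simp: indicator_def lorentz_slope_bound)
qed

text \<open>Substituting u = v / (n + 1) turns the concentrating kernel into a fixed one of mass 1
  and moves the concentration into the arguments of \<open>f n\<close> and \<open>\<rho>\<close>.
  Dominated convergence then applies, with the kernel times \<open>C * g\<close> as majorant. The
  indicator confines everything to the side of the diagonal on which \<open>g\<close> controls
  \<open>\<rho>\<close>.\<close>

lemma diagonal_limit:
  fixes \<rho> :: "real \<times> (real^'n) \<Rightarrow> real" and g d :: "real^'n \<Rightarrow> real" and h :: "real^'n \<Rightarrow> real"
  assumes \<rho>: "\<rho> \<in> borel_measurable borel" "\<And>z. 0 \<le> \<rho> z"
    and g: "integrable lborel g" "AE y in lborel. \<forall>u>0. \<rho> (below_diag i y u) \<le> g y"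
    and d: "d \<in> borel_measurable borel" "AE y in lborel. ((\<lambda>u. \<rho> (below_diag i y u)) \<longlongrightarrow> d y) (at_right 0)"
    and f: "\<And>n. f n \<in> borel_measurable borel" "\<And>n z. \<bar>f n z\<bar> \<le> C"
    and h: "h \<in> borel_measurable borel" "\<And>y v. 0 < v \<Longrightarrow> (\<lambda>n. f n (below_diag i y (v / real (Suc n)))) \<longlonglongrightarrow> h y"
  defines "\<Phi> \<equiv> \<lambda>n z. f n z * (indicator {0<..} (fst z - snd z $ i) * (real (Suc n) * lorentz_slope (real (Suc n) * (fst z - snd z $ i)))) * \<rho> z"
  shows "(\<lambda>n. \<integral> z. \<Phi> n z \<partial>lborel) \<longlonglongrightarrow> (\<integral> y. h y * d y \<partial>lborel)"
    and "\<bar>\<integral> z. \<Phi> n z \<partial>lborel\<bar> \<le> C * (\<integral> y. g y \<partial>lborel)"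
proof -
  let ?LL = "lborel \<Otimes>\<^sub>M (lborel :: (real^'n) measure)"
  let ?ker = "\<lambda>v. indicator {0<..} v * lorentz_slope v :: real"
  define \<Theta> where "\<Theta> n z = f n (below_diag i (snd z) (fst z / real (Suc n))) * (?ker (fst z)) * \<rho> (below_diag i (snd z) (fst z / real (Suc n)))" for n and z :: "real \<times> (real^'n)"
  have C: "0 \<le> C" using f(2)[of 0 undefined] by linarith
  have bm: "(\<lambda>z. below_diag i (snd z) (fst z / real (Suc n))) \<in> borel_measurable ?LL" for n
    using below_diag_measurable[of i "1 / real (Suc n)"] by (simp add: split_beta cong: measurable_cong_sets sets_pair_measure_cong)
  have \<Theta>m: "\<Theta> n \<in> borel_measurable ?LL" for n
    unfolding \<Theta>_def
    by (intro borel_measurable_times measurable_compose[OF bm f(1)] measurable_compose[OF bm \<rho>(1)]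
      measurable_compose[OF measurable_fst lorentz_slope_measurable[folded measurable_lborel2]] measurable_compose[OF measurable_fst])
       auto
  have \<Phi>m: "\<Phi> n \<in> borel_measurable borel" for n
  proof -
    have "continuous_on UNIV (\<lambda>z::real \<times> (real^'n). fst z - snd z $ i)" by (intro continuous_intros)
    from borel_measurable_continuous_onI[OF this]
    have [measurable]: "(\<lambda>z::real \<times> (real^'n). fst z - snd z $ i) \<in> borel_measurable borel" .
    have [measurable]: "f n \<in> borel_measurable borel" "\<rho> \<in> borel_measurable borel" by (rule f \<rho>)+
    show ?thesis unfolding \<Phi>_def by measurable
  qed
  have \<Phi>\<Theta>: "(\<integral> z. \<Phi> n z \<partial>lborel) = (\<integral> z. \<Theta> n z \<partial>?LL)" for n
  proof -
    have "(\<integral> z. \<Phi> n z \<partial>lborel) = (\<integral> (v, y). 1 / real (Suc n) * \<Phi> n (below_diag i y (1 / real (Suc n) * v)) \<partial>?LL)"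
      by (rule integral_below_diag[OF \<Phi>m]) simp
    also have "\<dots> = (\<integral> z. \<Theta> n z \<partial>?LL)"
    proof (rule Bochner_Integration.integral_cong[OF refl])
      fix z :: "real \<times> (real^'n)"
      have u: "fst (below_diag i y u) - snd (below_diag i y u) $ i = u" for u and y :: "real^'n"
        by (simp add: below_diag_def axis_def)
      show "(case z of (v, y) \<Rightarrow> 1 / real (Suc n) * \<Phi> n (below_diag i y (1 / real (Suc n) * v))) = \<Theta> n z"
      proof -
        have "1 / real (Suc n) * v = v / real (Suc n)" "real (Suc n) * (v / real (Suc n)) = v" for v :: real by simp_all
        then have "1 / real (Suc n) * \<Phi> n (below_diag i (snd z) (1 / real (Suc n) * fst z)) = \<Theta> n z"
          unfolding \<Phi>_def \<Theta>_def by (simp only: u) (simp add: indicator_def zero_less_divide_iff del: of_nat_Suc)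
        then show ?thesis by (simp only: case_prod_beta')
      qed
    qed
    finally show ?thesis .
  qed
  have kb: "has_bochner_integral lborel ?ker 1"
  proof (rule has_bochner_integral_cong[THEN iffD1, OF refl _ refl has_bochner_integral_lorentz_slope])
    show "indicator {0..} v * lorentz_slope v = ?ker v" for v by (auto simp: indicator_def lorentz_slope_def)
  qed
  have ki: "integrable lborel ?ker" "(\<integral> v. ?ker v \<partial>lborel) = 1" using kb by (auto simp: has_bochner_integral_iff)
  have prod: "has_bochner_integral ?LL (\<lambda>z. ?ker (fst z) * e (snd z)) (\<integral> y. e y \<partial>lborel)"
    if e: "integrable lborel e" for e :: "real^'n \<Rightarrow> real"
  proof -
    have i: "integrable ?LL (\<lambda>z. ?ker (fst z) * e (snd z))"
    proof (rule lborel_pair.Fubini_integrable)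
      show "(\<lambda>z. ?ker (fst z) * e (snd z)) \<in> borel_measurable ?LL"
        by (intro borel_measurable_times measurable_compose[OF measurable_fst borel_measurable_integrable[OF ki(1)]]
          measurable_compose[OF measurable_snd borel_measurable_integrable[OF e]])
      show "integrable lborel (\<lambda>v. \<integral> y. norm (?ker (fst (v, y)) * e (snd (v, y))) \<partial>lborel)"
        using integrable_norm[OF ki(1)] by (simp add: abs_mult)
      show "AE v in lborel. integrable lborel (\<lambda>y. ?ker (fst (v, y)) * e (snd (v, y)))"
        using e by simp
    qed
    have "(\<integral> z. ?ker (fst z) * e (snd z) \<partial>?LL) = (\<integral> v. (\<integral> y. ?ker v * e y \<partial>lborel) \<partial>lborel)"
      using lborel_pair.integral_fst'[OF i] by simp
    also have "\<dots> = (\<integral> v. ?ker v * (\<integral> y. e y \<partial>lborel) \<partial>lborel)" by simp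
    also have "\<dots> = (\<integral> y. e y \<partial>lborel)" using ki by simp
    finally show ?thesis using i by (simp add: has_bochner_integral_iff)
  qed
  have AE2: "AE z in ?LL. Q (snd z)" if Q: "AE y in lborel. Q y" for Q :: "real^'n \<Rightarrow> bool"
  proof -
    obtain N where N: "N \<in> null_sets lborel" "{y. \<not> Q y} \<subseteq> N" using Q unfolding eventually_ae_filter by auto
    have "UNIV \<times> N \<in> null_sets ?LL"
      using N(1) by (auto simp: null_sets_def lborel.emeasure_pair_measure_Times)
    then show ?thesis using N(2) unfolding eventually_ae_filter by (intro bexI[of _ "UNIV \<times> N"]) auto
  qed
  have bound: "AE z in ?LL. norm (\<Theta> n z) \<le> ?ker (fst z) * (C * g (snd z))" for n
    using AE2[OF g(2)]
  proof eventually_elim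
    case (elim z)
    show ?case
    proof (cases "0 < fst z")
      case True
      then have "\<rho> (below_diag i (snd z) (fst z / real (Suc n))) \<le> g (snd z)" using elim by simp
      then have "\<bar>f n (below_diag i (snd z) (fst z / real (Suc n)))\<bar> * \<rho> (below_diag i (snd z) (fst z / real (Suc n))) \<le> C * g (snd z)"
        using f(2) C \<rho>(2) by (intro mult_mono) auto
      then have "lorentz_slope (fst z) * (\<bar>f n (below_diag i (snd z) (fst z / real (Suc n)))\<bar> * \<rho> (below_diag i (snd z) (fst z / real (Suc n)))) \<le> lorentz_slope (fst z) * (C * g (snd z))"
        using True by (intro mult_left_mono) (auto simp: lorentz_slope_bound)
      then show ?thesis using True lorentz_slope_bound(1)[of "fst z"] \<rho>(2) by (simp add: \<Theta>_def abs_mult mult_ac)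
    qed (simp add: \<Theta>_def)
  qed
  have gi: "integrable lborel (\<lambda>y. C * g y)" using g(1) by simp
  note pg = prod[OF gi]
  have dm: "(\<lambda>z. h (snd z) * ?ker (fst z) * d (snd z)) \<in> borel_measurable ?LL"
    by (intro borel_measurable_times measurable_compose[OF measurable_fst borel_measurable_integrable[OF ki(1)]]
          measurable_compose[OF measurable_snd]) (use h(1) d(1) in auto)
  have lim: "AE z in ?LL. (\<lambda>n. \<Theta> n z) \<longlonglongrightarrow> h (snd z) * ?ker (fst z) * d (snd z)"
    using AE2[OF d(2)]
  proof eventually_elim
    case (elim z)
    show ?case
    proof (cases "0 < fst z")
      case True
      have "filterlim (\<lambda>n. fst z / real (Suc n)) (at_right 0) sequentially"
        unfolding filterlim_at using mesh_LIMSEQ[of "fst z"] True by (auto intro!: always_eventually)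
      from filterlim_compose[OF elim this]
      have "(\<lambda>n. \<rho> (below_diag i (snd z) (fst z / real (Suc n)))) \<longlonglongrightarrow> d (snd z)" .
      then show ?thesis unfolding \<Theta>_def by (intro tendsto_mult tendsto_const h(2) True)
    qed (simp add: \<Theta>_def)
  qed
  have "(\<lambda>n. \<integral> z. \<Theta> n z \<partial>?LL) \<longlonglongrightarrow> (\<integral> z. h (snd z) * ?ker (fst z) * d (snd z) \<partial>?LL)"
    by (rule integral_dominated_convergence[OF dm \<Theta>m _ lim bound]) (use pg in \<open>simp add: has_bochner_integral_iff\<close>)
  moreover have "(\<integral> z. h (snd z) * ?ker (fst z) * d (snd z) \<partial>?LL) = (\<integral> y. h y * d y \<partial>lborel)"
  proof -
    have hb: "\<bar>h y\<bar> \<le> C" for y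
      by (rule LIMSEQ_le_const2[OF tendsto_rabs[OF h(2)[of 1 y]]]) (use f(2) in auto)
    have db: "AE y in lborel. \<bar>d y\<bar> \<le> g y"
      using d(2) g(2)
    proof eventually_elim
      case (elim y)
      have "d y \<le> g y"
        by (rule tendsto_upperbound[OF elim(1)]) (use elim(2) in \<open>auto simp: eventually_at_filter\<close>)
      moreover have "0 \<le> d y"
        by (rule tendsto_lowerbound[OF elim(1)]) (use \<rho>(2) in auto)
      ultimately show ?case by simp
    qed
    \<comment> \<open>Integrability allows the kernel, of mass 1, to be integrated out of the
      product.\<close>
    have "integrable lborel (\<lambda>y. h y * d y)"
    proof (rule Bochner_Integration.integrable_bound[OF gi])
      show "(\<lambda>y. h y * d y) \<in> borel_measurable lborel" using h(1) d(1) by simp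
      show "AE y in lborel. norm (h y * d y) \<le> norm (C * g y)"
        using db by eventually_elim (auto simp: abs_mult abs_of_nonneg[OF C] intro!: mult_mono hb C)
    qed
    from prod[OF this] show ?thesis by (simp add: has_bochner_integral_iff mult_ac)
  qed
  ultimately show "(\<lambda>n. \<integral> z. \<Phi> n z \<partial>lborel) \<longlonglongrightarrow> (\<integral> y. h y * d y \<partial>lborel)" unfolding \<Phi>\<Theta> by simp
  have "\<bar>\<integral> z. \<Theta> n z \<partial>?LL\<bar> \<le> (\<integral> z. norm (\<Theta> n z) \<partial>?LL)" using integral_norm_bound[of ?LL "\<Theta> n"] by simp
  also have "\<dots> \<le> (\<integral> z. ?ker (fst z) * (C * g (snd z)) \<partial>?LL)"
  proof (rule integral_mono_AE)
    show gg: "integrable ?LL (\<lambda>z. ?ker (fst z) * (C * g (snd z)))" using pg by (simp add: has_bochner_integral_iff)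
    show "integrable ?LL (\<lambda>z. norm (\<Theta> n z))"
    proof (rule integrable_norm[OF Bochner_Integration.integrable_bound[OF gg \<Theta>m]])
      show "AE z in ?LL. norm (\<Theta> n z) \<le> norm (?ker (fst z) * (C * g (snd z)))"
        using bound[of n] by eventually_elim (unfold real_norm_def, erule order_trans[OF _ abs_ge_self])
    qed
  qed (rule bound)
  also have "\<dots> = C * (\<integral> y. g y \<partial>lborel)" using pg by (simp add: has_bochner_integral_iff)
  finally show "\<bar>\<integral> z. \<Phi> n z \<partial>lborel\<bar> \<le> C * (\<integral> y. g y \<partial>lborel)" unfolding \<Phi>\<Theta> .
qed

section \<open>Mollifying the running maximum\<close>

text \<open>The supremum in (H) is measurable for the completed measure only, while slicing at a
  fixed time requires a product-measurable function. It is first replaced by a Borel version, which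
  is finite almost everywhere because its integral is finite; Fubini then transfers the domination
  to almost every time.\<close>

lemma hypothesis_H_dominating:
  assumes H: "hypothesis_H i pV" and T: "0 < T" and nn: "\<And>s z. 0 < s \<Longrightarrow> 0 \<le> pV s z"
  obtains \<gamma> where "integrable lborel \<gamma>" "\<And>z. 0 \<le> \<gamma> z"
    "AE s in lborel. s \<in> {0<..T} \<longrightarrow> (AE y in lborel. \<forall>u>0. pV s (below_diag i y u) \<le> \<gamma> (s, y))"
proof -
  let ?S = "{0..T} \<times> (UNIV :: (real^'a) set)"
  define g where "g z = (SUP u\<in>{0<..}. ennreal (pV (fst z) (below_diag i (snd z) u)))" for z
  have S: "?S \<in> sets lebesgue"
    by (intro sets_completionI_sets) (auto intro!: borel_closed closed_Times)
  have gm: "g \<in> borel_measurable (lebesgue_on ?S)" and gi: "(\<integral>\<^sup>+ z. g z \<partial>lebesgue_on ?S) < \<infinity>"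
    using H T unfolding hypothesis_H_def g_def by (auto simp: case_prod_beta')
  have gm': "(\<lambda>z. g z * indicator ?S z) \<in> borel_measurable lebesgue"
    using borel_measurable_restrict_space_iff_ennreal[of ?S lebesgue g] gm S by simp
  have gi': "(\<integral>\<^sup>+ z. g z * indicator ?S z \<partial>lebesgue) < \<infinity>"
    using nn_integral_restrict_space[of ?S lebesgue g] gi S by simp
  obtain \<gamma>0 where \<gamma>0: "\<gamma>0 \<in> borel_measurable lborel" "AE z in lborel. g z * indicator ?S z = \<gamma>0 z"
    using completion_ex_borel_measurable[OF gm'] by blast
  have fin: "(\<integral>\<^sup>+ z. \<gamma>0 z \<partial>lborel) < \<infinity>"
  proof -
    have "(\<integral>\<^sup>+ z. g z * indicator ?S z \<partial>lebesgue) = (\<integral>\<^sup>+ z. \<gamma>0 z \<partial>lebesgue)"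
      by (rule nn_integral_cong_AE) (rule AE_completion[OF \<gamma>0(2)])
    also have "\<dots> = (\<integral>\<^sup>+ z. \<gamma>0 z \<partial>lborel)" by (simp add: nn_integral_completion)
    finally show ?thesis using gi' by simp
  qed
  define \<gamma> where "\<gamma> z = enn2real (\<gamma>0 z)" for z
  have AE\<gamma>: "AE z in lborel. g z * indicator ?S z = ennreal (\<gamma> z)"
    using \<gamma>0(2) nn_integral_PInf_AE[OF \<gamma>0(1)] fin
    by (auto simp: \<gamma>_def less_top elim!: eventually_elim2)
  have \<gamma>m: "\<gamma> \<in> borel_measurable lborel" unfolding \<gamma>_def using \<gamma>0(1) by measurable
  have \<gamma>i: "integrable lborel \<gamma>"
  proof (rule integrableI_bounded[OF \<gamma>m])
    have "(\<integral>\<^sup>+ z. ennreal (norm (\<gamma> z)) \<partial>lborel) \<le> (\<integral>\<^sup>+ z. \<gamma>0 z \<partial>lborel)"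
      by (intro nn_integral_mono) (simp add: \<gamma>_def ennreal_enn2real_if)
    then show "(\<integral>\<^sup>+ z. ennreal (norm (\<gamma> z)) \<partial>lborel) < \<infinity>" using fin by (rule le_less_trans)
  qed
  have "AE s in lborel. AE y in lborel. g (s, y) * indicator ?S (s, y) = ennreal (\<gamma> (s, y))"
    using AE\<gamma> unfolding lborel_prod[symmetric] by (rule lborel_pair.AE_pair)
  then have "AE s in lborel. s \<in> {0<..T} \<longrightarrow> (AE y in lborel. \<forall>u>0. pV s (below_diag i y u) \<le> \<gamma> (s, y))"
  proof eventually_elim
    case (elim s)
    show ?case
    proof
      assume s: "s \<in> {0<..T}"
      show "AE y in lborel. \<forall>u>0. pV s (below_diag i y u) \<le> \<gamma> (s, y)"
        using elim
      proof eventually_elim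
        case (elim y)
        then have e: "g (s, y) = ennreal (\<gamma> (s, y))" using s by simp
        show ?case
        proof (intro allI impI)
          fix u :: real assume "0 < u"
          then have "ennreal (pV s (below_diag i y u)) \<le> g (s, y)"
            unfolding g_def by (intro SUP_upper2[of u]) auto
          then show "pV s (below_diag i y u) \<le> \<gamma> (s, y)"
            unfolding e by (subst (asm) ennreal_le_iff) (auto simp: \<gamma>_def)
        qed
      qed
    qed
  qed
  with \<gamma>i show thesis by (intro that[of \<gamma>]) (auto simp: \<gamma>_def)
qed

definition coord :: "'n \<Rightarrow> (real^'n) \<Rightarrow>\<^sub>L real" where "coord i = Blinfun (\<lambda>x. x $ i)"

lemma coord_apply: "blinfun_apply (coord i) x = x $ i"
  by (simp add: coord_def bounded_linear_Blinfun_apply[OF bounded_linear_vec_nth])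

definition coord2 :: "'n \<Rightarrow> 'n \<Rightarrow> (real^'n) \<Rightarrow>\<^sub>L (real^'n) \<Rightarrow>\<^sub>L real" where "coord2 i k = Blinfun (\<lambda>x. x $ k *\<^sub>R coord i)"

lemma coord2_apply: "blinfun_apply (coord2 i k) x = x $ k *\<^sub>R coord i"
  by (simp add: coord2_def bounded_linear_Blinfun_apply[OF bounded_linear_compose[OF bounded_linear_scaleR_left bounded_linear_vec_nth]])

context bounded_diffusion
begin

text \<open>Partial derivatives \<open>g i\<close> and \<open>hh i k\<close> are assembled into
  derivatives with values in linear maps, the form that Taylor's formula requires. The constant
  \<open>C\<close> is the sum of all bounds that occur, plus 1.\<close>

lemma ito_coordinates:
  fixes i1 :: 'n and \<Psi> :: "real \<times> (real^'n) \<Rightarrow> real" and g :: "'n \<Rightarrow> real \<times> (real^'n) \<Rightarrow> real"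
    and hh :: "'n \<Rightarrow> 'n \<Rightarrow> real \<times> (real^'n) \<Rightarrow> real"
  assumes cont: "continuous_on UNIV \<Psi>" "\<And>i. continuous_on UNIV (g i)" "\<And>i k. continuous_on UNIV (hh i k)"
    and bound: "\<And>z. \<bar>\<Psi> z\<bar> \<le> c" "\<And>i z. \<bar>g i z\<bar> \<le> c" "\<And>i k z. \<bar>hh i k z\<bar> \<le> c"
    and \<Psi>: "\<And>m x. ((\<lambda>x. \<Psi> (m, x)) has_derivative (\<lambda>h. \<Sum>i\<in>UNIV. h $ i * g i (m, x))) (at x)"
    and g: "\<And>i m x. ((\<lambda>x. g i (m, x)) has_derivative (\<lambda>h. \<Sum>k\<in>UNIV. h $ k * hh i k (m, x))) (at x)"
    and r: "\<And>m x. ((\<lambda>m. \<Psi> (m, x)) has_real_derivative r m x) (at m)"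
      "\<And>m x. \<bar>r m x\<bar> \<le> c * min 1 \<bar>m - x $ i1\<bar> / (1 + m\<^sup>2)"
    and t: "0 < t"
  shows "expectation (\<lambda>\<omega>. \<Psi> (V i1 t \<omega>)) = expectation (\<lambda>\<omega>. \<Psi> (V i1 0 \<omega>)) +
     (LINT s:{0..t}|lborel. expectation (\<lambda>\<omega>. (\<Sum>i\<in>UNIV. g i (V i1 s \<omega>) * B (X s \<omega>) $ i) +
       1 / 2 * (\<Sum>i\<in>UNIV. \<Sum>k\<in>UNIV. hh i k (V i1 s \<omega>) * (\<Sum>j\<in>UNIV. A (X s \<omega>) $ i $ j * A (X s \<omega>) $ k $ j))))"
proof -
  define p where "p z = (\<Sum>i\<in>UNIV. g i z *\<^sub>R coord i)" for z
  define q where "q z = (\<Sum>i\<in>UNIV. \<Sum>k\<in>UNIV. hh i k z *\<^sub>R coord2 i k)" for z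
  have c0: "0 \<le> c" using bound(1)[of undefined] by linarith
  define np where "np = (\<Sum>i\<in>(UNIV::'n set). c * norm (coord i))"
  define nq where "nq = (\<Sum>i\<in>(UNIV::'n set). \<Sum>k\<in>(UNIV::'n set). c * norm (coord2 i k))"
  define C where "C = 1 + c + np + nq"
  have n0: "0 \<le> np" "0 \<le> nq" unfolding np_def nq_def using c0 by (auto intro!: sum_nonneg)
  interpret RF: regular_function P W X B A K i1 \<Psi> p q r C
  proof
    show "continuous_on UNIV \<Psi>" by (rule cont)
    show "continuous_on UNIV p" unfolding p_def by (intro continuous_intros cont)
    show "continuous_on UNIV q" unfolding q_def by (intro continuous_intros cont)
    show "1 \<le> C" using c0 n0 by (simp add: C_def)
    show "\<bar>\<Psi> z\<bar> \<le> C" for z using bound(1)[of z] n0 by (simp add: C_def)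
    have "norm (p z) \<le> np" for z
      unfolding p_def np_def using bound(2) by (intro order_trans[OF norm_sum sum_mono]) (simp add: mult_right_mono)
    then show "norm (p z) \<le> C" for z using c0 n0 by (simp add: C_def add_increasing add_increasing2)
    have "norm (q z) \<le> nq" for z
      unfolding q_def nq_def using bound(3) by (intro order_trans[OF norm_sum sum_mono]) (simp add: mult_right_mono)
    then show "norm (q z) \<le> C" for z using c0 n0 by (simp add: C_def add_increasing add_increasing2)
    show "((\<lambda>x. \<Psi> (m, x)) has_derivative p (m, x)) (at x)" for m x
    proof -
      have "blinfun_apply (p (m, x)) = (\<lambda>h. \<Sum>i\<in>UNIV. h $ i * g i (m, x))"
        by (simp add: fun_eq_iff p_def blinfun.sum_left blinfun.scaleR_left coord_apply mult.commute)
      with \<Psi>[of m x] show ?thesis by simp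
    qed
    show "((\<lambda>x. p (m, x)) has_derivative q (m, x)) (at x)" for m x
    proof -
      have "blinfun_apply (q (m, x)) = (\<lambda>h. \<Sum>i\<in>UNIV. (\<Sum>k\<in>UNIV. h $ k * hh i k (m, x)) *\<^sub>R coord i)"
        by (simp add: fun_eq_iff q_def blinfun.sum_left blinfun.scaleR_left coord2_apply scaleR_sum_left mult.commute)
      then show ?thesis unfolding p_def by (auto intro!: has_derivative_sum has_derivative_scaleR_left g)
    qed
    show "((\<lambda>m. \<Psi> (m, x)) has_real_derivative r m x) (at m)" for m x by (rule r)
    show "\<bar>r m x\<bar> \<le> C * min 1 \<bar>m - x $ i1\<bar> / (1 + m\<^sup>2)" for m x
    proof -
      have "c * min 1 \<bar>m - x $ i1\<bar> / (1 + m\<^sup>2) \<le> C * min 1 \<bar>m - x $ i1\<bar> / (1 + m\<^sup>2)"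
        using n0 by (intro divide_right_mono mult_right_mono) (auto simp: C_def)
      with r(2)[of m x] show ?thesis by linarith
    qed
  qed
  have p_ax: "blinfun_apply (p z) (axis i 1) = g i z" for z i
  proof -
    have "blinfun_apply (p z) (axis i 1) = (\<Sum>l\<in>UNIV. if l = i then g l z else 0)"
      unfolding p_def by (simp add: blinfun.sum_left blinfun.scaleR_left coord_apply axis_def if_distrib cong: if_cong)
    then show ?thesis by simp
  qed
  \<comment> \<open>The first argument of \<open>q\<close> is the direction in which
    \<open>p\<close> is differentiated, so the indices come out reversed; the symmetry of
    \<open>A A^t\<close> undoes this below.\<close>
  have q_ax: "blinfun_apply (blinfun_apply (q z) (axis i 1)) (axis k 1) = hh k i z" for z i k
  proof -
    have "blinfun_apply (blinfun_apply (q z) (axis i 1)) (axis k 1) =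
       (\<Sum>l\<in>UNIV. \<Sum>n\<in>UNIV. if l = k then (if n = i then hh l n z else 0) else 0)"
      unfolding q_def by (auto simp: blinfun.sum_left blinfun.scaleR_left coord_apply coord2_apply axis_def intro!: sum.cong)
    also have "\<dots> = (\<Sum>l\<in>UNIV. if l = k then (\<Sum>n\<in>UNIV. if n = i then hh l n z else 0) else 0)"
      by (intro sum.cong) auto
    also have "\<dots> = hh k i z" by simp
    finally show ?thesis .
  qed
  have "RF.G (V i1 s \<omega>) = (\<Sum>i\<in>UNIV. g i (V i1 s \<omega>) * B (X s \<omega>) $ i) +
       1 / 2 * (\<Sum>i\<in>UNIV. \<Sum>k\<in>UNIV. hh i k (V i1 s \<omega>) * (\<Sum>j\<in>UNIV. A (X s \<omega>) $ i $ j * A (X s \<omega>) $ k $ j))" for s \<omega>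
  proof -
    have "(\<Sum>i\<in>UNIV. \<Sum>k\<in>UNIV. hh k i (V i1 s \<omega>) * (\<Sum>j\<in>UNIV. A (X s \<omega>) $ i $ j * A (X s \<omega>) $ k $ j)) =
       (\<Sum>k\<in>UNIV. \<Sum>i\<in>UNIV. hh k i (V i1 s \<omega>) * (\<Sum>j\<in>UNIV. A (X s \<omega>) $ k $ j * A (X s \<omega>) $ i $ j))"
      by (subst sum.swap) (simp add: mult.commute)
    then show ?thesis unfolding RF.G_def p_ax q_ax by (simp add: V_def)
  qed
  then show ?thesis using RF.ito_expectation[OF t] by simp
qed

end

section \<open>The mollified maximum and its derivatives\<close>

definition shifted_max :: "real \<Rightarrow> real \<Rightarrow> real \<Rightarrow> real" where "shifted_max N m a = m - arctan (N * (m - a)) / N"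

definition mollified_max :: "real \<Rightarrow> real \<Rightarrow> real \<Rightarrow> real" where "mollified_max N m a = N * arctan (shifted_max N m a / N)"

definition lorentz :: "real \<Rightarrow> real" where "lorentz v = 1 / (1 + v\<^sup>2)"

text \<open>First derivative of the outer function N arctan(y / N), with \<open>chi2\<close> the
  second. It tends to 1 as \<open>N\<close> grows, and for fixed \<open>N\<close> it decays
  quadratically in \<open>y\<close>.\<close>

definition chi1 :: "real \<Rightarrow> real \<Rightarrow> real" where "chi1 N y = lorentz (y / N)"

definition chi2 :: "real \<Rightarrow> real \<Rightarrow> real" where "chi2 N y = - (lorentz_slope (y / N) / N)"

definition alpha :: "real \<Rightarrow> real \<Rightarrow> real \<Rightarrow> real" where
  "alpha N m a = chi1 N (shifted_max N m a) * lorentz (N * (m - a))"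

text \<open>
  \<open>alpha\<close> and \<open>beta\<close> are the first and second derivatives of \<open>mollified_max\<close> in \<open>a\<close>; \<open>beta0\<close> is
  the part of \<open>beta\<close> that vanishes in the limit.
\<close>

definition beta0 :: "real \<Rightarrow> real \<Rightarrow> real \<Rightarrow> real" where
  "beta0 N m a = chi2 N (shifted_max N m a) * (lorentz (N * (m - a)))\<^sup>2"

definition beta :: "real \<Rightarrow> real \<Rightarrow> real \<Rightarrow> real" where
  "beta N m a = beta0 N m a + chi1 N (shifted_max N m a) * (N * lorentz_slope (N * (m - a)))"

lemma lorentz_bounds: "0 < lorentz v" "lorentz v \<le> 1" "\<bar>lorentz v\<bar> \<le> 1"
proof -
  have *: "0 < 1 + v\<^sup>2" using zero_le_power2[of v] by linarith
  show "0 < lorentz v" "lorentz v \<le> 1" using * by (auto simp: lorentz_def divide_le_eq)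
  then show "\<bar>lorentz v\<bar> \<le> 1" by simp
qed

lemma one_plus_square_neq_0: "1 + v\<^sup>2 \<noteq> (0::real)"
  using zero_le_power2[of v] by linarith

lemma DERIV_lorentz: "(lorentz has_real_derivative - lorentz_slope v) (at v)"
  unfolding lorentz_def[abs_def] lorentz_slope_def using one_plus_square_neq_0[of v]
  by (auto intro!: derivative_eq_intros simp: power2_eq_square[of "1 + v\<^sup>2"])

lemma DERIV_arctan_lorentz: "(arctan has_real_derivative lorentz v) (at v)"
  using DERIV_arctan[of v] by (simp add: lorentz_def inverse_eq_divide)

lemma DERIV_chi:
  assumes "0 < N"
  shows "((\<lambda>y. N * arctan (y / N)) has_real_derivative chi1 N y) (at y)" "(chi1 N has_real_derivative chi2 N y) (at y)"
proof -
  have d: "((\<lambda>y. y / N) has_real_derivative 1 / N) (at y)"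
    using assms by (auto intro!: derivative_eq_intros)
  from DERIV_cmult[OF DERIV_chain2[OF DERIV_arctan_lorentz d], of N]
  show "((\<lambda>y. N * arctan (y / N)) has_real_derivative chi1 N y) (at y)" using assms by (simp add: chi1_def)
  from DERIV_chain2[OF DERIV_lorentz d]
  show "(chi1 N has_real_derivative chi2 N y) (at y)" unfolding chi1_def[abs_def] chi2_def by simp
qed

lemma DERIV_shifted_max:
  assumes "0 < N"
  shows "((\<lambda>a. shifted_max N m a) has_real_derivative lorentz (N * (m - a))) (at a)"
    "((\<lambda>m. shifted_max N m a) has_real_derivative 1 - lorentz (N * (m - a))) (at m)"
proof -
  have d: "((\<lambda>a. N * (m - a)) has_real_derivative - N) (at a)" "((\<lambda>m. N * (m - a)) has_real_derivative N) (at m)"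
    by (auto intro!: derivative_eq_intros)
  from DERIV_diff[OF DERIV_const[of m] DERIV_cdivide[OF DERIV_chain2[OF DERIV_arctan_lorentz d(1)], of N]]
  show "((\<lambda>a. shifted_max N m a) has_real_derivative lorentz (N * (m - a))) (at a)" unfolding shifted_max_def using assms by simp
  from DERIV_diff[OF DERIV_ident DERIV_cdivide[OF DERIV_chain2[OF DERIV_arctan_lorentz d(2)], of N]]
  show "((\<lambda>m. shifted_max N m a) has_real_derivative 1 - lorentz (N * (m - a))) (at m)" unfolding shifted_max_def using assms by simp
qed

lemma DERIV_mollified_max:
  assumes "0 < N"
  shows "((\<lambda>a. mollified_max N m a) has_real_derivative alpha N m a) (at a)"
    "((\<lambda>m. mollified_max N m a) has_real_derivative chi1 N (shifted_max N m a) * (1 - lorentz (N * (m - a)))) (at m)"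
    "((\<lambda>a. alpha N m a) has_real_derivative beta N m a) (at a)"
proof -
  show "((\<lambda>a. mollified_max N m a) has_real_derivative alpha N m a) (at a)"
    unfolding mollified_max_def alpha_def by (rule DERIV_chain2[OF DERIV_chi(1)[OF assms] DERIV_shifted_max(1)[OF assms]])
  show "((\<lambda>m. mollified_max N m a) has_real_derivative chi1 N (shifted_max N m a) * (1 - lorentz (N * (m - a)))) (at m)"
    unfolding mollified_max_def by (rule DERIV_chain2[OF DERIV_chi(1)[OF assms] DERIV_shifted_max(2)[OF assms]])
  have d: "((\<lambda>a. N * (m - a)) has_real_derivative - N) (at a)" by (auto intro!: derivative_eq_intros)
  have "((\<lambda>a. alpha N m a) has_real_derivative
     (chi2 N (shifted_max N m a) * lorentz (N * (m - a))) * lorentz (N * (m - a)) + (- lorentz_slope (N * (m - a)) * - N) * chi1 N (shifted_max N m a)) (at a)"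
    unfolding alpha_def
    by (rule DERIV_mult[OF DERIV_chain2[OF DERIV_chi(2)[OF assms] DERIV_shifted_max(1)[OF assms]] DERIV_chain2[OF DERIV_lorentz d]])
  then show "((\<lambda>a. alpha N m a) has_real_derivative beta N m a) (at a)"
    by (simp add: beta_def beta0_def power2_eq_square mult_ac)
qed

lemma continuous_lorentz: "continuous_on UNIV lorentz" and continuous_lorentz_slope: "continuous_on UNIV lorentz_slope"
  unfolding lorentz_def[abs_def] lorentz_slope_def[abs_def] using one_plus_square_neq_0
  by (auto intro!: continuous_intros)

lemma continuous_mollified_max:
  assumes N: "0 < N" and f: "continuous_on S f" and h: "continuous_on S h"
  shows "continuous_on S (\<lambda>z. shifted_max N (f z) (h z))" "continuous_on S (\<lambda>z. mollified_max N (f z) (h z))"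
    "continuous_on S (\<lambda>z. alpha N (f z) (h z))" "continuous_on S (\<lambda>z. beta0 N (f z) (h z))"
    "continuous_on S (\<lambda>z. beta N (f z) (h z))" "continuous_on S (\<lambda>z. chi1 N (shifted_max N (f z) (h z)))"
proof -
  have N0: "N \<noteq> 0" using N by simp
  show w: "continuous_on S (\<lambda>z. shifted_max N (f z) (h z))"
    unfolding shifted_max_def using N0 by (intro continuous_intros f h) auto
  have k: "continuous_on S (\<lambda>z. lorentz (e z))" "continuous_on S (\<lambda>z. lorentz_slope (e z))" if "continuous_on S e" for e
    using continuous_on_compose2[OF continuous_lorentz that] continuous_on_compose2[OF continuous_lorentz_slope that] by auto
  show "continuous_on S (\<lambda>z. mollified_max N (f z) (h z))"
    unfolding mollified_max_def using N0 by (intro continuous_intros w) auto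
  show c1: "continuous_on S (\<lambda>z. chi1 N (shifted_max N (f z) (h z)))"
    unfolding chi1_def using N0 by (intro k continuous_intros w) auto
  show "continuous_on S (\<lambda>z. alpha N (f z) (h z))"
    unfolding alpha_def by (intro continuous_intros c1 k f h)
  show b0: "continuous_on S (\<lambda>z. beta0 N (f z) (h z))"
    unfolding beta0_def chi2_def using N0 by (intro continuous_intros k w f h) auto
  show "continuous_on S (\<lambda>z. beta N (f z) (h z))"
    unfolding beta_def by (intro continuous_intros b0 c1 k f h)
qed

text \<open>The last bound is the flatness that the Ito formula demands: one minus
  \<open>lorentz\<close> vanishes on the diagonal, and \<open>chi1\<close> supplies the decay in
  \<open>m\<close>. It grows with \<open>N\<close>, which is harmless since the formula is applied
  for fixed \<open>N\<close>. The bounds on \<open>alpha\<close>, \<open>beta0\<close> and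
  \<open>chi1\<close> stay uniform and are used in the limit.\<close>

lemma mollified_max_bounds:
  assumes N: "1 \<le> N"
  shows "\<bar>alpha N m a\<bar> \<le> 1" "\<bar>beta0 N m a\<bar> \<le> 1 / N" "\<bar>chi1 N y\<bar> \<le> 1" "\<bar>beta N m a\<bar> \<le> 1 + N"
    "\<bar>chi1 N (shifted_max N m a) * (1 - lorentz (N * (m - a)))\<bar> \<le> 9 * N ^ 3 * min 1 \<bar>m - a\<bar> / (1 + m\<^sup>2)"
proof -
  have N0: "0 < N" using N by simp
  show c1: "\<bar>chi1 N y\<bar> \<le> 1" for y unfolding chi1_def by (rule lorentz_bounds)
  show "\<bar>alpha N m a\<bar> \<le> 1"
    unfolding alpha_def abs_mult using mult_mono[OF c1[of "shifted_max N m a"] lorentz_bounds(3)[of "N * (m - a)"]] by simp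
  have "\<bar>chi2 N y\<bar> \<le> 1 / N" for y
    using lorentz_slope_bound(2)[of "y / N"] N0 by (simp add: chi2_def abs_mult divide_right_mono)
  moreover have "\<bar>(lorentz v)\<^sup>2\<bar> \<le> 1" for v using power_mono[OF lorentz_bounds(3)[of v] abs_ge_zero, of 2] by simp
  ultimately show b0: "\<bar>beta0 N m a\<bar> \<le> 1 / N"
    unfolding beta0_def abs_mult[of "chi2 N (shifted_max N m a)"]
    using mult_mono[of "\<bar>chi2 N (shifted_max N m a)\<bar>" "1 / N" "\<bar>(lorentz (N * (m - a)))\<^sup>2\<bar>" 1] N0 by simp
  have "\<bar>chi1 N (shifted_max N m a) * (N * lorentz_slope (N * (m - a)))\<bar> \<le> 1 * (N * 1)"
    unfolding abs_mult using N0 by (intro mult_mono c1 lorentz_slope_bound) auto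
  moreover have "1 / N \<le> 1" using N by simp
  ultimately show "\<bar>beta N m a\<bar> \<le> 1 + N" using b0 unfolding beta_def by linarith
  define w where "w = shifted_max N m a"
  have v: "1 - lorentz v \<le> min 1 \<bar>v\<bar>" for v
  proof -
    have p: "0 < 1 + v\<^sup>2" using zero_le_power2[of v] by linarith
    have "1 - lorentz v = v\<^sup>2 / (1 + v\<^sup>2)" using p by (simp add: lorentz_def field_simps)
    moreover have "v\<^sup>2 \<le> \<bar>v\<bar> * (1 + v\<^sup>2)"
    proof -
      have "2 * \<bar>v\<bar> \<le> 1 + v\<^sup>2" using sum_squares_bound[of "\<bar>v\<bar>" 1] by simp
      then have "\<bar>v\<bar> * \<bar>v\<bar> \<le> \<bar>v\<bar> * (1 + v\<^sup>2)" by (intro mult_left_mono) auto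
      then show ?thesis by (simp add: power2_eq_square)
    qed
    ultimately have "1 - lorentz v \<le> \<bar>v\<bar>" using p by (simp add: divide_le_eq)
    then show ?thesis using lorentz_bounds(1)[of v] by simp
  qed
  have "min 1 \<bar>N * (m - a)\<bar> \<le> N * min 1 \<bar>m - a\<bar>"
    using N mult_right_mono[of 1 N "\<bar>m - a\<bar>"] by (auto simp: abs_mult min_def)
  then have 1: "1 - lorentz (N * (m - a)) \<le> N * min 1 \<bar>m - a\<bar>" using v[of "N * (m - a)"] by linarith
  \<comment> \<open>The inner arctangent shifts \<open>m\<close> by at most 2, so m^2 is at most 2
    w^2 + 8 and decay in \<open>w\<close> becomes decay in \<open>m\<close>. This is the origin of
    the 9.\<close>
  have mw: "\<bar>m - w\<bar> \<le> 2"
  proof -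
    have "\<bar>arctan (N * (m - a))\<bar> \<le> 2"
      using arctan_bounded[of "N * (m - a)"] pi_less_4 by (auto simp: abs_le_iff)
    then have "\<bar>arctan (N * (m - a))\<bar> / N \<le> 2 / 1" using N by (intro frac_le) auto
    then show ?thesis using N0 by (simp add: w_def shifted_max_def)
  qed
  have "1 + m\<^sup>2 \<le> 9 * (1 + w\<^sup>2)"
  proof -
    have "m\<^sup>2 \<le> 2 * w\<^sup>2 + 2 * (m - w)\<^sup>2" using square_sum_le2[of w "m - w"] by simp
    moreover have "(m - w)\<^sup>2 \<le> 4" using mw abs_le_square_iff[of "m - w" 2] by simp
    ultimately show ?thesis using zero_le_power2[of w] by (simp only: distrib_left)
  qed
  also have "\<dots> \<le> 9 * (N\<^sup>2 * (1 + (w / N)\<^sup>2))"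
  proof -
    have "1 \<le> N\<^sup>2" using N by (simp add: one_le_power)
    then show ?thesis using N0 by (simp add: distrib_left power_divide)
  qed
  finally have "1 + m\<^sup>2 \<le> 9 * N\<^sup>2 * (1 + (w / N)\<^sup>2)" by simp
  moreover have pos: "0 < 1 + m\<^sup>2" "0 < 1 + (w / N)\<^sup>2" using zero_le_power2[of m] zero_le_power2[of "w / N"] by linarith+
  ultimately have 2: "chi1 N w \<le> 9 * N\<^sup>2 / (1 + m\<^sup>2)"
    unfolding chi1_def lorentz_def by (simp add: field_simps)
  have nn: "0 \<le> chi1 N w" "0 \<le> 1 - lorentz (N * (m - a))"
    using lorentz_bounds(1)[of "w / N"] lorentz_bounds(2)[of "N * (m - a)"] by (auto simp: chi1_def)
  have "chi1 N w * (1 - lorentz (N * (m - a))) \<le> 9 * N\<^sup>2 / (1 + m\<^sup>2) * (N * min 1 \<bar>m - a\<bar>)"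
    using 1 2 nn N0 pos by (intro mult_mono) auto
  also have "\<dots> = 9 * N ^ 3 * min 1 \<bar>m - a\<bar> / (1 + m\<^sup>2)" by (simp add: power2_eq_square power3_eq_cube)
  finally show "\<bar>chi1 N (shifted_max N m a) * (1 - lorentz (N * (m - a)))\<bar> \<le> 9 * N ^ 3 * min 1 \<bar>m - a\<bar> / (1 + m\<^sup>2)"
    using nn unfolding w_def[symmetric] by simp
qed

text \<open>Serves for the density on the diagonal and for the diagonal term as a function of time:
  each agrees almost everywhere with a Borel function, but its values on the exceptional null set
  are not under control.\<close>

lemma borel_measurable_completion_AE:
  fixes f g :: "'a \<Rightarrow> real"
  assumes f: "f \<in> borel_measurable M" and ae: "AE x in M. f x = g x"
  shows "g \<in> borel_measurable (completion M)"
proof (rule measurableI)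
  obtain N where N: "N \<in> null_sets M" "{x\<in>space M. f x \<noteq> g x} \<subseteq> N"
    using ae unfolding eventually_ae_filter by auto
  fix S :: "real set" assume "S \<in> sets borel"
  then have S: "f -` S \<inter> space M \<in> sets M" by (rule measurable_sets[OF f])
  have "g -` S \<inter> space M = (f -` S \<inter> space M - N) \<union> (g -` S \<inter> space M \<inter> N)"
    using N(2) by auto
  then show "g -` S \<inter> space (completion M) \<in> sets (completion M)"
    using N(1) S by (intro sets_completionI[of _ "f -` S \<inter> space M - N" "g -` S \<inter> space M \<inter> N" N]) auto
qed simp

text \<open>Near 0 the arctangent deviates from the identity by a cubic error, so the outer factor N
  meets a term of order 1 / N^3.\<close>

lemma mollified_max_LIMSEQ:
  assumes w: "w \<longlonglongrightarrow> m"
  shows "(\<lambda>n. real (Suc n) * arctan (w n / real (Suc n))) \<longlonglongrightarrow> m" "(\<lambda>n. w n / real (Suc n)) \<longlonglongrightarrow> 0"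
proof -
  have "(\<lambda>n. w n * (1 / real (Suc n))) \<longlonglongrightarrow> m * 0"
    by (intro tendsto_mult w mesh_LIMSEQ)
  then show q: "(\<lambda>n. w n / real (Suc n)) \<longlonglongrightarrow> 0" by simp
  have le: "\<bar>arctan y - y\<bar> \<le> \<bar>y\<bar> * y\<^sup>2" for y :: real
  proof -
    have "\<exists>\<xi>. \<bar>\<xi>\<bar> \<le> \<bar>y\<bar> \<and> arctan y = y * lorentz \<xi>"
    proof (cases "y = 0")
      case False
      then consider "0 < y" | "y < 0" by linarith
      then show ?thesis
      proof cases
        case 1
        then obtain z where "0 < z" "z < y" "arctan y - arctan 0 = (y - 0) * lorentz z"
          using MVT2[OF 1, of arctan lorentz] DERIV_arctan_lorentz by blast
        then show ?thesis by (intro exI[of _ z]) auto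
      next
        case 2
        then obtain z where "y < z" "z < 0" "arctan 0 - arctan y = (0 - y) * lorentz z"
          using MVT2[OF 2, of arctan lorentz] DERIV_arctan_lorentz by blast
        then show ?thesis by (intro exI[of _ z]) auto
      qed
    qed simp
    then obtain \<xi> where \<xi>: "\<bar>\<xi>\<bar> \<le> \<bar>y\<bar>" "arctan y = y * lorentz \<xi>" by blast
    have "arctan y - y = - (y * (1 - lorentz \<xi>))" using \<xi> by (simp add: algebra_simps)
    then have "\<bar>arctan y - y\<bar> = \<bar>y\<bar> * \<bar>1 - lorentz \<xi>\<bar>" by (simp add: abs_mult)
    also have "\<bar>1 - lorentz \<xi>\<bar> = \<xi>\<^sup>2 / (1 + \<xi>\<^sup>2)"
    proof -
      have p: "0 < 1 + \<xi>\<^sup>2" using zero_le_power2[of \<xi>] by linarith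
      have "1 - lorentz \<xi> = \<xi>\<^sup>2 / (1 + \<xi>\<^sup>2)" using p by (simp add: lorentz_def field_simps)
      then show ?thesis using p by simp
    qed
    also have "\<dots> \<le> \<xi>\<^sup>2 / 1" by (intro divide_left_mono) (auto intro: add_pos_nonneg)
    also have "\<xi>\<^sup>2 / 1 \<le> y\<^sup>2" using \<xi>(1) by (simp add: abs_le_square_iff)
    finally show ?thesis by (simp add: mult_left_mono)
  qed
  have "(\<lambda>n. real (Suc n) * arctan (w n / real (Suc n)) - w n) \<longlonglongrightarrow> 0"
  proof (rule Lim_null_comparison)
    show "\<forall>\<^sub>F n in sequentially. norm (real (Suc n) * arctan (w n / real (Suc n)) - w n) \<le> \<bar>w n\<bar> * (w n / real (Suc n))\<^sup>2"
    proof (intro always_eventually allI)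
      fix n
      let ?N = "real (Suc n)"
      have "?N * arctan (w n / ?N) - w n = ?N * (arctan (w n / ?N) - w n / ?N)" by (simp add: right_diff_distrib del: of_nat_Suc)
      then have "norm (?N * arctan (w n / ?N) - w n) = ?N * \<bar>arctan (w n / ?N) - w n / ?N\<bar>" by (simp add: abs_mult del: of_nat_Suc)
      also have "\<dots> \<le> ?N * (\<bar>w n / ?N\<bar> * (w n / ?N)\<^sup>2)" by (intro mult_left_mono le) simp
      also have "\<dots> = \<bar>w n\<bar> * (w n / ?N)\<^sup>2" by (simp add: abs_divide del: of_nat_Suc)
      finally show "norm (?N * arctan (w n / ?N) - w n) \<le> \<bar>w n\<bar> * (w n / ?N)\<^sup>2" .
    qed
    have "(\<lambda>n. \<bar>w n\<bar> * (w n / real (Suc n))\<^sup>2) \<longlonglongrightarrow> \<bar>m\<bar> * 0\<^sup>2"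
      by (intro tendsto_mult tendsto_rabs w tendsto_power q)
    then show "(\<lambda>n. \<bar>w n\<bar> * (w n / real (Suc n))\<^sup>2) \<longlonglongrightarrow> 0" by simp
  qed
  from tendsto_add[OF this w] show "(\<lambda>n. real (Suc n) * arctan (w n / real (Suc n))) \<longlonglongrightarrow> m" by simp
qed

lemma bounded_over_LIMSEQ:
  assumes "\<And>n. \<bar>b n\<bar> \<le> (C::real)"
  shows "(\<lambda>n. b n / real (Suc n)) \<longlonglongrightarrow> 0"
proof (rule Lim_null_comparison)
  show "\<forall>\<^sub>F n in sequentially. norm (b n / real (Suc n)) \<le> C / real (Suc n)"
    using assms by (intro always_eventually allI) (simp add: abs_divide divide_right_mono del: of_nat_Suc)
  show "(\<lambda>n. C / real (Suc n)) \<longlonglongrightarrow> 0" by (rule mesh_LIMSEQ)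
qed

lemma arctan_le_2: "\<bar>arctan v\<bar> \<le> 2"
  using arctan_bounded[of v] pi_less_4 by (auto simp: abs_le_iff)

lemma shifted_max_mollified_max_LIMSEQ:
  assumes N: "\<And>n. N n = real (Suc n)"
  shows "(\<lambda>n. shifted_max (N n) m (a n)) \<longlonglongrightarrow> m" "(\<lambda>n. mollified_max (N n) m (a n)) \<longlonglongrightarrow> m" "(\<lambda>n. chi1 (N n) (shifted_max (N n) m (a n))) \<longlonglongrightarrow> 1"
proof -
  have "(\<lambda>n. m - arctan (N n * (m - a n)) / real (Suc n)) \<longlonglongrightarrow> m - 0"
    by (intro tendsto_diff tendsto_const bounded_over_LIMSEQ[OF arctan_le_2])
  then show w: "(\<lambda>n. shifted_max (N n) m (a n)) \<longlonglongrightarrow> m" by (simp add: shifted_max_def N)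
  show "(\<lambda>n. mollified_max (N n) m (a n)) \<longlonglongrightarrow> m" using mollified_max_LIMSEQ(1)[OF w] by (simp only: mollified_max_def N)
  have "(\<lambda>n. lorentz (shifted_max (N n) m (a n) / real (Suc n))) \<longlonglongrightarrow> lorentz 0"
    by (rule continuous_on_tendsto_compose[OF continuous_lorentz mollified_max_LIMSEQ(2)[OF w]]) auto
  then show "(\<lambda>n. chi1 (N n) (shifted_max (N n) m (a n))) \<longlonglongrightarrow> 1" by (simp add: chi1_def N lorentz_def)
qed

text \<open>At distance m - a from the diagonal, \<open>lorentz\<close> is at most 1 / (N (m - a)).
  On the diagonal itself \<open>alpha\<close> tends to 1, which is why the law of the pair must give
  the diagonal no mass.\<close>

lemma alpha_beta0_LIMSEQ:
  assumes N: "\<And>n. N n = real (Suc n)" and a: "a < m"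
  shows "(\<lambda>n. alpha (N n) m a) \<longlonglongrightarrow> 0" "(\<lambda>n. beta0 (N n) m a) \<longlonglongrightarrow> 0"
proof -
  show "(\<lambda>n. beta0 (N n) m a) \<longlonglongrightarrow> 0"
  proof (rule Lim_null_comparison)
    show "\<forall>\<^sub>F n in sequentially. norm (beta0 (N n) m a) \<le> 1 / real (Suc n)"
      using mollified_max_bounds(2)[of "real (Suc n)" for n] by (intro always_eventually allI) (simp add: N)
    show "(\<lambda>n. 1 / real (Suc n)) \<longlonglongrightarrow> 0" by (rule mesh_LIMSEQ)
  qed
  show "(\<lambda>n. alpha (N n) m a) \<longlonglongrightarrow> 0"
  proof (rule Lim_null_comparison)
    show "\<forall>\<^sub>F n in sequentially. norm (alpha (N n) m a) \<le> (1 / (m - a)) / real (Suc n)"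
    proof (intro always_eventually allI)
      fix n
      let ?v = "real (Suc n) * (m - a)"
      have v: "0 < ?v" using a by simp
      have "norm (alpha (N n) m a) = \<bar>chi1 (N n) (shifted_max (N n) m a)\<bar> * lorentz ?v"
        using lorentz_bounds(1)[of ?v] by (simp add: alpha_def abs_mult N)
      also have "\<dots> \<le> 1 * lorentz ?v"
        using lorentz_bounds(1)[of ?v] mollified_max_bounds(3)[of "real (Suc n)"] by (intro mult_right_mono) (auto simp: N)
      also have "lorentz ?v \<le> 1 / ?v"
      proof -
        have "?v \<le> 1 + ?v\<^sup>2" using sum_squares_bound[of ?v 1] v by (simp del: of_nat_Suc)
        then show ?thesis unfolding lorentz_def using v by (intro divide_left_mono) (auto intro!: mult_pos_pos add_pos_nonneg simp del: of_nat_Suc)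
      qed
      also have "1 / ?v = (1 / (m - a)) / real (Suc n)" by simp
      finally show "norm (alpha (N n) m a) \<le> (1 / (m - a)) / real (Suc n)" by simp
    qed
    show "(\<lambda>n. (1 / (m - a)) / real (Suc n)) \<longlonglongrightarrow> 0" by (rule mesh_LIMSEQ)
  qed
qed

context bounded_diffusion
begin

text \<open>The generator as a function of a prescribed gradient \<open>g\<close> and Hessian
  \<open>h\<close> at \<open>x\<close>, so that convergence of derivatives can be passed through
  it.\<close>

definition gen :: "('n \<Rightarrow> real) \<Rightarrow> ('n \<Rightarrow> 'n \<Rightarrow> real) \<Rightarrow> real^'n \<Rightarrow> real" where
  "gen g h x = (\<Sum>i\<in>UNIV. g i * B x $ i) + 1 / 2 * (\<Sum>i\<in>UNIV. \<Sum>k\<in>UNIV. h i k * (\<Sum>j\<in>UNIV. A x $ i $ j * A x $ k $ j))"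

lemma AA_bounded: "\<bar>\<Sum>j\<in>UNIV. A x $ i $ j * A x $ k $ j\<bar> \<le> real CARD('n) * K\<^sup>2"
proof -
  have "\<bar>\<Sum>j\<in>UNIV. A x $ i $ j * A x $ k $ j\<bar> \<le> (\<Sum>j\<in>(UNIV::'n set). K * K)"
    by (rule order_trans[OF sum_abs sum_mono]) (auto simp: abs_mult intro!: mult_mono A_bounded K_nonneg)
  then show ?thesis by (simp add: power2_eq_square)
qed

lemma gen_bounded:
  assumes g: "\<And>i. \<bar>g i\<bar> \<le> c" and h: "\<And>i k. \<bar>h i k\<bar> \<le> c"
  shows "\<bar>gen g h x\<bar> \<le> real CARD('n) * (c * K) + (real CARD('n))\<^sup>2 * (c * (real CARD('n) * K\<^sup>2))"
proof -
  have C0: "0 \<le> c" using g[of undefined] by linarith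
  have 1: "\<bar>\<Sum>i\<in>UNIV. g i * B x $ i\<bar> \<le> (\<Sum>i\<in>(UNIV::'n set). c * K)"
    by (rule order_trans[OF sum_abs sum_mono]) (auto simp: abs_mult intro!: mult_mono g B_nth_bounded C0)
  have 2: "\<bar>\<Sum>i\<in>UNIV. \<Sum>k\<in>UNIV. h i k * (\<Sum>j\<in>UNIV. A x $ i $ j * A x $ k $ j)\<bar> \<le>
     (\<Sum>i\<in>(UNIV::'n set). \<Sum>k\<in>(UNIV::'n set). c * (real CARD('n) * K\<^sup>2))"
    by (intro order_trans[OF sum_abs sum_mono]) (auto simp: abs_mult intro!: mult_mono h AA_bounded C0)
  have "0 \<le> (real CARD('n))\<^sup>2 * (c * (real CARD('n) * K\<^sup>2))" using C0 by simp
  then show ?thesis using 1 2 unfolding gen_def by (simp add: power2_eq_square mult.assoc)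
qed

lemma gen_continuous:
  fixes g :: "'n \<Rightarrow> real \<times> (real^'n) \<Rightarrow> real"
  assumes "\<And>i. continuous_on UNIV (g i)" "\<And>i k. continuous_on UNIV (h i k)"
  shows "continuous_on UNIV (\<lambda>z. gen (\<lambda>i. g i z) (\<lambda>i k. h i k z) (snd z))"
proof -
  have B': "continuous_on UNIV (\<lambda>z::real \<times> (real^'n). B (snd z) $ i)" for i
    by (rule continuous_on_compose2[OF B_nth_continuous]) (auto intro!: continuous_intros)
  have A': "continuous_on UNIV (\<lambda>z::real \<times> (real^'n). A (snd z) $ i $ j)" for i j
    by (rule continuous_on_compose2[OF A_continuous]) (auto intro!: continuous_intros)
  show ?thesis unfolding gen_def by (intro continuous_intros assms A' B')
qed

lemma gen_LIMSEQ:
  assumes "\<And>i. (\<lambda>n. g n i) \<longlonglongrightarrow> g' i" "\<And>i k. (\<lambda>n. h n i k) \<longlonglongrightarrow> h' i k"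
  shows "(\<lambda>n. gen (g n) (h n) x) \<longlonglongrightarrow> gen g' h' x"
  unfolding gen_def by (intro tendsto_intros assms)

end

text \<open>Here \<open>\<Psi>\<close> is the function \<open>F\<close> of the theorem, that letter
  being taken by the filtration, and \<open>f1\<close>, \<open>f2\<close> are its derivatives in all
  variables jointly. The Ito formula is applied to \<open>\<Psi>\<close> after
  \<open>mollified_point\<close>.\<close>

locale smooth_function = bounded_diffusion P W X B A K
  for P :: "'a measure" and W X :: "real \<Rightarrow> 'a \<Rightarrow> real ^ 'n"
    and B :: "real ^ 'n \<Rightarrow> real ^ 'n" and A :: "real ^ 'n \<Rightarrow> real ^ 'n ^ 'n" and K :: real +
  fixes i1 :: 'n and \<Psi> :: "real \<times> (real^'n) \<Rightarrow> real"
    and f1 :: "real \<times> (real^'n) \<Rightarrow> (real \<times> (real^'n)) \<Rightarrow>\<^sub>L real"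
    and f2 :: "real \<times> (real^'n) \<Rightarrow> (real \<times> (real^'n)) \<Rightarrow>\<^sub>L (real \<times> (real^'n)) \<Rightarrow>\<^sub>L real"
    and c :: real
  assumes \<Psi>_bound: "\<bar>\<Psi> z\<bar> \<le> c" and f1_bound: "norm (f1 z) \<le> c" and f2_bound: "norm (f2 z) \<le> c"
    and \<Psi>_deriv: "(\<Psi> has_derivative f1 z) (at z)" and f1_deriv: "(f1 has_derivative f2 z) (at z)"
    and f2_cont: "continuous_on UNIV f2"
begin

lemma c_nonneg: "0 \<le> c"
  using \<Psi>_bound[of undefined] by linarith

lemma f1_cont: "continuous_on UNIV f1"
  using f1_deriv by (intro continuous_at_imp_continuous_on ballI has_derivative_continuous)

lemma \<Psi>_cont: "continuous_on UNIV \<Psi>"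
  using \<Psi>_deriv by (intro continuous_at_imp_continuous_on ballI has_derivative_continuous)

definition coord_delta :: "'n \<Rightarrow> real" where "coord_delta i = (if i = i1 then 1 else 0)"

text \<open>
  The derivative of \<open>mollified_point N\<close> in the direction \<open>(0, axis i 1)\<close> is
  \<open>chain_dir a i\<close>, where \<open>a\<close> is the derivative of the mollified maximum in \<open>x\<close>.
\<close>

definition chain_dir :: "real \<Rightarrow> 'n \<Rightarrow> real \<times> (real^'n)" where "chain_dir a i = (coord_delta i * a, axis i 1)"

lemma norm_chain_dir: "\<bar>a\<bar> \<le> 1 \<Longrightarrow> norm (chain_dir a i) \<le> 2"
  using norm_Pair_le[of "coord_delta i * a" "axis i 1 :: real^'n"] by (simp add: chain_dir_def coord_delta_def split: if_splits)

definition mollified_point :: "real \<Rightarrow> real \<times> (real^'n) \<Rightarrow> real \<times> (real^'n)" where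
  "mollified_point N z = (mollified_max N (fst z) (snd z $ i1), snd z)"

definition alpha_at :: "real \<Rightarrow> real \<times> (real^'n) \<Rightarrow> real" where "alpha_at N z = alpha N (fst z) (snd z $ i1)"

definition gN :: "real \<Rightarrow> 'n \<Rightarrow> real \<times> (real^'n) \<Rightarrow> real" where
  "gN N i z = f1 (mollified_point N z) (chain_dir (alpha_at N z) i)"

text \<open>Second derivative of the mollified function, with the second derivative of the mollified
  maximum left open as \<open>b\<close>: \<open>beta\<close> gives the true one,
  \<open>beta0\<close> the part that stays bounded in \<open>N\<close>.\<close>

definition h0 :: "real \<Rightarrow> real \<Rightarrow> 'n \<Rightarrow> 'n \<Rightarrow> real \<times> (real^'n) \<Rightarrow> real" where
  "h0 N b i k z = f2 (mollified_point N z) (chain_dir (alpha_at N z) k) (chain_dir (alpha_at N z) i) + coord_delta i * coord_delta k * (b * f1 (mollified_point N z) (1, 0))"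

definition hN :: "real \<Rightarrow> 'n \<Rightarrow> 'n \<Rightarrow> real \<times> (real^'n) \<Rightarrow> real" where
  "hN N i k z = h0 N (beta N (fst z) (snd z $ i1)) i k z"

lemma partial_m_bounded: "\<bar>f1 z (1, 0)\<bar> \<le> c"
  using norm_blinfun[of "f1 z" "(1, 0)"] f1_bound[of z] by (simp add: norm_Pair)

lemma gN_bound: "1 \<le> N \<Longrightarrow> \<bar>gN N i z\<bar> \<le> 2 * c"
proof -
  assume "1 \<le> N"
  have "\<bar>gN N i z\<bar> \<le> norm (f1 (mollified_point N z)) * norm (chain_dir (alpha_at N z) i)"
    unfolding gN_def using norm_blinfun[of "f1 (mollified_point N z)" "chain_dir (alpha_at N z) i"] by simp
  also have "\<dots> \<le> c * 2"
    using mollified_max_bounds(1)[OF \<open>1 \<le> N\<close>] c_nonneg by (intro mult_mono f1_bound norm_chain_dir) (auto simp: alpha_at_def)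
  finally show ?thesis by simp
qed

lemma h0_bound: "1 \<le> N \<Longrightarrow> \<bar>b\<bar> \<le> b' \<Longrightarrow> \<bar>h0 N b i k z\<bar> \<le> (4 + b') * c"
proof -
  assume N: "1 \<le> N" and b: "\<bar>b\<bar> \<le> b'"
  have n: "norm (chain_dir (alpha_at N z) i) \<le> 2" for i using mollified_max_bounds(1)[OF N] by (intro norm_chain_dir) (simp add: alpha_at_def)
  have "\<bar>f2 (mollified_point N z) (chain_dir (alpha_at N z) k) (chain_dir (alpha_at N z) i)\<bar> \<le> norm (f2 (mollified_point N z)) * norm (chain_dir (alpha_at N z) k) * norm (chain_dir (alpha_at N z) i)"
    by (rule norm_blinfun2)
  also have "\<dots> \<le> c * 2 * 2" using c_nonneg by (intro mult_mono f2_bound n) auto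
  finally have 1: "\<bar>f2 (mollified_point N z) (chain_dir (alpha_at N z) k) (chain_dir (alpha_at N z) i)\<bar> \<le> 4 * c" by simp
  have "\<bar>b * f1 (mollified_point N z) (1, 0)\<bar> \<le> b' * c"
    unfolding abs_mult using b by (intro mult_mono partial_m_bounded) auto
  moreover have "\<bar>coord_delta i * coord_delta k * (b * f1 (mollified_point N z) (1, 0))\<bar> \<le> \<bar>b * f1 (mollified_point N z) (1, 0)\<bar>" by (simp add: coord_delta_def)
  ultimately show ?thesis using 1 unfolding h0_def by (simp add: distrib_right)
qed

lemma fst_snd_cont: "continuous_on UNIV (\<lambda>z::real \<times> (real^'n). fst z)" "continuous_on UNIV (\<lambda>z::real \<times> (real^'n). snd z $ i)"
  by (intro continuous_intros)+

lemma N_cont: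
  assumes N: "0 < N"
  shows "continuous_on UNIV (mollified_point N)" "continuous_on UNIV (alpha_at N)" "continuous_on UNIV (gN N i)"
    "continuous_on UNIV b \<Longrightarrow> continuous_on UNIV (\<lambda>z. h0 N (b z) i k z)"
    "continuous_on UNIV (\<lambda>z. f1 (mollified_point N z) (1, 0))" "continuous_on UNIV (\<lambda>z. \<Psi> (mollified_point N z))"
proof -
  note cp = continuous_mollified_max[OF N fst_snd_cont]
  show mollified_point: "continuous_on UNIV (mollified_point N)" unfolding mollified_point_def by (intro continuous_intros cp)
  show alpha_at: "continuous_on UNIV (alpha_at N)" unfolding alpha_at_def by (rule cp)
  have f: "continuous_on UNIV (\<lambda>z. f1 (mollified_point N z))" "continuous_on UNIV (\<lambda>z. f2 (mollified_point N z))"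
    using continuous_on_compose2[OF f1_cont mollified_point] continuous_on_compose2[OF f2_cont mollified_point] by auto
  have chain_dir: "continuous_on UNIV (\<lambda>z. chain_dir (alpha_at N z) i)" for i unfolding chain_dir_def by (intro continuous_intros alpha_at)
  show "continuous_on UNIV (gN N i)" unfolding gN_def by (intro continuous_intros f chain_dir)
  show "continuous_on UNIV b \<Longrightarrow> continuous_on UNIV (\<lambda>z. h0 N (b z) i k z)"
    unfolding h0_def by (intro continuous_intros f chain_dir)
  show "continuous_on UNIV (\<lambda>z. f1 (mollified_point N z) (1, 0))" by (intro continuous_intros f)
  show "continuous_on UNIV (\<lambda>z. \<Psi> (mollified_point N z))" using continuous_on_compose2[OF \<Psi>_cont mollified_point] by auto
qed

lemma mollified_point_deriv:
  assumes N: "0 < N"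
  shows "((\<lambda>x. mollified_point N (m, x)) has_derivative (\<lambda>h. (alpha N m (x $ i1) * h $ i1, h))) (at x)"
    "((\<lambda>x. alpha_at N (m, x)) has_derivative (\<lambda>h. beta N m (x $ i1) * h $ i1)) (at x)"
proof -
  have l: "((\<lambda>x. x $ i1) has_derivative (\<lambda>h. h $ i1)) (at x)" for x :: "real^'n"
    by (rule bounded_linear_imp_has_derivative) (rule bounded_linear_vec_nth)
  have "((\<lambda>x. mollified_max N m (x $ i1)) has_derivative (\<lambda>h. alpha N m (x $ i1) * h $ i1)) (at x)"
    using has_derivative_compose[OF l DERIV_mollified_max(1)[OF N, unfolded has_field_derivative_def]] .
  then show "((\<lambda>x. mollified_point N (m, x)) has_derivative (\<lambda>h. (alpha N m (x $ i1) * h $ i1, h))) (at x)"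
    unfolding mollified_point_def by (auto intro!: has_derivative_Pair)
  show "((\<lambda>x. alpha_at N (m, x)) has_derivative (\<lambda>h. beta N m (x $ i1) * h $ i1)) (at x)"
    unfolding alpha_at_def using has_derivative_compose[OF l DERIV_mollified_max(3)[OF N, unfolded has_field_derivative_def]] by simp
qed

lemma direction_sum: "(a * h $ i1, h) = (\<Sum>i\<in>UNIV. h $ i *\<^sub>R chain_dir a i)"
proof (rule prod_eqI)
  have "(\<Sum>i\<in>UNIV. h $ i * (coord_delta i * a)) = (\<Sum>i\<in>UNIV. if i = i1 then a * h $ i else 0)"
    by (intro sum.cong) (auto simp: coord_delta_def)
  then show "fst (a * h $ i1, h) = fst (\<Sum>i\<in>UNIV. h $ i *\<^sub>R chain_dir a i)" by (simp add: fst_sum chain_dir_def)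
  show "snd (a * h $ i1, h) = snd (\<Sum>i\<in>UNIV. h $ i *\<^sub>R chain_dir a i)"
    using basis_expansion[of h] by (simp add: snd_sum chain_dir_def scalar_mult_eq_scaleR)
qed

lemma mollified_ito:
  assumes N: "1 \<le> N" and t: "0 < t"
  shows "expectation (\<lambda>\<omega>. \<Psi> (mollified_point N (V i1 t \<omega>))) = expectation (\<lambda>\<omega>. \<Psi> (mollified_point N (V i1 0 \<omega>))) +
     (LINT s:{0..t}|lborel. expectation (\<lambda>\<omega>. gen (\<lambda>i. gN N i (V i1 s \<omega>)) (\<lambda>i k. hN N i k (V i1 s \<omega>)) (X s \<omega>)))"
proof -
  have N0: "0 < N" using N by simp
  \<comment> \<open>The term 5 + N covers the function and its derivatives in \<open>x\<close>, the
    Hessian needing 4 + (1 + N) by \<open>h0_bound\<close>; the term 9 N^3 covers the derivative in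
    \<open>m\<close>.\<close>
  define c' where "c' = (5 + N + 9 * N ^ 3) * c"
  have c': "x \<le> c'" if "x \<le> (5 + N) * c" for x
    using that c_nonneg N0 by (simp add: c'_def distrib_right add_increasing2)
  have c1: "b * c \<le> (5 + N) * c" if "b \<le> 5 + N" for b using that c_nonneg by (rule mult_right_mono)
  show ?thesis
    unfolding gen_def
  proof (rule ito_coordinates[where c = c' and \<Psi> = "\<lambda>z. \<Psi> (mollified_point N z)" and
        r = "\<lambda>m x. f1 (mollified_point N (m, x)) (1, 0) * (chi1 N (shifted_max N m (x $ i1)) * (1 - lorentz (N * (m - x $ i1))))"])
    show "continuous_on UNIV (\<lambda>z. \<Psi> (mollified_point N z))" "continuous_on UNIV (gN N i)" for i by (rule N_cont[OF N0])+
    show "continuous_on UNIV (hN N i k)" for i k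
      unfolding hN_def[abs_def] by (intro N_cont[OF N0] continuous_mollified_max[OF N0 fst_snd_cont])
    show "\<bar>\<Psi> (mollified_point N z)\<bar> \<le> c'" for z using \<Psi>_bound[of "mollified_point N z"] c1[of 1] N by (intro c') simp
    show "\<bar>gN N i z\<bar> \<le> c'" for i z using gN_bound[OF N, of i z] c1[of 2] N by (intro c') simp
    show "\<bar>hN N i k z\<bar> \<le> c'" for i k z
      unfolding hN_def using h0_bound[OF N mollified_max_bounds(4)[OF N]] by (intro c') (simp add: add.assoc[symmetric])
    show "((\<lambda>x. \<Psi> (mollified_point N (m, x))) has_derivative (\<lambda>h. \<Sum>i\<in>UNIV. h $ i * gN N i (m, x))) (at x)" for m x
    proof -
      have "((\<lambda>x. \<Psi> (mollified_point N (m, x))) has_derivative (\<lambda>h. f1 (mollified_point N (m, x)) (alpha N m (x $ i1) * h $ i1, h))) (at x)"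
        by (rule has_derivative_compose[OF mollified_point_deriv(1)[OF N0] \<Psi>_deriv])
      then show ?thesis unfolding direction_sum by (simp add: blinfun.sum_right blinfun.scaleR_right gN_def alpha_at_def)
    qed
    show "((\<lambda>x. gN N i (m, x)) has_derivative (\<lambda>h. \<Sum>k\<in>UNIV. h $ k * hN N i k (m, x))) (at x)" for i m x
    proof -
      have d1: "((\<lambda>x. f1 (mollified_point N (m, x))) has_derivative (\<lambda>h. f2 (mollified_point N (m, x)) (alpha N m (x $ i1) * h $ i1, h))) (at x)"
        by (rule has_derivative_compose[OF mollified_point_deriv(1)[OF N0] f1_deriv])
      have d2: "((\<lambda>x. chain_dir (alpha_at N (m, x)) i) has_derivative (\<lambda>h. (coord_delta i * (beta N m (x $ i1) * h $ i1), 0))) (at x)"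
        unfolding chain_dir_def by (intro has_derivative_Pair has_derivative_mult_right mollified_point_deriv(2)[OF N0] has_derivative_const)
      have "((\<lambda>x. gN N i (m, x)) has_derivative (\<lambda>h. f1 (mollified_point N (m, x)) (coord_delta i * (beta N m (x $ i1) * h $ i1), 0) +
          f2 (mollified_point N (m, x)) (alpha N m (x $ i1) * h $ i1, h) (chain_dir (alpha_at N (m, x)) i))) (at x)"
        unfolding gN_def by (rule bounded_bilinear.FDERIV[OF bounded_bilinear_blinfun_apply d1 d2])
      moreover have "f1 (mollified_point N (m, x)) (coord_delta i * (beta N m (x $ i1) * h $ i1), 0) +
          f2 (mollified_point N (m, x)) (alpha N m (x $ i1) * h $ i1, h) (chain_dir (alpha_at N (m, x)) i) = (\<Sum>k\<in>UNIV. h $ k * hN N i k (m, x))" for h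
      proof -
        have "(coord_delta i * (beta N m (x $ i1) * h $ i1), 0 :: real^'n) = (coord_delta i * (beta N m (x $ i1) * h $ i1)) *\<^sub>R (1, 0)" by simp
        then have 1: "f1 (mollified_point N (m, x)) (coord_delta i * (beta N m (x $ i1) * h $ i1), 0) = coord_delta i * (beta N m (x $ i1) * h $ i1) * f1 (mollified_point N (m, x)) (1, 0)"
          by (simp only: blinfun.scaleR_right real_scaleR_def)
        have "(\<Sum>k\<in>UNIV. h $ k * (coord_delta i * coord_delta k * (beta N m (x $ i1) * f1 (mollified_point N (m, x)) (1, 0)))) =
          (\<Sum>k\<in>UNIV. if k = i1 then coord_delta i * (beta N m (x $ i1) * h $ k) * f1 (mollified_point N (m, x)) (1, 0) else 0)"
          by (intro sum.cong) (auto simp: coord_delta_def)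
        also have "\<dots> = coord_delta i * (beta N m (x $ i1) * h $ i1) * f1 (mollified_point N (m, x)) (1, 0)" by simp
        finally show ?thesis
          unfolding 1 direction_sum hN_def h0_def
          by (simp add: blinfun.sum_right blinfun.sum_left blinfun.scaleR_right blinfun.scaleR_left distrib_left sum.distrib alpha_at_def)
      qed
      ultimately show ?thesis by simp
    qed
    show "((\<lambda>m. \<Psi> (mollified_point N (m, x))) has_real_derivative f1 (mollified_point N (m, x)) (1, 0) * (chi1 N (shifted_max N m (x $ i1)) * (1 - lorentz (N * (m - x $ i1))))) (at m)" for m x
    proof -
      let ?d = "chi1 N (shifted_max N m (x $ i1)) * (1 - lorentz (N * (m - x $ i1)))"
      have "((\<lambda>m. mollified_point N (m, x)) has_derivative (\<lambda>h. (?d * h, 0))) (at m)"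
        unfolding mollified_point_def using DERIV_mollified_max(2)[OF N0, where m = m and a = "x $ i1"]
        by (auto intro!: has_derivative_Pair simp: has_field_derivative_def)
      from has_derivative_compose[OF this \<Psi>_deriv]
      have "((\<lambda>m. \<Psi> (mollified_point N (m, x))) has_derivative (\<lambda>h. f1 (mollified_point N (m, x)) (?d * h, 0))) (at m)" .
      moreover have "(\<lambda>h. f1 (mollified_point N (m, x)) (?d * h, 0)) = (*) (f1 (mollified_point N (m, x)) (1, 0) * ?d)"
      proof
        fix h
        have "(?d * h, 0 :: real^'n) = (?d * h) *\<^sub>R (1, 0)" by simp
        then show "f1 (mollified_point N (m, x)) (?d * h, 0) = f1 (mollified_point N (m, x)) (1, 0) * ?d * h"
          by (simp only: blinfun.scaleR_right real_scaleR_def) simp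
      qed
      ultimately show ?thesis unfolding has_field_derivative_def by (simp only:)
    qed
    show "\<bar>f1 (mollified_point N (m, x)) (1, 0) * (chi1 N (shifted_max N m (x $ i1)) * (1 - lorentz (N * (m - x $ i1))))\<bar> \<le> c' * min 1 \<bar>m - x $ i1\<bar> / (1 + m\<^sup>2)" for m x
    proof -
      have "\<bar>f1 (mollified_point N (m, x)) (1, 0) * (chi1 N (shifted_max N m (x $ i1)) * (1 - lorentz (N * (m - x $ i1))))\<bar> \<le>
         c * (9 * N ^ 3 * min 1 \<bar>m - x $ i1\<bar> / (1 + m\<^sup>2))"
        unfolding abs_mult[of "f1 (mollified_point N (m, x)) (1, 0)"] using c_nonneg by (intro mult_mono partial_m_bounded mollified_max_bounds(5)[OF N]) auto
      also have "\<dots> = (9 * N ^ 3 * c) * min 1 \<bar>m - x $ i1\<bar> / (1 + m\<^sup>2)" by simp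
      also have "\<dots> \<le> c' * min 1 \<bar>m - x $ i1\<bar> / (1 + m\<^sup>2)"
      proof -
        have "9 * N ^ 3 * c \<le> c'" unfolding c'_def using c_nonneg N0 by (intro mult_right_mono) auto
        then show ?thesis by (intro divide_right_mono mult_right_mono) auto
      qed
      finally show ?thesis .
    qed
  qed (rule t)
qed

end

section \<open>Removing the mollification\<close>

context smooth_function
begin

text \<open>The factor that multiplies the concentrating kernel; \<open>smooth_weight\<close> is
  what is left of the generator, bounded uniformly in \<open>N\<close>.\<close>

definition kernel_weight :: "real \<Rightarrow> real \<times> (real^'n) \<Rightarrow> real" where
  "kernel_weight N z = (norm (A (snd z) $ i1))\<^sup>2 * chi1 N (shifted_max N (fst z) (snd z $ i1)) * f1 (mollified_point N z) (1, 0)"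

definition smooth_weight :: "real \<Rightarrow> real \<times> (real^'n) \<Rightarrow> real" where
  "smooth_weight N z = gen (\<lambda>i. gN N i z) (\<lambda>i k. h0 N (beta0 N (fst z) (snd z $ i1)) i k z) (snd z)"

definition generator_form :: "real \<times> (real^'n) \<Rightarrow> real" where
  "generator_form z = gen (\<lambda>i. f1 z (0, axis i 1)) (\<lambda>i k. f2 z (0, axis k 1) (0, axis i 1)) (snd z)"

abbreviation M :: "real \<Rightarrow> 'a \<Rightarrow> real" where "M \<equiv> running_sup i1 X"

lemma norm_A_row: "(norm (A x $ i1))\<^sup>2 = (\<Sum>j\<in>UNIV. A x $ i1 $ j * A x $ i1 $ j)"
  unfolding norm_power2_vec by (simp add: power2_eq_square)

text \<open>The second derivative of the mollified maximum enters the entry \<open>(i1, i1)\<close>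
  of the Hessian alone and is paired with the same entry of \<open>A A^t\<close>. This is where the
  squared norm of the first row of \<open>A\<close> comes from.\<close>

lemma gen_split:
  "gen (\<lambda>i. gN N i z) (\<lambda>i k. hN N i k z) (snd z) =
     smooth_weight N z + 1 / 2 * (kernel_weight N z * (N * lorentz_slope (N * (fst z - snd z $ i1))))"
proof -
  let ?k = "chi1 N (shifted_max N (fst z) (snd z $ i1)) * (N * lorentz_slope (N * (fst z - snd z $ i1))) * f1 (mollified_point N z) (1, 0)"
  let ?a = "\<lambda>i k. \<Sum>j\<in>UNIV. A (snd z) $ i $ j * A (snd z) $ k $ j"
  have h: "hN N i k z = h0 N (beta0 N (fst z) (snd z $ i1)) i k z + coord_delta i * coord_delta k * ?k" for i k
    unfolding hN_def h0_def beta_def by (simp add: algebra_simps)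
  have "(\<Sum>k\<in>UNIV. (coord_delta i * coord_delta k * ?k) * ?a i k) = (if i = i1 then ?k * ?a i1 i1 else 0)" for i
  proof -
    have "(\<Sum>k\<in>UNIV. (coord_delta i * coord_delta k * ?k) * ?a i k) = (\<Sum>k\<in>UNIV. if k = i1 then coord_delta i * ?k * ?a i k else 0)"
      by (intro sum.cong) (auto simp: coord_delta_def)
    also have "\<dots> = coord_delta i * ?k * ?a i i1" by simp
    finally show ?thesis by (simp add: coord_delta_def)
  qed
  then have "(\<Sum>i\<in>UNIV. \<Sum>k\<in>UNIV. (coord_delta i * coord_delta k * ?k) * ?a i k) = (\<Sum>i\<in>UNIV. if i = i1 then ?k * ?a i1 i1 else 0)"
    by (intro sum.cong refl)
  also have "\<dots> = ?k * ?a i1 i1" by simp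
  finally have "(\<Sum>i\<in>UNIV. \<Sum>k\<in>UNIV. (coord_delta i * coord_delta k * ?k) * ?a i k) = ?k * (norm (A (snd z) $ i1))\<^sup>2"
    by (simp add: norm_A_row)
  then show ?thesis
    unfolding smooth_weight_def gen_def h distrib_right[of _ "coord_delta _ * coord_delta _ * _"] sum.distrib by (simp add: kernel_weight_def algebra_simps)
qed

lemma smooth_weight_bound:
  obtains C where "\<And>n z. \<bar>smooth_weight (real (Suc n)) z\<bar> \<le> C" "\<And>z. \<bar>generator_form z\<bar> \<le> C"
proof
  \<comment> \<open>The 5 is 4 + 1: \<open>h0_bound\<close> is used with \<open>beta0\<close> at
    most 1 / N, hence at most 1.\<close>
  let ?C = "real CARD('n) * (5 * c * K) + (real CARD('n))\<^sup>2 * (5 * c * (real CARD('n) * K\<^sup>2))"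
  show "\<bar>smooth_weight (real (Suc n)) z\<bar> \<le> ?C" for n z
    unfolding smooth_weight_def
  proof (rule gen_bounded)
    show "\<bar>gN (real (Suc n)) i z\<bar> \<le> 5 * c" for i using gN_bound[of "real (Suc n)" i z] c_nonneg by simp
    have "\<bar>beta0 (real (Suc n)) (fst z) (snd z $ i1)\<bar> \<le> 1 / real (Suc n)" by (rule mollified_max_bounds) simp
    also have "\<dots> \<le> 1" by simp
    finally show "\<bar>h0 (real (Suc n)) (beta0 (real (Suc n)) (fst z) (snd z $ i1)) i k z\<bar> \<le> 5 * c" for i k
      using h0_bound[of "real (Suc n)" _ 1 i k z] by simp
  qed
  show "\<bar>generator_form z\<bar> \<le> ?C" for z
    unfolding generator_form_def
  proof (rule gen_bounded)
    have n: "norm (0 :: real, axis i 1 :: real^'n) \<le> 1" for i by (simp add: norm_Pair)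
    show "\<bar>f1 z (0, axis i 1)\<bar> \<le> 5 * c" for i
    proof -
      have "\<bar>f1 z (0, axis i 1)\<bar> \<le> norm (f1 z) * norm (0 :: real, axis i 1 :: real^'n)" using norm_blinfun[of "f1 z" "(0, axis i 1)"] by simp
      also have "\<dots> \<le> c * 1" using c_nonneg by (intro mult_mono f1_bound n) auto
      finally show ?thesis using c_nonneg by simp
    qed
    show "\<bar>f2 z (0, axis k 1) (0, axis i 1)\<bar> \<le> 5 * c" for i k
    proof -
      have "\<bar>f2 z (0, axis k 1) (0, axis i 1)\<bar> \<le> norm (f2 z) * norm (0 :: real, axis k 1 :: real^'n) * norm (0 :: real, axis i 1 :: real^'n)"
        by (rule norm_blinfun2)
      also have "\<dots> \<le> c * 1 * 1" using c_nonneg by (intro mult_mono f2_bound n) auto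
      finally show ?thesis using c_nonneg by simp
    qed
  qed
qed

lemma kernel_weight_bound: "\<bar>kernel_weight N z\<bar> \<le> real CARD('n) * K\<^sup>2 * c"
proof -
  have 1: "\<bar>(norm (A (snd z) $ i1))\<^sup>2\<bar> \<le> real CARD('n) * K\<^sup>2"
    unfolding norm_A_row by (rule AA_bounded)
  have 2: "\<bar>chi1 N (shifted_max N (fst z) (snd z $ i1))\<bar> \<le> 1" unfolding chi1_def by (rule lorentz_bounds)
  have "\<bar>kernel_weight N z\<bar> \<le> real CARD('n) * K\<^sup>2 * 1 * c"
    unfolding kernel_weight_def abs_mult by (intro mult_mono 1[unfolded abs_mult] 2 partial_m_bounded) (use 1 in \<open>auto simp: abs_mult\<close>)
  then show ?thesis by simp
qed

lemma A_row_cont: "continuous_on UNIV (\<lambda>x. (norm (A x $ i1))\<^sup>2)"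
  unfolding norm_A_row by (intro continuous_intros A_continuous)

lemma kernel_weight_cont: "0 < N \<Longrightarrow> continuous_on UNIV (kernel_weight N)"
  unfolding kernel_weight_def
  by (intro continuous_intros N_cont continuous_mollified_max fst_snd_cont continuous_on_compose2[OF A_row_cont]) auto

lemma smooth_weight_cont: "0 < N \<Longrightarrow> continuous_on UNIV (smooth_weight N)"
  unfolding smooth_weight_def by (intro gen_continuous N_cont continuous_mollified_max fst_snd_cont)

lemma generator_form_cont: "continuous_on UNIV generator_form"
  unfolding generator_form_def by (intro gen_continuous continuous_intros f1_cont f2_cont)

lemma f_LIMSEQ:
  assumes "z \<longlonglongrightarrow> z'"
  shows "(\<lambda>n. \<Psi> (z n)) \<longlonglongrightarrow> \<Psi> z'" "(\<lambda>n. f1 (z n)) \<longlonglongrightarrow> f1 z'" "(\<lambda>n. f2 (z n)) \<longlonglongrightarrow> f2 z'"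
  using continuous_on_tendsto_compose[OF \<Psi>_cont assms] continuous_on_tendsto_compose[OF f1_cont assms]
    continuous_on_tendsto_compose[OF f2_cont assms] by auto

lemma mollified_point_LIMSEQ: "(\<lambda>n. mollified_point (real (Suc n)) z) \<longlonglongrightarrow> z"
  using tendsto_Pair[OF shifted_max_mollified_max_LIMSEQ(2)[of "\<lambda>n. real (Suc n)" "fst z" "\<lambda>_. snd z $ i1"] tendsto_const[of "snd z"]]
  by (simp add: mollified_point_def)

lemma smooth_weight_LIMSEQ:
  assumes "snd z $ i1 < fst z"
  shows "(\<lambda>n. smooth_weight (real (Suc n)) z) \<longlonglongrightarrow> generator_form z"
  unfolding smooth_weight_def generator_form_def
proof (rule gen_LIMSEQ)
  note f = f_LIMSEQ[OF mollified_point_LIMSEQ[of z]]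
  have alpha_at: "(\<lambda>n. alpha_at (real (Suc n)) z) \<longlonglongrightarrow> 0"
    unfolding alpha_at_def by (rule alpha_beta0_LIMSEQ(1)[of "\<lambda>n. real (Suc n)", OF refl assms])
  have chain_dir: "(\<lambda>n. chain_dir (alpha_at (real (Suc n)) z) i) \<longlonglongrightarrow> (0, axis i 1)" for i
    using tendsto_Pair[OF tendsto_mult[OF tendsto_const[of "coord_delta i"] alpha_at] tendsto_const[of "axis i 1"]] by (simp add: chain_dir_def)
  show "(\<lambda>n. gN (real (Suc n)) i z) \<longlonglongrightarrow> f1 z (0, axis i 1)" for i
    unfolding gN_def by (intro blinfun.tendsto f chain_dir)
  have "(\<lambda>n. h0 (real (Suc n)) (beta0 (real (Suc n)) (fst z) (snd z $ i1)) i k z) \<longlonglongrightarrow>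
     f2 z (0, axis k 1) (0, axis i 1) + coord_delta i * coord_delta k * (0 * f1 z (1, 0))" for i k
    unfolding h0_def
    by (intro tendsto_add tendsto_mult tendsto_const blinfun.tendsto f chain_dir
      alpha_beta0_LIMSEQ(2)[of "\<lambda>n. real (Suc n)", OF refl assms])
  then show "(\<lambda>n. h0 (real (Suc n)) (beta0 (real (Suc n)) (fst z) (snd z $ i1)) i k z) \<longlonglongrightarrow> f2 z (0, axis k 1) (0, axis i 1)" for i k
    by simp
qed

definition diag_limit :: "real^'n \<Rightarrow> real" where
  "diag_limit y = (norm (A y $ i1))\<^sup>2 * f1 (y $ i1, y) (1, 0)"

lemma diag_limit_measurable: "diag_limit \<in> borel_measurable borel"
proof (rule borel_measurable_continuous_onI)
  have "continuous_on UNIV (\<lambda>y::real^'n. f1 (y $ i1, y))"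
    by (rule continuous_on_compose2[OF f1_cont]) (auto intro!: continuous_intros)
  then show "continuous_on UNIV diag_limit" unfolding diag_limit_def by (intro continuous_intros A_row_cont)
qed

text \<open>The argument approaches the diagonal while the mollification sharpens. No rate is
  involved: the shifted and the mollified maximum converge to \<open>m\<close> whatever sequence
  stands in their last argument.\<close>

lemma kernel_weight_LIMSEQ: "(\<lambda>n. kernel_weight (real (Suc n)) (below_diag i1 y (v / real (Suc n)))) \<longlonglongrightarrow> diag_limit y"
proof -
  let ?N = "\<lambda>n. real (Suc n)"
  let ?x = "\<lambda>n. y - (v / ?N n) *\<^sub>R axis i1 1"
  have "(\<lambda>n. y - (v / ?N n) *\<^sub>R axis i1 1) \<longlonglongrightarrow> y - 0 *\<^sub>R axis i1 1"
    by (intro tendsto_diff tendsto_const tendsto_scaleR mesh_LIMSEQ)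
  then have x: "?x \<longlonglongrightarrow> y" by simp
  have a: "(\<lambda>n. (norm (A (?x n) $ i1))\<^sup>2) \<longlonglongrightarrow> (norm (A y $ i1))\<^sup>2"
    by (rule continuous_on_tendsto_compose[OF A_row_cont x]) auto
  note w = shifted_max_mollified_max_LIMSEQ[of ?N, OF refl, of "y $ i1" "\<lambda>n. ?x n $ i1"]
  have "(\<lambda>n. (mollified_max (?N n) (y $ i1) (?x n $ i1), ?x n)) \<longlonglongrightarrow> (y $ i1, y)"
    by (intro tendsto_Pair w x)
  from f_LIMSEQ(2)[OF this]
  have "(\<lambda>n. (norm (A (?x n) $ i1))\<^sup>2 * chi1 (?N n) (shifted_max (?N n) (y $ i1) (?x n $ i1)) * f1 (mollified_max (?N n) (y $ i1) (?x n $ i1), ?x n) (1, 0))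
     \<longlonglongrightarrow> (norm (A y $ i1))\<^sup>2 * 1 * f1 (y $ i1, y) (1, 0)"
    by (intro tendsto_mult a w blinfun.tendsto tendsto_const)
  then show ?thesis by (simp add: kernel_weight_def diag_limit_def below_diag_def mollified_point_def)
qed

section \<open>Limits that use the densities and Hypothesis (H)\<close>

context
  fixes pV :: "real \<Rightarrow> real \<times> (real^'n) \<Rightarrow> real" and pX :: "real \<Rightarrow> real^'n \<Rightarrow> real"
  assumes pV_nonneg: "\<And>s z. 0 < s \<Longrightarrow> 0 \<le> pV s z"
    and pV: "\<And>s. 0 < s \<Longrightarrow> distributed P lborel (V i1 s) (\<lambda>z. ennreal (pV s z))"
    and pX_pos: "\<And>s x. 0 < s \<Longrightarrow> 0 < pX s x"
    and pX: "\<And>s. 0 < s \<Longrightarrow> distributed P lborel (X s) (\<lambda>x. ennreal (pX s x))"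
    and H: "hypothesis_H i1 pV"
begin

lemma pV_measurable: "0 < s \<Longrightarrow> pV s \<in> borel_measurable borel"
proof -
  assume s: "0 < s"
  have "(\<lambda>z. ennreal (pV s z)) \<in> borel_measurable lborel" by (rule distributed_borel_measurable[OF pV[OF s]])
  then have "(\<lambda>z. enn2real (ennreal (pV s z))) \<in> borel_measurable lborel" by measurable
  then show ?thesis using pV_nonneg[OF s] by simp
qed

lemma pX_measurable: "0 < s \<Longrightarrow> pX s \<in> borel_measurable borel"
proof -
  assume s: "0 < s"
  have "(\<lambda>z. ennreal (pX s z)) \<in> borel_measurable lborel" by (rule distributed_borel_measurable[OF pX[OF s]])
  then have "(\<lambda>z. enn2real (ennreal (pX s z))) \<in> borel_measurable lborel" by measurable
  then show ?thesis using less_imp_le[OF pX_pos[OF s]] by simp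
qed

text \<open>The diagonal is a Lebesgue null set and the law of the pair has a density, while the
  path never exceeds its running supremum.\<close>

lemma AE_off_diagonal: "0 < s \<Longrightarrow> AE \<omega> in P. X s \<omega> $ i1 < M s \<omega>"
proof -
  assume s: "0 < s"
  let ?D = "{z::real \<times> (real^'n). fst z = snd z $ i1}"
  have cl: "?D \<in> sets borel" by (intro borel_closed closed_Collect_eq continuous_intros)
  have "emeasure lborel ?D = (\<integral>\<^sup>+ z. indicator ?D z \<partial>lborel)" using cl by simp
  also have "\<dots> = (\<integral>\<^sup>+ u. (\<integral>\<^sup>+ y. indicator ?D (below_diag i1 (y::real^'n) u) \<partial>lborel) \<partial>lborel)"
    by (rule nn_integral_below_diag) (use cl in simp)
  also have "\<dots> = (\<integral>\<^sup>+ u. indicator {0::real} u * (\<integral>\<^sup>+ y. 1 \<partial>(lborel :: (real^'n) measure)) \<partial>lborel)"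
    by (intro nn_integral_cong) (auto simp: below_diag_def axis_def indicator_def)
  also have "\<dots> = 0"
    by (subst nn_integral_multc) auto
  finally have "?D \<in> null_sets lborel" using cl by (auto simp: null_sets_def)
  then have "AE z in lborel. 0 < ennreal (pV s z) \<longrightarrow> z \<notin> ?D" by (auto dest: AE_not_in)
  moreover have "Measurable.pred lborel (\<lambda>z. z \<notin> ?D)"
    using borel_comp[OF cl] unfolding pred_def by (simp add: Compl_eq)
  ultimately have "AE \<omega> in P. V i1 s \<omega> \<notin> ?D"
    using distributed_AE2[OF pV[OF s], of "\<lambda>z. z \<notin> ?D"] by blast
  then show ?thesis
    using AE_space
  proof eventually_elim
    case (elim \<omega>)
    then show ?case using sup_X(1)[OF elim(2), where s = s and t = s and i = i1] s by (auto simp: V_def)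
  qed
qed

text \<open>Uniform bounds permit bounded convergence twice, under the expectation and then in
  time.\<close>

lemma smooth_part_LIMSEQ:
  assumes t: "0 < t"
  shows "(\<lambda>n. LINT s:{0..t}|lborel. expectation (\<lambda>\<omega>. smooth_weight (real (Suc n)) (V i1 s \<omega>))) \<longlonglongrightarrow>
    (LINT s:{0..t}|lborel. expectation (\<lambda>\<omega>. generator_form (V i1 s \<omega>)))"
proof -
  obtain C where C: "\<And>n z. \<bar>smooth_weight (real (Suc n)) z\<bar> \<le> C" "\<And>z. \<bar>generator_form z\<bar> \<le> C" using smooth_weight_bound by blast
  have C0: "0 \<le> C" using C(2)[of undefined] by linarith
  have m: "(\<lambda>s. indicator {0..t} s *\<^sub>R expectation (\<lambda>\<omega>. e (V i1 s \<omega>))) \<in> borel_measurable lborel"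
    if "continuous_on UNIV e" "\<And>z. \<bar>e z\<bar> \<le> C" for e :: "real \<times> (real^'n) \<Rightarrow> real"
  proof -
    have "continuous_on {0..t} (\<lambda>s. expectation (\<lambda>\<omega>. e (V i1 s \<omega>)))"
      by (rule continuous_on_subset[OF E_V_continuous[OF that]]) auto
    from borel_measurable_continuous_on_indicator[OF _ this] show ?thesis by simp
  qed
  have b: "\<bar>expectation (\<lambda>\<omega>. e (V i1 s \<omega>))\<bar> \<le> C"
    if e: "continuous_on UNIV e" "\<And>z. \<bar>e z\<bar> \<le> C" and s: "0 \<le> s" for e :: "real \<times> (real^'n) \<Rightarrow> real" and s
  proof -
    have i: "integrable P (\<lambda>\<omega>. e (V i1 s \<omega>))" by (rule bounded_FD(3)[OF bounded_F_V[OF e s]])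
    have "\<bar>expectation (\<lambda>\<omega>. e (V i1 s \<omega>))\<bar> \<le> expectation (\<lambda>\<omega>. \<bar>e (V i1 s \<omega>)\<bar>)" by (rule integral_abs_bound)
    also have "\<dots> \<le> expectation (\<lambda>\<omega>. C)" using i e by (intro integral_mono) auto
    finally show ?thesis by (simp add: prob_space)
  qed
  show ?thesis
    unfolding set_lebesgue_integral_def
  proof (rule integral_dominated_convergence[where w = "\<lambda>s. indicator {0..t} s * C"])
    show "(\<lambda>s. indicator {0..t} s *\<^sub>R expectation (\<lambda>\<omega>. generator_form (V i1 s \<omega>))) \<in> borel_measurable lborel"
      by (rule m[OF generator_form_cont C(2)])
    show "(\<lambda>s. indicator {0..t} s *\<^sub>R expectation (\<lambda>\<omega>. smooth_weight (real (Suc n)) (V i1 s \<omega>))) \<in> borel_measurable lborel" for n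
      by (rule m[OF smooth_weight_cont C(1)]) simp
    show "integrable lborel (\<lambda>s. indicator {0..t} s * C)"
      by (intro integrable_mult_left integrable_real_indicator) (auto simp: emeasure_lborel_Icc_eq)
    show "AE s in lborel. norm (indicator {0..t} s *\<^sub>R expectation (\<lambda>\<omega>. smooth_weight (real (Suc n)) (V i1 s \<omega>))) \<le> indicator {0..t} s * C" for n
      using b[OF smooth_weight_cont C(1), of n] by (intro AE_I2) (auto simp: indicator_def)
    have "AE s in lborel. s \<noteq> (0::real)" by (rule AE_lborel_singleton)
    then show "AE s in lborel. (\<lambda>n. indicator {0..t} s *\<^sub>R expectation (\<lambda>\<omega>. smooth_weight (real (Suc n)) (V i1 s \<omega>))) \<longlonglongrightarrow>
        indicator {0..t} s *\<^sub>R expectation (\<lambda>\<omega>. generator_form (V i1 s \<omega>))"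
    proof eventually_elim
      case (elim s)
      show ?case
      proof (cases "s \<in> {0..t}")
        case True
        then have s: "0 < s" using elim by auto
        have "(\<lambda>n. expectation (\<lambda>\<omega>. smooth_weight (real (Suc n)) (V i1 s \<omega>))) \<longlonglongrightarrow> expectation (\<lambda>\<omega>. generator_form (V i1 s \<omega>))"
        proof (rule integral_dominated_convergence[where w = "\<lambda>_. C"])
          show "(\<lambda>\<omega>. generator_form (V i1 s \<omega>)) \<in> borel_measurable P"
            by (rule bounded_FD(2)[OF bounded_F_V[OF generator_form_cont C(2) less_imp_le[OF s]]])
          show "(\<lambda>\<omega>. smooth_weight (real (Suc n)) (V i1 s \<omega>)) \<in> borel_measurable P" for n
            by (rule bounded_FD(2)[OF bounded_F_V[OF smooth_weight_cont C(1) less_imp_le[OF s]]]) simp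
          show "AE \<omega> in P. (\<lambda>n. smooth_weight (real (Suc n)) (V i1 s \<omega>)) \<longlonglongrightarrow> generator_form (V i1 s \<omega>)"
            using AE_off_diagonal[OF s] by eventually_elim (rule smooth_weight_LIMSEQ, simp add: V_def)
        qed (use C in auto)
        then show ?thesis by (intro tendsto_scaleR tendsto_const)
      qed simp
    qed
  qed
qed

text \<open>The integral is over the completion because \<open>diag_density\<close> is unspecified
  wherever its limit fails to exist, so that the integrand is measurable only up to null
  sets.\<close>

definition diag_term :: "real \<Rightarrow> real" where
  "diag_term s = (\<integral>\<omega>. f1 (X s \<omega> $ i1, X s \<omega>) (1, 0) * (norm (A (X s \<omega>) $ i1))\<^sup>2
             * (diag_density i1 pV s (X s \<omega>) / pX s (X s \<omega>)) \<partial>completion P)"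

definition kernel_expectation :: "nat \<Rightarrow> real \<Rightarrow> real" where
  "kernel_expectation n s = expectation (\<lambda>\<omega>. kernel_weight (real (Suc n)) (V i1 s \<omega>) * (real (Suc n) * lorentz_slope (real (Suc n) * (M s \<omega> - X s \<omega> $ i1))))"

lemma lorentz_slope_part_cont: "continuous_on UNIV (\<lambda>z::real \<times> (real^'n). real (Suc n) * lorentz_slope (real (Suc n) * (fst z - snd z $ i1)))"
  by (intro continuous_intros continuous_on_compose2[OF continuous_lorentz_slope]) auto

lemma kernel_expectation_integrand_bound: "\<bar>kernel_weight (real (Suc n)) z * (real (Suc n) * lorentz_slope (real (Suc n) * (fst z - snd z $ i1)))\<bar> \<le> real CARD('n) * K\<^sup>2 * c * (real (Suc n) * 1)"
  unfolding abs_mult using c_nonneg by (intro mult_mono kernel_weight_bound lorentz_slope_bound) auto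

lemma kernel_expectation_integrand_cont: "continuous_on UNIV (\<lambda>z. kernel_weight (real (Suc n)) z * (real (Suc n) * lorentz_slope (real (Suc n) * (fst z - snd z $ i1))))"
  by (intro continuous_on_mult[OF kernel_weight_cont lorentz_slope_part_cont]) simp

lemma kernel_expectation_cont: "continuous_on {0..} (kernel_expectation n)"
  using E_V_continuous[OF kernel_expectation_integrand_cont kernel_expectation_integrand_bound] by (simp add: kernel_expectation_def[abs_def] V_def del: of_nat_Suc)

text \<open>At a fixed time the kernel expectation is an integral against \<open>pV s\<close>, and
  \<open>diagonal_limit\<close> applies. The limit, an integral over \<open>y\<close>, is read as an
  expectation of a function of \<open>X s\<close> by multiplying and dividing by
  \<open>pX s\<close>, which is where positivity of that density enters.\<close>

lemma diagonal_slice: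
  assumes s: "0 < s" and g: "integrable lborel g" "AE y in lborel. \<forall>u>0. pV s (below_diag i1 y u) \<le> g y"
  shows "(\<lambda>n. kernel_expectation n s) \<longlonglongrightarrow> diag_term s" "\<bar>kernel_expectation n s\<bar> \<le> real CARD('n) * K\<^sup>2 * c * (\<integral>y. g y \<partial>lborel)"
proof -
  \<comment> \<open>A limit along a sequence is Borel measurable in \<open>y\<close>; it agrees with
    \<open>diag_density\<close> wherever the limit from the right exists.\<close>
  define d where "d y = lim (\<lambda>n. pV s (below_diag i1 y (1 / real (Suc n))))" for y
  have slice: "(\<lambda>y. pV s (below_diag i1 y u)) \<in> borel_measurable borel" for u
  proof -
    have "continuous_on UNIV (\<lambda>y::real^'n. below_diag i1 y u)" unfolding below_diag_def by (intro continuous_intros)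
    from measurable_compose[OF borel_measurable_continuous_onI[OF this] pV_measurable[OF s]] show ?thesis .
  qed
  have dm: "d \<in> borel_measurable borel"
    unfolding d_def by (rule borel_measurable_lim_metric) (rule slice)
  have "AE y in lborel. \<exists>l. ((\<lambda>u. pV s (below_diag i1 y u)) \<longlongrightarrow> l) (at_right 0)"
    using H s unfolding hypothesis_H_def by blast
  then have dlim: "AE y in lborel. ((\<lambda>u. pV s (below_diag i1 y u)) \<longlongrightarrow> d y) (at_right 0) \<and> diag_density i1 pV s y = d y"
  proof eventually_elim
    case (elim y)
    then obtain l where l: "((\<lambda>u. pV s (below_diag i1 y u)) \<longlongrightarrow> l) (at_right 0)" by blast
    have "filterlim (\<lambda>n. 1 / real (Suc n)) (at_right 0) sequentially"
      unfolding filterlim_at using mesh_LIMSEQ[of 1] by (auto intro!: always_eventually)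
    from filterlim_compose[OF l this] have "d y = l" unfolding d_def by (rule limI)
    moreover have "diag_density i1 pV s y = l"
      unfolding diag_density_def by (rule tendsto_Lim[OF _ l]) simp
    ultimately show ?case using l by simp
  qed
  let ?\<Phi> = "\<lambda>n z. kernel_weight (real (Suc n)) z * (indicator {0<..} (fst z - snd z $ i1) * (real (Suc n) * lorentz_slope (real (Suc n) * (fst z - snd z $ i1)))) * pV s z"
  have tm: "kernel_weight (real (Suc n)) \<in> borel_measurable borel" for n
    by (rule borel_measurable_continuous_onI[OF kernel_weight_cont]) simp
  note DL = diagonal_limit[where f = "\<lambda>n. kernel_weight (real (Suc n))" and h = diag_limit and d = d and \<rho> = "pV s" and g = g and i = i1,
    OF pV_measurable[OF s] pV_nonneg[OF s] g dm _ tm kernel_weight_bound diag_limit_measurable kernel_weight_LIMSEQ]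
  have coord_delta: "AE y in lborel. ((\<lambda>u. pV s (below_diag i1 y u)) \<longlongrightarrow> d y) (at_right 0)"
    using dlim by (rule eventually_mono) simp
  have kernel_expectation: "kernel_expectation n s = (\<integral>z. ?\<Phi> n z \<partial>lborel)" for n
  proof -
    let ?q = "\<lambda>z. kernel_weight (real (Suc n)) z * (indicator {0<..} (fst z - snd z $ i1) * (real (Suc n) * lorentz_slope (real (Suc n) * (fst z - snd z $ i1))))"
    have [measurable]: "(\<lambda>z::real \<times> (real^'n). fst z - snd z $ i1) \<in> borel_measurable borel"
      by (intro borel_measurable_continuous_onI continuous_intros)
    have qm: "?q \<in> borel_measurable lborel" using tm[of n] by measurable
    have "(\<integral>z. pV s z * ?q z \<partial>lborel) = expectation (\<lambda>\<omega>. ?q (V i1 s \<omega>))"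
      by (rule distributed_integral[OF pV[OF s] qm]) (rule pV_nonneg[OF s])
    also have "\<dots> = kernel_expectation n s"
      unfolding kernel_expectation_def
    proof (rule Bochner_Integration.integral_cong[OF refl])
      fix \<omega> assume \<omega>: "\<omega> \<in> space P"
      \<comment> \<open>The indicator changes nothing: the difference is never negative, and
        \<open>lorentz_slope\<close> vanishes at 0.\<close>
      have "0 \<le> M s \<omega> - X s \<omega> $ i1" using sup_X(1)[OF \<omega>, of s s] s by simp
      then show "?q (V i1 s \<omega>) = kernel_weight (real (Suc n)) (V i1 s \<omega>) * (real (Suc n) * lorentz_slope (real (Suc n) * (M s \<omega> - X s \<omega> $ i1)))"
        by (cases "M s \<omega> - X s \<omega> $ i1 = 0") (simp_all add: V_def lorentz_slope_def del: of_nat_Suc)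
    qed
    finally show ?thesis by (simp add: mult_ac del: of_nat_Suc)
  qed
  show "\<bar>kernel_expectation n s\<bar> \<le> real CARD('n) * K\<^sup>2 * c * (\<integral>y. g y \<partial>lborel)"
    unfolding kernel_expectation by (rule DL(2)[OF coord_delta])
  have "diag_term s = (\<integral>y. diag_limit y * d y \<partial>lborel)"
  proof -
    let ?f = "\<lambda>x. diag_limit x * (d x / pX s x)"
    have fm: "?f \<in> borel_measurable borel"
      using diag_limit_measurable dm pX_measurable[OF s] by measurable
    have Xm: "X s \<in> borel_measurable P" using s by simp
    have fX: "(\<lambda>\<omega>. ?f (X s \<omega>)) \<in> borel_measurable P" by (rule measurable_compose[OF Xm fm])
    have ae: "AE \<omega> in P. ?f (X s \<omega>) = f1 (X s \<omega> $ i1, X s \<omega>) (1, 0) * (norm (A (X s \<omega>) $ i1))\<^sup>2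
             * (diag_density i1 pV s (X s \<omega>) / pX s (X s \<omega>))"
    proof -
      obtain N where N: "N \<in> null_sets lborel" "{y\<in>space lborel. \<not> (diag_density i1 pV s y = d y)} \<subseteq> N"
        using dlim unfolding eventually_ae_filter by auto
      then have Nb: "N \<in> sets borel" by (auto simp: null_sets_def)
      have "AE y in lborel. 0 < ennreal (pX s y) \<longrightarrow> y \<notin> N" using AE_not_in[OF N(1)] by (rule eventually_mono) simp
      then have "AE \<omega> in P. X s \<omega> \<notin> N"
        using distributed_AE2[OF pX[OF s], of "\<lambda>y. y \<notin> N"] Nb by simp
      then show ?thesis
      proof eventually_elim
        case (elim \<omega>)
        then have "diag_density i1 pV s (X s \<omega>) = d (X s \<omega>)" using N(2) by auto
        then show ?case by (simp add: diag_limit_def mult_ac)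
      qed
    qed
    have "diag_term s = (\<integral>\<omega>. ?f (X s \<omega>) \<partial>completion P)"
      unfolding diag_term_def
      by (rule integral_cong_AE[symmetric])
         (use fX borel_measurable_completion_AE[OF fX ae] AE_completion[OF ae] in \<open>auto intro: measurable_completion\<close>)
    also have "\<dots> = expectation (\<lambda>\<omega>. ?f (X s \<omega>))" by (rule integral_completion[OF fX])
    also have "\<dots> = (\<integral>x. pX s x * ?f x \<partial>lborel)"
      by (rule distributed_integral[OF pX[OF s], symmetric]) (use fm less_imp_le[OF pX_pos[OF s]] in auto)
    also have "\<dots> = (\<integral>y. diag_limit y * d y \<partial>lborel)"
      by (rule Bochner_Integration.integral_cong[OF refl]) (use pX_pos[OF s] in \<open>simp add: less_imp_neq[symmetric]\<close>)
    finally show ?thesis .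
  qed
  then show "(\<lambda>n. kernel_expectation n s) \<longlonglongrightarrow> diag_term s"
    using DL(1)[OF coord_delta] unfolding kernel_expectation by simp
qed

text \<open>Integrating the majorant over \<open>y\<close> leaves an integrable function of time
  that bounds all kernel expectations up to a constant, so (H) dominates the time integral as
  well.\<close>

lemma diagonal_part_LIMSEQ:
  assumes t: "0 < t"
  shows "(\<lambda>n. LINT s:{0..t}|lborel. kernel_expectation n s) \<longlonglongrightarrow> (LINT s:{0..t}|lebesgue. diag_term s)"
proof -
  obtain \<gamma> where \<gamma>: "integrable lborel \<gamma>" "\<And>z. 0 \<le> \<gamma> z"
    "AE s in lborel. s \<in> {0<..t} \<longrightarrow> (AE y in lborel. \<forall>u>0. pV s (below_diag i1 y u) \<le> \<gamma> (s, y))"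
    using hypothesis_H_dominating[OF H t pV_nonneg] by blast
  have \<gamma>': "integrable (lborel \<Otimes>\<^sub>M lborel) \<gamma>" using \<gamma>(1) by (simp add: lborel_prod)
  let ?C = "real CARD('n) * K\<^sup>2 * c"
  have C: "0 \<le> ?C" using c_nonneg by simp
  let ?S = "\<lambda>s. ?C * (\<integral>y. \<gamma> (s, y) \<partial>lborel)"
  let ?f = "\<lambda>n s. indicator {0..t} s *\<^sub>R kernel_expectation n s"
  have S: "integrable lborel ?S" using lborel_pair.integrable_fst'[OF \<gamma>'] by simp
  have S0: "0 \<le> ?S s" for s by (rule mult_nonneg_nonneg[OF C Bochner_Integration.integral_nonneg]) (rule \<gamma>(2))
  have good: "AE s in lborel. (\<forall>n. norm (?f n s) \<le> ?S s) \<and> (\<lambda>n. ?f n s) \<longlonglongrightarrow> indicator {0..t} s *\<^sub>R diag_term s"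
    using \<gamma>(3) lborel_pair.AE_integrable_fst'[OF \<gamma>'] AE_lborel_singleton[of 0]
  proof eventually_elim
    case (elim s)
    show ?case
    proof (cases "s \<in> {0..t}")
      case True
      then have s: "s \<in> {0<..t}" "0 < s" using elim(3) by auto
      note ds = diagonal_slice[OF s(2) elim(2)]
      have ae: "AE y in lborel. \<forall>u>0. pV s (below_diag i1 y u) \<le> \<gamma> (s, y)" using elim(1) s(1) by blast
      show ?thesis using ds(1)[OF ae] ds(2)[OF ae] True by simp
    qed (use S0[of s] in simp)
  qed
  have fm: "?f n \<in> borel_measurable lborel" for n
    using borel_measurable_continuous_on_indicator[OF _ continuous_on_subset[OF kernel_expectation_cont], of "{0..t}"] by simp
  \<comment> \<open>The pointwise limit of the kernel expectations is Borel in time and agrees with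
    \<open>diag_term\<close> for almost every time, which makes the latter measurable for the
    completed measure. Hence the integral over \<open>lebesgue\<close>.\<close>
  define j where "j s = lim (\<lambda>n. ?f n s)" for s
  have jm: "j \<in> borel_measurable lborel" unfolding j_def by (rule borel_measurable_lim_metric[OF fm])
  have j: "AE s in lborel. j s = indicator {0..t} s *\<^sub>R diag_term s"
    using good by eventually_elim (auto simp: j_def intro!: limI)
  have "(\<lambda>n. \<integral>s. ?f n s \<partial>lborel) \<longlonglongrightarrow> (\<integral>s. j s \<partial>lborel)"
  proof (rule integral_dominated_convergence[OF jm fm S])
    show "AE s in lborel. (\<lambda>n. ?f n s) \<longlonglongrightarrow> j s" using good j by eventually_elim simp
    show "AE s in lborel. norm (?f n s) \<le> ?S s" for n using good by eventually_elim simp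
  qed
  also have "(\<integral>s. j s \<partial>lborel) = (\<integral>s. j s \<partial>lebesgue)" by (rule integral_completion[OF jm, symmetric])
  also have "\<dots> = (\<integral>s. indicator {0..t} s *\<^sub>R diag_term s \<partial>lebesgue)"
    by (rule integral_cong_AE[OF measurable_completion[OF jm] borel_measurable_completion_AE[OF jm j] AE_completion[OF j]])
  finally show ?thesis unfolding set_lebesgue_integral_def .
qed

text \<open>For N = n + 1 the generator of the mollified function splits into a regular and a
  concentrating part. Each converges separately, the first by boundedness and the second by
  (H).\<close>

theorem ito_running_sup:
  assumes t: "0 < t"
  shows "expectation (\<lambda>\<omega>. \<Psi> (V i1 t \<omega>)) = expectation (\<lambda>\<omega>. \<Psi> (V i1 0 \<omega>))
     + (LINT s:{0..t}|lebesgue. expectation (\<lambda>\<omega>. generator_form (V i1 s \<omega>)))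
     + 1 / 2 * (LINT s:{0..t}|lebesgue. diag_term s)"
proof -
  let ?N = "\<lambda>n. real (Suc n)"
  have lim\<Psi>: "(\<lambda>n. expectation (\<lambda>\<omega>. \<Psi> (mollified_point (?N n) (V i1 s \<omega>)))) \<longlonglongrightarrow> expectation (\<lambda>\<omega>. \<Psi> (V i1 s \<omega>))" if s: "0 \<le> s" for s
  proof (rule integral_dominated_convergence[where w = "\<lambda>_. c"])
    show "(\<lambda>\<omega>. \<Psi> (V i1 s \<omega>)) \<in> borel_measurable P" by (rule bounded_FD(2)[OF bounded_F_V[OF \<Psi>_cont \<Psi>_bound s]])
    show "(\<lambda>\<omega>. \<Psi> (mollified_point (?N n) (V i1 s \<omega>))) \<in> borel_measurable P" for n
      by (rule bounded_FD(2)[OF bounded_F_V[OF N_cont(6) \<Psi>_bound s]]) simp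
    show "AE \<omega> in P. (\<lambda>n. \<Psi> (mollified_point (?N n) (V i1 s \<omega>))) \<longlonglongrightarrow> \<Psi> (V i1 s \<omega>)"
      by (intro AE_I2 f_LIMSEQ mollified_point_LIMSEQ)
  qed (use \<Psi>_bound in auto)
  obtain C where C: "\<And>n z. \<bar>smooth_weight (?N n) z\<bar> \<le> C" "\<And>z. \<bar>generator_form z\<bar> \<le> C" using smooth_weight_bound by blast
  have eq: "expectation (\<lambda>\<omega>. \<Psi> (mollified_point (?N n) (V i1 t \<omega>))) = expectation (\<lambda>\<omega>. \<Psi> (mollified_point (?N n) (V i1 0 \<omega>))) +
     ((LINT s:{0..t}|lborel. expectation (\<lambda>\<omega>. smooth_weight (?N n) (V i1 s \<omega>))) + 1 / 2 * (LINT s:{0..t}|lborel. kernel_expectation n s))" for n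
  proof -
    have gs: "expectation (\<lambda>\<omega>. gen (\<lambda>i. gN (?N n) i (V i1 s \<omega>)) (\<lambda>i k. hN (?N n) i k (V i1 s \<omega>)) (X s \<omega>)) =
       expectation (\<lambda>\<omega>. smooth_weight (?N n) (V i1 s \<omega>)) + 1 / 2 * kernel_expectation n s" if s: "s \<in> {0..t}" for s
    proof -
      have "gen (\<lambda>i. gN (?N n) i (V i1 s \<omega>)) (\<lambda>i k. hN (?N n) i k (V i1 s \<omega>)) (X s \<omega>) = smooth_weight (?N n) (V i1 s \<omega>) +
         1 / 2 * (kernel_weight (?N n) (V i1 s \<omega>) * (?N n * lorentz_slope (?N n * (M s \<omega> - X s \<omega> $ i1))))" for \<omega>
        using gen_split[of "?N n" "V i1 s \<omega>"] by (simp add: V_def del: of_nat_Suc)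
      moreover have "integrable P (\<lambda>\<omega>. smooth_weight (?N n) (V i1 s \<omega>))"
        using s by (intro bounded_FD(3)[OF bounded_F_V[OF smooth_weight_cont C(1)]]) auto
      moreover have "integrable P (\<lambda>\<omega>. kernel_weight (?N n) (V i1 s \<omega>) * (?N n * lorentz_slope (?N n * (M s \<omega> - X s \<omega> $ i1))))"
        using bounded_FD(3)[OF bounded_F_V[OF kernel_expectation_integrand_cont kernel_expectation_integrand_bound], of s n i1] s
        by (simp add: V_def del: of_nat_Suc)
      ultimately show ?thesis by (simp add: kernel_expectation_def del: of_nat_Suc)
    qed
    have i1: "set_integrable lborel {0..t} (\<lambda>s. expectation (\<lambda>\<omega>. smooth_weight (?N n) (V i1 s \<omega>)))"
      by (intro borel_integrable_atLeastAtMost' continuous_on_subset[OF E_V_continuous[OF smooth_weight_cont C(1)]]) auto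
    have i2: "set_integrable lborel {0..t} (\<lambda>s. 1 / 2 * kernel_expectation n s)"
      by (intro borel_integrable_atLeastAtMost' continuous_intros continuous_on_subset[OF kernel_expectation_cont]) auto
    have "(LINT s:{0..t}|lborel. expectation (\<lambda>\<omega>. gen (\<lambda>i. gN (?N n) i (V i1 s \<omega>)) (\<lambda>i k. hN (?N n) i k (V i1 s \<omega>)) (X s \<omega>))) =
       (LINT s:{0..t}|lborel. expectation (\<lambda>\<omega>. smooth_weight (?N n) (V i1 s \<omega>)) + 1 / 2 * kernel_expectation n s)"
      by (rule set_lebesgue_integral_cong) (use gs in auto)
    also have "\<dots> = (LINT s:{0..t}|lborel. expectation (\<lambda>\<omega>. smooth_weight (?N n) (V i1 s \<omega>))) + (LINT s:{0..t}|lborel. 1 / 2 * kernel_expectation n s)"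
      by (rule set_integral_add(2)[OF i1 i2])
    also have "(LINT s:{0..t}|lborel. 1 / 2 * kernel_expectation n s) = 1 / 2 * (LINT s:{0..t}|lborel. kernel_expectation n s)"
      by (rule set_integral_mult_right)
    finally show ?thesis using mollified_ito[of "?N n", OF _ t] by simp
  qed
  have "(\<lambda>n. expectation (\<lambda>\<omega>. \<Psi> (mollified_point (?N n) (V i1 t \<omega>)))) \<longlonglongrightarrow> expectation (\<lambda>\<omega>. \<Psi> (V i1 0 \<omega>)) +
     ((LINT s:{0..t}|lborel. expectation (\<lambda>\<omega>. generator_form (V i1 s \<omega>))) + 1 / 2 * (LINT s:{0..t}|lebesgue. diag_term s))"
    unfolding eq
    by (intro tendsto_add tendsto_mult tendsto_const lim\<Psi> smooth_part_LIMSEQ diagonal_part_LIMSEQ t order_refl)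
  from LIMSEQ_unique[OF this lim\<Psi>[of t]] t
  have "expectation (\<lambda>\<omega>. \<Psi> (V i1 t \<omega>)) = expectation (\<lambda>\<omega>. \<Psi> (V i1 0 \<omega>)) +
     ((LINT s:{0..t}|lborel. expectation (\<lambda>\<omega>. generator_form (V i1 s \<omega>))) + 1 / 2 * (LINT s:{0..t}|lebesgue. diag_term s))" by simp
  moreover have "(LINT s:{0..t}|lebesgue. expectation (\<lambda>\<omega>. generator_form (V i1 s \<omega>))) = (LINT s:{0..t}|lborel. expectation (\<lambda>\<omega>. generator_form (V i1 s \<omega>)))"
    unfolding set_lebesgue_integral_def
  proof (rule integral_completion)
    have "continuous_on {0..t} (\<lambda>s. expectation (\<lambda>\<omega>. generator_form (V i1 s \<omega>)))"
      by (rule continuous_on_subset[OF E_V_continuous[OF generator_form_cont C(2)]]) auto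
    from borel_measurable_continuous_on_indicator[OF _ this]
    show "(\<lambda>s. indicator {0..t} s *\<^sub>R expectation (\<lambda>\<omega>. generator_form (V i1 s \<omega>))) \<in> borel_measurable lborel" by simp
  qed
  ultimately show ?thesis by simp
qed

end

end

section \<open>From the function classes to constants and derivatives\<close>

lemma C1_b_bounds:
  fixes f :: "'a::real_normed_vector \<Rightarrow> 'b::real_normed_vector"
  assumes "C1_b f"
  obtains L where "\<And>x. norm (f x) \<le> L" "\<And>x y. norm (f x - f y) \<le> L * norm (x - y)"
proof -
  obtain f' :: "'a \<Rightarrow> 'a \<Rightarrow>\<^sub>L 'b" where f: "bounded (range f)" and d: "\<And>x. (f has_derivative f' x) (at x)" and b: "bounded (range f')"
    using assms unfolding C1_b_def by blast
  obtain L1 where L1: "\<And>x. norm (f x) \<le> L1" using f unfolding bounded_iff by blast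
  obtain L2 where L2: "\<And>x. norm (f' x) \<le> L2" using b unfolding bounded_iff by blast
  have lip: "norm (f x - f y) \<le> L2 * norm (x - y)" for x y
    by (rule differentiable_bound[of UNIV f "\<lambda>x. f' x"]) (use d L2 in \<open>auto simp: norm_blinfun.rep_eq[symmetric]\<close>)
  show thesis
  proof (rule that[of "max L1 L2"])
    show "norm (f x) \<le> max L1 L2" for x using L1[of x] by simp
    have "L2 * norm (x - y) \<le> max L1 L2 * norm (x - y)" for x y by (intro mult_right_mono) auto
    then show "norm (f x - f y) \<le> max L1 L2 * norm (x - y)" for x y using lip order_trans by blast
  qed
qed

lemma C2_b_imp_C1_b:
  fixes f :: "'a::real_normed_vector \<Rightarrow> 'b::real_normed_vector"
  assumes "C2_b f"
  shows "C1_b f"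
proof -
  obtain f' :: "'a \<Rightarrow> 'a \<Rightarrow>\<^sub>L 'b" where f: "bounded (range f)" and d: "\<And>x. (f has_derivative f' x) (at x)" and f': "C1_b f'"
    using assms unfolding C2_b_def by blast
  obtain f'' :: "'a \<Rightarrow> 'a \<Rightarrow>\<^sub>L 'a \<Rightarrow>\<^sub>L 'b" where "\<And>x. (f' has_derivative f'' x) (at x)" and b: "bounded (range f')"
    using f' unfolding C1_b_def by blast
  then have "continuous_on UNIV f'"
    by (intro continuous_at_imp_continuous_on ballI has_derivative_continuous)
  with f d b show ?thesis unfolding C1_b_def by blast
qed

lemma partial_deriv_eq:
  assumes "(f has_derivative f') (at z)"
  shows "partial_deriv e f z = f' e"
proof -
  have l: "((\<lambda>h::real. z + h *\<^sub>R e) has_derivative (\<lambda>h. h *\<^sub>R e)) (at 0)" by (auto intro!: derivative_eq_intros)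
  have "((\<lambda>h. f (z + h *\<^sub>R e)) has_derivative (\<lambda>h. f' (h *\<^sub>R e))) (at 0)"
    using has_derivative_compose[OF l, of f f'] assms by simp
  moreover have "f' (h *\<^sub>R e) = f' e * h" for h
    using linear_scale[OF has_derivative_linear[OF assms]] by simp
  ultimately have "((\<lambda>h. f (z + h *\<^sub>R e)) has_real_derivative f' e) (at 0)"
    by (simp add: has_field_derivative_def)
  then show ?thesis unfolding partial_deriv_def by (rule DERIV_imp_deriv)
qed

theorem theorem2p2:
  fixes P :: "'a measure"
    and W X :: "real \<Rightarrow> 'a \<Rightarrow> real ^ 'n"
    and B :: "real ^ 'n \<Rightarrow> real ^ 'n"
    and A :: "real ^ 'n \<Rightarrow> real ^ 'n ^ 'n"
    and \<mu>\<^sub>0 :: "(real ^ 'n) measure"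
    and i1 :: 'n
    and pV :: "real \<Rightarrow> real \<times> (real ^ 'n) \<Rightarrow> real"
    and pX :: "real \<Rightarrow> real ^ 'n \<Rightarrow> real"
    and F :: "real \<times> (real ^ 'n) \<Rightarrow> real"
    and c t :: real
  assumes B: "C1_b B" and A: "C2_b A"
    and c: "0 < c" and elliptic: "\<And>v x. c * (norm v)\<^sup>2 \<le> v \<bullet> ((A x ** transpose (A x)) *v v)"
    and P: "prob_space P"
    and W: "brownian_motion P W"
    and \<mu>\<^sub>0: "prob_space \<mu>\<^sub>0" "sets \<mu>\<^sub>0 = sets borel"
    and X: "sde_solution P W B A X" and X0: "distr P borel (X 0) = \<mu>\<^sub>0"
    and pV_nonneg: "\<And>s z. 0 < s \<Longrightarrow> 0 \<le> pV s z"
    and pV: "\<And>s. 0 < s \<Longrightarrow>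
      distributed P lborel (\<lambda>\<omega>. (running_sup i1 X s \<omega>, X s \<omega>)) (\<lambda>z. ennreal (pV s z))"
    and pX_pos: "\<And>s x. 0 < s \<Longrightarrow> 0 < pX s x"
    and pX: "\<And>s. 0 < s \<Longrightarrow> distributed P lborel (X s) (\<lambda>x. ennreal (pX s x))"
    and H: "hypothesis_H i1 pV"
    and F: "C2_b F"
    and t: "0 < t"
  shows "(\<integral>\<omega>. F (running_sup i1 X t \<omega>, X t \<omega>) \<partial>P) =
      (\<integral>\<omega>. F (X 0 \<omega> $ i1, X 0 \<omega>) \<partial>P)
      + (LINT s:{0..t}|lebesgue. (\<integral>\<omega>. generator B A F (running_sup i1 X s \<omega>, X s \<omega>) \<partial>P))
      + 1 / 2 * (LINT s:{0..t}|lebesgue.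
          (\<integral>\<omega>. partial_deriv (1, 0) F (X s \<omega> $ i1, X s \<omega>) * (norm (A (X s \<omega>) $ i1))\<^sup>2
             * (diag_density i1 pV s (X s \<omega>) / pX s (X s \<omega>)) \<partial>completion P))"
proof -
  obtain LB where LB: "\<And>x. norm (B x) \<le> LB" "\<And>x y. norm (B x - B y) \<le> LB * norm (x - y)"
    using C1_b_bounds[OF B] by blast
  obtain LA where LA: "\<And>x. norm (A x) \<le> LA" "\<And>x y. norm (A x - A y) \<le> LA * norm (x - y)"
    using C1_b_bounds[OF C2_b_imp_C1_b[OF A]] by blast
  define K where "K = max LA LB"
  have entry: "\<bar>m $ i $ j\<bar> \<le> norm m" for m :: "real^'n^'n" and i j
    using component_le_norm_cart[of "m $ i" j] Finite_Cartesian_Product.norm_nth_le[of m i] by linarith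
  obtain f1 :: "real \<times> (real ^ 'n) \<Rightarrow> (real \<times> (real ^ 'n)) \<Rightarrow>\<^sub>L real"
    where F0: "bounded (range F)" and f1: "\<And>z. (F has_derivative f1 z) (at z)" and C1f1: "C1_b f1"
    using F unfolding C2_b_def by blast
  obtain f2 :: "real \<times> (real ^ 'n) \<Rightarrow> (real \<times> (real ^ 'n)) \<Rightarrow>\<^sub>L (real \<times> (real ^ 'n)) \<Rightarrow>\<^sub>L real"
    where f1b: "bounded (range f1)" and f2: "\<And>z. (f1 has_derivative f2 z) (at z)" and f2c: "continuous_on UNIV f2" and f2b: "bounded (range f2)"
    using C1f1 unfolding C1_b_def by blast
  obtain c0 where c0: "\<And>z. norm (F z) \<le> c0" using F0 unfolding bounded_iff by blast
  obtain c1 where c1: "\<And>z. norm (f1 z) \<le> c1" using f1b unfolding bounded_iff by blast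
  obtain c2 where c2: "\<And>z. norm (f2 z) \<le> c2" using f2b unfolding bounded_iff by blast
  interpret S: smooth_function P W X B A K i1 F f1 f2 "max c0 (max c1 c2)"
  proof (intro smooth_function.intro bounded_diffusion.intro diffusion.intro diffusion_axioms.intro
      bounded_diffusion_axioms.intro smooth_function_axioms.intro P W X f1 f2 f2c)
    show "norm (B x) \<le> K" for x using LB(1)[of x] by (simp add: K_def)
    have "LB * norm (x - y) \<le> K * norm (x - y)" for x y :: "real^'n" unfolding K_def by (intro mult_right_mono) auto
    then show "norm (B x - B y) \<le> K * norm (x - y)" for x y using LB(2) order_trans by blast
    show "\<bar>A x $ i $ j\<bar> \<le> K" for x i j using entry[of "A x" i j] LA(1)[of x] by (simp add: K_def)
    have "LA * norm (x - y) \<le> K * norm (x - y)" for x y :: "real^'n" unfolding K_def by (intro mult_right_mono) auto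
    then show "\<bar>A x $ i $ j - A y $ i $ j\<bar> \<le> K * norm (x - y)" for x i j y
      using entry[of "A x - A y" i j] LA(2)[of x y] by (simp only: vector_minus_component) (meson order_trans)
    show "\<bar>F z\<bar> \<le> max c0 (max c1 c2)" "norm (f1 z) \<le> max c0 (max c1 c2)" "norm (f2 z) \<le> max c0 (max c1 c2)" for z
      using c0[of z] c1[of z] c2[of z] by auto
  qed
  have V: "S.V i1 s \<omega> = (running_sup i1 X s \<omega>, X s \<omega>)" for s \<omega> by (rule S.V_def)
  have pV': "distributed P lborel (S.V i1 s) (\<lambda>z. ennreal (pV s z))" if "0 < s" for s
    using pV[OF that] unfolding V[abs_def] .
  have d1: "partial_deriv e F = (\<lambda>z. f1 z e)" for e using partial_deriv_eq[OF f1] by (intro ext)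
  have d2: "partial_deriv e (\<lambda>z. f1 z e') z = f2 z e e'" for e e' z
    by (rule partial_deriv_eq) (auto intro!: derivative_eq_intros f2 simp: blinfun.zero_right)
  \<comment> \<open>\<open>generator\<close> and \<open>generator_form\<close> take the two
    directions of the second derivative in opposite order; the symmetry of \<open>A A^t\<close>
    reconciles them.\<close>
  have gen: "generator B A F z = S.generator_form z" for z
  proof -
    have "(\<Sum>i\<in>UNIV. \<Sum>j\<in>UNIV. (A x ** transpose (A x)) $ i $ j * f2 (m, x) (0, axis i 1) (0, axis j 1)) =
      (\<Sum>i\<in>UNIV. \<Sum>k\<in>UNIV. f2 (m, x) (0, axis k 1) (0, axis i 1) * (\<Sum>j\<in>UNIV. A x $ i $ j * A x $ k $ j))" for m x
      by (subst sum.swap) (simp add: matrix_matrix_mult_def transpose_def mult.commute)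
    then show ?thesis
      by (cases z) (simp add: generator_def d1 d2 S.generator_form_def S.gen_def mult.commute[of "B _ $ _"])
  qed
  note pVX = pV_nonneg pV' pX_pos pX H
  have diag: "S.diag_term pV pX s = (\<integral>\<omega>. partial_deriv (1, 0) F (X s \<omega> $ i1, X s \<omega>) * (norm (A (X s \<omega>) $ i1))\<^sup>2
             * (diag_density i1 pV s (X s \<omega>) / pX s (X s \<omega>)) \<partial>completion P)" for s
    unfolding d1 by (rule S.diag_term_def[OF pVX])
  show ?thesis
    using S.ito_running_sup[OF pVX t] unfolding V gen diag S.running_sup_0 .
qed

end
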